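(* Let $(T,\gamma)$ be a tame $B$-$A$ herd with pen $\widehat{T}$, and let $C$ and $D$ be the associated $R$-coring and $S$-coring (defined in the context). Then the $R$-$S$ bimodule $\overline{T}=(C\otimes_R\widehat{T})\cap(\widehat{T}\otimes_S D)\subseteq\widehat{T}\otimes_S T\otimes_R\widehat{T}$ is a companion of $T$, and $(T,\chi)$ is a $D$-$C$ bicomodule coherd, where $\chi:T\otimes_R\overline{T}\otimes_S T\to T$ is given by $$\chi(x\otimes_R\hat{x}\otimes_S y\otimes_R\hat{y}\otimes_S z)=\widehat{\mathrm{ev}}(x\otimes_R\hat{x})\,y\,\mathrm{ev}(\hat{y}\otimes_S z),$$ for all $x,z\in T$ and $\hat{x}\otimes_S y\otimes_R\hat{y}\in\overline{T}\subset\widehat{T}\otimes_S T\otimes_R\widehat{T}$ (summation implicit).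
   Context: All rings are associative and unital. $\alpha:R\to A$ and $\beta:S\to B$ are fixed ring homomorphisms; $A$-modules are regarded as $R$-modules via $\alpha$ and $B$-modules as $S$-modules via $\beta$. The identity map on an object $X$ is denoted $X$. Formal dual: given a $B$-$A$ bimodule $T$, an $A$-$B$ bimodule $\widehat{T}$ is a formal dual of $T$ if there exist an $A$-bimodule map $\mathrm{ev}:\widehat{T}\otimes_S T\to A$ and a $B$-bimodule map $\widehat{\mathrm{ev}}:T\otimes_R\widehat{T}\to B$ such that for all $x,y\in T$, $\hat{x},\hat{y}\in\widehat{T}$: $$\widehat{\mathrm{ev}}(x\otimes_R\hat{x})\,y=x\,\mathrm{ev}(\hat{x}\otimes_S y),\qquad \hat{x}\,\widehat{\mathrm{ev}}(x\otimes_R\hat{y})=\mathrm{ev}(\hat{x}\otimes_S x)\,\hat{y}.$$ Herd: a $B$-$A$ bimodule $T$ with a formal dual $\widehat{T}$ (called the pen) is a bimodule herd, or $B$-$A$ herd, $(T,\gamma)$ if there is an $S$-$R$ bimodule map (the shepherd) $\gamma:T\to T\otimes_R\widehat{T}\otimes_S T$, written $\gamma(x)=x^{\langle1\rangle}\otimes_R x^{\langle2\rangle}\otimes_S x^{\langle3\rangle}$ (summation implicit), such that for all $x\in T$: $\widehat{\mathrm{ev}}(x^{\langle1\rangle}\otimes_R x^{\langle2\rangle})\otimes_S x^{\langle3\rangle}=1_B\otimes_S x$ in $B\otimes_S T$; $x^{\langle1\rangle}\otimes_R\mathrm{ev}(x^{\langle2\rangle}\otimes_S x^{\langle3\rangle})=x\otimes_R1_A$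 in $T\otimes_R A$; and $(\gamma\otimes_R\widehat{T}\otimes_S T)\circ\gamma=(T\otimes_R\widehat{T}\otimes_S\gamma)\circ\gamma$. The herd is tame if $\mathrm{ev}$ and $\widehat{\mathrm{ev}}$ are surjective and $T$ is faithfully flat as a right $R$-module and as a left $S$-module. Associated corings: for a tame herd, $$C=\{c\in\widehat{T}\otimes_S T:(\mathrm{ev}\otimes_R\widehat{T}\otimes_S T)(\widehat{T}\otimes_S\gamma)(c)=1_A\otimes_R c\}$$ is an $R$-coring with coproduct $\Delta_C=(\widehat{T}\otimes_S\gamma)|_C$ and counit $\varepsilon_C=\mathrm{ev}|_C$ (with values in $R\subseteq A$; $\alpha$ is injective), and $$D=\{d\in T\otimes_R\widehat{T}:(T\otimes_R\widehat{T}\otimes_S\widehat{\mathrm{ev}})(\gamma\otimes_R\widehat{T})(d)=d\otimes_S1_B\}$$ is an $S$-coring with coproduct $\Delta_D=(\gamma\otimes_R\widehat{T})|_D$ and counit $\varepsilon_D=\widehat{\mathrm{ev}}|_D$ (with values in $S\subseteq B$). The image of $\gamma$ lies in $T\otimes_R C$ and in $D\otimes_S T$, and $T$ is a $D$-$C$ bicomodule with both coactions given by $\gamma$. $\overline{T}$ is a $C$-$D$ bicomodule with left coaction $\overline{T}\to C\otimes_R\overline{T}$ and right coaction $\overline{T}\to\overline{T}\otimes_S D$ both induced by $\widehat{T}\otimes_S\gamma\otimes_R\widehat{T}$. Companion: let $C$ be an $R$-coring, $D$ an $S$-coring and $X$ a $D$-$C$ bicomodule with coactions $\rho^{D,X}:X\to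 D\otimes_S X$, $\rho^{X,C}:X\to X\otimes_R C$. A $C$-$D$ bicomodule $\overline{X}$ with coactions $\rho^{C,\overline{X}}$, $\rho^{\overline{X},D}$ is a companion of $X$ if there exist a $C$-bicomodule map $\mathrm{cov}:C\to\overline{X}\otimes_S X$ and a $D$-bicomodule map $\overline{\mathrm{cov}}:D\to X\otimes_R\overline{X}$ with $$(X\otimes_R\mathrm{cov})\circ\rho^{X,C}=(\overline{\mathrm{cov}}\otimes_S X)\circ\rho^{D,X},\qquad(\mathrm{cov}\otimes_R\overline{X})\circ\rho^{C,\overline{X}}=(\overline{X}\otimes_S\overline{\mathrm{cov}})\circ\rho^{\overline{X},D}.$$ Bicomodule coherd: a $D$-$C$ bicomodule $X$ with companion $\overline{X}$ is a bicomodule coherd $(X,\chi)$ if there is an $S$-$R$ bimodule map $\chi:X\otimes_R\overline{X}\otimes_S X\to X$ with $\chi\circ(X\otimes_R\mathrm{cov})=X\otimes_R\varepsilon_C$ (identifying $X\otimes_R R\cong X$), $\chi\circ(\overline{\mathrm{cov}}\otimes_S X)=\varepsilon_D\otimes_S X$ (identifying $S\otimes_S X\cong X$), and $\chi\circ(\chi\otimes_R\overline{X}\otimes_S X)=\chi\circ(X\otimes_R\overline{X}\otimes_S\chi)$. *)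

theory Defs
  imports "HOL-Algebra.Free_Abelian_Groups" "HOL-Algebra.Module"
begin

section \<open>Modules and bimodules over not necessarily commutative rings\<close>

record ('l, 'r, 'm) bimod = "('l, 'm) module" +
  rsmult :: "['m, 'r] \<Rightarrow> 'm" (infixl \<open>\<odot>r\<index>\<close> 70)

text \<open>
  The library locale \<^locale>\<open>module\<close> is restricted to commutative rings. As in the library
  record for modules, the fields \<^term>\<open>monoid.mult\<close> and \<^term>\<open>monoid.one\<close> of a
  bimodule carry no meaning; likewise for the unused action of a one-sided module.
\<close>

locale left_module = R?: ring R + M?: abelian_group M
  for R :: "'r ring" (structure) and M :: "('r, 'k, 'm, 'z) bimod_scheme" (structure) +
  assumes lsmult_closed: "\<lbrakk>a \<in> carrier R; x \<in> carrier M\<rbrakk> \<Longrightarrow> a \<odot>\<^bsub>M\<^esub> x \<in> carrier M"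
    and lsmult_l_distr: "\<lbrakk>a \<in> carrier R; b \<in> carrier R; x \<in> carrier M\<rbrakk> \<Longrightarrow>
      (a \<oplus>\<^bsub>R\<^esub> b) \<odot>\<^bsub>M\<^esub> x = a \<odot>\<^bsub>M\<^esub> x \<oplus>\<^bsub>M\<^esub> b \<odot>\<^bsub>M\<^esub> x"
    and lsmult_r_distr: "\<lbrakk>a \<in> carrier R; x \<in> carrier M; y \<in> carrier M\<rbrakk> \<Longrightarrow>
      a \<odot>\<^bsub>M\<^esub> (x \<oplus>\<^bsub>M\<^esub> y) = a \<odot>\<^bsub>M\<^esub> x \<oplus>\<^bsub>M\<^esub> a \<odot>\<^bsub>M\<^esub> y"
    and lsmult_assoc: "\<lbrakk>a \<in> carrier R; b \<in> carrier R; x \<in> carrier M\<rbrakk> \<Longrightarrow>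
      (a \<otimes>\<^bsub>R\<^esub> b) \<odot>\<^bsub>M\<^esub> x = a \<odot>\<^bsub>M\<^esub> (b \<odot>\<^bsub>M\<^esub> x)"
    and lsmult_one: "x \<in> carrier M \<Longrightarrow> \<one>\<^bsub>R\<^esub> \<odot>\<^bsub>M\<^esub> x = x"

locale right_module = R?: ring R + M?: abelian_group M
  for R :: "'r ring" (structure) and M :: "('k, 'r, 'm, 'z) bimod_scheme" (structure) +
  assumes rsmult_closed: "\<lbrakk>a \<in> carrier R; x \<in> carrier M\<rbrakk> \<Longrightarrow> x \<odot>r\<^bsub>M\<^esub> a \<in> carrier M"
    and rsmult_r_distr: "\<lbrakk>a \<in> carrier R; b \<in> carrier R; x \<in> carrier M\<rbrakk> \<Longrightarrow>
      x \<odot>r\<^bsub>M\<^esub> (a \<oplus>\<^bsub>R\<^esub> b) = x \<odot>r\<^bsub>M\<^esub> a \<oplus>\<^bsub>M\<^esub> x \<odot>r\<^bsub>M\<^esub> b"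
    and rsmult_l_distr: "\<lbrakk>a \<in> carrier R; x \<in> carrier M; y \<in> carrier M\<rbrakk> \<Longrightarrow>
      (x \<oplus>\<^bsub>M\<^esub> y) \<odot>r\<^bsub>M\<^esub> a = x \<odot>r\<^bsub>M\<^esub> a \<oplus>\<^bsub>M\<^esub> y \<odot>r\<^bsub>M\<^esub> a"
    and rsmult_assoc: "\<lbrakk>a \<in> carrier R; b \<in> carrier R; x \<in> carrier M\<rbrakk> \<Longrightarrow>
      x \<odot>r\<^bsub>M\<^esub> (a \<otimes>\<^bsub>R\<^esub> b) = (x \<odot>r\<^bsub>M\<^esub> a) \<odot>r\<^bsub>M\<^esub> b"
    and rsmult_one: "x \<in> carrier M \<Longrightarrow> x \<odot>r\<^bsub>M\<^esub> \<one>\<^bsub>R\<^esub> = x"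

locale bimodule = left?: left_module K M + right: right_module R M
  for K :: "'k ring" and R :: "'r ring" and M :: "('k, 'r, 'm, 'z) bimod_scheme" (structure) +
  assumes smult_rsmult: "\<lbrakk>a \<in> carrier K; b \<in> carrier R; x \<in> carrier M\<rbrakk> \<Longrightarrow>
      (a \<odot>\<^bsub>M\<^esub> x) \<odot>r\<^bsub>M\<^esub> b = a \<odot>\<^bsub>M\<^esub> (x \<odot>r\<^bsub>M\<^esub> b)"

definition left_hom ::
  "'k ring \<Rightarrow> ('k, 'r1, 'm, 'z1) bimod_scheme \<Rightarrow> ('k, 'r2, 'n, 'z2) bimod_scheme \<Rightarrow> ('m \<Rightarrow> 'n) set" where
  "left_hom K M N = {f \<in> hom (add_monoid M) (add_monoid N).
     \<forall>a \<in> carrier K. \<forall>x \<in> carrier M. f (a \<odot>\<^bsub>M\<^esub> x) = a \<odot>\<^bsub>N\<^esub> f x}"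

definition right_hom ::
  "'r ring \<Rightarrow> ('k1, 'r, 'm, 'z1) bimod_scheme \<Rightarrow> ('k2, 'r, 'n, 'z2) bimod_scheme \<Rightarrow> ('m \<Rightarrow> 'n) set" where
  "right_hom R M N = {f \<in> hom (add_monoid M) (add_monoid N).
     \<forall>a \<in> carrier R. \<forall>x \<in> carrier M. f (x \<odot>r\<^bsub>M\<^esub> a) = f x \<odot>r\<^bsub>N\<^esub> a}"

definition bimod_hom ::
  "'k ring \<Rightarrow> 'r ring \<Rightarrow> ('k, 'r, 'm, 'z1) bimod_scheme \<Rightarrow> ('k, 'r, 'n, 'z2) bimod_scheme \<Rightarrow> ('m \<Rightarrow> 'n) set" where
  "bimod_hom K R M N = left_hom K M N \<inter> right_hom R M N"

definition ring_bimod :: "'a ring \<Rightarrow> ('a, 'a, 'a) bimod" where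
  "ring_bimod A = \<lparr>carrier = carrier A, monoid.mult = monoid.mult A, monoid.one = monoid.one A,
     ring.zero = ring.zero A, ring.add = ring.add A,
     smult = monoid.mult A, rsmult = monoid.mult A\<rparr>"

text \<open>Restriction of scalars along \<open>f\<close> on the left and along \<open>g\<close> on the right.\<close>

definition restrict_scalars ::
  "('k \<Rightarrow> 'l) \<Rightarrow> ('q \<Rightarrow> 'r) \<Rightarrow> ('l, 'r, 'm, 'z) bimod_scheme \<Rightarrow> ('k, 'q, 'm) bimod" where
  "restrict_scalars f g M = \<lparr>carrier = carrier M, monoid.mult = monoid.mult M, monoid.one = monoid.one M,
     ring.zero = ring.zero M, ring.add = ring.add M,
     smult = (\<lambda>a x. f a \<odot>\<^bsub>M\<^esub> x), rsmult = (\<lambda>x a. x \<odot>r\<^bsub>M\<^esub> g a)\<rparr>"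


section \<open>Tensor products\<close>

text \<open>
  Elements of a tensor product over \<open>R\<close> are cosets in the free Abelian group on pairs, modulo the
  subgroup generated by the usual relations.
\<close>

type_synonym ('m, 'n) tens = "(('m \<times> 'n) \<Rightarrow>\<^sub>0 int) set"

definition tensor_relations ::
  "'r ring \<Rightarrow> ('k, 'r, 'm, 'z1) bimod_scheme \<Rightarrow> ('r, 'l, 'n, 'z2) bimod_scheme \<Rightarrow> (('m \<times> 'n) \<Rightarrow>\<^sub>0 int) set" where
  "tensor_relations R M N =
     {frag_of (x \<oplus>\<^bsub>M\<^esub> x', y) - frag_of (x, y) - frag_of (x', y) | x x' y.
        x \<in> carrier M \<and> x' \<in> carrier M \<and> y \<in> carrier N} \<union>
     {frag_of (x, y \<oplus>\<^bsub>N\<^esub> y') - frag_of (x, y) - frag_of (x, y') | x y y'.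
        x \<in> carrier M \<and> y \<in> carrier N \<and> y' \<in> carrier N} \<union>
     {frag_of (x \<odot>r\<^bsub>M\<^esub> a, y) - frag_of (x, a \<odot>\<^bsub>N\<^esub> y) | x a y.
        x \<in> carrier M \<and> a \<in> carrier R \<and> y \<in> carrier N}"

definition tensor_subgroup ::
  "'r ring \<Rightarrow> ('k, 'r, 'm, 'z1) bimod_scheme \<Rightarrow> ('r, 'l, 'n, 'z2) bimod_scheme \<Rightarrow> (('m \<times> 'n) \<Rightarrow>\<^sub>0 int) set" where
  "tensor_subgroup R M N =
     generate (free_Abelian_group (carrier M \<times> carrier N)) (tensor_relations R M N)"

definition tensor_group ::
  "'r ring \<Rightarrow> ('k, 'r, 'm, 'z1) bimod_scheme \<Rightarrow> ('r, 'l, 'n, 'z2) bimod_scheme \<Rightarrow> ('m, 'n) tens monoid" where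
  "tensor_group R M N = free_Abelian_group (carrier M \<times> carrier N) Mod tensor_subgroup R M N"

definition pure_tensor ::
  "'r ring \<Rightarrow> ('k, 'r, 'm, 'z1) bimod_scheme \<Rightarrow> ('r, 'l, 'n, 'z2) bimod_scheme \<Rightarrow> 'm \<Rightarrow> 'n \<Rightarrow> ('m, 'n) tens" where
  "pure_tensor R M N x y =
     tensor_subgroup R M N #>\<^bsub>free_Abelian_group (carrier M \<times> carrier N)\<^esub> frag_of (x, y)"

text \<open>
  The additive map out of a tensor product into the Abelian group \<open>G\<close> that sends the pure tensor
  of \<open>x\<close> and \<open>y\<close> to \<open>b (x, y)\<close>. It is evaluated on an arbitrary representative of the coset
  \<open>X\<close>, which is immaterial if \<open>b\<close> is biadditive and balanced; it is only used for such \<open>b\<close>.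
\<close>

definition tensor_lift :: "('p, 'z) monoid_scheme \<Rightarrow> ('m \<times> 'n \<Rightarrow> 'p) \<Rightarrow> ('m, 'n) tens \<Rightarrow> 'p" where
  "tensor_lift G b X = (let c = (SOME c. c \<in> X) in
     finprod G (\<lambda>z. b z [^]\<^bsub>G\<^esub> Poly_Mapping.lookup c z) (Poly_Mapping.keys c))"

definition tensor ::
  "'r ring \<Rightarrow> ('k, 'r, 'm, 'z1) bimod_scheme \<Rightarrow> ('r, 'l, 'n, 'z2) bimod_scheme \<Rightarrow> ('k, 'l, ('m, 'n) tens) bimod" where
  "tensor R M N = \<lparr>carrier = carrier (tensor_group R M N), monoid.mult = undefined, monoid.one = undefined,
     ring.zero = monoid.one (tensor_group R M N), ring.add = monoid.mult (tensor_group R M N),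
     smult = (\<lambda>a. tensor_lift (tensor_group R M N) (\<lambda>(x, y). pure_tensor R M N (a \<odot>\<^bsub>M\<^esub> x) y)),
     rsmult = (\<lambda>X a. tensor_lift (tensor_group R M N) (\<lambda>(x, y). pure_tensor R M N x (y \<odot>r\<^bsub>N\<^esub> a)) X)\<rparr>"

text \<open>
  The map \<open>f \<otimes> g\<close>; the arguments \<open>M\<close> and \<open>N\<close> are the targets of \<open>f\<close> and \<open>g\<close>. With
  \<open>f = g = id\<close> it is the map between tensor products induced by inclusions of carriers.
\<close>

definition tensor_map ::
  "'r ring \<Rightarrow> ('k, 'r, 'm, 'z1) bimod_scheme \<Rightarrow> ('r, 'l, 'n, 'z2) bimod_scheme \<Rightarrow>
   ('x \<Rightarrow> 'm) \<Rightarrow> ('y \<Rightarrow> 'n) \<Rightarrow> ('x, 'y) tens \<Rightarrow> ('m, 'n) tens" where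
  "tensor_map R M N f g = tensor_lift (tensor_group R M N) (\<lambda>(x, y). pure_tensor R M N (f x) (g y))"

text \<open>\<open>assoc\<close>: \<open>(M \<otimes>\<^sub>R N) \<otimes>\<^sub>S P \<rightarrow> M \<otimes>\<^sub>R (N \<otimes>\<^sub>S P)\<close>, and \<open>unassoc\<close> is its inverse.\<close>

definition assoc ::
  "'r ring \<Rightarrow> 's ring \<Rightarrow> ('k, 'r, 'm, 'z1) bimod_scheme \<Rightarrow> ('r, 's, 'n, 'z2) bimod_scheme \<Rightarrow>
   ('s, 'l, 'p, 'z3) bimod_scheme \<Rightarrow> (('m, 'n) tens, 'p) tens \<Rightarrow> ('m, ('n, 'p) tens) tens" where
  "assoc R S M N P = (let G = tensor_group R M (tensor S N P) in
     tensor_lift G (\<lambda>(u, z). tensor_lift G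
       (\<lambda>(x, y). pure_tensor R M (tensor S N P) x (pure_tensor S N P y z)) u))"

definition unassoc ::
  "'r ring \<Rightarrow> 's ring \<Rightarrow> ('k, 'r, 'm, 'z1) bimod_scheme \<Rightarrow> ('r, 's, 'n, 'z2) bimod_scheme \<Rightarrow>
   ('s, 'l, 'p, 'z3) bimod_scheme \<Rightarrow> ('m, ('n, 'p) tens) tens \<Rightarrow> (('m, 'n) tens, 'p) tens" where
  "unassoc R S M N P = (let G = tensor_group S (tensor R M N) P in
     tensor_lift G (\<lambda>(x, v). tensor_lift G
       (\<lambda>(y, z). pure_tensor S (tensor R M N) P (pure_tensor R M N x y) z) v))"

text \<open>The identifications \<open>R \<otimes>\<^sub>R M \<cong> M\<close> and \<open>M \<otimes>\<^sub>R R \<cong> M\<close>.\<close>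

definition lunit :: "('r, 'l, 'm, 'z) bimod_scheme \<Rightarrow> ('r, 'm) tens \<Rightarrow> 'm" where
  "lunit M = tensor_lift (add_monoid M) (\<lambda>(a, x). a \<odot>\<^bsub>M\<^esub> x)"

definition runit :: "('k, 'r, 'm, 'z) bimod_scheme \<Rightarrow> ('m, 'r) tens \<Rightarrow> 'm" where
  "runit M = tensor_lift (add_monoid M) (\<lambda>(x, a). x \<odot>r\<^bsub>M\<^esub> a)"


section \<open>Faithful flatness\<close>

definition exact_at ::
  "('m, 'z1) ring_scheme \<Rightarrow> ('m \<Rightarrow> 'n) \<Rightarrow> ('n, 'z2) ring_scheme \<Rightarrow> ('n \<Rightarrow> 'p) \<Rightarrow> ('p, 'z3) ring_scheme \<Rightarrow> bool" where
  "exact_at M f N g P \<longleftrightarrow> f ` carrier M = {y \<in> carrier N. g y = \<zero>\<^bsub>P\<^esub>}"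

text \<open>
  A module is faithfully flat if tensoring with it preserves and reflects exact sequences. HOL cannot
  quantify over all types, so the modules in the test sequences have their carrier in the type \<open>'u\<close>.
  As soon as \<open>'u\<close> is infinite and at least as large as the type of scalars, every finitely generated
  module is isomorphic to one with carrier in \<open>'u\<close>. Since the vanishing of an element of a tensor
  product involves only finitely many elements, injectivity can be tested on finitely generated
  modules, and nonvanishing of a tensor product on cyclic ones; hence this notion then coincides
  with faithful flatness with respect to all modules.
\<close>

definition faithfully_flat_right ::
  "'u itself \<Rightarrow> 'r ring \<Rightarrow> ('k, 'r, 'm, 'z) bimod_scheme \<Rightarrow> bool" where
  "faithfully_flat_right U R T \<longleftrightarrow> right_module R T \<and>
     (\<forall>(M :: ('r, unit, 'u) bimod) (N :: ('r, unit, 'u) bimod) (P :: ('r, unit, 'u) bimod) f g.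
        left_module R M \<and> left_module R N \<and> left_module R P \<and>
        f \<in> left_hom R M N \<and> g \<in> left_hom R N P \<longrightarrow>
        (exact_at M f N g P \<longleftrightarrow>
         exact_at (tensor R T M) (tensor_map R T N id f) (tensor R T N) (tensor_map R T P id g) (tensor R T P)))"

definition faithfully_flat_left ::
  "'u itself \<Rightarrow> 's ring \<Rightarrow> ('s, 'k, 'm, 'z) bimod_scheme \<Rightarrow> bool" where
  "faithfully_flat_left U S T \<longleftrightarrow> left_module S T \<and>
     (\<forall>(M :: (unit, 's, 'u) bimod) (N :: (unit, 's, 'u) bimod) (P :: (unit, 's, 'u) bimod) f g.
        right_module S M \<and> right_module S N \<and> right_module S P \<and>
        f \<in> right_hom S M N \<and> g \<in> right_hom S N P \<longrightarrow>
        (exact_at M f N g P \<longleftrightarrow>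
         exact_at (tensor S M T) (tensor_map S N T f id) (tensor S N T) (tensor_map S P T g id) (tensor S P T)))"


section \<open>Corings and bicomodules\<close>

record ('r, 'c) coring = "('r, 'r, 'c) bimod" +
  comult :: "'c \<Rightarrow> ('c, 'c) tens"
  counit :: "'c \<Rightarrow> 'r"

definition is_coring :: "'r ring \<Rightarrow> ('r, 'c) coring \<Rightarrow> bool" where
  "is_coring R C \<longleftrightarrow>
     bimodule R R C \<and>
     comult C \<in> bimod_hom R R C (tensor R C C) \<and>
     counit C \<in> bimod_hom R R C (ring_bimod R) \<and>
     (\<forall>c \<in> carrier C.
        assoc R R C C C (tensor_map R (tensor R C C) C (comult C) id (comult C c)) =
          tensor_map R C (tensor R C C) id (comult C) (comult C c) \<and>
        tensor_map R (ring_bimod R) C (counit C) id (comult C c) = pure_tensor R (ring_bimod R) C \<one>\<^bsub>R\<^esub> c \<and>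
        tensor_map R C (ring_bimod R) id (counit C) (comult C c) = pure_tensor R C (ring_bimod R) c \<one>\<^bsub>R\<^esub>)"

record ('s, 'r, 'd, 'c, 'x) bicomod = "('s, 'r, 'x) bimod" +
  lcoact :: "'x \<Rightarrow> ('d, 'x) tens"
  rcoact :: "'x \<Rightarrow> ('x, 'c) tens"

definition bicomodule ::
  "'s ring \<Rightarrow> 'r ring \<Rightarrow> ('s, 'd) coring \<Rightarrow> ('r, 'c) coring \<Rightarrow> ('s, 'r, 'd, 'c, 'x) bicomod \<Rightarrow> bool" where
  "bicomodule S R D C X \<longleftrightarrow>
     is_coring S D \<and> is_coring R C \<and> bimodule S R X \<and>
     lcoact X \<in> bimod_hom S R X (tensor S D X) \<and>
     rcoact X \<in> bimod_hom S R X (tensor R X C) \<and>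
     (\<forall>x \<in> carrier X.
        assoc S S D D X (tensor_map S (tensor S D D) X (comult D) id (lcoact X x)) =
          tensor_map S D (tensor S D X) id (lcoact X) (lcoact X x) \<and>
        tensor_map S (ring_bimod S) X (counit D) id (lcoact X x) = pure_tensor S (ring_bimod S) X \<one>\<^bsub>S\<^esub> x \<and>
        assoc R R X C C (tensor_map R (tensor R X C) C (rcoact X) id (rcoact X x)) =
          tensor_map R X (tensor R C C) id (comult C) (rcoact X x) \<and>
        tensor_map R X (ring_bimod R) id (counit C) (rcoact X x) = pure_tensor R X (ring_bimod R) x \<one>\<^bsub>R\<^esub> \<and>
        assoc S R D X C (tensor_map R (tensor S D X) C (lcoact X) id (rcoact X x)) =
          tensor_map S D (tensor R X C) id (rcoact X) (lcoact X x))"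

definition bicomod_hom ::
  "'s ring \<Rightarrow> 'r ring \<Rightarrow> ('s, 'd) coring \<Rightarrow> ('r, 'c) coring \<Rightarrow>
   ('s, 'r, 'd, 'c, 'x) bicomod \<Rightarrow> ('s, 'r, 'd, 'c, 'y) bicomod \<Rightarrow> ('x \<Rightarrow> 'y) set" where
  "bicomod_hom S R D C X Y = {f \<in> bimod_hom S R X Y. \<forall>x \<in> carrier X.
     lcoact Y (f x) = tensor_map S D Y id f (lcoact X x) \<and>
     rcoact Y (f x) = tensor_map R Y C f id (rcoact X x)}"

definition with_coactions ::
  "('s, 'r, 'x, 'z) bimod_scheme \<Rightarrow> ('x \<Rightarrow> ('d, 'x) tens) \<Rightarrow> ('x \<Rightarrow> ('x, 'c) tens) \<Rightarrow> ('s, 'r, 'd, 'c, 'x) bicomod" where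
  "with_coactions X l r = \<lparr>carrier = carrier X, monoid.mult = monoid.mult X, monoid.one = monoid.one X,
     ring.zero = ring.zero X, ring.add = ring.add X,
     smult = smult X, rsmult = rsmult X, lcoact = l, rcoact = r\<rparr>"

definition coring_bicomod :: "('r, 'c) coring \<Rightarrow> ('r, 'r, 'c, 'c, 'c) bicomod" where
  "coring_bicomod C = with_coactions C (comult C) (comult C)"

text \<open>
  For \<open>X\<close> with a left coaction of the \<open>K\<close>-coring \<open>C\<close> and \<open>Y\<close> with a right coaction of the
  \<open>L\<close>-coring \<open>F\<close>, the \<open>C\<close>-\<open>F\<close> bicomodule \<open>X \<otimes>\<^sub>Q Y\<close>.
\<close>

definition tensor_bicomod ::
  "'k ring \<Rightarrow> 'q ring \<Rightarrow> 'l ring \<Rightarrow> ('k, 'c) coring \<Rightarrow> ('l, 'f) coring \<Rightarrow>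
   ('k, 'q, 'c, 'd, 'x) bicomod \<Rightarrow> ('q, 'l, 'e, 'f, 'y) bicomod \<Rightarrow> ('k, 'l, 'c, 'f, ('x, 'y) tens) bicomod" where
  "tensor_bicomod K Q L C F X Y = with_coactions (tensor Q X Y)
     (assoc K Q C X Y \<circ> tensor_map Q (tensor K C X) Y (lcoact X) id)
     (unassoc Q L X Y F \<circ> tensor_map Q X (tensor L Y F) id (rcoact Y))"


section \<open>Companions and bicomodule coherds\<close>

definition companion_via ::
  "'r ring \<Rightarrow> 's ring \<Rightarrow> ('r, 'c) coring \<Rightarrow> ('s, 'd) coring \<Rightarrow>
   ('s, 'r, 'd, 'c, 'x) bicomod \<Rightarrow> ('r, 's, 'c, 'd, 'y) bicomod \<Rightarrow>
   ('c \<Rightarrow> ('y, 'x) tens) \<Rightarrow> ('d \<Rightarrow> ('x, 'y) tens) \<Rightarrow> bool" where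
  "companion_via R S C D X Y cov cov' \<longleftrightarrow>
     bicomodule S R D C X \<and> bicomodule R S C D Y \<and>
     cov \<in> bicomod_hom R R C C (coring_bicomod C) (tensor_bicomod R S R C C Y X) \<and>
     cov' \<in> bicomod_hom S S D D (coring_bicomod D) (tensor_bicomod S R S D D X Y) \<and>
     (\<forall>x \<in> carrier X.
        tensor_map R X (tensor S Y X) id cov (rcoact X x) =
        assoc R S X Y X (tensor_map S (tensor R X Y) X cov' id (lcoact X x))) \<and>
     (\<forall>y \<in> carrier Y.
        assoc S R Y X Y (tensor_map R (tensor S Y X) Y cov id (lcoact Y y)) =
        tensor_map S Y (tensor R X Y) id cov' (rcoact Y y))"

definition companion ::
  "'r ring \<Rightarrow> 's ring \<Rightarrow> ('r, 'c) coring \<Rightarrow> ('s, 'd) coring \<Rightarrow>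
   ('s, 'r, 'd, 'c, 'x) bicomod \<Rightarrow> ('r, 's, 'c, 'd, 'y) bicomod \<Rightarrow> bool" where
  "companion R S C D X Y \<longleftrightarrow> (\<exists>cov cov'. companion_via R S C D X Y cov cov')"

definition bicomodule_coherd ::
  "'r ring \<Rightarrow> 's ring \<Rightarrow> ('r, 'c) coring \<Rightarrow> ('s, 'd) coring \<Rightarrow>
   ('s, 'r, 'd, 'c, 'x) bicomod \<Rightarrow> ('r, 's, 'c, 'd, 'y) bicomod \<Rightarrow>
   ((('x, 'y) tens, 'x) tens \<Rightarrow> 'x) \<Rightarrow> bool" where
  "bicomodule_coherd R S C D X Y chi \<longleftrightarrow>
     (let XY = tensor R X Y; XYX = tensor S XY X in
      chi \<in> bimod_hom S R XYX X \<and>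
      (\<exists>cov cov'. companion_via R S C D X Y cov cov' \<and>
        (\<forall>u \<in> carrier (tensor R X C).
           chi (unassoc R S X Y X (tensor_map R X (tensor S Y X) id cov u)) =
           runit X (tensor_map R X (ring_bimod R) id (counit C) u)) \<and>
        (\<forall>u \<in> carrier (tensor S D X).
           chi (tensor_map S XY X cov' id u) =
           lunit X (tensor_map S (ring_bimod S) X (counit D) id u))) \<and>
      (\<forall>u \<in> carrier (tensor S (tensor R XYX Y) X).
         chi (tensor_map S XY X (tensor_map R X Y chi id) id u) =
         chi (tensor_map S XY X id chi
           (assoc S S XY XY X (tensor_map S (tensor S XY XY) X (assoc S R XY X Y) id u)))))"


section \<open>Bimodule herds\<close>

text \<open>
  \<open>ringR\<close>, \<open>ringS\<close>, \<open>ringA\<close>, \<open>ringB\<close>, \<open>alpha\<close>, \<open>beta\<close>: the rings and ring maps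
  \<open>\<alpha> : R \<rightarrow> A\<close>, \<open>\<beta> : S \<rightarrow> B\<close>; \<open>modT\<close>, \<open>pen\<close>: the bimodule \<open>T\<close> and its formal dual
  \<open>T\<^sup>^\<close>; \<open>ev\<close> and \<open>evh\<close>: the two evaluations, into \<open>A\<close> and \<open>B\<close>; \<open>shepherd\<close>: \<open>\<gamma>\<close>.
\<close>

record ('r, 's, 'a, 'b, 't, 'h) herd_data =
  ringR :: "'r ring"
  ringS :: "'s ring"
  ringA :: "'a ring"
  ringB :: "'b ring"
  alpha :: "'r \<Rightarrow> 'a"
  beta :: "'s \<Rightarrow> 'b"
  modT :: "('b, 'a, 't) bimod"
  pen :: "('a, 'b, 'h) bimod"
  ev :: "('h, 't) tens \<Rightarrow> 'a"
  evh :: "('t, 'h) tens \<Rightarrow> 'b"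
  shepherd :: "'t \<Rightarrow> (('t, 'h) tens, 't) tens"

definition modT_SR :: "('r, 's, 'a, 'b, 't, 'h) herd_data \<Rightarrow> ('s, 'r, 't) bimod" where
  "modT_SR E = restrict_scalars (beta E) (alpha E) (modT E)"

definition pen_RS :: "('r, 's, 'a, 'b, 't, 'h) herd_data \<Rightarrow> ('r, 's, 'h) bimod" where
  "pen_RS E = restrict_scalars (alpha E) (beta E) (pen E)"

definition ringA_R :: "('r, 's, 'a, 'b, 't, 'h) herd_data \<Rightarrow> ('r, 'r, 'a) bimod" where
  "ringA_R E = restrict_scalars (alpha E) (alpha E) (ring_bimod (ringA E))"

definition ringB_S :: "('r, 's, 'a, 'b, 't, 'h) herd_data \<Rightarrow> ('s, 's, 'b) bimod" where
  "ringB_S E = restrict_scalars (beta E) (beta E) (ring_bimod (ringB E))"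

definition PT :: "('r, 's, 'a, 'b, 't, 'h) herd_data \<Rightarrow> ('r, 'r, ('h, 't) tens) bimod" where
  "PT E = tensor (ringS E) (pen_RS E) (modT_SR E)"

definition TP :: "('r, 's, 'a, 'b, 't, 'h) herd_data \<Rightarrow> ('s, 's, ('t, 'h) tens) bimod" where
  "TP E = tensor (ringR E) (modT_SR E) (pen_RS E)"

definition TPT :: "('r, 's, 'a, 'b, 't, 'h) herd_data \<Rightarrow> ('s, 'r, (('t, 'h) tens, 't) tens) bimod" where
  "TPT E = tensor (ringS E) (TP E) (modT_SR E)"

definition PTP :: "('r, 's, 'a, 'b, 't, 'h) herd_data \<Rightarrow> ('r, 's, (('h, 't) tens, 'h) tens) bimod" where
  "PTP E = tensor (ringR E) (PT E) (pen_RS E)"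

text \<open>
  In \<open>formal_dual\<close> the outer scalars of the tensor products are kept: there they are an
  \<open>A\<close>-bimodule and a \<open>B\<close>-bimodule. They have the same carrier and addition as \<open>PT\<close> and \<open>TP\<close>.
\<close>

definition formal_dual :: "('r, 's, 'a, 'b, 't, 'h) herd_data \<Rightarrow> bool" where
  "formal_dual E \<longleftrightarrow>
     ev E \<in> bimod_hom (ringA E) (ringA E)
       (tensor (ringS E) (restrict_scalars id (beta E) (pen E)) (restrict_scalars (beta E) id (modT E)))
       (ring_bimod (ringA E)) \<and>
     evh E \<in> bimod_hom (ringB E) (ringB E)
       (tensor (ringR E) (restrict_scalars id (alpha E) (modT E)) (restrict_scalars (alpha E) id (pen E)))
       (ring_bimod (ringB E)) \<and>
     (\<forall>x \<in> carrier (modT E). \<forall>y \<in> carrier (modT E). \<forall>p \<in> carrier (pen E).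
        evh E (pure_tensor (ringR E) (modT_SR E) (pen_RS E) x p) \<odot>\<^bsub>modT E\<^esub> y =
        x \<odot>r\<^bsub>modT E\<^esub> ev E (pure_tensor (ringS E) (pen_RS E) (modT_SR E) p y)) \<and>
     (\<forall>x \<in> carrier (modT E). \<forall>p \<in> carrier (pen E). \<forall>q \<in> carrier (pen E).
        p \<odot>r\<^bsub>pen E\<^esub> evh E (pure_tensor (ringR E) (modT_SR E) (pen_RS E) x q) =
        ev E (pure_tensor (ringS E) (pen_RS E) (modT_SR E) p x) \<odot>\<^bsub>pen E\<^esub> q)"

text \<open>The shepherd with values in \<open>T \<otimes>\<^sub>R (T\<^sup>^ \<otimes>\<^sub>S T)\<close>.\<close>

definition shepherd_r :: "('r, 's, 'a, 'b, 't, 'h) herd_data \<Rightarrow> 't \<Rightarrow> ('t, ('h, 't) tens) tens" where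
  "shepherd_r E = assoc (ringR E) (ringS E) (modT_SR E) (pen_RS E) (modT_SR E) \<circ> shepherd E"

definition herd :: "('r, 's, 'a, 'b, 't, 'h) herd_data \<Rightarrow> bool" where
  "herd E \<longleftrightarrow>
     ring (ringR E) \<and> ring (ringS E) \<and> ring (ringA E) \<and> ring (ringB E) \<and>
     alpha E \<in> ring_hom (ringR E) (ringA E) \<and> beta E \<in> ring_hom (ringS E) (ringB E) \<and>
     bimodule (ringB E) (ringA E) (modT E) \<and> bimodule (ringA E) (ringB E) (pen E) \<and>
     formal_dual E \<and>
     shepherd E \<in> bimod_hom (ringS E) (ringR E) (modT_SR E) (TPT E) \<and>
     (\<forall>x \<in> carrier (modT E).
        tensor_map (ringS E) (ringB_S E) (modT_SR E) (evh E) id (shepherd E x) =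
          pure_tensor (ringS E) (ringB_S E) (modT_SR E) \<one>\<^bsub>ringB E\<^esub> x \<and>
        tensor_map (ringR E) (modT_SR E) (ringA_R E) id (ev E) (shepherd_r E x) =
          pure_tensor (ringR E) (modT_SR E) (ringA_R E) x \<one>\<^bsub>ringA E\<^esub> \<and>
        assoc (ringS E) (ringS E) (TP E) (TP E) (modT_SR E)
          (tensor_map (ringS E) (tensor (ringS E) (TP E) (TP E)) (modT_SR E)
            (assoc (ringS E) (ringR E) (TP E) (modT_SR E) (pen_RS E)) id
            (tensor_map (ringS E) (tensor (ringR E) (TPT E) (pen_RS E)) (modT_SR E)
              (tensor_map (ringR E) (TPT E) (pen_RS E) (shepherd E) id) id (shepherd E x))) =
        tensor_map (ringS E) (TP E) (TPT E) id (shepherd E) (shepherd E x))"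

text \<open>
  The test type used for faithful flatness is infinite and contains copies of all types involved.
\<close>

definition tame_herd :: "('r, 's, 'a, 'b, 't, 'h) herd_data \<Rightarrow> bool" where
  "tame_herd E \<longleftrightarrow> herd E \<and>
     ev E ` carrier (PT E) = carrier (ringA E) \<and>
     evh E ` carrier (TP E) = carrier (ringB E) \<and>
     faithfully_flat_right TYPE('r + 's + 'a + 'b + 't + 'h + nat) (ringR E) (modT_SR E) \<and>
     faithfully_flat_left TYPE('r + 's + 'a + 'b + 't + 'h + nat) (ringS E) (modT_SR E)"


section \<open>The associated corings and bicomodules\<close>

text \<open>
  The maps \<open>T\<^sup>^ \<otimes>\<^sub>S \<gamma>\<close> and \<open>\<gamma> \<otimes>\<^sub>R T\<^sup>^\<close>, with values in
  \<open>(T\<^sup>^ \<otimes>\<^sub>S T) \<otimes>\<^sub>R (T\<^sup>^ \<otimes>\<^sub>S T)\<close> and \<open>(T \<otimes>\<^sub>R T\<^sup>^) \<otimes>\<^sub>S (T \<otimes>\<^sub>R T\<^sup>^)\<close>.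
\<close>

definition pen_shepherd ::
  "('r, 's, 'a, 'b, 't, 'h) herd_data \<Rightarrow> ('h, 't) tens \<Rightarrow> (('h, 't) tens, ('h, 't) tens) tens" where
  "pen_shepherd E = unassoc (ringS E) (ringR E) (pen_RS E) (modT_SR E) (PT E) \<circ>
     tensor_map (ringS E) (pen_RS E) (tensor (ringR E) (modT_SR E) (PT E)) id (shepherd_r E)"

definition shepherd_pen ::
  "('r, 's, 'a, 'b, 't, 'h) herd_data \<Rightarrow> ('t, 'h) tens \<Rightarrow> (('t, 'h) tens, ('t, 'h) tens) tens" where
  "shepherd_pen E = assoc (ringS E) (ringR E) (TP E) (modT_SR E) (pen_RS E) \<circ>
     tensor_map (ringR E) (TPT E) (pen_RS E) (shepherd E) id"

definition coringC_carrier :: "('r, 's, 'a, 'b, 't, 'h) herd_data \<Rightarrow> ('h, 't) tens set" where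
  "coringC_carrier E = {c \<in> carrier (PT E).
     tensor_map (ringR E) (ringA_R E) (PT E) (ev E) id (pen_shepherd E c) =
     pure_tensor (ringR E) (ringA_R E) (PT E) \<one>\<^bsub>ringA E\<^esub> c}"

definition coringD_carrier :: "('r, 's, 'a, 'b, 't, 'h) herd_data \<Rightarrow> ('t, 'h) tens set" where
  "coringD_carrier E = {d \<in> carrier (TP E).
     tensor_map (ringS E) (TP E) (ringB_S E) id (evh E) (shepherd_pen E d) =
     pure_tensor (ringS E) (TP E) (ringB_S E) d \<one>\<^bsub>ringB E\<^esub>}"

definition bimodC :: "('r, 's, 'a, 'b, 't, 'h) herd_data \<Rightarrow> ('r, 'r, ('h, 't) tens) bimod" where
  "bimodC E = (PT E)\<lparr>carrier := coringC_carrier E\<rparr>"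

definition bimodD :: "('r, 's, 'a, 'b, 't, 'h) herd_data \<Rightarrow> ('s, 's, ('t, 'h) tens) bimod" where
  "bimodD E = (TP E)\<lparr>carrier := coringD_carrier E\<rparr>"

text \<open>
  The structure maps below are obtained by corestriction: a value in a tensor product of ambient
  modules is pulled back along the map induced by the inclusions of the submodules (injective for
  a tame herd). Similarly the counits are pulled back along \<open>\<alpha>\<close> and \<open>\<beta>\<close>.
\<close>

definition coringC :: "('r, 's, 'a, 'b, 't, 'h) herd_data \<Rightarrow> ('r, ('h, 't) tens) coring" where
  "coringC E = bimod.extend (bimodC E) (coring.fields
     (\<lambda>c. the_inv_into (carrier (tensor (ringR E) (bimodC E) (bimodC E)))
            (tensor_map (ringR E) (PT E) (PT E) id id) (pen_shepherd E c))
     (\<lambda>c. the_inv_into (carrier (ringR E)) (alpha E) (ev E c)))"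

definition coringD :: "('r, 's, 'a, 'b, 't, 'h) herd_data \<Rightarrow> ('s, ('t, 'h) tens) coring" where
  "coringD E = bimod.extend (bimodD E) (coring.fields
     (\<lambda>d. the_inv_into (carrier (tensor (ringS E) (bimodD E) (bimodD E)))
            (tensor_map (ringS E) (TP E) (TP E) id id) (shepherd_pen E d))
     (\<lambda>d. the_inv_into (carrier (ringS E)) (beta E) (evh E d)))"

definition bicomodT ::
  "('r, 's, 'a, 'b, 't, 'h) herd_data \<Rightarrow> ('s, 'r, ('t, 'h) tens, ('h, 't) tens, 't) bicomod" where
  "bicomodT E = with_coactions (modT_SR E)
     (\<lambda>x. the_inv_into (carrier (tensor (ringS E) (coringD E) (modT_SR E)))
            (tensor_map (ringS E) (TP E) (modT_SR E) id id) (shepherd E x))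
     (\<lambda>x. the_inv_into (carrier (tensor (ringR E) (modT_SR E) (coringC E)))
            (tensor_map (ringR E) (modT_SR E) (PT E) id id) (shepherd_r E x))"

text \<open>
  \<open>(C \<otimes>\<^sub>R T\<^sup>^) \<inter> (T\<^sup>^ \<otimes>\<^sub>S D)\<close>, both regarded as subsets of \<open>(T\<^sup>^ \<otimes>\<^sub>S T) \<otimes>\<^sub>R T\<^sup>^\<close>.
\<close>

definition Tbar_carrier :: "('r, 's, 'a, 'b, 't, 'h) herd_data \<Rightarrow> (('h, 't) tens, 'h) tens set" where
  "Tbar_carrier E =
     tensor_map (ringR E) (PT E) (pen_RS E) id id ` carrier (tensor (ringR E) (coringC E) (pen_RS E)) \<inter>
     unassoc (ringS E) (ringR E) (pen_RS E) (modT_SR E) (pen_RS E) `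
       tensor_map (ringS E) (pen_RS E) (TP E) id id ` carrier (tensor (ringS E) (pen_RS E) (coringD E))"

definition bimodTbar :: "('r, 's, 'a, 'b, 't, 'h) herd_data \<Rightarrow> ('r, 's, (('h, 't) tens, 'h) tens) bimod" where
  "bimodTbar E = (PTP E)\<lparr>carrier := Tbar_carrier E\<rparr>"

text \<open>
  The map \<open>T\<^sup>^ \<otimes>\<^sub>S \<gamma> \<otimes>\<^sub>R T\<^sup>^\<close> on \<open>(T\<^sup>^ \<otimes>\<^sub>S T) \<otimes>\<^sub>R T\<^sup>^\<close>, with values bracketed as
  \<open>(T\<^sup>^ \<otimes>\<^sub>S T) \<otimes>\<^sub>R ((T\<^sup>^ \<otimes>\<^sub>S T) \<otimes>\<^sub>R T\<^sup>^)\<close> and as \<open>((T\<^sup>^ \<otimes>\<^sub>S T) \<otimes>\<^sub>R T\<^sup>^) \<otimes>\<^sub>S (T \<otimes>\<^sub>R T\<^sup>^)\<close>.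
\<close>

definition pen_shepherd_pen_l ::
  "('r, 's, 'a, 'b, 't, 'h) herd_data \<Rightarrow> (('h, 't) tens, 'h) tens \<Rightarrow> (('h, 't) tens, (('h, 't) tens, 'h) tens) tens" where
  "pen_shepherd_pen_l E = assoc (ringR E) (ringR E) (PT E) (PT E) (pen_RS E) \<circ>
     tensor_map (ringR E) (tensor (ringR E) (PT E) (PT E)) (pen_RS E) (pen_shepherd E) id"

definition pen_shepherd_pen_r ::
  "('r, 's, 'a, 'b, 't, 'h) herd_data \<Rightarrow> (('h, 't) tens, 'h) tens \<Rightarrow> ((('h, 't) tens, 'h) tens, ('t, 'h) tens) tens" where
  "pen_shepherd_pen_r E =
     tensor_map (ringS E) (PTP E) (TP E) (unassoc (ringS E) (ringR E) (pen_RS E) (modT_SR E) (pen_RS E)) id \<circ>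
     unassoc (ringS E) (ringS E) (pen_RS E) (TP E) (TP E) \<circ>
     tensor_map (ringS E) (pen_RS E) (tensor (ringS E) (TP E) (TP E)) id (shepherd_pen E) \<circ>
     assoc (ringS E) (ringR E) (pen_RS E) (modT_SR E) (pen_RS E)"

definition bicomodTbar ::
  "('r, 's, 'a, 'b, 't, 'h) herd_data \<Rightarrow>
   ('r, 's, ('h, 't) tens, ('t, 'h) tens, (('h, 't) tens, 'h) tens) bicomod" where
  "bicomodTbar E = with_coactions (bimodTbar E)
     (\<lambda>w. the_inv_into (carrier (tensor (ringR E) (coringC E) (bimodTbar E)))
            (tensor_map (ringR E) (PT E) (PTP E) id id) (pen_shepherd_pen_l E w))
     (\<lambda>w. the_inv_into (carrier (tensor (ringS E) (bimodTbar E) (coringD E)))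
            (tensor_map (ringS E) (PTP E) (TP E) id id) (pen_shepherd_pen_r E w))"

definition chi ::
  "('r, 's, 'a, 'b, 't, 'h) herd_data \<Rightarrow> (('t, (('h, 't) tens, 'h) tens) tens, 't) tens \<Rightarrow> 't" where
  "chi E = (let G = add_monoid (modT E) in
     tensor_lift G (\<lambda>(u, z). tensor_lift G (\<lambda>(x, w). tensor_lift G (\<lambda>(v, q). tensor_lift G (\<lambda>(p, y).
       (evh E (pure_tensor (ringR E) (modT_SR E) (pen_RS E) x p) \<odot>\<^bsub>modT E\<^esub> y)
         \<odot>r\<^bsub>modT E\<^esub> ev E (pure_tensor (ringS E) (pen_RS E) (modT_SR E) q z)) v) w) u))"

end

theory Submission
  imports Defs "HOL-Library.Equipollence"
begin

text \<open>
  All coassociativity and compatibility identities hold already for the maps between tensor products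
  of \<open>T\<close> and its pen: in Sweedler notation both sides have the shape
  \<open>\<Sum> h(x\<langle>1\<rangle>, x\<langle>2\<rangle>, x\<langle>3\<rangle>\<langle>1\<rangle>, x\<langle>3\<rangle>\<langle>2\<rangle>, x\<langle>3\<rangle>\<langle>3\<rangle>)\<close> for the same multilinear \<open>h\<close>, by
  coassociativity of the shepherd. It remains to see that the structure maps corestrict to \<open>C\<close>,
  \<open>D\<close> and \<open>T\<close>-bar and that identities can be tested in the ambient tensor products.

  The submodules \<open>C\<close>, \<open>D\<close> and \<open>T\<close>-bar are equalizers, and tensoring with the faithfully flat \<open>T\<close>
  preserves and reflects equalizers and injectivity. After tensoring with \<open>T\<close> each of the inclusions
  splits: \<open>x \<otimes> p \<otimes> y \<mapsto> evh(x \<otimes> p) \<gamma>(y)\<close> is a retraction of \<open>T \<otimes> C \<rightarrow> T \<otimes> pen \<otimes> T\<close>, and similarly for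
  \<open>D\<close> and for \<open>T\<close>-bar. Being split they stay injective under any further tensor product, and
  by descent so do the inclusions themselves. The maps cov are the corestrictions of \<open>pen \<otimes> \<gamma>\<close> and
  \<open>\<gamma> \<otimes> pen\<close>, and the coherd axioms reduce to \<open>x \<cdot> ev(p \<otimes> y) = evh(x \<otimes> p) \<cdot> y\<close>.
\<close>

section \<open>Additive maps and homomorphisms\<close>

text \<open>The obstacle is that flatness is given for \<open>T\<close> alone. Nothing makes the
  pen, \<open>C\<close>, \<open>D\<close> or T-bar flat, so injectivity of, say,
  \<open>C \<otimes> C \<rightarrow> pt \<otimes> pt\<close> is not automatic. What helps is that
  \<open>pt = P \<otimes> T\<close> and \<open>tp = T \<otimes> P\<close> carry their own copy of
  \<open>T\<close>: grouped with a neighbouring submodule, this copy produces a split inclusion,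
  which survives tensoring with \<open>P\<close>. T-bar is harder, since its splitting needs a
  \<open>T\<close> on both sides; where only one is present, the other is added and removed again by
  faithful flatness. All splittings rest on one move,
  \<open>evh(x \<otimes> p) y = x ev(p \<otimes> y)\<close>, which trades a contraction on the left
  for one on the right. A second obstacle is size. Faithful flatness quantifies over modules in one
  fixed type, whereas iterated tensor products live in ever new types; cardinality bounds and
  transport of structure bridge the gap. That the counits take values in \<open>R\<close> and
  \<open>S\<close> is also a descent statement: the image of \<alpha> is the set of \<open>a\<close>
  with \<open>a \<otimes> 1 = 1 \<otimes> a\<close>.\<close>

definition ahom :: "('m, 'z1) ring_scheme \<Rightarrow> ('n, 'z2) ring_scheme \<Rightarrow> ('m \<Rightarrow> 'n) set" where
  "ahom M N = {f. (\<forall>x \<in> carrier M. f x \<in> carrier N) \<and>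
     (\<forall>x \<in> carrier M. \<forall>y \<in> carrier M. f (x \<oplus>\<^bsub>M\<^esub> y) = f x \<oplus>\<^bsub>N\<^esub> f y)}"

lemma hom_add_monoid [simp]: "hom (add_monoid M) (add_monoid N) = ahom M N"
  by (auto simp: hom_def ahom_def)

lemma ahomI:
  "\<lbrakk>\<And>x. x \<in> carrier M \<Longrightarrow> f x \<in> carrier N;
    \<And>x y. \<lbrakk>x \<in> carrier M; y \<in> carrier M\<rbrakk> \<Longrightarrow> f (x \<oplus>\<^bsub>M\<^esub> y) = f x \<oplus>\<^bsub>N\<^esub> f y\<rbrakk> \<Longrightarrow> f \<in> ahom M N"
  by (simp add: ahom_def)

lemma ahom_closed: "\<lbrakk>f \<in> ahom M N; x \<in> carrier M\<rbrakk> \<Longrightarrow> f x \<in> carrier N"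
  by (simp add: ahom_def)

lemma ahom_add: "\<lbrakk>f \<in> ahom M N; x \<in> carrier M; y \<in> carrier M\<rbrakk> \<Longrightarrow> f (x \<oplus>\<^bsub>M\<^esub> y) = f x \<oplus>\<^bsub>N\<^esub> f y"
  by (simp add: ahom_def)

lemma ahom_zero: "\<lbrakk>abelian_group M; abelian_group N; f \<in> ahom M N\<rbrakk> \<Longrightarrow> f \<zero>\<^bsub>M\<^esub> = \<zero>\<^bsub>N\<^esub>"
  using hom_one[of f "add_monoid M" "add_monoid N"]
  by (simp add: abelian_group.a_group)

lemma ahom_uminus:
  assumes "abelian_group M" "abelian_group N" "f \<in> ahom M N" "x \<in> carrier M"
  shows "f (\<ominus>\<^bsub>M\<^esub> x) = \<ominus>\<^bsub>N\<^esub> f x"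
proof -
  interpret M: abelian_group M by fact
  interpret N: abelian_group N by fact
  have "f (\<ominus>\<^bsub>M\<^esub> x) \<oplus>\<^bsub>N\<^esub> f x = \<zero>\<^bsub>N\<^esub>"
    using assms by (simp flip: ahom_add add: ahom_zero M.l_neg)
  then show ?thesis
    using assms N.minus_equality ahom_closed M.a_inv_closed by metis
qed

lemma ahom_comp:
  "\<lbrakk>f \<in> ahom X M; g \<in> ahom M N\<rbrakk> \<Longrightarrow> (\<lambda>u. g (f u)) \<in> ahom X N"
  by (simp add: ahom_def)

lemma ahom_id: "(\<lambda>u. u) \<in> ahom M M"
  by (simp add: ahom_def)

lemma left_hom_iff:
  "f \<in> left_hom K M N \<longleftrightarrow> f \<in> ahom M N \<and>
     (\<forall>a \<in> carrier K. \<forall>x \<in> carrier M. f (a \<odot>\<^bsub>M\<^esub> x) = a \<odot>\<^bsub>N\<^esub> f x)"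
  by (simp add: left_hom_def)

lemma right_hom_iff:
  "f \<in> right_hom K M N \<longleftrightarrow> f \<in> ahom M N \<and>
     (\<forall>a \<in> carrier K. \<forall>x \<in> carrier M. f (x \<odot>r\<^bsub>M\<^esub> a) = f x \<odot>r\<^bsub>N\<^esub> a)"
  by (simp add: right_hom_def)

lemma bimod_hom_iff:
  "f \<in> bimod_hom K R M N \<longleftrightarrow> f \<in> left_hom K M N \<and> f \<in> right_hom R M N"
  by (simp add: bimod_hom_def)

lemma left_hom_ahom: "f \<in> left_hom K M N \<Longrightarrow> f \<in> ahom M N"
  by (simp add: left_hom_iff)

lemma right_hom_ahom: "f \<in> right_hom K M N \<Longrightarrow> f \<in> ahom M N"
  by (simp add: right_hom_iff)

lemma bimod_hom_ahom: "f \<in> bimod_hom K R M N \<Longrightarrow> f \<in> ahom M N"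
  by (simp add: bimod_hom_iff left_hom_iff)

lemma bimod_hom_left: "f \<in> bimod_hom K R M N \<Longrightarrow> f \<in> left_hom K M N"
  by (simp add: bimod_hom_iff)

lemma bimod_hom_right: "f \<in> bimod_hom K R M N \<Longrightarrow> f \<in> right_hom R M N"
  by (simp add: bimod_hom_iff)

lemma left_hom_closed: "\<lbrakk>f \<in> left_hom K M N; x \<in> carrier M\<rbrakk> \<Longrightarrow> f x \<in> carrier N"
  by (simp add: left_hom_iff ahom_def)

lemma right_hom_closed: "\<lbrakk>f \<in> right_hom K M N; x \<in> carrier M\<rbrakk> \<Longrightarrow> f x \<in> carrier N"
  by (simp add: right_hom_iff ahom_def)

lemma bimod_hom_closed: "\<lbrakk>f \<in> bimod_hom K R M N; x \<in> carrier M\<rbrakk> \<Longrightarrow> f x \<in> carrier N"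
  using ahom_closed bimod_hom_ahom by metis

lemma left_hom_id: "id \<in> left_hom K M M"
  by (simp add: left_hom_iff ahom_def)

lemma right_hom_id: "id \<in> right_hom K M M"
  by (simp add: right_hom_iff ahom_def)

lemma bimod_hom_id: "id \<in> bimod_hom K R M M"
  by (simp add: bimod_hom_iff left_hom_id right_hom_id)

lemma left_hom_comp: "\<lbrakk>f \<in> left_hom K M N; g \<in> left_hom K N P\<rbrakk> \<Longrightarrow> g \<circ> f \<in> left_hom K M P"
  by (simp add: left_hom_iff ahom_def)

lemma right_hom_comp: "\<lbrakk>f \<in> right_hom K M N; g \<in> right_hom K N P\<rbrakk> \<Longrightarrow> g \<circ> f \<in> right_hom K M P"
  by (simp add: right_hom_iff ahom_def)

lemma bimod_hom_comp:
  "\<lbrakk>f \<in> bimod_hom K R M N; g \<in> bimod_hom K R N P\<rbrakk> \<Longrightarrow> g \<circ> f \<in> bimod_hom K R M P"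
  by (auto simp: bimod_hom_iff intro: left_hom_comp right_hom_comp)

lemma right_module_abelian_group: "right_module R M \<Longrightarrow> abelian_group M"
  by (simp add: right_module_def)

lemma left_module_abelian_group: "left_module R M \<Longrightarrow> abelian_group M"
  by (simp add: left_module_def)

lemma bimodule_abelian_group: "bimodule K R M \<Longrightarrow> abelian_group M"
  by (simp add: bimodule_def left_module_def)

lemma bimodule_left: "bimodule K R M \<Longrightarrow> left_module K M"
  by (simp add: bimodule_def)

lemma bimodule_right: "bimodule K R M \<Longrightarrow> right_module R M"
  by (simp add: bimodule_def)

section \<open>Tensor products\<close>

lemma tensor_simps:
  "carrier (tensor R M N) = carrier (tensor_group R M N)"
  "\<zero>\<^bsub>tensor R M N\<^esub> = \<one>\<^bsub>tensor_group R M N\<^esub>"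
  "x \<oplus>\<^bsub>tensor R M N\<^esub> y = x \<otimes>\<^bsub>tensor_group R M N\<^esub> y"
  by (simp_all add: tensor_def)

section \<open>The universal property of the tensor product\<close>

definition balanced ::
  "'r ring \<Rightarrow> ('k, 'r, 'm, 'z1) bimod_scheme \<Rightarrow> ('r, 'l, 'n, 'z2) bimod_scheme \<Rightarrow>
   ('p, 'z3) ring_scheme \<Rightarrow> ('m \<times> 'n \<Rightarrow> 'p) \<Rightarrow> bool" where
  "balanced R M N X b \<longleftrightarrow>
     (\<forall>x \<in> carrier M. \<forall>y \<in> carrier N. b (x, y) \<in> carrier X) \<and>
     (\<forall>x \<in> carrier M. \<forall>x' \<in> carrier M. \<forall>y \<in> carrier N. b (x \<oplus>\<^bsub>M\<^esub> x', y) = b (x, y) \<oplus>\<^bsub>X\<^esub> b (x', y)) \<and>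
     (\<forall>x \<in> carrier M. \<forall>y \<in> carrier N. \<forall>y' \<in> carrier N. b (x, y \<oplus>\<^bsub>N\<^esub> y') = b (x, y) \<oplus>\<^bsub>X\<^esub> b (x, y')) \<and>
     (\<forall>x \<in> carrier M. \<forall>a \<in> carrier R. \<forall>y \<in> carrier N. b (x \<odot>r\<^bsub>M\<^esub> a, y) = b (x, a \<odot>\<^bsub>N\<^esub> y))"

locale tensor_ctx = M: right_module R M + N: left_module R N
  for R :: "'r ring" and M :: "('k, 'r, 'm, 'z1) bimod_scheme" and N :: "('r, 'l, 'n, 'z2) bimod_scheme"
begin

abbreviation "F \<equiv> free_Abelian_group (carrier M \<times> carrier N)"
abbreviation "T0 \<equiv> tensor_subgroup R M N"

lemma relations_carrier: "tensor_relations R M N \<subseteq> carrier F"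
  unfolding tensor_relations_def
  by (auto dest!: subsetD[OF keys_diff]
      simp: M.rsmult_closed N.lsmult_closed keys_frag_of)

lemma subgroup_T0: "subgroup T0 F"
  unfolding tensor_subgroup_def
  by (rule group.generate_is_subgroup[OF group_free_Abelian_group relations_carrier])

lemma normal_T0: "T0 \<lhd> F"
  by (simp add: abelian_free_Abelian_group comm_group.subgroup_imp_normal subgroup_T0)

lemma comm_group_tensor_group: "comm_group (tensor_group R M N)"
  unfolding tensor_group_def
  by (simp add: abelian_free_Abelian_group comm_group.abelian_FactGroup subgroup_T0)

lemma abelian_group_tensor: "abelian_group (tensor R M N)"
proof -
  interpret G: comm_group "tensor_group R M N" by (rule comm_group_tensor_group)
  show ?thesis
    by (rule abelian_groupI) (auto simp: tensor_simps G.m_ac intro: G.l_inv_ex)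
qed

lemma tensor_carrier_cases:
  assumes "X \<in> carrier (tensor R M N)"
  obtains c where "c \<in> carrier F" "X = T0 #>\<^bsub>F\<^esub> c"
  using assms by (auto simp: tensor_simps tensor_group_def FactGroup_def RCOSETS_def)

lemma coset_hom: "(\<lambda>c. T0 #>\<^bsub>F\<^esub> c) \<in> hom F (tensor_group R M N)"
  unfolding tensor_group_def using normal.r_coset_hom_Mod[OF normal_T0] .

lemma pure_tensor_closed: "\<lbrakk>x \<in> carrier M; y \<in> carrier N\<rbrakk> \<Longrightarrow> pure_tensor R M N x y \<in> carrier (tensor R M N)"
  unfolding pure_tensor_def tensor_simps using coset_hom by (auto simp: hom_def keys_frag_of)

lemma relation_coset:
  assumes "c \<in> carrier F" "d \<in> carrier F" "c - d \<in> tensor_relations R M N"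
  shows "T0 #>\<^bsub>F\<^esub> c = T0 #>\<^bsub>F\<^esub> d"
proof -
  have "c - d \<in> T0"
    using assms(3) by (auto simp: tensor_subgroup_def intro: generate.incl)
  moreover have "c = (c - d) \<otimes>\<^bsub>F\<^esub> d" by simp
  ultimately have "c \<in> T0 #>\<^bsub>F\<^esub> d" unfolding r_coset_def by blast
  then show ?thesis
    using group.repr_independence[OF group_free_Abelian_group _ assms(2) subgroup_T0] by metis
qed

lemma coset_frag_add:
  assumes "z \<in> carrier M \<times> carrier N" "z' \<in> carrier M \<times> carrier N"
  shows "(T0 #>\<^bsub>F\<^esub> frag_of z) \<oplus>\<^bsub>tensor R M N\<^esub> (T0 #>\<^bsub>F\<^esub> frag_of z') = T0 #>\<^bsub>F\<^esub> (frag_of z + frag_of z')"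
  using hom_mult[OF coset_hom, of "frag_of z" "frag_of z'"] assms
  by (simp add: tensor_simps keys_frag_of)

lemma keys_frag2: "z \<in> A \<Longrightarrow> z' \<in> A \<Longrightarrow> Poly_Mapping.keys (frag_of z + frag_of z') \<subseteq> A"
  by (metis (no_types, lifting) Un_least empty_subsetI insert_subset keys_add keys_frag_of order_trans)

lemma pure_tensor_add_l:
  assumes "x \<in> carrier M" "x' \<in> carrier M" "y \<in> carrier N"
  shows "pure_tensor R M N (x \<oplus>\<^bsub>M\<^esub> x') y = pure_tensor R M N x y \<oplus>\<^bsub>tensor R M N\<^esub> pure_tensor R M N x' y"
  unfolding pure_tensor_def using assms
  by (subst coset_frag_add, simp, simp, intro relation_coset)
     (auto simp: keys_frag_of keys_frag2 tensor_relations_def diff_diff_eq[symmetric])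

lemma pure_tensor_add_r:
  assumes "x \<in> carrier M" "y \<in> carrier N" "y' \<in> carrier N"
  shows "pure_tensor R M N x (y \<oplus>\<^bsub>N\<^esub> y') = pure_tensor R M N x y \<oplus>\<^bsub>tensor R M N\<^esub> pure_tensor R M N x y'"
  unfolding pure_tensor_def using assms
  by (subst coset_frag_add, simp, simp, intro relation_coset)
     (auto simp: keys_frag_of keys_frag2 tensor_relations_def diff_diff_eq[symmetric])

lemma pure_tensor_balanced:
  assumes "x \<in> carrier M" "a \<in> carrier R" "y \<in> carrier N"
  shows "pure_tensor R M N (x \<odot>r\<^bsub>M\<^esub> a) y = pure_tensor R M N x (a \<odot>\<^bsub>N\<^esub> y)"
  unfolding pure_tensor_def using assms
  by (intro relation_coset) (auto simp: keys_frag_of tensor_relations_def M.rsmult_closed N.lsmult_closed)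

lemma hom_F_ext:
  assumes "group G" "f \<in> hom F G" "g \<in> hom F G" "c \<in> carrier F"
    and "\<And>x y. \<lbrakk>x \<in> carrier M; y \<in> carrier N\<rbrakk> \<Longrightarrow> f (frag_of (x, y)) = g (frag_of (x, y))"
  shows "f c = g c"
proof -
  interpret f: group_hom F G f using assms by (simp add: group_hom_def group_hom_axioms_def)
  interpret g: group_hom F G g using assms by (simp add: group_hom_def group_hom_axioms_def)
  have "Poly_Mapping.keys c \<subseteq> carrier M \<times> carrier N" using assms(4) by simp
  then show ?thesis
  proof (rule free_Abelian_group_induct)
    show "f 0 = g 0" using f.hom_one g.hom_one by simp
  next
    fix u v assume uv: "Poly_Mapping.keys u \<subseteq> carrier M \<times> carrier N"
      "Poly_Mapping.keys v \<subseteq> carrier M \<times> carrier N" "f u = g u" "f v = g v"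
    \<comment> \<open>The induction builds elements by differences, so preservation of inverses
      enters; the difference is written with the operations of \<open>F\<close> in order to use
      it.\<close>
    have eq: "u - v = u \<otimes>\<^bsub>F\<^esub> inv\<^bsub>F\<^esub> v" using uv by simp
    have "u \<in> carrier F" "inv\<^bsub>F\<^esub> v \<in> carrier F" "v \<in> carrier F" using uv by auto
    then show "f (u - v) = g (u - v)" unfolding eq
      using uv by (simp only: f.hom_mult g.hom_mult f.hom_inv g.hom_inv)
  next
    fix z assume "z \<in> carrier M \<times> carrier N"
    then show "f (frag_of z) = g (frag_of z)" using assms(5) by auto
  qed
qed

text \<open>Composition with the quotient map reduces the claim to the free group, which is
  generated by the pairs. Only additivity is asked of \<open>f\<close> and \<open>g\<close>:
  linearity of the maps built below is itself proved by this principle, both sides being additive in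
  \<open>u\<close> for a fixed scalar.\<close>

lemma hom_eqI:
  assumes X: "abelian_group X" and f: "f \<in> ahom (tensor R M N) X" and g: "g \<in> ahom (tensor R M N) X"
    and eq: "\<And>x y. \<lbrakk>x \<in> carrier M; y \<in> carrier N\<rbrakk> \<Longrightarrow> f (pure_tensor R M N x y) = g (pure_tensor R M N x y)"
    and u: "u \<in> carrier (tensor R M N)"
  shows "f u = g u"
proof -
  obtain c where c: "c \<in> carrier F" "u = T0 #>\<^bsub>F\<^esub> c" using tensor_carrier_cases[OF u] .
  have fg: "h \<circ> (\<lambda>c. T0 #>\<^bsub>F\<^esub> c) \<in> hom F (add_monoid X)" if "h \<in> ahom (tensor R M N) X" for h
  proof -
    have "h \<in> hom (tensor_group R M N) (add_monoid X)"
      using that by (auto simp: hom_def ahom_def tensor_simps)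
    then show ?thesis using coset_hom hom_compose by blast
  qed
  have "(f \<circ> (\<lambda>c. T0 #>\<^bsub>F\<^esub> c)) c = (g \<circ> (\<lambda>c. T0 #>\<^bsub>F\<^esub> c)) c"
    using abelian_group.a_group[OF X] fg[OF f] fg[OF g] c(1)
    by (rule hom_F_ext) (use eq in \<open>simp add: pure_tensor_def\<close>)
  then show ?thesis using c by simp
qed

text \<open>The additive extension of \<open>b\<close> to the free group, in the very form in which
  \<open>tensor_lift\<close> evaluates a representative. Independence of the representative is thus
  constancy of \<open>comb G b\<close> on cosets.\<close>

definition comb :: "('p, 'z) monoid_scheme \<Rightarrow> ('m \<times> 'n \<Rightarrow> 'p) \<Rightarrow> ('m \<times> 'n \<Rightarrow>\<^sub>0 int) \<Rightarrow> 'p" where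
  "comb G b c = finprod G (\<lambda>z. b z [^]\<^bsub>G\<^esub> Poly_Mapping.lookup c z) (Poly_Mapping.keys c)"

lemma comb_hom:
  assumes "comm_group G" and b: "\<And>z. z \<in> carrier M \<times> carrier N \<Longrightarrow> b z \<in> carrier G"
  shows "comb G b \<in> hom F G"
proof -
  interpret G: comm_group G by fact
  \<comment> \<open>The support of a sum can be smaller than the union of the supports. The product
    is therefore extended to any finite set containing the support, where the additional factors are
    trivial.\<close>
  have ext: "comb G b c = finprod G (\<lambda>z. b z [^]\<^bsub>G\<^esub> Poly_Mapping.lookup c z) K"
    if "Poly_Mapping.keys c \<subseteq> K" "finite K" "K \<subseteq> carrier M \<times> carrier N" for c K
  proof -
    have "\<And>z. z \<in> K \<Longrightarrow> b z \<in> carrier G" using that b by blast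
    then show ?thesis
      unfolding comb_def using that
      by (intro G.finprod_mono_neutral_cong) (auto simp: in_keys_iff subset_iff)
  qed
  show ?thesis
  proof (rule homI)
    fix c assume "c \<in> carrier F"
    then show "comb G b c \<in> carrier G"
      unfolding comb_def using b by (intro G.finprod_closed) auto
  next
    fix c d assume cd: "c \<in> carrier F" "d \<in> carrier F"
    let ?K = "Poly_Mapping.keys c \<union> Poly_Mapping.keys d"
    have K: "finite ?K" "?K \<subseteq> carrier M \<times> carrier N" using cd by auto
    have "comb G b (c + d) = finprod G (\<lambda>z. b z [^]\<^bsub>G\<^esub> Poly_Mapping.lookup (c + d) z) ?K"
      using K by (intro ext) (auto simp: keys_add dest: subsetD[OF keys_add])
    also have "\<dots> = finprod G (\<lambda>z. b z [^]\<^bsub>G\<^esub> Poly_Mapping.lookup c z \<otimes>\<^bsub>G\<^esub> b z [^]\<^bsub>G\<^esub> Poly_Mapping.lookup d z) ?K"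
      using b K by (intro G.finprod_cong refl) (auto simp: lookup_add G.int_pow_mult simp_implies_def)
    also have "\<dots> = comb G b c \<otimes>\<^bsub>G\<^esub> comb G b d"
      using b K by (subst G.finprod_multf) (auto simp: ext[of _ ?K])
    finally show "comb G b (c \<otimes>\<^bsub>F\<^esub> d) = comb G b c \<otimes>\<^bsub>G\<^esub> comb G b d" by simp
  qed
qed

lemma comb_frag_of:
  assumes "comm_group G" and b: "b z \<in> carrier G"
  shows "comb G b (frag_of z) = b z"
proof -
  interpret G: comm_group G by fact
  show ?thesis unfolding comb_def using b by (simp add: keys_frag_of G.int_pow_1)
qed

text \<open>The kernel of \<open>comb G b\<close> is a subgroup, and it contains each generating
  relation because \<open>b\<close> is biadditive and balanced. \<open>G\<close> and
  \<open>X\<close> are kept apart since the lifts go into different records that share carrier and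
  addition.\<close>

lemma comb_T0:
  assumes G: "comm_group G" and X: "carrier G = carrier X" "\<And>x y. x \<otimes>\<^bsub>G\<^esub> y = x \<oplus>\<^bsub>X\<^esub> y"
    and b: "balanced R M N X b" and c: "c \<in> T0"
  shows "comb G b c = \<one>\<^bsub>G\<^esub>"
proof -
  interpret G: comm_group G by fact
  have bc: "\<And>z. z \<in> carrier M \<times> carrier N \<Longrightarrow> b z \<in> carrier G"
    using b by (auto simp: balanced_def X)
  interpret h: group_hom F G "comb G b"
    using comb_hom[OF G bc] by (simp add: group_hom_def group_hom_axioms_def)
  have fr: "comb G b (frag_of z - w) = b z \<otimes>\<^bsub>G\<^esub> inv\<^bsub>G\<^esub> (comb G b w)"
    if "z \<in> carrier M \<times> carrier N" "w \<in> carrier F" for z w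
  proof -
    have z: "frag_of z \<in> carrier F" using that by (simp add: keys_frag_of)
    have "comb G b (frag_of z \<otimes>\<^bsub>F\<^esub> inv\<^bsub>F\<^esub> w) = comb G b (frag_of z) \<otimes>\<^bsub>G\<^esub> inv\<^bsub>G\<^esub> (comb G b w)"
      using z that by (simp only: h.hom_mult h.G.inv_closed h.hom_inv)
    then show ?thesis using that comb_frag_of[OF G, of b z] bc[OF that(1)] by simp
  qed
  have fa: "comb G b (frag_of z + frag_of w) = b z \<otimes>\<^bsub>G\<^esub> b w"
    if "z \<in> carrier M \<times> carrier N" "w \<in> carrier M \<times> carrier N" for z w
    using h.hom_mult[of "frag_of z" "frag_of w"] comb_frag_of[OF G, of b z] comb_frag_of[OF G, of b w] bc that
    by (simp add: keys_frag_of)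
  have "tensor_relations R M N \<subseteq> kernel F G (comb G b)"
  proof
    fix r assume r: "r \<in> tensor_relations R M N"
    then have "r \<in> carrier F" using relations_carrier by blast
    moreover have "comb G b r = \<one>\<^bsub>G\<^esub>"
    proof -
      have tri: "comb G b (frag_of z - frag_of w - frag_of w') = \<one>\<^bsub>G\<^esub>"
        if "z \<in> carrier M \<times> carrier N" "w \<in> carrier M \<times> carrier N" "w' \<in> carrier M \<times> carrier N"
          "b z = b w \<otimes>\<^bsub>G\<^esub> b w'" for z w w'
      proof -
        have w: "frag_of w + frag_of w' \<in> carrier F" using that keys_frag2 by simp
        have "comb G b (frag_of z - (frag_of w + frag_of w')) = b z \<otimes>\<^bsub>G\<^esub> inv\<^bsub>G\<^esub> (b w \<otimes>\<^bsub>G\<^esub> b w')"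
          by (simp only: fr[OF that(1) w] fa[OF that(2,3)])
        also have "\<dots> = \<one>\<^bsub>G\<^esub>" unfolding that(4) by (rule G.r_inv) (intro G.m_closed bc that)
        finally show ?thesis by (simp only: diff_diff_eq)
      qed
      have bX: "b (x \<oplus>\<^bsub>M\<^esub> x', y) = b (x, y) \<otimes>\<^bsub>G\<^esub> b (x', y)"
        "b (x, v \<oplus>\<^bsub>N\<^esub> v') = b (x, v) \<otimes>\<^bsub>G\<^esub> b (x, v')"
        "b (x \<odot>r\<^bsub>M\<^esub> a, y) = b (x, a \<odot>\<^bsub>N\<^esub> y)"
        if "x \<in> carrier M" "x' \<in> carrier M" "y \<in> carrier N" "v \<in> carrier N" "v' \<in> carrier N" "a \<in> carrier R"
        for x x' y v v' a
        using b that by (simp_all add: balanced_def X(2))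
      from r[unfolded tensor_relations_def Un_iff mem_Collect_eq] show ?thesis
      proof (elim disjE exE conjE)
        fix x x' y assume *: "x \<in> carrier M" "x' \<in> carrier M" "y \<in> carrier N"
          "r = frag_of (x \<oplus>\<^bsub>M\<^esub> x', y) - frag_of (x, y) - frag_of (x', y)"
        \<comment> \<open>\<open>bX\<close> states three identities under one list of hypotheses;
          the variables that do not occur in the identity at hand are filled with arbitrary elements
          such as zero.\<close>
        then show ?thesis unfolding *(4) by (intro tri bX(1)[of _ _ _ y y "\<zero>\<^bsub>R\<^esub>"]) auto
      next
        fix x y y' assume *: "x \<in> carrier M" "y \<in> carrier N" "y' \<in> carrier N"
          "r = frag_of (x, y \<oplus>\<^bsub>N\<^esub> y') - frag_of (x, y) - frag_of (x, y')"
        then show ?thesis unfolding *(4) by (intro tri bX(2)[of _ x y _ _ "\<zero>\<^bsub>R\<^esub>"]) auto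
      next
        fix x a y assume *: "x \<in> carrier M" "a \<in> carrier R" "y \<in> carrier N"
          "r = frag_of (x \<odot>r\<^bsub>M\<^esub> a, y) - frag_of (x, a \<odot>\<^bsub>N\<^esub> y)"
        have z: "(x \<odot>r\<^bsub>M\<^esub> a, y) \<in> carrier M \<times> carrier N" "(x, a \<odot>\<^bsub>N\<^esub> y) \<in> carrier M \<times> carrier N"
          using * by (simp_all add: M.rsmult_closed N.lsmult_closed)
        have w: "frag_of (x, a \<odot>\<^bsub>N\<^esub> y) \<in> carrier F" using z by (simp add: keys_frag_of)
        have "comb G b r = b (x \<odot>r\<^bsub>M\<^esub> a, y) \<otimes>\<^bsub>G\<^esub> inv\<^bsub>G\<^esub> (b (x, a \<odot>\<^bsub>N\<^esub> y))"
          unfolding *(4) by (simp only: fr[OF z(1) w] comb_frag_of[OF G, of b, OF bc[OF z(2)]])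
        also have "\<dots> = \<one>\<^bsub>G\<^esub>"
          unfolding bX(3)[OF *(1) *(1) *(3) *(3) *(3) *(2)] by (rule G.r_inv) (rule bc[OF z(2)])
        finally show ?thesis .
      qed
    qed
    ultimately show "r \<in> kernel F G (comb G b)" by (simp add: kernel_def)
  qed
  then have "T0 \<subseteq> kernel F G (comb G b)"
    unfolding tensor_subgroup_def
    by (rule group.generate_subgroup_incl[OF group_free_Abelian_group _ h.subgroup_kernel])
  then show ?thesis using c by (auto simp: kernel_def)
qed

text \<open>The representative picked by \<open>tensor_lift\<close> differs from \<open>c\<close> by
  an element of \<open>T0\<close>, on which \<open>comb\<close> is trivial.\<close>

lemma tensor_lift_coset:
  assumes G: "comm_group G" and X: "carrier G = carrier X" "\<And>x y. x \<otimes>\<^bsub>G\<^esub> y = x \<oplus>\<^bsub>X\<^esub> y"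
    and b: "balanced R M N X b" and c: "c \<in> carrier F"
  shows "tensor_lift G b (T0 #>\<^bsub>F\<^esub> c) = comb G b c"
proof -
  interpret G: comm_group G by fact
  have bc: "\<And>z. z \<in> carrier M \<times> carrier N \<Longrightarrow> b z \<in> carrier G"
    using b by (auto simp: balanced_def X)
  interpret h: group_hom F G "comb G b"
    using comb_hom[OF G bc] by (simp add: group_hom_def group_hom_axioms_def)
  let ?c = "SOME d. d \<in> T0 #>\<^bsub>F\<^esub> c"
  have "c \<in> T0 #>\<^bsub>F\<^esub> c" by (rule group.rcos_self[OF group_free_Abelian_group c subgroup_T0])
  then have "?c \<in> T0 #>\<^bsub>F\<^esub> c" by (rule someI)
  then obtain t where t: "t \<in> T0" "?c = t \<otimes>\<^bsub>F\<^esub> c" by (auto simp: r_coset_def)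
  have "t \<in> carrier F" using t subgroup.mem_carrier[OF subgroup_T0] by blast
  then have "comb G b ?c = comb G b c"
    unfolding t(2) using h.hom_mult[of t c] c comb_T0[OF G X b t(1)] h.hom_closed[OF c] by simp
  then show ?thesis by (simp add: tensor_lift_def comb_def)
qed

lemma tensor_lift_ahom:
  assumes G: "comm_group G" and X: "carrier G = carrier X" "\<And>x y. x \<otimes>\<^bsub>G\<^esub> y = x \<oplus>\<^bsub>X\<^esub> y"
    and b: "balanced R M N X b"
  shows "tensor_lift G b \<in> ahom (tensor R M N) X"
proof -
  have bc: "\<And>z. z \<in> carrier M \<times> carrier N \<Longrightarrow> b z \<in> carrier G"
    using b by (auto simp: balanced_def X)
  interpret h: group_hom F G "comb G b"
    using comb_hom[OF G bc] G by (simp add: group_hom_def group_hom_axioms_def comm_group_def)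
  note lc = tensor_lift_coset[OF G X b]
  show ?thesis
  proof (rule ahomI)
    fix u assume "u \<in> carrier (tensor R M N)"
    then show "tensor_lift G b u \<in> carrier X"
      using lc h.hom_closed X by (metis tensor_carrier_cases)
  next
    fix u v assume "u \<in> carrier (tensor R M N)" "v \<in> carrier (tensor R M N)"
    then obtain c d where cd: "c \<in> carrier F" "d \<in> carrier F" "u = T0 #>\<^bsub>F\<^esub> c" "v = T0 #>\<^bsub>F\<^esub> d"
      by (metis tensor_carrier_cases)
    have "u \<oplus>\<^bsub>tensor R M N\<^esub> v = T0 #>\<^bsub>F\<^esub> (c \<otimes>\<^bsub>F\<^esub> d)"
      unfolding cd tensor_simps by (rule hom_mult[OF coset_hom cd(1,2), symmetric])
    moreover have "c \<otimes>\<^bsub>F\<^esub> d \<in> carrier F" using cd h.G.m_closed by blast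
    ultimately show "tensor_lift G b (u \<oplus>\<^bsub>tensor R M N\<^esub> v) = tensor_lift G b u \<oplus>\<^bsub>X\<^esub> tensor_lift G b v"
      using lc cd h.hom_mult X by metis
  qed
qed

lemma tensor_lift_pure:
  assumes G: "comm_group G" and X: "carrier G = carrier X" "\<And>x y. x \<otimes>\<^bsub>G\<^esub> y = x \<oplus>\<^bsub>X\<^esub> y"
    and b: "balanced R M N X b" and xy: "x \<in> carrier M" "y \<in> carrier N"
  shows "tensor_lift G b (pure_tensor R M N x y) = b (x, y)"
proof -
  have "b (x, y) \<in> carrier G" using b xy by (auto simp: balanced_def X)
  then show ?thesis
    unfolding pure_tensor_def using xy
    by (subst tensor_lift_coset[OF G X b]) (auto simp: keys_frag_of comb_frag_of[OF G])
qed

end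

lemma tensor_ctxI: "\<lbrakk>right_module R M; left_module R N\<rbrakk> \<Longrightarrow> tensor_ctx R M N"
  by (simp add: tensor_ctx_def)

lemmas tensor_abelian_group [simp] = tensor_ctx.abelian_group_tensor[OF tensor_ctxI]
lemmas pure_closed [simp] = tensor_ctx.pure_tensor_closed[OF tensor_ctxI]
lemmas pure_add_l = tensor_ctx.pure_tensor_add_l[OF tensor_ctxI]
lemmas pure_add_r = tensor_ctx.pure_tensor_add_r[OF tensor_ctxI]
lemmas pure_balanced = tensor_ctx.pure_tensor_balanced[OF tensor_ctxI]
lemmas tensor_eqI = tensor_ctx.hom_eqI[OF tensor_ctxI]

text \<open>
  \<open>tensor_lift\<close> takes its target as a group; the two shapes of target that occur in the definitions
  are additive groups of modules and tensor groups.
\<close>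

definition group_of :: "('p, 'z) monoid_scheme \<Rightarrow> ('p, 'z1) ring_scheme \<Rightarrow> bool" where
  "group_of G X \<longleftrightarrow> carrier G = carrier X \<and> (\<forall>x y. x \<otimes>\<^bsub>G\<^esub> y = x \<oplus>\<^bsub>X\<^esub> y) \<and> comm_group G"

lemma group_of_add_monoid: "abelian_group X \<Longrightarrow> group_of (add_monoid X) X"
  by (simp add: group_of_def abelian_group.a_comm_group)

lemma group_of_tensor: "\<lbrakk>right_module R M; left_module R N\<rbrakk> \<Longrightarrow> group_of (tensor_group R M N) (tensor R M N)"
  by (simp add: group_of_def tensor_simps tensor_ctx.comm_group_tensor_group[OF tensor_ctxI])

lemma lift_ahom:
  "\<lbrakk>right_module R M; left_module R N; group_of G X; balanced R M N X b\<rbrakk> \<Longrightarrow> tensor_lift G b \<in> ahom (tensor R M N) X"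
  by (rule tensor_ctx.tensor_lift_ahom[OF tensor_ctxI]) (simp_all add: group_of_def)

lemma lift_pure:
  "\<lbrakk>right_module R M; left_module R N; group_of G X; balanced R M N X b; x \<in> carrier M; y \<in> carrier N\<rbrakk>
    \<Longrightarrow> tensor_lift G b (pure_tensor R M N x y) = b (x, y)"
  by (rule tensor_ctx.tensor_lift_pure[OF tensor_ctxI, where X = X]) (simp_all add: group_of_def)

section \<open>Tensor products of maps and the bimodule structure of a tensor product\<close>

context
  fixes R :: "'r ring" and M :: "('k, 'r, 'm, 'z1) bimod_scheme" and N :: "('r, 'l, 'n, 'z2) bimod_scheme"
    and M' :: "('k1, 'r, 'm1, 'z3) bimod_scheme" and N' :: "('r, 'l1, 'n1, 'z4) bimod_scheme" and f g
  assumes M: "right_module R M" and N: "left_module R N"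
    and M': "right_module R M'" and N': "left_module R N'"
    and f: "f \<in> right_hom R M M'" and g: "g \<in> left_hom R N N'"
begin

lemma tensor_map_balanced:
  "balanced R M N (tensor R M' N') (\<lambda>(x, y). pure_tensor R M' N' (f x) (g y))"
  using M N M' N' f g
  by (auto simp: balanced_def right_hom_iff left_hom_iff ahom_def pure_add_l pure_add_r pure_balanced
      right_module.rsmult_closed left_module.lsmult_closed)

lemma tensor_map_ahom: "tensor_map R M' N' f g \<in> ahom (tensor R M N) (tensor R M' N')"
  unfolding tensor_map_def by (rule lift_ahom[OF M N group_of_tensor[OF M' N'] tensor_map_balanced])

lemma tensor_map_pure [simp]:
  "\<lbrakk>x \<in> carrier M; y \<in> carrier N\<rbrakk> \<Longrightarrow>
    tensor_map R M' N' f g (pure_tensor R M N x y) = pure_tensor R M' N' (f x) (g y)"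
  unfolding tensor_map_def by (simp add: lift_pure[OF M N group_of_tensor[OF M' N'] tensor_map_balanced])

end

text \<open>A scalar acts on a tensor product through a map of the form
  \<open>f \<otimes> id\<close>, so closure, additivity and the value on pure tensors are inherited
  from \<open>tensor_map\<close>.\<close>

lemma tensor_smult: "smult (tensor R M N) a = tensor_map R M N (\<lambda>x. a \<odot>\<^bsub>M\<^esub> x) id"
  by (simp add: tensor_def tensor_map_def)

lemma tensor_rsmult: "rsmult (tensor R M N) u a = tensor_map R M N id (\<lambda>x. x \<odot>r\<^bsub>N\<^esub> a) u"
  by (simp add: tensor_def tensor_map_def)

lemma bimodule_smult_right_hom: "\<lbrakk>bimodule K R M; a \<in> carrier K\<rbrakk> \<Longrightarrow> (\<lambda>x. a \<odot>\<^bsub>M\<^esub> x) \<in> right_hom R M M"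
  by (auto simp: right_hom_iff ahom_def bimodule.smult_rsmult left_module.lsmult_closed left_module.lsmult_r_distr
      dest: bimodule_left)

lemma bimodule_rsmult_left_hom: "\<lbrakk>bimodule K R M; a \<in> carrier R\<rbrakk> \<Longrightarrow> (\<lambda>x. x \<odot>r\<^bsub>M\<^esub> a) \<in> left_hom K M M"
  by (auto simp: left_hom_iff ahom_def bimodule.smult_rsmult right_module.rsmult_closed right_module.rsmult_l_distr
      dest: bimodule_right)

lemma smult_ahom:
  "\<lbrakk>bimodule K R M; left_module R N; a \<in> carrier K\<rbrakk> \<Longrightarrow> smult (tensor R M N) a \<in> ahom (tensor R M N) (tensor R M N)"
  unfolding tensor_smult
  by (rule tensor_map_ahom) (simp_all add: bimodule_smult_right_hom left_hom_id bimodule_right)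

lemma rsmult_ahom:
  "\<lbrakk>right_module R M; bimodule R L N; a \<in> carrier L\<rbrakk> \<Longrightarrow> (\<lambda>u. u \<odot>r\<^bsub>tensor R M N\<^esub> a) \<in> ahom (tensor R M N) (tensor R M N)"
  unfolding tensor_rsmult
  by (rule tensor_map_ahom) (simp_all add: bimodule_rsmult_left_hom right_hom_id bimodule_left)

lemma smult_pure [simp]:
  "\<lbrakk>a \<in> carrier K; bimodule K R M; left_module R N; x \<in> carrier M; y \<in> carrier N\<rbrakk>
    \<Longrightarrow> a \<odot>\<^bsub>tensor R M N\<^esub> pure_tensor R M N x y = pure_tensor R M N (a \<odot>\<^bsub>M\<^esub> x) y"
  unfolding tensor_smult by (simp add: bimodule_smult_right_hom left_hom_id bimodule_right)

text \<open>With its premises in a different order the rule lets the simplifier find the ring of scalars from the module.\<close>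

lemma smult_pure' [simp]:
  "\<lbrakk>bimodule K R M; left_module R N; a \<in> carrier K; x \<in> carrier M; y \<in> carrier N\<rbrakk>
    \<Longrightarrow> a \<odot>\<^bsub>tensor R M N\<^esub> pure_tensor R M N x y = pure_tensor R M N (a \<odot>\<^bsub>M\<^esub> x) y"
  by (rule smult_pure)

lemma rsmult_pure [simp]:
  "\<lbrakk>a \<in> carrier L; right_module R M; bimodule R L N; x \<in> carrier M; y \<in> carrier N\<rbrakk>
    \<Longrightarrow> pure_tensor R M N x y \<odot>r\<^bsub>tensor R M N\<^esub> a = pure_tensor R M N x (y \<odot>r\<^bsub>N\<^esub> a)"
  unfolding tensor_rsmult by (simp add: bimodule_rsmult_left_hom right_hom_id bimodule_left)

lemma rsmult_pure' [simp]:
  "\<lbrakk>right_module R M; bimodule R L N; a \<in> carrier L; x \<in> carrier M; y \<in> carrier N\<rbrakk>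
    \<Longrightarrow> pure_tensor R M N x y \<odot>r\<^bsub>tensor R M N\<^esub> a = pure_tensor R M N x (y \<odot>r\<^bsub>N\<^esub> a)"
  by (rule rsmult_pure)

lemma ahom_pointwise_add:
  assumes "abelian_group N" "f \<in> ahom M N" "g \<in> ahom M N"
  shows "(\<lambda>u. f u \<oplus>\<^bsub>N\<^esub> g u) \<in> ahom M N"
proof -
  interpret abelian_group N by fact
  show ?thesis using assms(2,3) by (auto simp: ahom_def a_ac)
qed

text \<open>For fixed scalars both sides of each axiom are additive in \<open>u\<close>; on pure
  tensors they reduce to the axioms of \<open>M\<close>.\<close>

lemma tensor_left_module [simp]:
  assumes M: "bimodule K R M" and N: "left_module R N"
  shows "left_module K (tensor R M N)"
proof -
  interpret M: bimodule K R M by fact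
  interpret N: left_module R N by fact
  let ?T = "tensor R M N"
  have rM: "right_module R M" using M by (rule bimodule_right)
  have T: "abelian_group ?T" using rM N by simp
  interpret T: abelian_group ?T by fact
  have h: "smult ?T a \<in> ahom ?T ?T" if "a \<in> carrier K" for a using smult_ahom[OF M N that] .
  have cl: "a \<odot>\<^bsub>?T\<^esub> u \<in> carrier ?T" if "a \<in> carrier K" "u \<in> carrier ?T" for a u
    using ahom_closed[OF h] that by blast
  show ?thesis
  proof (unfold_locales)
    fix a b u assume *: "a \<in> carrier K" "b \<in> carrier K" "u \<in> carrier ?T"
    show "(a \<oplus>\<^bsub>K\<^esub> b) \<odot>\<^bsub>?T\<^esub> u = a \<odot>\<^bsub>?T\<^esub> u \<oplus>\<^bsub>?T\<^esub> b \<odot>\<^bsub>?T\<^esub> u"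
      by (rule tensor_eqI[OF rM N T h ahom_pointwise_add[OF T h h] _ *(3)])
         (use * M N rM in \<open>auto simp: M.lsmult_l_distr M.lsmult_closed pure_add_l\<close>)
    show "(a \<otimes>\<^bsub>K\<^esub> b) \<odot>\<^bsub>?T\<^esub> u = a \<odot>\<^bsub>?T\<^esub> (b \<odot>\<^bsub>?T\<^esub> u)"
      by (rule tensor_eqI[OF rM N T h ahom_comp[OF h h] _ *(3)])
         (use * M N rM in \<open>auto simp: M.lsmult_assoc M.lsmult_closed\<close>)
  next
    fix u assume "u \<in> carrier ?T"
    then show "\<one>\<^bsub>K\<^esub> \<odot>\<^bsub>?T\<^esub> u = u"
      by (rule tensor_eqI[OF rM N T h ahom_id, rotated -1])
         (use M N rM in \<open>auto simp: M.lsmult_one\<close>)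
  qed (use cl h in \<open>auto simp: ahom_add\<close>)
qed

lemma tensor_right_module [simp]:
  assumes M: "right_module R M" and N: "bimodule R L N"
  shows "right_module L (tensor R M N)"
proof -
  interpret M: right_module R M by fact
  interpret N: bimodule R L N by fact
  let ?T = "tensor R M N"
  have lN: "left_module R N" using N by (rule bimodule_left)
  have T: "abelian_group ?T" using M lN by simp
  interpret T: abelian_group ?T by fact
  have h: "(\<lambda>u. u \<odot>r\<^bsub>?T\<^esub> a) \<in> ahom ?T ?T" if "a \<in> carrier L" for a using rsmult_ahom[OF M N that] .
  have cl: "u \<odot>r\<^bsub>?T\<^esub> a \<in> carrier ?T" if "a \<in> carrier L" "u \<in> carrier ?T" for a u
    using ahom_closed[OF h] that by blast
  show ?thesis
  proof (unfold_locales)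
    fix a b u assume *: "a \<in> carrier L" "b \<in> carrier L" "u \<in> carrier ?T"
    show "u \<odot>r\<^bsub>?T\<^esub> (a \<oplus>\<^bsub>L\<^esub> b) = u \<odot>r\<^bsub>?T\<^esub> a \<oplus>\<^bsub>?T\<^esub> u \<odot>r\<^bsub>?T\<^esub> b"
      by (rule tensor_eqI[OF M lN T h ahom_pointwise_add[OF T h h] _ *(3)])
         (use * M N lN in \<open>auto simp: N.right.rsmult_r_distr N.right.rsmult_closed pure_add_r\<close>)
    show "u \<odot>r\<^bsub>?T\<^esub> (a \<otimes>\<^bsub>L\<^esub> b) = (u \<odot>r\<^bsub>?T\<^esub> a) \<odot>r\<^bsub>?T\<^esub> b"
      by (rule tensor_eqI[OF M lN T h ahom_comp[OF h h] _ *(3)])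
         (use * M N lN in \<open>auto simp: N.right.rsmult_assoc N.right.rsmult_closed\<close>)
  next
    fix u assume "u \<in> carrier ?T"
    then show "u \<odot>r\<^bsub>?T\<^esub> \<one>\<^bsub>L\<^esub> = u"
      by (rule tensor_eqI[OF M lN T h ahom_id, rotated -1])
         (use M N lN in \<open>auto simp: N.right.rsmult_one\<close>)
  next
    fix a u v assume "a \<in> carrier L" "u \<in> carrier ?T" "v \<in> carrier ?T"
    then show "(u \<oplus>\<^bsub>?T\<^esub> v) \<odot>r\<^bsub>?T\<^esub> a = u \<odot>r\<^bsub>?T\<^esub> a \<oplus>\<^bsub>?T\<^esub> v \<odot>r\<^bsub>?T\<^esub> a"
      by (rule ahom_add[OF h])
  qed (use cl in auto)
qed

lemma tensor_bimodule [simp]: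
  assumes M: "bimodule K R M" and N: "bimodule R L N"
  shows "bimodule K L (tensor R M N)"
proof -
  note s = bimodule_left[OF M] bimodule_right[OF M] bimodule_left[OF N] bimodule_right[OF N]
  let ?T = "tensor R M N"
  show ?thesis
  proof (intro bimodule.intro bimodule_axioms.intro)
    show "left_module K ?T" "right_module L ?T" using M N s by simp_all
    fix a b u assume *: "a \<in> carrier K" "b \<in> carrier L" "u \<in> carrier ?T"
    show "(a \<odot>\<^bsub>?T\<^esub> u) \<odot>r\<^bsub>?T\<^esub> b = a \<odot>\<^bsub>?T\<^esub> (u \<odot>r\<^bsub>?T\<^esub> b)"
      by (rule tensor_eqI[OF s(2,3) _ ahom_comp[OF smult_ahom[OF M s(3)] rsmult_ahom[OF s(2) N]]
            ahom_comp[OF rsmult_ahom[OF s(2) N] smult_ahom[OF M s(3)]] _ *(3)])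
         (use * M N s in \<open>auto simp: left_module.lsmult_closed[OF s(1)] right_module.rsmult_closed[OF s(4)]\<close>)
  qed
qed

lemma tensor_map_left_hom [simp]:
  assumes M: "bimodule K R M" and N: "left_module R N" and M': "bimodule K R M'" and N': "left_module R N'"
    and f: "f \<in> bimod_hom K R M M'" and g: "g \<in> left_hom R N N'"
  shows "tensor_map R M' N' f g \<in> left_hom K (tensor R M N) (tensor R M' N')"
proof -
  note s = bimodule_right[OF M] bimodule_right[OF M'] bimod_hom_right[OF f]
  have h: "tensor_map R M' N' f g \<in> ahom (tensor R M N) (tensor R M' N')"
    by (rule tensor_map_ahom[OF s(1) N s(2) N' s(3) g])
  have "tensor_map R M' N' f g (a \<odot>\<^bsub>tensor R M N\<^esub> u) = a \<odot>\<^bsub>tensor R M' N'\<^esub> tensor_map R M' N' f g u"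
    if "a \<in> carrier K" "u \<in> carrier (tensor R M N)" for a u
    by (rule tensor_eqI[OF s(1) N _ ahom_comp[OF smult_ahom[OF M N] h] ahom_comp[OF h smult_ahom[OF M' N']] _ that(2)])
       (use that assms s bimod_hom_left[OF f] in \<open>auto simp: left_module.lsmult_closed[OF bimodule_left[OF M]] bimod_hom_closed left_hom_closed left_hom_iff[of f]\<close>)
  then show ?thesis using h by (simp add: left_hom_iff)
qed

lemma tensor_map_right_hom [simp]:
  assumes M: "right_module R M" and N: "bimodule R L N" and M': "right_module R M'" and N': "bimodule R L N'"
    and f: "f \<in> right_hom R M M'" and g: "g \<in> bimod_hom R L N N'"
  shows "tensor_map R M' N' f g \<in> right_hom L (tensor R M N) (tensor R M' N')"
proof -
  note s = bimodule_left[OF N] bimodule_left[OF N'] bimod_hom_left[OF g]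
  have h: "tensor_map R M' N' f g \<in> ahom (tensor R M N) (tensor R M' N')"
    by (rule tensor_map_ahom[OF M s(1) M' s(2) f s(3)])
  have "tensor_map R M' N' f g (u \<odot>r\<^bsub>tensor R M N\<^esub> a) = tensor_map R M' N' f g u \<odot>r\<^bsub>tensor R M' N'\<^esub> a"
    if "a \<in> carrier L" "u \<in> carrier (tensor R M N)" for a u
    by (rule tensor_eqI[OF M s(1) _ ahom_comp[OF rsmult_ahom[OF M N] h] ahom_comp[OF h rsmult_ahom[OF M' N']] _ that(2)])
       (use that assms s bimod_hom_right[OF g] in \<open>auto simp: right_module.rsmult_closed[OF bimodule_right[OF N]] bimod_hom_closed right_hom_closed right_hom_iff[of g]\<close>)
  then show ?thesis using h by (simp add: right_hom_iff)
qed

lemma tensor_map_bimod_hom [simp]: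
  assumes "bimodule K R M" "bimodule R L N" "bimodule K R M'" "bimodule R L N'"
    and "f \<in> bimod_hom K R M M'" "g \<in> bimod_hom R L N N'"
  shows "tensor_map R M' N' f g \<in> bimod_hom K L (tensor R M N) (tensor R M' N')"
  using assms
  by (auto simp: bimod_hom_iff bimodule_left bimodule_right intro!: tensor_map_left_hom tensor_map_right_hom)

lemma tensor_map_id: "u \<in> carrier (tensor R M N) \<Longrightarrow> right_module R M \<Longrightarrow> left_module R N \<Longrightarrow> tensor_map R M N id id u = u"
  by (rule tensor_eqI[OF _ _ _ tensor_map_ahom ahom_id])
     (simp_all add: left_hom_id right_hom_id)

lemma tensor_map_comp:
  assumes "right_module R M" "left_module R N" "right_module R M'" "left_module R N'" "right_module R M''" "left_module R N''"
    and f: "f \<in> right_hom R M M'" "f' \<in> right_hom R M' M''" and g: "g \<in> left_hom R N N'" "g' \<in> left_hom R N' N''"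
    and "u \<in> carrier (tensor R M N)"
  shows "tensor_map R M'' N'' f' g' (tensor_map R M' N' f g u) = tensor_map R M'' N'' (f' \<circ> f) (g' \<circ> g) u"
proof -
  have "f' \<circ> f \<in> right_hom R M M''" "g' \<circ> g \<in> left_hom R N N''"
    using f g by (auto intro: right_hom_comp left_hom_comp)
  then show ?thesis
    by (intro tensor_eqI[OF _ _ _ ahom_comp[OF tensor_map_ahom tensor_map_ahom] tensor_map_ahom _ assms(11), rotated -1])
       (use assms in \<open>auto simp: right_hom_closed left_hom_closed\<close>)
qed

lemma tensor_map_cong:
  assumes "right_module R M" "left_module R N" "right_module R M'" "left_module R N'"
    and "f \<in> right_hom R M M'" "g \<in> left_hom R N N'" "f' \<in> right_hom R M M'" "g' \<in> left_hom R N N'"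
    and "\<And>x. x \<in> carrier M \<Longrightarrow> f x = f' x" "\<And>x. x \<in> carrier N \<Longrightarrow> g x = g' x"
    and "u \<in> carrier (tensor R M N)"
  shows "tensor_map R M' N' f g u = tensor_map R M' N' f' g' u"
  by (rule tensor_eqI[OF _ _ _ tensor_map_ahom tensor_map_ahom _ assms(11)]) (use assms in auto)

section \<open>Triple tensor products and the associativity isomorphisms\<close>

definition tribalanced ::
  "'r ring \<Rightarrow> 's ring \<Rightarrow> ('k, 'r, 'm, 'z1) bimod_scheme \<Rightarrow> ('r, 's, 'n, 'z2) bimod_scheme \<Rightarrow>
   ('s, 'l, 'p, 'z3) bimod_scheme \<Rightarrow> ('x, 'z) ring_scheme \<Rightarrow> ('m \<Rightarrow> 'n \<Rightarrow> 'p \<Rightarrow> 'x) \<Rightarrow> bool" where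
  "tribalanced R S M N P X b \<longleftrightarrow>
     (\<forall>x \<in> carrier M. \<forall>y \<in> carrier N. \<forall>z \<in> carrier P. b x y z \<in> carrier X) \<and>
     (\<forall>x \<in> carrier M. \<forall>x' \<in> carrier M. \<forall>y \<in> carrier N. \<forall>z \<in> carrier P. b (x \<oplus>\<^bsub>M\<^esub> x') y z = b x y z \<oplus>\<^bsub>X\<^esub> b x' y z) \<and>
     (\<forall>x \<in> carrier M. \<forall>y \<in> carrier N. \<forall>y' \<in> carrier N. \<forall>z \<in> carrier P. b x (y \<oplus>\<^bsub>N\<^esub> y') z = b x y z \<oplus>\<^bsub>X\<^esub> b x y' z) \<and>
     (\<forall>x \<in> carrier M. \<forall>y \<in> carrier N. \<forall>z \<in> carrier P. \<forall>z' \<in> carrier P. b x y (z \<oplus>\<^bsub>P\<^esub> z') = b x y z \<oplus>\<^bsub>X\<^esub> b x y z') \<and>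
     (\<forall>x \<in> carrier M. \<forall>a \<in> carrier R. \<forall>y \<in> carrier N. \<forall>z \<in> carrier P. b (x \<odot>r\<^bsub>M\<^esub> a) y z = b x (a \<odot>\<^bsub>N\<^esub> y) z) \<and>
     (\<forall>x \<in> carrier M. \<forall>y \<in> carrier N. \<forall>a \<in> carrier S. \<forall>z \<in> carrier P. b x (y \<odot>r\<^bsub>N\<^esub> a) z = b x y (a \<odot>\<^bsub>P\<^esub> z))"

context
  fixes R :: "'r ring" and S :: "'s ring" and M :: "('k, 'r, 'm, 'z1) bimod_scheme"
    and N :: "('r, 's, 'n, 'z2) bimod_scheme" and P :: "('s, 'l, 'p, 'z3) bimod_scheme"
  assumes M: "right_module R M" and N: "bimodule R S N" and P: "left_module S P"
begin

private lemma mods: "left_module R N" "right_module S N" "right_module S (tensor R M N)" "left_module R (tensor S N P)"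
  using M N P by (simp_all add: bimodule_left bimodule_right)

lemma tensor_eqI3l:
  assumes X: "abelian_group X" and f: "f \<in> ahom (tensor S (tensor R M N) P) X" and g: "g \<in> ahom (tensor S (tensor R M N) P) X"
    and eq: "\<And>x y z. \<lbrakk>x \<in> carrier M; y \<in> carrier N; z \<in> carrier P\<rbrakk> \<Longrightarrow>
      f (pure_tensor S (tensor R M N) P (pure_tensor R M N x y) z) = g (pure_tensor S (tensor R M N) P (pure_tensor R M N x y) z)"
    and u: "u \<in> carrier (tensor S (tensor R M N) P)"
  shows "f u = g u"
proof (rule tensor_eqI[OF mods(3) P X f g _ u])
  fix v z assume v: "v \<in> carrier (tensor R M N)" and z: "z \<in> carrier P"
  have h: "(\<lambda>v. pure_tensor S (tensor R M N) P v z) \<in> ahom (tensor R M N) (tensor S (tensor R M N) P)"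
    using z mods P by (auto simp: ahom_def pure_add_l)
  show "f (pure_tensor S (tensor R M N) P v z) = g (pure_tensor S (tensor R M N) P v z)"
    by (rule tensor_eqI[OF M mods(1) X ahom_comp[OF h f] ahom_comp[OF h g] eq v]) (use z in auto)
qed

lemma tensor_eqI3r:
  assumes X: "abelian_group X" and f: "f \<in> ahom (tensor R M (tensor S N P)) X" and g: "g \<in> ahom (tensor R M (tensor S N P)) X"
    and eq: "\<And>x y z. \<lbrakk>x \<in> carrier M; y \<in> carrier N; z \<in> carrier P\<rbrakk> \<Longrightarrow>
      f (pure_tensor R M (tensor S N P) x (pure_tensor S N P y z)) = g (pure_tensor R M (tensor S N P) x (pure_tensor S N P y z))"
    and u: "u \<in> carrier (tensor R M (tensor S N P))"
  shows "f u = g u"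
proof (rule tensor_eqI[OF M mods(4) X f g _ u])
  fix x v assume v: "v \<in> carrier (tensor S N P)" and x: "x \<in> carrier M"
  have h: "(\<lambda>v. pure_tensor R M (tensor S N P) x v) \<in> ahom (tensor S N P) (tensor R M (tensor S N P))"
    using x mods M by (auto simp: ahom_def pure_add_r)
  show "f (pure_tensor R M (tensor S N P) x v) = g (pure_tensor R M (tensor S N P) x v)"
    by (rule tensor_eqI[OF mods(2) P X ahom_comp[OF h f] ahom_comp[OF h g] eq v]) (use x in auto)
qed

text \<open>For each fixed \<open>z\<close> the map lifts in the inner pair. These inner lifts are
  additive and balanced in \<open>z\<close>, as pure tensors show, so a second lift exists.
  \<open>lift3r\<close> is the mirror image, with the same condition on \<open>b\<close> for the
  other bracketing.\<close>

lemma lift3l: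
  assumes X: "abelian_group X" and G: "group_of G X" and b: "tribalanced R S M N P X b"
  shows "tensor_lift G (\<lambda>(u, z). tensor_lift G (\<lambda>(x, y). b x y z) u) \<in> ahom (tensor S (tensor R M N) P) X" (is "?L \<in> _")
    and "\<lbrakk>x \<in> carrier M; y \<in> carrier N; z \<in> carrier P\<rbrakk> \<Longrightarrow>
      tensor_lift G (\<lambda>(u, z). tensor_lift G (\<lambda>(x, y). b x y z) u) (pure_tensor S (tensor R M N) P (pure_tensor R M N x y) z) = b x y z"
proof -
  interpret X: abelian_group X by fact
  let ?b = "\<lambda>z (x, y). b x y z"
  have bal: "balanced R M N X (?b z)" if "z \<in> carrier P" for z
    using b that unfolding balanced_def tribalanced_def by simp
  note h = lift_ahom[OF M mods(1) G bal] and p = lift_pure[OF M mods(1) G bal]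
  have cl: "z \<oplus>\<^bsub>P\<^esub> z' \<in> carrier P" "a \<odot>\<^bsub>P\<^esub> z \<in> carrier P" if "z \<in> carrier P" "z' \<in> carrier P" "a \<in> carrier S" for a z z'
    using that P by (auto intro: abelian_monoid.a_closed left_module.lsmult_closed simp: abelian_group.axioms(1) left_module_abelian_group)
  have S: "\<zero>\<^bsub>S\<^esub> \<in> carrier S"
    using P by (auto simp: left_module_def intro!: ring.ring_simprules(2))
  have outer: "balanced S (tensor R M N) P X (\<lambda>(u, z). tensor_lift G (?b z) u)"
    unfolding balanced_def prod.case
  proof (intro conjI ballI)
    fix u z z' assume *: "u \<in> carrier (tensor R M N)" "z \<in> carrier P" "z' \<in> carrier P"
    show "tensor_lift G (?b (z \<oplus>\<^bsub>P\<^esub> z')) u = tensor_lift G (?b z) u \<oplus>\<^bsub>X\<^esub> tensor_lift G (?b z') u"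
      by (rule tensor_eqI[OF M mods(1) X h ahom_pointwise_add[OF X h h] _ *(1)])
         (use * cl S b in \<open>simp_all add: p tribalanced_def\<close>)
  next
    fix u a z assume *: "u \<in> carrier (tensor R M N)" "a \<in> carrier S" "z \<in> carrier P"
    show "tensor_lift G (?b z) (u \<odot>r\<^bsub>tensor R M N\<^esub> a) = tensor_lift G (?b (a \<odot>\<^bsub>P\<^esub> z)) u"
      by (rule tensor_eqI[OF M mods(1) X ahom_comp[OF rsmult_ahom[OF M N] h] h _ *(1)])
         (use * cl b M N in \<open>simp_all add: p tribalanced_def right_module.rsmult_closed[OF mods(2)] mods\<close>)
  qed (use h in \<open>auto simp: ahom_def\<close>)
  show "?L \<in> ahom (tensor S (tensor R M N) P) X" by (rule lift_ahom[OF mods(3) P G outer])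
  show "?L (pure_tensor S (tensor R M N) P (pure_tensor R M N x y) z) = b x y z"
    if "x \<in> carrier M" "y \<in> carrier N" "z \<in> carrier P"
    using that M mods by (simp add: lift_pure[OF mods(3) P G outer] p)
qed

lemma lift3r:
  assumes X: "abelian_group X" and G: "group_of G X" and b: "tribalanced R S M N P X b"
  shows "tensor_lift G (\<lambda>(x, v). tensor_lift G (\<lambda>(y, z). b x y z) v) \<in> ahom (tensor R M (tensor S N P)) X" (is "?L \<in> _")
    and "\<lbrakk>x \<in> carrier M; y \<in> carrier N; z \<in> carrier P\<rbrakk> \<Longrightarrow>
      tensor_lift G (\<lambda>(x, v). tensor_lift G (\<lambda>(y, z). b x y z) v) (pure_tensor R M (tensor S N P) x (pure_tensor S N P y z)) = b x y z"
proof -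
  interpret X: abelian_group X by fact
  let ?b = "\<lambda>x (y, z). b x y z"
  have bal: "balanced S N P X (?b x)" if "x \<in> carrier M" for x
    using b that unfolding balanced_def tribalanced_def by simp
  note h = lift_ahom[OF mods(2) P G bal] and p = lift_pure[OF mods(2) P G bal]
  have cl: "z \<oplus>\<^bsub>M\<^esub> z' \<in> carrier M" "z \<odot>r\<^bsub>M\<^esub> a \<in> carrier M" if "z \<in> carrier M" "z' \<in> carrier M" "a \<in> carrier R" for a z z'
    using that M by (auto intro: abelian_monoid.a_closed right_module.rsmult_closed simp: abelian_group.axioms(1) right_module_abelian_group)
  have S: "\<zero>\<^bsub>R\<^esub> \<in> carrier R"
    using M by (auto simp: right_module_def intro!: ring.ring_simprules(2))
  have outer: "balanced R M (tensor S N P) X (\<lambda>(x, v). tensor_lift G (?b x) v)"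
    unfolding balanced_def prod.case
  proof (intro conjI ballI)
    fix u z z' assume *: "z \<in> carrier M" "z' \<in> carrier M" "u \<in> carrier (tensor S N P)"
    show "tensor_lift G (?b (z \<oplus>\<^bsub>M\<^esub> z')) u = tensor_lift G (?b z) u \<oplus>\<^bsub>X\<^esub> tensor_lift G (?b z') u"
      by (rule tensor_eqI[OF mods(2) P X h ahom_pointwise_add[OF X h h] _ *(3)])
         (use * cl S b in \<open>simp_all add: p tribalanced_def\<close>)
  next
    fix u a z assume *: "z \<in> carrier M" "a \<in> carrier R" "u \<in> carrier (tensor S N P)"
    show "tensor_lift G (?b (z \<odot>r\<^bsub>M\<^esub> a)) u = tensor_lift G (?b z) (a \<odot>\<^bsub>tensor S N P\<^esub> u)"
      by (rule tensor_eqI[OF mods(2) P X h ahom_comp[OF smult_ahom[OF N P] h] _ *(3)])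
         (use * cl b P N in \<open>simp_all add: p tribalanced_def left_module.lsmult_closed[OF mods(1)] mods\<close>)
  qed (use h in \<open>auto simp: ahom_def\<close>)
  show "?L \<in> ahom (tensor R M (tensor S N P)) X" by (rule lift_ahom[OF M mods(4) G outer])
  show "?L (pure_tensor R M (tensor S N P) x (pure_tensor S N P y z)) = b x y z"
    if "x \<in> carrier M" "y \<in> carrier N" "z \<in> carrier P"
    using that P mods by (simp add: lift_pure[OF M mods(4) G outer] p)
qed

private lemma tri_assoc:
  "tribalanced R S M N P (tensor R M (tensor S N P)) (\<lambda>x y z. pure_tensor R M (tensor S N P) x (pure_tensor S N P y z))"
  using M N P mods
  \<comment> \<open>The rule for scalars on pure tensors is reversed: a scalar first leaves the
    inner tensor, after which \<open>pure_balanced\<close> carries it across the outer one.\<close>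
  by (auto simp: tribalanced_def pure_add_l pure_add_r pure_balanced smult_pure[symmetric] simp del: smult_pure smult_pure')

private lemma tri_unassoc:
  "tribalanced R S M N P (tensor S (tensor R M N) P) (\<lambda>x y z. pure_tensor S (tensor R M N) P (pure_tensor R M N x y) z)"
  using M N P mods
  by (auto simp: tribalanced_def pure_add_l pure_add_r pure_balanced rsmult_pure[symmetric] simp del: rsmult_pure rsmult_pure')

lemma assoc_ahom: "assoc R S M N P \<in> ahom (tensor S (tensor R M N) P) (tensor R M (tensor S N P))"
  unfolding assoc_def Let_def
  by (rule lift3l[OF _ group_of_tensor tri_assoc]) (use M mods in simp_all)

lemma assoc_pure [simp]:
  "\<lbrakk>x \<in> carrier M; y \<in> carrier N; z \<in> carrier P\<rbrakk> \<Longrightarrow>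
    assoc R S M N P (pure_tensor S (tensor R M N) P (pure_tensor R M N x y) z) =
    pure_tensor R M (tensor S N P) x (pure_tensor S N P y z)"
  unfolding assoc_def Let_def
  by (rule lift3l[OF _ group_of_tensor tri_assoc]) (use M mods in simp_all)

lemma unassoc_ahom: "unassoc R S M N P \<in> ahom (tensor R M (tensor S N P)) (tensor S (tensor R M N) P)"
  unfolding unassoc_def Let_def
  by (rule lift3r[OF _ group_of_tensor tri_unassoc]) (use P mods in simp_all)

lemma unassoc_pure [simp]:
  "\<lbrakk>x \<in> carrier M; y \<in> carrier N; z \<in> carrier P\<rbrakk> \<Longrightarrow>
    unassoc R S M N P (pure_tensor R M (tensor S N P) x (pure_tensor S N P y z)) =
    pure_tensor S (tensor R M N) P (pure_tensor R M N x y) z"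
  unfolding unassoc_def Let_def
  by (rule lift3r[OF _ group_of_tensor tri_unassoc]) (use P mods in simp_all)

lemma unassoc_assoc [simp]: "u \<in> carrier (tensor S (tensor R M N) P) \<Longrightarrow> unassoc R S M N P (assoc R S M N P u) = u"
  by (rule tensor_eqI3l[OF _ ahom_comp[OF assoc_ahom unassoc_ahom] ahom_id]) (use P mods in simp_all)

lemma assoc_unassoc [simp]: "u \<in> carrier (tensor R M (tensor S N P)) \<Longrightarrow> assoc R S M N P (unassoc R S M N P u) = u"
  by (rule tensor_eqI3r[OF _ ahom_comp[OF unassoc_ahom assoc_ahom] ahom_id]) (use M mods in simp_all)

end

lemma assoc_left_hom [simp]:
  assumes M: "bimodule K R M" and N: "bimodule R S N" and P: "left_module S P"
  shows "assoc R S M N P \<in> left_hom K (tensor S (tensor R M N) P) (tensor R M (tensor S N P))"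
proof -
  note s = bimodule_left[OF M] bimodule_right[OF M] bimodule_left[OF N] bimodule_right[OF N]
  note h = assoc_ahom[OF s(2) N P]
  have "assoc R S M N P (a \<odot>\<^bsub>tensor S (tensor R M N) P\<^esub> u) = a \<odot>\<^bsub>tensor R M (tensor S N P)\<^esub> assoc R S M N P u"
    if "a \<in> carrier K" "u \<in> carrier (tensor S (tensor R M N) P)" for a u
    by (rule tensor_eqI3l[OF s(2) N P _ ahom_comp[OF smult_ahom h] ahom_comp[OF h smult_ahom] _ that(2)])
       (use that assms s in \<open>auto simp: left_module.lsmult_closed[OF s(1)]\<close>)
  then show ?thesis using h by (simp add: left_hom_iff)
qed

lemma assoc_right_hom [simp]:
  assumes M: "right_module R M" and N: "bimodule R S N" and P: "bimodule S L P"
  shows "assoc R S M N P \<in> right_hom L (tensor S (tensor R M N) P) (tensor R M (tensor S N P))"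
proof -
  note s = bimodule_left[OF N] bimodule_right[OF N] bimodule_left[OF P] bimodule_right[OF P]
  note h = assoc_ahom[OF M N s(3)]
  have "assoc R S M N P (u \<odot>r\<^bsub>tensor S (tensor R M N) P\<^esub> a) = assoc R S M N P u \<odot>r\<^bsub>tensor R M (tensor S N P)\<^esub> a"
    if "a \<in> carrier L" "u \<in> carrier (tensor S (tensor R M N) P)" for a u
    by (rule tensor_eqI3l[OF M N s(3) _ ahom_comp[OF rsmult_ahom h] ahom_comp[OF h rsmult_ahom] _ that(2)])
       (use that assms s in \<open>auto simp: right_module.rsmult_closed[OF s(4)]\<close>)
  then show ?thesis using h by (simp add: right_hom_iff)
qed

lemma assoc_bimod_hom [simp]:
  "\<lbrakk>bimodule K R M; bimodule R S N; bimodule S L P\<rbrakk> \<Longrightarrow>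
    assoc R S M N P \<in> bimod_hom K L (tensor S (tensor R M N) P) (tensor R M (tensor S N P))"
  by (simp add: bimod_hom_iff bimodule_left bimodule_right)

lemma unassoc_left_hom [simp]:
  assumes M: "bimodule K R M" and N: "bimodule R S N" and P: "left_module S P"
  shows "unassoc R S M N P \<in> left_hom K (tensor R M (tensor S N P)) (tensor S (tensor R M N) P)"
proof -
  note s = bimodule_left[OF M] bimodule_right[OF M] bimodule_left[OF N] bimodule_right[OF N]
  note h = unassoc_ahom[OF s(2) N P]
  have "unassoc R S M N P (a \<odot>\<^bsub>tensor R M (tensor S N P)\<^esub> u) = a \<odot>\<^bsub>tensor S (tensor R M N) P\<^esub> unassoc R S M N P u"
    if "a \<in> carrier K" "u \<in> carrier (tensor R M (tensor S N P))" for a u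
    by (rule tensor_eqI3r[OF s(2) N P _ ahom_comp[OF smult_ahom h] ahom_comp[OF h smult_ahom] _ that(2)])
       (use that assms s in \<open>auto simp: left_module.lsmult_closed[OF s(1)]\<close>)
  then show ?thesis using h by (simp add: left_hom_iff)
qed

lemma unassoc_right_hom [simp]:
  assumes M: "right_module R M" and N: "bimodule R S N" and P: "bimodule S L P"
  shows "unassoc R S M N P \<in> right_hom L (tensor R M (tensor S N P)) (tensor S (tensor R M N) P)"
proof -
  note s = bimodule_left[OF N] bimodule_right[OF N] bimodule_left[OF P] bimodule_right[OF P]
  note h = unassoc_ahom[OF M N s(3)]
  have "unassoc R S M N P (u \<odot>r\<^bsub>tensor R M (tensor S N P)\<^esub> a) = unassoc R S M N P u \<odot>r\<^bsub>tensor S (tensor R M N) P\<^esub> a"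
    if "a \<in> carrier L" "u \<in> carrier (tensor R M (tensor S N P))" for a u
    by (rule tensor_eqI3r[OF M N s(3) _ ahom_comp[OF rsmult_ahom h] ahom_comp[OF h rsmult_ahom] _ that(2)])
       (use that assms s in \<open>auto simp: right_module.rsmult_closed[OF s(4)]\<close>)
  then show ?thesis using h by (simp add: right_hom_iff)
qed

lemma unassoc_bimod_hom [simp]:
  "\<lbrakk>bimodule K R M; bimodule R S N; bimodule S L P\<rbrakk> \<Longrightarrow>
    unassoc R S M N P \<in> bimod_hom K L (tensor R M (tensor S N P)) (tensor S (tensor R M N) P)"
  by (simp add: bimod_hom_iff bimodule_left bimodule_right)

lemma assoc_natural:
  assumes M: "right_module R M" "right_module R M'" and N: "bimodule R S N" "bimodule R S N'"
    and P: "left_module S P" "left_module S P'"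
    and f: "f \<in> right_hom R M M'" and g: "g \<in> bimod_hom R S N N'" and h: "h \<in> left_hom S P P'"
    and u: "u \<in> carrier (tensor S (tensor R M N) P)"
  shows "assoc R S M' N' P' (tensor_map S (tensor R M' N') P' (tensor_map R M' N' f g) h u) =
    tensor_map R M' (tensor S N' P') f (tensor_map S N' P' g h) (assoc R S M N P u)"
proof -
  note s = N[THEN bimodule_left] N[THEN bimodule_right] bimod_hom_left[OF g] bimod_hom_right[OF g]
  show ?thesis
    by (rule tensor_eqI3l[OF M(1) N(1) P(1) _ ahom_comp[OF tensor_map_ahom assoc_ahom] ahom_comp[OF assoc_ahom tensor_map_ahom] _ u])
       (use assms s in \<open>auto simp: right_hom_closed left_hom_closed bimod_hom_closed\<close>)
qed

lemma unassoc_natural: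
  assumes M: "right_module R M" "right_module R M'" and N: "bimodule R S N" "bimodule R S N'"
    and P: "left_module S P" "left_module S P'"
    and f: "f \<in> right_hom R M M'" and g: "g \<in> bimod_hom R S N N'" and h: "h \<in> left_hom S P P'"
    and u: "u \<in> carrier (tensor R M (tensor S N P))"
  shows "unassoc R S M' N' P' (tensor_map R M' (tensor S N' P') f (tensor_map S N' P' g h) u) =
    tensor_map S (tensor R M' N') P' (tensor_map R M' N' f g) h (unassoc R S M N P u)"
proof -
  note s = N[THEN bimodule_left] N[THEN bimodule_right] bimod_hom_left[OF g] bimod_hom_right[OF g]
  show ?thesis
    by (rule tensor_eqI3r[OF M(1) N(1) P(1) _ ahom_comp[OF tensor_map_ahom unassoc_ahom] ahom_comp[OF unassoc_ahom tensor_map_ahom] _ u])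
       (use assms s in \<open>auto simp: right_hom_closed left_hom_closed bimod_hom_closed\<close>)
qed

section \<open>Faithful flatness\<close>

text \<open>Whether a module can be copied into the test type depends only on the cardinality of its
  carrier; hence a comparison of sets rather than a condition on types, which also passes to
  submodules.\<close>

definition small :: "'u itself \<Rightarrow> 'm set \<Rightarrow> bool" where
  "small U X \<longleftrightarrow> X \<lesssim> (UNIV :: 'u set)"

lemma small_subset: "small U X \<Longrightarrow> Y \<subseteq> X \<Longrightarrow> small U Y"
  unfolding small_def using lepoll_trans[OF subset_imp_lepoll] .

text \<open>The free Abelian group is functorial: an injection has a left inverse on its image, and
  the induced maps of free groups are again left inverse to each other.\<close>

lemma lepoll_free_Abelian_group:
  assumes "A \<lesssim> B"
  shows "carrier (free_Abelian_group A) \<lesssim> carrier (free_Abelian_group B)"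
proof -
  obtain f where f: "inj_on f A" "f ` A \<subseteq> B" using assms by (auto simp: lepoll_def)
  let ?h = "frag_extend (frag_of \<circ> f)"
  have "frag_extend (frag_of \<circ> the_inv_into A f) (?h c) = c" if "Poly_Mapping.keys c \<subseteq> A" for c
  proof -
    have "frag_extend (frag_of \<circ> the_inv_into A f) (?h c) = frag_extend (frag_of \<circ> the_inv_into A f \<circ> f) c"
      by (rule frag_extend_compose)
    also have "\<dots> = frag_extend frag_of c"
      by (rule frag_extend_eq) (use that f in \<open>auto simp: the_inv_into_f_f\<close>)
    finally show ?thesis by (simp only: frag_expansion[symmetric])
  qed
  then have "inj_on ?h (carrier (free_Abelian_group A))"
    by (intro inj_on_inverseI[of _ "frag_extend (frag_of \<circ> the_inv_into A f)"]) simp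
  moreover have "?h ` carrier (free_Abelian_group A) \<subseteq> carrier (free_Abelian_group B)"
  proof (rule image_subsetI)
    fix c assume "c \<in> carrier (free_Abelian_group A)"
    then have "(\<Union>x \<in> Poly_Mapping.keys c. Poly_Mapping.keys ((frag_of \<circ> f) x)) \<subseteq> B"
      using f(2) by (auto simp: keys_frag_of)
    then show "?h c \<in> carrier (free_Abelian_group B)"
      using order_trans[OF keys_frag_extend[of "frag_of \<circ> f" c]] by simp
  qed
  ultimately show ?thesis unfolding lepoll_def by (intro exI conjI)
qed

text \<open>A tensor product is a quotient of the free Abelian group on pairs. For an infinite set
  neither the square nor the free Abelian group on it is larger than the set itself.\<close>

lemma small_tensor:
  fixes U :: "'u itself"
  assumes "infinite (UNIV :: 'u set)" "small U (carrier M)" "small U (carrier N)" "right_module R M" "left_module R N"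
  shows "small U (carrier (tensor R M N))"
proof -
  interpret tensor_ctx R M N using assms by (simp add: tensor_ctxI)
  have "carrier (tensor R M N) \<subseteq> (\<lambda>c. T0 #>\<^bsub>F\<^esub> c) ` carrier F"
    using tensor_carrier_cases by blast
  then have "carrier (tensor R M N) \<lesssim> carrier F"
    by (rule lepoll_trans[OF subset_imp_lepoll image_lepoll])
  also have "carrier F \<lesssim> carrier (free_Abelian_group (UNIV :: 'u set))"
  proof (rule lepoll_free_Abelian_group)
    have "carrier M \<times> carrier N \<lesssim> (UNIV :: 'u set) \<times> (UNIV :: 'u set)"
      using assms(2,3) unfolding small_def by (rule times_lepoll_mono)
    also have "\<dots> \<approx> (UNIV :: 'u set)" using card_of_Times_same_infinite[OF assms(1)] by (simp add: eqpoll_iff_card_of_ordIso)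
    finally show "carrier M \<times> carrier N \<lesssim> (UNIV :: 'u set)" .
  qed
  also have "\<dots> \<approx> (UNIV :: 'u set)" by (rule eqpoll_free_Abelian_group_infinite[OF assms(1)])
  finally show ?thesis unfolding small_def .
qed

section \<open>Transport of modules into the test type\<close>

definition ab_iso where
  "ab_iso M M' i j \<longleftrightarrow> i \<in> ahom M M' \<and> j \<in> ahom M' M \<and> (\<forall>x \<in> carrier M. j (i x) = x) \<and> (\<forall>y \<in> carrier M'. i (j y) = y)"

text \<open>Exactness compares an image and a kernel in the middle term. The bijection
  \<open>iN\<close> carries both over, while of \<open>iP\<close> only the detection of zero
  matters.\<close>

lemma exact_at_iso:
  assumes iM: "ab_iso M M' iM jM" and iN: "ab_iso N N' iN jN" and iP: "ab_iso P P' iP jP"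
    and P: "abelian_group P" "abelian_group P'"
    and f: "f \<in> ahom M N" and g: "g \<in> ahom N P"
    and f': "\<And>x. x \<in> carrier M \<Longrightarrow> f' (iM x) = iN (f x)" and g': "\<And>x. x \<in> carrier N \<Longrightarrow> g' (iN x) = iP (g x)"
  shows "exact_at M f N g P \<longleftrightarrow> exact_at M' f' N' g' P'"
proof -
  have M': "carrier M' = iM ` carrier M"
    using iM unfolding ab_iso_def ahom_def by (intro equalityI subsetI) (auto simp: image_iff intro!: bexI[of _ "jM _"])
  have N': "carrier N' = iN ` carrier N"
    using iN unfolding ab_iso_def ahom_def by (intro equalityI subsetI) (auto simp: image_iff intro!: bexI[of _ "jN _"])
  have injN: "inj_on iN (carrier N)"
    using iN unfolding ab_iso_def by (intro inj_on_inverseI[of _ jN]) simp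
  have iP0: "iP p = \<zero>\<^bsub>P'\<^esub> \<longleftrightarrow> p = \<zero>\<^bsub>P\<^esub>" if p: "p \<in> carrier P" for p
  proof
    have h: "iP \<in> ahom P P'" "jP \<in> ahom P' P" "jP (iP p) = p" using iP p by (simp_all add: ab_iso_def)
    show "p = \<zero>\<^bsub>P\<^esub>" if "iP p = \<zero>\<^bsub>P'\<^esub>" using h(3) ahom_zero[OF P(2,1) h(2)] by (simp add: that)
    show "iP p = \<zero>\<^bsub>P'\<^esub>" if "p = \<zero>\<^bsub>P\<^esub>" using ahom_zero[OF P h(1)] by (simp add: that)
  qed
  have g0: "g' (iN y) = \<zero>\<^bsub>P'\<^esub> \<longleftrightarrow> g y = \<zero>\<^bsub>P\<^esub>" if "y \<in> carrier N" for y
    using that iP0[OF ahom_closed[OF g that]] g' by simp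
  have ker: "{y \<in> carrier N'. g' y = \<zero>\<^bsub>P'\<^esub>} = iN ` {y \<in> carrier N. g y = \<zero>\<^bsub>P\<^esub>}"
    unfolding N' using g0 by auto
  have im: "f' ` carrier M' = iN ` f ` carrier M" unfolding M' using f' by (auto simp: image_iff)
  show ?thesis unfolding exact_at_def ker im
    by (rule inj_on_image_eq_iff[OF injN, symmetric]) (use f in \<open>auto simp: ahom_def\<close>)
qed

text \<open>Structure copied along an injection into the test type. The two variants below fill in
  one action and give the other side the scalars \<open>unit\<close>, as the definition of faithful
  flatness demands of its test modules.\<close>

definition transport :: "('m \<Rightarrow> 'u) \<Rightarrow> ('k, 'l, 'm, 'z) bimod_scheme \<Rightarrow> ('k1, 'l1, 'u) bimod" where
  "transport i M = \<lparr>carrier = i ` carrier M, monoid.mult = undefined, monoid.one = undefined,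
     ring.zero = i \<zero>\<^bsub>M\<^esub>, ring.add = (\<lambda>x y. i (the_inv_into (carrier M) i x \<oplus>\<^bsub>M\<^esub> the_inv_into (carrier M) i y)),
     smult = undefined, rsmult = undefined\<rparr>"

definition transport_l :: "('m \<Rightarrow> 'u) \<Rightarrow> ('k, 'l, 'm, 'z) bimod_scheme \<Rightarrow> ('k, unit, 'u) bimod" where
  "transport_l i M = (transport i M)\<lparr>smult := (\<lambda>a x. i (a \<odot>\<^bsub>M\<^esub> the_inv_into (carrier M) i x))\<rparr>"

definition transport_r :: "('m \<Rightarrow> 'u) \<Rightarrow> ('k, 'l, 'm, 'z) bimod_scheme \<Rightarrow> (unit, 'l, 'u) bimod" where
  "transport_r i M = (transport i M)\<lparr>rsmult := (\<lambda>x a. i (the_inv_into (carrier M) i x \<odot>r\<^bsub>M\<^esub> a))\<rparr>"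

context
  fixes M :: "('k, 'l, 'm, 'z) bimod_scheme" and i :: "'m \<Rightarrow> 'u"
  assumes i: "inj_on i (carrier M)"
begin

private lemma ji: "x \<in> carrier M \<Longrightarrow> the_inv_into (carrier M) i (i x) = x"
  using i by (simp add: the_inv_into_f_f)

lemma transport_l_module:
  assumes "left_module R M"
  shows "left_module R (transport_l i M)"
proof -
  interpret left_module R M by fact
  have "abelian_group (transport_l i M)"
  proof (rule abelian_groupI)
    fix x assume "x \<in> carrier (transport_l i M)"
    then obtain x' where "x = i x'" "x' \<in> carrier M" by (auto simp: transport_l_def transport_def)
    then show "\<exists>y \<in> carrier (transport_l i M). y \<oplus>\<^bsub>transport_l i M\<^esub> x = \<zero>\<^bsub>transport_l i M\<^esub>"
      by (intro bexI[of _ "i (\<ominus>\<^bsub>M\<^esub> x')"]) (simp_all add: transport_l_def transport_def ji M.l_neg)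
  qed (auto simp: transport_l_def transport_def ji a_ac)
  then show ?thesis
    using R.ring_axioms
    by (auto simp: left_module_def left_module_axioms_def transport_l_def transport_def ji lsmult_closed
        lsmult_l_distr lsmult_r_distr lsmult_assoc lsmult_one)
qed

lemma transport_r_module:
  assumes "right_module R M"
  shows "right_module R (transport_r i M)"
proof -
  interpret right_module R M by fact
  have "abelian_group (transport_r i M)"
  proof (rule abelian_groupI)
    fix x assume "x \<in> carrier (transport_r i M)"
    then obtain x' where "x = i x'" "x' \<in> carrier M" by (auto simp: transport_r_def transport_def)
    then show "\<exists>y \<in> carrier (transport_r i M). y \<oplus>\<^bsub>transport_r i M\<^esub> x = \<zero>\<^bsub>transport_r i M\<^esub>"
      by (intro bexI[of _ "i (\<ominus>\<^bsub>M\<^esub> x')"]) (simp_all add: transport_r_def transport_def ji M.l_neg)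
  qed (auto simp: transport_r_def transport_def ji a_ac)
  then show ?thesis
    using R.ring_axioms
    by (auto simp: right_module_def right_module_axioms_def transport_r_def transport_def ji rsmult_closed
        rsmult_l_distr rsmult_r_distr rsmult_assoc rsmult_one)
qed

lemma transport_l_hom:
  assumes "left_module R M"
  shows "i \<in> left_hom R M (transport_l i M)" "the_inv_into (carrier M) i \<in> left_hom R (transport_l i M) M"
    "ab_iso M (transport_l i M) i (the_inv_into (carrier M) i)"
proof -
  interpret left_module R M by fact
  have T: "carrier (transport_l i M) = i ` carrier M"
    "\<And>x y. x \<oplus>\<^bsub>transport_l i M\<^esub> y = i (the_inv_into (carrier M) i x \<oplus>\<^bsub>M\<^esub> the_inv_into (carrier M) i y)"
    "\<And>a x. a \<odot>\<^bsub>transport_l i M\<^esub> x = i (a \<odot>\<^bsub>M\<^esub> the_inv_into (carrier M) i x)"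
    by (simp_all add: transport_l_def transport_def)
  have 1: "i \<in> ahom M (transport_l i M)" by (rule ahomI) (simp_all add: T ji)
  have 2: "the_inv_into (carrier M) i \<in> ahom (transport_l i M) M"
    by (rule ahomI) (auto simp: T ji)
  show "i \<in> left_hom R M (transport_l i M)" using 1 by (simp add: left_hom_iff T ji)
  show "the_inv_into (carrier M) i \<in> left_hom R (transport_l i M) M"
    using 2 by (auto simp: left_hom_iff T ji lsmult_closed)
  show "ab_iso M (transport_l i M) i (the_inv_into (carrier M) i)"
    using 1 2 by (auto simp: ab_iso_def T ji)
qed

lemma transport_r_hom:
  assumes "right_module R M"
  shows "i \<in> right_hom R M (transport_r i M)" "the_inv_into (carrier M) i \<in> right_hom R (transport_r i M) M"
    "ab_iso M (transport_r i M) i (the_inv_into (carrier M) i)"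
proof -
  interpret right_module R M by fact
  have T: "carrier (transport_r i M) = i ` carrier M"
    "\<And>x y. x \<oplus>\<^bsub>transport_r i M\<^esub> y = i (the_inv_into (carrier M) i x \<oplus>\<^bsub>M\<^esub> the_inv_into (carrier M) i y)"
    "\<And>a x. x \<odot>r\<^bsub>transport_r i M\<^esub> a = i (the_inv_into (carrier M) i x \<odot>r\<^bsub>M\<^esub> a)"
    by (simp_all add: transport_r_def transport_def)
  have 1: "i \<in> ahom M (transport_r i M)" by (rule ahomI) (simp_all add: T ji)
  have 2: "the_inv_into (carrier M) i \<in> ahom (transport_r i M) M"
    by (rule ahomI) (auto simp: T ji)
  show "i \<in> right_hom R M (transport_r i M)" using 1 by (simp add: right_hom_iff T ji)
  show "the_inv_into (carrier M) i \<in> right_hom R (transport_r i M) M"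
    using 2 by (auto simp: right_hom_iff T ji rsmult_closed)
  show "ab_iso M (transport_r i M) i (the_inv_into (carrier M) i)"
    using 1 2 by (auto simp: ab_iso_def T ji)
qed

end

lemma ab_iso_tensor_r:
  assumes T: "right_module R T" and M: "left_module R M" "left_module R M'"
    and i: "i \<in> left_hom R M M'" and j: "j \<in> left_hom R M' M" and ij: "ab_iso M M' i j"
  shows "ab_iso (tensor R T M) (tensor R T M') (tensor_map R T M' id i) (tensor_map R T M id j)"
proof -
  note h = tensor_map_ahom[OF T M(1) T M(2) right_hom_id i] tensor_map_ahom[OF T M(2) T M(1) right_hom_id j]
  show ?thesis unfolding ab_iso_def
  proof (intro conjI ballI h)
    fix u assume u: "u \<in> carrier (tensor R T M)"
    show "tensor_map R T M id j (tensor_map R T M' id i u) = u"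
      by (rule tensor_eqI[OF T M(1) _ ahom_comp[OF h] ahom_id _ u])
         (use assms in \<open>auto simp: ab_iso_def right_hom_id ahom_closed\<close>)
  next
    fix u assume u: "u \<in> carrier (tensor R T M')"
    show "tensor_map R T M' id i (tensor_map R T M id j u) = u"
      by (rule tensor_eqI[OF T M(2) _ ahom_comp[OF h(2,1)] ahom_id _ u])
         (use assms in \<open>auto simp: ab_iso_def right_hom_id ahom_closed\<close>)
  qed
qed

lemma ab_iso_tensor_l:
  assumes T: "left_module R T" and M: "right_module R M" "right_module R M'"
    and i: "i \<in> right_hom R M M'" and j: "j \<in> right_hom R M' M" and ij: "ab_iso M M' i j"
  shows "ab_iso (tensor R M T) (tensor R M' T) (tensor_map R M' T i id) (tensor_map R M T j id)"
proof -
  note h = tensor_map_ahom[OF M(1) T M(2) T i left_hom_id] tensor_map_ahom[OF M(2) T M(1) T j left_hom_id]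
  show ?thesis unfolding ab_iso_def
  proof (intro conjI ballI h)
    fix u assume u: "u \<in> carrier (tensor R M T)"
    show "tensor_map R M T j id (tensor_map R M' T i id u) = u"
      by (rule tensor_eqI[OF M(1) T _ ahom_comp[OF h] ahom_id _ u])
         (use assms in \<open>auto simp: ab_iso_def left_hom_id ahom_closed\<close>)
  next
    fix u assume u: "u \<in> carrier (tensor R M' T)"
    show "tensor_map R M' T i id (tensor_map R M T j id u) = u"
      by (rule tensor_eqI[OF M(2) T _ ahom_comp[OF h(2,1)] ahom_id _ u])
         (use assms in \<open>auto simp: ab_iso_def left_hom_id ahom_closed\<close>)
  qed
qed

text \<open>Removes the restriction to a fixed type: the sequence is moved into \<open>'u\<close>,
  the definition is applied there, and the tensored sequence is moved back along the tensored
  isomorphisms.\<close>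

theorem faithfully_flat_right_exact_iff:
  fixes U :: "'u itself"
  assumes ff: "faithfully_flat_right U R T"
    and M: "left_module R M" and N: "left_module R N" and P: "left_module R P"
    and small: "small U (carrier M)" "small U (carrier N)" "small U (carrier P)"
    and f: "f \<in> left_hom R M N" and g: "g \<in> left_hom R N P"
  shows "exact_at M f N g P \<longleftrightarrow>
    exact_at (tensor R T M) (tensor_map R T N id f) (tensor R T N) (tensor_map R T P id g) (tensor R T P)"
proof -
  have T: "right_module R T" using ff unfolding faithfully_flat_right_def by (rule conjunct1)
  obtain iM :: "_ \<Rightarrow> 'u" where iM: "inj_on iM (carrier M)"
    using small(1) unfolding small_def lepoll_def by blast
  obtain iN :: "_ \<Rightarrow> 'u" where iN: "inj_on iN (carrier N)"
    using small(2) unfolding small_def lepoll_def by blast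
  obtain iP :: "_ \<Rightarrow> 'u" where iP: "inj_on iP (carrier P)"
    using small(3) unfolding small_def lepoll_def by blast
  note i = iM iN iP
  let ?M = "transport_l iM M" and ?N = "transport_l iN N" and ?P = "transport_l iP P"
  let ?jM = "the_inv_into (carrier M) iM" and ?jN = "the_inv_into (carrier N) iN"
  note m = transport_l_module[OF i(1) M] transport_l_module[OF i(2) N] transport_l_module[OF i(3) P]
  note hM = transport_l_hom[OF i(1) M] and hN = transport_l_hom[OF i(2) N] and hP = transport_l_hom[OF i(3) P]
  let ?f = "iN \<circ> f \<circ> ?jM" and ?g = "iP \<circ> g \<circ> ?jN"
  have f': "?f \<in> left_hom R ?M ?N" using hM(2) f hN(1) by (metis left_hom_comp)
  have g': "?g \<in> left_hom R ?N ?P" using hN(2) g hP(1) by (metis left_hom_comp)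
  have jM: "?jM (iM x) = x" if "x \<in> carrier M" for x using that i by (simp add: the_inv_into_f_f)
  have jN: "?jN (iN x) = x" if "x \<in> carrier N" for x using that i by (simp add: the_inv_into_f_f)
  have "exact_at M f N g P \<longleftrightarrow> exact_at ?M ?f ?N ?g ?P"
    by (rule exact_at_iso[OF hM(3) hN(3) hP(3)])
       (use f g P m jM jN in \<open>auto simp: left_hom_ahom left_module_abelian_group\<close>)
  also have "\<dots> \<longleftrightarrow> exact_at (tensor R T ?M) (tensor_map R T ?N id ?f) (tensor R T ?N) (tensor_map R T ?P id ?g) (tensor R T ?P)"
    using ff[unfolded faithfully_flat_right_def, THEN conjunct2, rule_format] f' g' m by blast
  also have "\<dots> \<longleftrightarrow> exact_at (tensor R T M) (tensor_map R T N id f) (tensor R T N) (tensor_map R T P id g) (tensor R T P)"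
  proof (rule exact_at_iso[OF ab_iso_tensor_r[OF T M m(1) hM] ab_iso_tensor_r[OF T N m(2) hN] ab_iso_tensor_r[OF T P m(3) hP], symmetric])
    have id: "id \<in> right_hom R T T" by (rule right_hom_id)
    show "tensor_map R T N id f \<in> ahom (tensor R T M) (tensor R T N)"
      using T M N f by (intro tensor_map_ahom) (auto simp: right_hom_id)
    show "tensor_map R T P id g \<in> ahom (tensor R T N) (tensor R T P)"
      using T N P g by (intro tensor_map_ahom) (auto simp: right_hom_id)
    show "tensor_map R T ?N id ?f (tensor_map R T ?M id iM u) = tensor_map R T ?N id iN (tensor_map R T N id f u)"
      if "u \<in> carrier (tensor R T M)" for u
      using T M N m f f' hM hN jM that id
      by (simp add: tensor_map_comp) (rule tensor_map_cong, auto intro!: left_hom_comp)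
    show "tensor_map R T ?P id ?g (tensor_map R T ?N id iN u) = tensor_map R T ?P id iP (tensor_map R T P id g u)"
      if "u \<in> carrier (tensor R T N)" for u
      using T N P m g g' hN hP jN that id
      by (simp add: tensor_map_comp) (rule tensor_map_cong, auto intro!: left_hom_comp)
  qed (use T P m in auto)
  finally show ?thesis .
qed

theorem faithfully_flat_left_exact_iff:
  fixes U :: "'u itself"
  assumes ff: "faithfully_flat_left U R T"
    and M: "right_module R M" and N: "right_module R N" and P: "right_module R P"
    and small: "small U (carrier M)" "small U (carrier N)" "small U (carrier P)"
    and f: "f \<in> right_hom R M N" and g: "g \<in> right_hom R N P"
  shows "exact_at M f N g P \<longleftrightarrow>
    exact_at (tensor R M T) (tensor_map R N T f id) (tensor R N T) (tensor_map R P T g id) (tensor R P T)"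
proof -
  have T: "left_module R T" using ff unfolding faithfully_flat_left_def by (rule conjunct1)
  obtain iM :: "_ \<Rightarrow> 'u" where iM: "inj_on iM (carrier M)"
    using small(1) unfolding small_def lepoll_def by blast
  obtain iN :: "_ \<Rightarrow> 'u" where iN: "inj_on iN (carrier N)"
    using small(2) unfolding small_def lepoll_def by blast
  obtain iP :: "_ \<Rightarrow> 'u" where iP: "inj_on iP (carrier P)"
    using small(3) unfolding small_def lepoll_def by blast
  note i = iM iN iP
  let ?M = "transport_r iM M" and ?N = "transport_r iN N" and ?P = "transport_r iP P"
  let ?jM = "the_inv_into (carrier M) iM" and ?jN = "the_inv_into (carrier N) iN"
  note m = transport_r_module[OF i(1) M] transport_r_module[OF i(2) N] transport_r_module[OF i(3) P]
  note hM = transport_r_hom[OF i(1) M] and hN = transport_r_hom[OF i(2) N] and hP = transport_r_hom[OF i(3) P]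
  let ?f = "iN \<circ> f \<circ> ?jM" and ?g = "iP \<circ> g \<circ> ?jN"
  have f': "?f \<in> right_hom R ?M ?N" using hM(2) f hN(1) by (metis right_hom_comp)
  have g': "?g \<in> right_hom R ?N ?P" using hN(2) g hP(1) by (metis right_hom_comp)
  have jM: "?jM (iM x) = x" if "x \<in> carrier M" for x using that i by (simp add: the_inv_into_f_f)
  have jN: "?jN (iN x) = x" if "x \<in> carrier N" for x using that i by (simp add: the_inv_into_f_f)
  have "exact_at M f N g P \<longleftrightarrow> exact_at ?M ?f ?N ?g ?P"
    by (rule exact_at_iso[OF hM(3) hN(3) hP(3)])
       (use f g P m jM jN in \<open>auto simp: right_hom_ahom right_module_abelian_group\<close>)
  also have "\<dots> \<longleftrightarrow> exact_at (tensor R ?M T) (tensor_map R ?N T ?f id) (tensor R ?N T) (tensor_map R ?P T ?g id) (tensor R ?P T)"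
    using ff[unfolded faithfully_flat_left_def, THEN conjunct2, rule_format] f' g' m by blast
  also have "\<dots> \<longleftrightarrow> exact_at (tensor R M T) (tensor_map R N T f id) (tensor R N T) (tensor_map R P T g id) (tensor R P T)"
  proof (rule exact_at_iso[OF ab_iso_tensor_l[OF T M m(1) hM] ab_iso_tensor_l[OF T N m(2) hN] ab_iso_tensor_l[OF T P m(3) hP], symmetric])
    have id: "id \<in> left_hom R T T" by (rule left_hom_id)
    show "tensor_map R N T f id \<in> ahom (tensor R M T) (tensor R N T)"
      using T M N f by (intro tensor_map_ahom) (auto simp: left_hom_id)
    show "tensor_map R P T g id \<in> ahom (tensor R N T) (tensor R P T)"
      using T N P g by (intro tensor_map_ahom) (auto simp: left_hom_id)
    show "tensor_map R ?N T ?f id (tensor_map R ?M T iM id u) = tensor_map R ?N T iN id (tensor_map R N T f id u)"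
      if "u \<in> carrier (tensor R M T)" for u
      using T M N m f f' hM hN jM that id
      by (simp add: tensor_map_comp) (rule tensor_map_cong, auto intro!: right_hom_comp)
    show "tensor_map R ?P T ?g id (tensor_map R ?N T iN id u) = tensor_map R ?P T iP id (tensor_map R P T g id u)"
      if "u \<in> carrier (tensor R N T)" for u
      using T N P m g g' hN hP jN that id
      by (simp add: tensor_map_comp) (rule tensor_map_cong, auto intro!: right_hom_comp)
  qed (use T P m in auto)
  finally show ?thesis .
qed

section \<open>Submodules and equalizers\<close>

lemma left_module_sub:
  assumes "left_module R M" and X: "X \<subseteq> carrier M" "\<zero>\<^bsub>M\<^esub> \<in> X"
    and cl: "\<And>x y. x \<in> X \<Longrightarrow> y \<in> X \<Longrightarrow> x \<oplus>\<^bsub>M\<^esub> y \<in> X" "\<And>a x. a \<in> carrier R \<Longrightarrow> x \<in> X \<Longrightarrow> a \<odot>\<^bsub>M\<^esub> x \<in> X"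
  shows "left_module R (M\<lparr>carrier := X\<rparr>)"
proof -
  interpret left_module R M by fact
  have X': "x \<in> carrier M" if "x \<in> X" for x using that X by blast
  have "abelian_group (M\<lparr>carrier := X\<rparr>)"
  proof (rule abelian_groupI)
    \<comment> \<open>Closure under negatives comes from the scalars: the inverse of
      \<open>x\<close> is the multiple of \<open>x\<close> by minus one.\<close>
    fix x assume x: "x \<in> carrier (M\<lparr>carrier := X\<rparr>)"
    have "(\<ominus>\<^bsub>R\<^esub> \<one>\<^bsub>R\<^esub>) \<odot>\<^bsub>M\<^esub> x \<oplus>\<^bsub>M\<^esub> x = (\<ominus>\<^bsub>R\<^esub> \<one>\<^bsub>R\<^esub> \<oplus>\<^bsub>R\<^esub> \<one>\<^bsub>R\<^esub>) \<odot>\<^bsub>M\<^esub> x"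
      using x X' by (simp add: lsmult_l_distr lsmult_one)
    also have "\<dots> = \<zero>\<^bsub>M\<^esub>"
    proof -
      have "\<zero>\<^bsub>R\<^esub> \<odot>\<^bsub>M\<^esub> x \<oplus>\<^bsub>M\<^esub> \<zero>\<^bsub>R\<^esub> \<odot>\<^bsub>M\<^esub> x = \<zero>\<^bsub>R\<^esub> \<odot>\<^bsub>M\<^esub> x"
        using x X' by (simp flip: lsmult_l_distr)
      then have "\<zero>\<^bsub>R\<^esub> \<odot>\<^bsub>M\<^esub> x = \<zero>\<^bsub>M\<^esub>"
        using x X' lsmult_closed M.add.r_cancel_one by simp
      then show ?thesis by (simp add: R.l_neg)
    qed
    finally show "\<exists>y \<in> carrier (M\<lparr>carrier := X\<rparr>). y \<oplus>\<^bsub>M\<lparr>carrier := X\<rparr>\<^esub> x = \<zero>\<^bsub>M\<lparr>carrier := X\<rparr>\<^esub>"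
      using x cl(2)[of "\<ominus>\<^bsub>R\<^esub> \<one>\<^bsub>R\<^esub>" x] by auto
  qed (use X X' cl in \<open>auto simp: M.a_ac\<close>)
  then show ?thesis
    using R.ring_axioms cl X'
    by (auto simp: left_module_def left_module_axioms_def lsmult_l_distr lsmult_r_distr lsmult_assoc lsmult_one)
qed

lemma right_module_sub:
  assumes "right_module R M" and X: "X \<subseteq> carrier M" "\<zero>\<^bsub>M\<^esub> \<in> X"
    and cl: "\<And>x y. x \<in> X \<Longrightarrow> y \<in> X \<Longrightarrow> x \<oplus>\<^bsub>M\<^esub> y \<in> X" "\<And>a x. a \<in> carrier R \<Longrightarrow> x \<in> X \<Longrightarrow> x \<odot>r\<^bsub>M\<^esub> a \<in> X"
  shows "right_module R (M\<lparr>carrier := X\<rparr>)"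
proof -
  interpret right_module R M by fact
  have X': "x \<in> carrier M" if "x \<in> X" for x using that X by blast
  have "abelian_group (M\<lparr>carrier := X\<rparr>)"
  proof (rule abelian_groupI)
    fix x assume x: "x \<in> carrier (M\<lparr>carrier := X\<rparr>)"
    have "x \<odot>r\<^bsub>M\<^esub> (\<ominus>\<^bsub>R\<^esub> \<one>\<^bsub>R\<^esub>) \<oplus>\<^bsub>M\<^esub> x = x \<odot>r\<^bsub>M\<^esub> (\<ominus>\<^bsub>R\<^esub> \<one>\<^bsub>R\<^esub> \<oplus>\<^bsub>R\<^esub> \<one>\<^bsub>R\<^esub>)"
      using x X' by (simp add: rsmult_r_distr rsmult_one)
    also have "\<dots> = \<zero>\<^bsub>M\<^esub>"
    proof -
      have "x \<odot>r\<^bsub>M\<^esub> \<zero>\<^bsub>R\<^esub> \<oplus>\<^bsub>M\<^esub> x \<odot>r\<^bsub>M\<^esub> \<zero>\<^bsub>R\<^esub> = x \<odot>r\<^bsub>M\<^esub> \<zero>\<^bsub>R\<^esub>"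
        using x X' by (simp flip: rsmult_r_distr)
      then have "x \<odot>r\<^bsub>M\<^esub> \<zero>\<^bsub>R\<^esub> = \<zero>\<^bsub>M\<^esub>"
        using x X' rsmult_closed M.add.r_cancel_one by simp
      then show ?thesis by (simp add: R.l_neg)
    qed
    finally show "\<exists>y \<in> carrier (M\<lparr>carrier := X\<rparr>). y \<oplus>\<^bsub>M\<lparr>carrier := X\<rparr>\<^esub> x = \<zero>\<^bsub>M\<lparr>carrier := X\<rparr>\<^esub>"
      using x cl(2)[of "\<ominus>\<^bsub>R\<^esub> \<one>\<^bsub>R\<^esub>" x] by auto
  qed (use X X' cl in \<open>auto simp: M.a_ac\<close>)
  then show ?thesis
    using R.ring_axioms cl X'
    by (auto simp: right_module_def right_module_axioms_def rsmult_l_distr rsmult_r_distr rsmult_assoc rsmult_one)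
qed

lemma bimodule_sub:
  assumes M: "bimodule K R M" and X: "X \<subseteq> carrier M" "\<zero>\<^bsub>M\<^esub> \<in> X"
    and cl: "\<And>x y. x \<in> X \<Longrightarrow> y \<in> X \<Longrightarrow> x \<oplus>\<^bsub>M\<^esub> y \<in> X" "\<And>a x. a \<in> carrier K \<Longrightarrow> x \<in> X \<Longrightarrow> a \<odot>\<^bsub>M\<^esub> x \<in> X"
      "\<And>a x. a \<in> carrier R \<Longrightarrow> x \<in> X \<Longrightarrow> x \<odot>r\<^bsub>M\<^esub> a \<in> X"
  shows "bimodule K R (M\<lparr>carrier := X\<rparr>)"
proof (intro bimodule.intro bimodule_axioms.intro)
  show "left_module K (M\<lparr>carrier := X\<rparr>)" by (rule left_module_sub[OF bimodule_left[OF M] X cl(1,2)])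
  show "right_module R (M\<lparr>carrier := X\<rparr>)" by (rule right_module_sub[OF bimodule_right[OF M] X cl(1,3)])
qed (use X in \<open>auto simp: bimodule.smult_rsmult[OF M]\<close>)

lemma bimodule_equalizer:
  assumes M: "bimodule K R M" and N: "abelian_group N" and f: "f \<in> bimod_hom K R M N" and g: "g \<in> bimod_hom K R M N"
  shows "bimodule K R (M\<lparr>carrier := {x \<in> carrier M. f x = g x}\<rparr>)"
proof -
  interpret M: bimodule K R M by fact
  show ?thesis
    by (rule bimodule_sub[OF M])
       (use f g M.abelian_group_axioms N in \<open>auto simp: bimod_hom_iff left_hom_iff right_hom_iff ahom_add M.lsmult_closed M.right.rsmult_closed ahom_zero\<close>)
qed

lemma id_inclusion_hom [simp]:
  "X \<subseteq> carrier M \<Longrightarrow> id \<in> bimod_hom K R (M\<lparr>carrier := X\<rparr>) M"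
  by (auto simp: bimod_hom_iff left_hom_iff right_hom_iff ahom_def)

lemma ahom_inj_iff:
  assumes "abelian_group M" "abelian_group N" "f \<in> ahom M N"
  shows "inj_on f (carrier M) \<longleftrightarrow> {\<zero>\<^bsub>M\<^esub>} = {x \<in> carrier M. f x = \<zero>\<^bsub>N\<^esub>}"
proof -
  interpret h: group_hom "add_monoid M" "add_monoid N" f
    using assms by (simp add: group_hom_def group_hom_axioms_def abelian_group.a_group)
  show ?thesis using h.inj_iff_trivial_ker by (auto simp: kernel_def)
qed

lemma ahom_diff:
  assumes "abelian_group M" "abelian_group P" "f \<in> ahom M P" "g \<in> ahom M P"
  shows "(\<lambda>u. f u \<ominus>\<^bsub>P\<^esub> g u) \<in> ahom M P"
proof -
  interpret P: abelian_group P by fact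
  show ?thesis using assms(3,4) by (auto simp: ahom_def a_minus_def P.minus_add P.a_ac)
qed

lemma diff_zero_iff:
  assumes "abelian_group P" "x \<in> carrier P" "y \<in> carrier P"
  shows "x \<ominus>\<^bsub>P\<^esub> y = \<zero>\<^bsub>P\<^esub> \<longleftrightarrow> x = y"
proof -
  interpret P: abelian_group P by fact
  show ?thesis using assms P.r_neg P.minus_equality[of x "\<ominus>\<^bsub>P\<^esub> y"] by (auto simp: a_minus_def)
qed

section \<open>Injectivity and equalizers under tensoring with a faithfully flat module\<close>

context
  fixes U :: "'u itself" and R :: "'r ring" and T :: "('k, 'r, 't, 'z) bimod_scheme"
  assumes ff: "faithfully_flat_right U R T"
begin

text \<open>Injectivity is exactness of \<open>0 \<rightarrow> N \<rightarrow> P\<close>. The zero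
  module is realised as the submodule \<open>?Z\<close> of \<open>N\<close>, so that it has the type
  of \<open>N\<close> and its tensor product with \<open>T\<close> visibly has zero image.\<close>

lemma faithfully_flat_right_inj_iff:
  assumes N: "left_module R N" and P: "left_module R P" and small: "small U (carrier N)" "small U (carrier P)"
    and f: "f \<in> left_hom R N P"
  shows "inj_on f (carrier N) \<longleftrightarrow> inj_on (tensor_map R T P id f) (carrier (tensor R T N))"
proof -
  have T: "right_module R T" using ff unfolding faithfully_flat_right_def by (rule conjunct1)
  interpret N: left_module R N by fact
  let ?Z = "N\<lparr>carrier := {\<zero>\<^bsub>N\<^esub>}\<rparr>"
  have s0: "a \<odot>\<^bsub>N\<^esub> \<zero>\<^bsub>N\<^esub> = \<zero>\<^bsub>N\<^esub>" if "a \<in> carrier R" for a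
    using N.lsmult_r_distr[of a "\<zero>\<^bsub>N\<^esub>" "\<zero>\<^bsub>N\<^esub>"] N.lsmult_closed[of a "\<zero>\<^bsub>N\<^esub>"] that by simp
  have Z: "left_module R ?Z" by (rule left_module_sub[OF N]) (auto simp: s0)
  have i: "id \<in> left_hom R ?Z N" by (auto simp: left_hom_iff ahom_def)
  have TN: "abelian_group (tensor R T N)" "abelian_group (tensor R T P)" using T N P by simp_all
  interpret TN: abelian_group "tensor R T N" by fact
  have hf: "tensor_map R T P id f \<in> ahom (tensor R T N) (tensor R T P)"
    by (rule tensor_map_ahom[OF T N T P right_hom_id f])
  have hz: "tensor_map R T N id id \<in> ahom (tensor R T ?Z) (tensor R T N)"
    by (rule tensor_map_ahom[OF T Z T N right_hom_id i])
  have z: "pure_tensor R T N x \<zero>\<^bsub>N\<^esub> = \<zero>\<^bsub>tensor R T N\<^esub>" if "x \<in> carrier T" for x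
    using pure_add_r[OF T N that, of "\<zero>\<^bsub>N\<^esub>" "\<zero>\<^bsub>N\<^esub>"] pure_closed[OF T N that, of "\<zero>\<^bsub>N\<^esub>"] by simp
  have "tensor_map R T N id id u = \<zero>\<^bsub>tensor R T N\<^esub>" if "u \<in> carrier (tensor R T ?Z)" for u
    by (rule tensor_eqI[OF T Z TN(1) hz _ _ that, of "\<lambda>_. \<zero>\<^bsub>tensor R T N\<^esub>"])
       (use T Z N i z in \<open>auto simp: ahom_def right_hom_id\<close>)
  moreover have "\<zero>\<^bsub>tensor R T ?Z\<^esub> \<in> carrier (tensor R T ?Z)"
    using T Z by (intro abelian_monoid.zero_closed abelian_group.axioms(1)) simp
  ultimately have im: "tensor_map R T N id id ` carrier (tensor R T ?Z) = {\<zero>\<^bsub>tensor R T N\<^esub>}" by blast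
  have "inj_on f (carrier N) \<longleftrightarrow> exact_at ?Z id N f P"
    using ahom_inj_iff[OF N.abelian_group_axioms left_module_abelian_group[OF P] left_hom_ahom[OF f]] by (simp add: exact_at_def)
  also have "\<dots> \<longleftrightarrow> exact_at (tensor R T ?Z) (tensor_map R T N id id) (tensor R T N) (tensor_map R T P id f) (tensor R T P)"
    by (rule faithfully_flat_right_exact_iff[OF ff Z N P small_subset[OF small(1)] small i f]) auto
  also have "\<dots> \<longleftrightarrow> inj_on (tensor_map R T P id f) (carrier (tensor R T N))"
    using ahom_inj_iff[OF TN hf] by (simp add: exact_at_def im)
  finally show ?thesis .
qed

text \<open>The equalizer of \<open>f\<close> and \<open>g\<close> is the kernel of their difference
  \<open>?d\<close>, and tensoring with \<open>T\<close> respects differences of maps. Both sides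
  are therefore exactness statements. The direction from right to left is the descent used for
  \<open>C\<close>, \<open>D\<close> and the image of \<alpha>.\<close>

lemma faithfully_flat_right_equalizer_iff:
  assumes M: "left_module R M" and N: "left_module R N" and P: "left_module R P"
    and small: "small U (carrier M)" "small U (carrier N)" "small U (carrier P)"
    and h: "h \<in> left_hom R M N" and f: "f \<in> left_hom R N P" and g: "g \<in> left_hom R N P"
  shows "h ` carrier M = {y \<in> carrier N. f y = g y} \<longleftrightarrow>
    tensor_map R T N id h ` carrier (tensor R T M) =
      {u \<in> carrier (tensor R T N). tensor_map R T P id f u = tensor_map R T P id g u}"
proof -
  have T: "right_module R T" using ff unfolding faithfully_flat_right_def by (rule conjunct1)
  interpret P: left_module R P by fact
  interpret N: left_module R N by fact
  let ?d = "\<lambda>y. f y \<ominus>\<^bsub>P\<^esub> g y"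
  have TN: "abelian_group (tensor R T N)" "abelian_group (tensor R T P)" using T N P by simp_all
  interpret TP: abelian_group "tensor R T P" by fact
  have s: "a \<odot>\<^bsub>P\<^esub> (\<ominus>\<^bsub>P\<^esub> x) = \<ominus>\<^bsub>P\<^esub> (a \<odot>\<^bsub>P\<^esub> x)" if "a \<in> carrier R" "x \<in> carrier P" for a x
    using that ahom_uminus[OF P.abelian_group_axioms P.abelian_group_axioms, of "smult P a" x]
    by (simp add: ahom_def P.lsmult_closed P.lsmult_r_distr)
  have d: "?d \<in> left_hom R N P"
    using ahom_diff[OF N.abelian_group_axioms P.abelian_group_axioms left_hom_ahom[OF f] left_hom_ahom[OF g]] f g
    by (auto simp: left_hom_iff ahom_def a_minus_def P.lsmult_r_distr s P.lsmult_closed)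
  note hf = tensor_map_ahom[OF T N T P right_hom_id f] and hg = tensor_map_ahom[OF T N T P right_hom_id g]
    and hd = tensor_map_ahom[OF T N T P right_hom_id d]
  have um: "pure_tensor R T P x (\<ominus>\<^bsub>P\<^esub> y) = \<ominus>\<^bsub>tensor R T P\<^esub> pure_tensor R T P x y" if "x \<in> carrier T" "y \<in> carrier P" for x y
    using that T P ahom_uminus[OF P.abelian_group_axioms TN(2), of "pure_tensor R T P x" y]
    by (simp add: ahom_def pure_add_r)
  have td: "tensor_map R T P id ?d u = tensor_map R T P id f u \<ominus>\<^bsub>tensor R T P\<^esub> tensor_map R T P id g u"
    if "u \<in> carrier (tensor R T N)" for u
    by (rule tensor_eqI[OF T N TN(2) hd ahom_diff[OF TN hf hg] _ that])
       (use T N P f g d in \<open>simp_all add: a_minus_def pure_add_r um left_hom_closed right_hom_id\<close>)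
  have "h ` carrier M = {y \<in> carrier N. f y = g y} \<longleftrightarrow> exact_at M h N ?d P"
    unfolding exact_at_def using f g
    by (simp add: diff_zero_iff[OF P.abelian_group_axioms] left_hom_closed cong: conj_cong)
  also have "\<dots> \<longleftrightarrow> exact_at (tensor R T M) (tensor_map R T N id h) (tensor R T N) (tensor_map R T P id ?d) (tensor R T P)"
    by (rule faithfully_flat_right_exact_iff[OF ff M N P small h d])
  also have "\<dots> \<longleftrightarrow> tensor_map R T N id h ` carrier (tensor R T M) =
      {u \<in> carrier (tensor R T N). tensor_map R T P id f u = tensor_map R T P id g u}"
    unfolding exact_at_def using hf hg
    by (simp add: td diff_zero_iff[OF TN(2)] ahom_closed cong: conj_cong)
  finally show ?thesis .
qed

end
context
  fixes U :: "'u itself" and R :: "'r ring" and T :: "('r, 'k, 't, 'z) bimod_scheme"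
  assumes ff: "faithfully_flat_left U R T"
begin

lemma faithfully_flat_left_inj_iff:
  assumes N: "right_module R N" and P: "right_module R P" and small: "small U (carrier N)" "small U (carrier P)"
    and f: "f \<in> right_hom R N P"
  shows "inj_on f (carrier N) \<longleftrightarrow> inj_on (tensor_map R P T f id) (carrier (tensor R N T))"
proof -
  have T: "left_module R T" using ff unfolding faithfully_flat_left_def by (rule conjunct1)
  interpret N: right_module R N by fact
  let ?Z = "N\<lparr>carrier := {\<zero>\<^bsub>N\<^esub>}\<rparr>"
  have s0: "\<zero>\<^bsub>N\<^esub> \<odot>r\<^bsub>N\<^esub> a = \<zero>\<^bsub>N\<^esub>" if "a \<in> carrier R" for a
    using N.rsmult_l_distr[of a "\<zero>\<^bsub>N\<^esub>" "\<zero>\<^bsub>N\<^esub>"] N.rsmult_closed[of a "\<zero>\<^bsub>N\<^esub>"] that by simp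
  have Z: "right_module R ?Z" by (rule right_module_sub[OF N]) (auto simp: s0)
  have i: "id \<in> right_hom R ?Z N" by (auto simp: right_hom_iff ahom_def)
  have TN: "abelian_group (tensor R N T)" "abelian_group (tensor R P T)" using T N P by simp_all
  interpret TN: abelian_group "tensor R N T" by fact
  have hf: "tensor_map R P T f id \<in> ahom (tensor R N T) (tensor R P T)"
    by (rule tensor_map_ahom[OF N T P T f left_hom_id])
  have hz: "tensor_map R N T id id \<in> ahom (tensor R ?Z T) (tensor R N T)"
    by (rule tensor_map_ahom[OF Z T N T i left_hom_id])
  have z: "pure_tensor R N T \<zero>\<^bsub>N\<^esub> x = \<zero>\<^bsub>tensor R N T\<^esub>" if "x \<in> carrier T" for x
    using pure_add_l[OF N T _ _ that, of "\<zero>\<^bsub>N\<^esub>" "\<zero>\<^bsub>N\<^esub>"] pure_closed[OF N T _ that, of "\<zero>\<^bsub>N\<^esub>"] by simp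
  have "tensor_map R N T id id u = \<zero>\<^bsub>tensor R N T\<^esub>" if "u \<in> carrier (tensor R ?Z T)" for u
    by (rule tensor_eqI[OF Z T TN(1) hz _ _ that, of "\<lambda>_. \<zero>\<^bsub>tensor R N T\<^esub>"])
       (use T Z N i z in \<open>auto simp: ahom_def left_hom_id\<close>)
  moreover have "\<zero>\<^bsub>tensor R ?Z T\<^esub> \<in> carrier (tensor R ?Z T)"
    using T Z by (intro abelian_monoid.zero_closed abelian_group.axioms(1)) simp
  ultimately have im: "tensor_map R N T id id ` carrier (tensor R ?Z T) = {\<zero>\<^bsub>tensor R N T\<^esub>}" by blast
  have "inj_on f (carrier N) \<longleftrightarrow> exact_at ?Z id N f P"
    using ahom_inj_iff[OF N.abelian_group_axioms right_module_abelian_group[OF P] right_hom_ahom[OF f]] by (simp add: exact_at_def)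
  also have "\<dots> \<longleftrightarrow> exact_at (tensor R ?Z T) (tensor_map R N T id id) (tensor R N T) (tensor_map R P T f id) (tensor R P T)"
    by (rule faithfully_flat_left_exact_iff[OF ff Z N P small_subset[OF small(1)] small i f]) auto
  also have "\<dots> \<longleftrightarrow> inj_on (tensor_map R P T f id) (carrier (tensor R N T))"
    using ahom_inj_iff[OF TN hf] by (simp add: exact_at_def im)
  finally show ?thesis .
qed

lemma faithfully_flat_left_equalizer_iff:
  assumes M: "right_module R M" and N: "right_module R N" and P: "right_module R P"
    and small: "small U (carrier M)" "small U (carrier N)" "small U (carrier P)"
    and h: "h \<in> right_hom R M N" and f: "f \<in> right_hom R N P" and g: "g \<in> right_hom R N P"
  shows "h ` carrier M = {y \<in> carrier N. f y = g y} \<longleftrightarrow>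
    tensor_map R N T h id ` carrier (tensor R M T) =
      {u \<in> carrier (tensor R N T). tensor_map R P T f id u = tensor_map R P T g id u}"
proof -
  have T: "left_module R T" using ff unfolding faithfully_flat_left_def by (rule conjunct1)
  interpret P: right_module R P by fact
  interpret N: right_module R N by fact
  let ?d = "\<lambda>y. f y \<ominus>\<^bsub>P\<^esub> g y"
  have TN: "abelian_group (tensor R N T)" "abelian_group (tensor R P T)" using T N P by simp_all
  interpret TP: abelian_group "tensor R P T" by fact
  have s: "(\<ominus>\<^bsub>P\<^esub> x) \<odot>r\<^bsub>P\<^esub> a = \<ominus>\<^bsub>P\<^esub> (x \<odot>r\<^bsub>P\<^esub> a)" if "a \<in> carrier R" "x \<in> carrier P" for a x
    using that ahom_uminus[OF P.abelian_group_axioms P.abelian_group_axioms, of "\<lambda>x. x \<odot>r\<^bsub>P\<^esub> a" x]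
    by (simp add: ahom_def P.rsmult_closed P.rsmult_l_distr)
  have d: "?d \<in> right_hom R N P"
    using ahom_diff[OF N.abelian_group_axioms P.abelian_group_axioms right_hom_ahom[OF f] right_hom_ahom[OF g]] f g
    by (auto simp: right_hom_iff ahom_def a_minus_def P.rsmult_l_distr s P.rsmult_closed)
  note hf = tensor_map_ahom[OF N T P T f left_hom_id] and hg = tensor_map_ahom[OF N T P T g left_hom_id]
    and hd = tensor_map_ahom[OF N T P T d left_hom_id]
  have um: "pure_tensor R P T (\<ominus>\<^bsub>P\<^esub> y) x = \<ominus>\<^bsub>tensor R P T\<^esub> pure_tensor R P T y x" if "x \<in> carrier T" "y \<in> carrier P" for x y
    using that T P ahom_uminus[OF P.abelian_group_axioms TN(2), of "\<lambda>y. pure_tensor R P T y x" y]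
    by (simp add: ahom_def pure_add_l)
  have td: "tensor_map R P T ?d id u = tensor_map R P T f id u \<ominus>\<^bsub>tensor R P T\<^esub> tensor_map R P T g id u"
    if "u \<in> carrier (tensor R N T)" for u
    by (rule tensor_eqI[OF N T TN(2) hd ahom_diff[OF TN hf hg] _ that])
       (use T N P f g d in \<open>simp_all add: a_minus_def pure_add_l um right_hom_closed left_hom_id\<close>)
  have "h ` carrier M = {y \<in> carrier N. f y = g y} \<longleftrightarrow> exact_at M h N ?d P"
    unfolding exact_at_def using f g
    by (simp add: diff_zero_iff[OF P.abelian_group_axioms] right_hom_closed cong: conj_cong)
  also have "\<dots> \<longleftrightarrow> exact_at (tensor R M T) (tensor_map R N T h id) (tensor R N T) (tensor_map R P T ?d id) (tensor R P T)"
    by (rule faithfully_flat_left_exact_iff[OF ff M N P small h d])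
  also have "\<dots> \<longleftrightarrow> tensor_map R N T h id ` carrier (tensor R M T) =
      {u \<in> carrier (tensor R N T). tensor_map R P T f id u = tensor_map R P T g id u}"
    unfolding exact_at_def using hf hg
    by (simp add: td diff_zero_iff[OF TN(2)] ahom_closed cong: conj_cong)
  finally show ?thesis .
qed

end

section \<open>Herds\<close>

definition bilinear ::
  "'k ring \<Rightarrow> 'r ring \<Rightarrow> 'l ring \<Rightarrow> ('k, 'r, 'm, 'z1) bimod_scheme \<Rightarrow> ('r, 'l, 'n, 'z2) bimod_scheme \<Rightarrow>
   ('k, 'l, 'x, 'z3) bimod_scheme \<Rightarrow> ('m \<Rightarrow> 'n \<Rightarrow> 'x) \<Rightarrow> bool" where
  "bilinear K R L M N X b \<longleftrightarrow> balanced R M N X (\<lambda>(x, y). b x y) \<and>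
     (\<forall>k \<in> carrier K. \<forall>x \<in> carrier M. \<forall>y \<in> carrier N. b (k \<odot>\<^bsub>M\<^esub> x) y = k \<odot>\<^bsub>X\<^esub> b x y) \<and>
     (\<forall>l \<in> carrier L. \<forall>x \<in> carrier M. \<forall>y \<in> carrier N. b x (y \<odot>r\<^bsub>N\<^esub> l) = b x y \<odot>r\<^bsub>X\<^esub> l)"

definition bilift :: "('x, 'z) ring_scheme \<Rightarrow> ('m \<Rightarrow> 'n \<Rightarrow> 'x) \<Rightarrow> ('m, 'n) tens \<Rightarrow> 'x" where
  "bilift X b = tensor_lift (add_monoid X) (\<lambda>(x, y). b x y)"

context
  fixes K :: "'k ring" and R :: "'r ring" and L :: "'l ring" and M :: "('k, 'r, 'm, 'z1) bimod_scheme"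
    and N :: "('r, 'l, 'n, 'z2) bimod_scheme" and X :: "('k, 'l, 'x, 'z3) bimod_scheme" and b
  assumes M: "bimodule K R M" and N: "bimodule R L N" and X: "bimodule K L X" and b: "bilinear K R L M N X b"
begin

private lemmas bmods = bimodule_left[OF M] bimodule_right[OF M] bimodule_left[OF N] bimodule_right[OF N]
  bimodule_left[OF X] bimodule_right[OF X] bimodule_abelian_group[OF X]

lemma bilift_pure: "\<lbrakk>x \<in> carrier M; y \<in> carrier N\<rbrakk> \<Longrightarrow> bilift X b (pure_tensor R M N x y) = b x y"
  unfolding bilift_def using b
  by (subst lift_pure[OF bmods(2,3) group_of_add_monoid[OF bmods(7)]]) (auto simp: bilinear_def)

lemma bilift_bimod_hom: "bilift X b \<in> bimod_hom K L (tensor R M N) X"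
proof -
  have h: "bilift X b \<in> ahom (tensor R M N) X"
    unfolding bilift_def using b
    by (intro lift_ahom[OF bmods(2,3) group_of_add_monoid[OF bmods(7)]]) (simp add: bilinear_def)
  have hk: "smult X k \<in> ahom X X" if "k \<in> carrier K" for k
    using that bmods by (simp add: ahom_def left_module.lsmult_closed left_module.lsmult_r_distr)
  have hl: "(\<lambda>x. x \<odot>r\<^bsub>X\<^esub> l) \<in> ahom X X" if "l \<in> carrier L" for l
    using that bmods by (simp add: ahom_def right_module.rsmult_closed right_module.rsmult_l_distr)
  have "bilift X b (k \<odot>\<^bsub>tensor R M N\<^esub> u) = k \<odot>\<^bsub>X\<^esub> bilift X b u" if "k \<in> carrier K" "u \<in> carrier (tensor R M N)" for k u
    by (rule tensor_eqI[OF bmods(2,3,7) ahom_comp[OF smult_ahom[OF M bmods(3)] h] ahom_comp[OF h hk] _ that(2)])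
       (use that M N bmods b in \<open>auto simp: bilift_pure left_module.lsmult_closed[OF bmods(1)] bilinear_def\<close>)
  moreover have "bilift X b (u \<odot>r\<^bsub>tensor R M N\<^esub> l) = bilift X b u \<odot>r\<^bsub>X\<^esub> l" if "l \<in> carrier L" "u \<in> carrier (tensor R M N)" for l u
    by (rule tensor_eqI[OF bmods(2,3,7) ahom_comp[OF rsmult_ahom[OF bmods(2) N] h] ahom_comp[OF h hl] _ that(2)])
       (use that M N bmods b in \<open>auto simp: bilift_pure right_module.rsmult_closed[OF bmods(4)] bilinear_def\<close>)
  ultimately show ?thesis using h by (simp add: bimod_hom_iff left_hom_iff right_hom_iff)
qed

end

text \<open>The herd freed from its record. \<open>A\<close> and \<open>B\<close> enter as bimodules
  over \<open>R\<close> and \<open>S\<close> with distinguished elements, and their actions on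
  \<open>T\<close> and \<open>P\<close> as bilinear maps, so that every tensor product has uniform
  scalars. The multiplication \<open>mulA\<close> records what restriction of scalars forgets: right
  linearity of \<open>ev\<close> over the ring, on which the associativity of \<chi> rests.\<close>

locale herd_ctx =
  fixes R :: "'r ring" and S :: "'s ring"
    and A :: "('r, 'r, 'a) bimod" and B :: "('s, 's, 'b) bimod"
    and T :: "('s, 'r, 't) bimod" and P :: "('r, 's, 'h) bimod"
    and oneA :: 'a and oneB :: 'b and alpha :: "'r \<Rightarrow> 'a" and beta :: "'s \<Rightarrow> 'b" and mulA :: "'a \<Rightarrow> 'a \<Rightarrow> 'a"
    and aT :: "'t \<Rightarrow> 'a \<Rightarrow> 't" and bT :: "'b \<Rightarrow> 't \<Rightarrow> 't" and aP :: "'a \<Rightarrow> 'h \<Rightarrow> 'h" and bP :: "'h \<Rightarrow> 'b \<Rightarrow> 'h"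
    and ev :: "('h, 't) tens \<Rightarrow> 'a" and evh :: "('t, 'h) tens \<Rightarrow> 'b" and \<gamma> :: "'t \<Rightarrow> (('t, 'h) tens, 't) tens"
  assumes ringR: "ring R" and ringS: "ring S"
    and bimodA: "bimodule R R A" and bimodB: "bimodule S S B" and bimodT: "bimodule S R T" and bimodP: "bimodule R S P"
    and oneA: "oneA \<in> carrier A" and oneB: "oneB \<in> carrier B"
    and alpha: "\<And>r. r \<in> carrier R \<Longrightarrow> r \<odot>\<^bsub>A\<^esub> oneA = alpha r" "\<And>r. r \<in> carrier R \<Longrightarrow> oneA \<odot>r\<^bsub>A\<^esub> r = alpha r"
    and beta: "\<And>s. s \<in> carrier S \<Longrightarrow> s \<odot>\<^bsub>B\<^esub> oneB = beta s" "\<And>s. s \<in> carrier S \<Longrightarrow> oneB \<odot>r\<^bsub>B\<^esub> s = beta s"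
    and aT: "bilinear S R R T A T aT" and bT: "bilinear S S R B T T bT"
    and aP: "bilinear R R S A P P aP" and bP: "bilinear R S S P B P bP"
    and aT_one: "\<And>x. x \<in> carrier T \<Longrightarrow> aT x oneA = x" and bT_one: "\<And>x. x \<in> carrier T \<Longrightarrow> bT oneB x = x"
    and aP_one: "\<And>p. p \<in> carrier P \<Longrightarrow> aP oneA p = p" and bP_one: "\<And>p. p \<in> carrier P \<Longrightarrow> bP p oneB = p"
    and aT_mul: "\<And>x a a'. \<lbrakk>x \<in> carrier T; a \<in> carrier A; a' \<in> carrier A\<rbrakk> \<Longrightarrow> aT (aT x a) a' = aT x (mulA a a')"
    and mulA_closed: "\<And>a a'. \<lbrakk>a \<in> carrier A; a' \<in> carrier A\<rbrakk> \<Longrightarrow> mulA a a' \<in> carrier A"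
    and ev: "ev \<in> bimod_hom R R (tensor S P T) A" and evh: "evh \<in> bimod_hom S S (tensor R T P) B"
    and ev_mul: "\<And>p x a. \<lbrakk>p \<in> carrier P; x \<in> carrier T; a \<in> carrier A\<rbrakk> \<Longrightarrow>
      ev (pure_tensor S P T p (aT x a)) = mulA (ev (pure_tensor S P T p x)) a"
    and fd_T: "\<And>x p y. \<lbrakk>x \<in> carrier T; p \<in> carrier P; y \<in> carrier T\<rbrakk> \<Longrightarrow>
      bT (evh (pure_tensor R T P x p)) y = aT x (ev (pure_tensor S P T p y))"
    and fd_P: "\<And>p x q. \<lbrakk>p \<in> carrier P; x \<in> carrier T; q \<in> carrier P\<rbrakk> \<Longrightarrow>
      bP p (evh (pure_tensor R T P x q)) = aP (ev (pure_tensor S P T p x)) q"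
    and shepherd: "\<gamma> \<in> bimod_hom S R T (tensor S (tensor R T P) T)"
    and shepherd_evh: "\<And>x. x \<in> carrier T \<Longrightarrow> tensor_map S B T evh id (\<gamma> x) = pure_tensor S B T oneB x"
    and shepherd_ev: "\<And>x. x \<in> carrier T \<Longrightarrow>
      tensor_map R T A id ev (assoc R S T P T (\<gamma> x)) = pure_tensor R T A x oneA"
    and shepherd_coassoc: "\<And>x. x \<in> carrier T \<Longrightarrow>
      assoc S S (tensor R T P) (tensor R T P) T
        (tensor_map S (tensor S (tensor R T P) (tensor R T P)) T (assoc S R (tensor R T P) T P) id
          (tensor_map S (tensor R (tensor S (tensor R T P) T) P) T
            (tensor_map R (tensor S (tensor R T P) T) P \<gamma> id) id (\<gamma> x))) =
      tensor_map S (tensor R T P) (tensor S (tensor R T P) T) id \<gamma> (\<gamma> x)"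
begin

abbreviation "pt \<equiv> tensor S P T"
abbreviation "tp \<equiv> tensor R T P"
abbreviation "tpt \<equiv> tensor S tp T"
abbreviation "ptp \<equiv> tensor R pt P"

abbreviation tPT (infixr "\<diamondop>" 75) where "p \<diamondop> x \<equiv> pure_tensor S P T p x"
abbreviation tTP (infixr "\<star>" 75) where "x \<star> p \<equiv> pure_tensor R T P x p"

lemmas base_modules [simp] = bimodA bimodB bimodT bimodP
  bimodule_left[OF bimodA] bimodule_right[OF bimodA] bimodule_left[OF bimodB] bimodule_right[OF bimodB]
  bimodule_left[OF bimodT] bimodule_right[OF bimodT] bimodule_left[OF bimodP] bimodule_right[OF bimodP]
  bimodule_abelian_group[OF bimodA] bimodule_abelian_group[OF bimodB] bimodule_abelian_group[OF bimodT]
  bimodule_abelian_group[OF bimodP]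

lemmas base_homs [simp] = ev evh shepherd bimod_hom_left[OF ev] bimod_hom_right[OF ev]
  bimod_hom_left[OF evh] bimod_hom_right[OF evh] bimod_hom_left[OF shepherd] bimod_hom_right[OF shepherd]
  bimod_hom_ahom[OF ev] bimod_hom_ahom[OF evh] bimod_hom_ahom[OF shepherd]
  left_hom_id right_hom_id bimod_hom_id

lemmas base_closed [simp] = oneA oneB bimod_hom_closed[OF ev] bimod_hom_closed[OF evh] bimod_hom_closed[OF shepherd]
  left_module.lsmult_closed[OF bimodule_left[OF bimodT]] right_module.rsmult_closed[OF bimodule_right[OF bimodT]]
  left_module.lsmult_closed[OF bimodule_left[OF bimodP]] right_module.rsmult_closed[OF bimodule_right[OF bimodP]]
  left_module.lsmult_closed[OF bimodule_left[OF bimodA]] right_module.rsmult_closed[OF bimodule_right[OF bimodA]]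
  left_module.lsmult_closed[OF bimodule_left[OF bimodB]] right_module.rsmult_closed[OF bimodule_right[OF bimodB]]

text \<open>
  \<open>sw X b y\<close> is the Sweedler sum of \<open>b\<close> over \<open>\<gamma> y\<close>. That \<open>b\<close> is additive and balanced in each argument
  is encoded in \<open>Tri X b\<close> as the existence of the induced map on the triple tensor product.
\<close>

definition Tri :: "('x, 'z) ring_scheme \<Rightarrow> ('t \<Rightarrow> 'h \<Rightarrow> 't \<Rightarrow> 'x) \<Rightarrow> bool" where
  "Tri X b \<longleftrightarrow> abelian_group X \<and> (\<exists>F \<in> ahom tpt X. \<forall>a \<in> carrier T. \<forall>q \<in> carrier P. \<forall>z \<in> carrier T.
     F (pure_tensor S tp T (a \<star> q) z) = b a q z)"

definition sw :: "('x, 'z) ring_scheme \<Rightarrow> ('t \<Rightarrow> 'h \<Rightarrow> 't \<Rightarrow> 'x) \<Rightarrow> 't \<Rightarrow> 'x" where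
  "sw X b y = (SOME v. \<exists>F \<in> ahom tpt X. (\<forall>a \<in> carrier T. \<forall>q \<in> carrier P. \<forall>z \<in> carrier T.
     F (pure_tensor S tp T (a \<star> q) z) = b a q z) \<and> v = F (\<gamma> y))"

text \<open>As congruence rules, this lemma and the next supply the carrier hypotheses for the bound
  Sweedler components, which all rules about pure tensors presuppose.\<close>

lemma sw_cong [cong]:
  "\<lbrakk>X = X'; y = y'; \<And>a q z. \<lbrakk>a \<in> carrier T; q \<in> carrier P; z \<in> carrier T\<rbrakk> \<Longrightarrow> b a q z = b' a q z\<rbrakk>
    \<Longrightarrow> sw X b y = sw X' b' y'"
  by (simp add: sw_def)

lemma Tri_cong [cong]:
  "\<lbrakk>X = X'; \<And>a q z. \<lbrakk>a \<in> carrier T; q \<in> carrier P; z \<in> carrier T\<rbrakk> \<Longrightarrow> b a q z = b' a q z\<rbrakk>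
    \<Longrightarrow> Tri X b = Tri X' b'"
  by (simp add: Tri_def)

lemma Tri_I:
  assumes "abelian_group X" "F \<in> ahom tpt X"
    and "\<And>a q z. \<lbrakk>a \<in> carrier T; q \<in> carrier P; z \<in> carrier T\<rbrakk> \<Longrightarrow> F (pure_tensor S tp T (a \<star> q) z) = b a q z"
  shows "Tri X b"
  using assms unfolding Tri_def by blast

lemma tribalanced_Tri:
  assumes "abelian_group X" "tribalanced R S T P T X b" shows "Tri X b"
  by (rule Tri_I[OF assms(1) lift3l(1)[OF _ _ _ assms(1) group_of_add_monoid[OF assms(1)] assms(2)]])
     (simp_all add: lift3l(2)[OF _ _ _ assms(1) group_of_add_monoid[OF assms(1)] assms(2)])

text \<open>The choice inside \<open>sw\<close> is harmless: any two additive maps inducing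
  \<open>b\<close> agree on pure tensors, hence at \<open>\<gamma> y\<close>, even if they differ
  outside the tensor product.\<close>

lemma sw_eqI:
  assumes X: "abelian_group X" and F: "F \<in> ahom tpt X"
    and eq: "\<And>a q z. \<lbrakk>a \<in> carrier T; q \<in> carrier P; z \<in> carrier T\<rbrakk> \<Longrightarrow> F (pure_tensor S tp T (a \<star> q) z) = b a q z"
    and y: "y \<in> carrier T"
  shows "F (\<gamma> y) = sw X b y"
proof -
  have "\<exists>v. \<exists>F \<in> ahom tpt X. (\<forall>a \<in> carrier T. \<forall>q \<in> carrier P. \<forall>z \<in> carrier T.
     F (pure_tensor S tp T (a \<star> q) z) = b a q z) \<and> v = F (\<gamma> y)"
    using F eq by blast
  from someI_ex[OF this] obtain G where G: "G \<in> ahom tpt X" "sw X b y = G (\<gamma> y)"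
    "\<And>a q z. \<lbrakk>a \<in> carrier T; q \<in> carrier P; z \<in> carrier T\<rbrakk> \<Longrightarrow> G (pure_tensor S tp T (a \<star> q) z) = b a q z"
    unfolding sw_def by blast
  have "F (\<gamma> y) = G (\<gamma> y)"
    by (rule tensor_eqI3l[OF _ _ _ X F G(1)]) (use y eq G(3) in simp_all)
  then show ?thesis using G(2) by simp
qed

lemma sw_hom:
  assumes b: "Tri X b" and F: "F \<in> ahom X Y" and Y: "abelian_group Y" and y: "y \<in> carrier T"
  shows "F (sw X b y) = sw Y (\<lambda>a q z. F (b a q z)) y"
proof -
  have X: "abelian_group X" using b by (simp add: Tri_def)
  obtain G where G: "G \<in> ahom tpt X"
    "\<And>a q z. \<lbrakk>a \<in> carrier T; q \<in> carrier P; z \<in> carrier T\<rbrakk> \<Longrightarrow> G (pure_tensor S tp T (a \<star> q) z) = b a q z"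
    using b unfolding Tri_def by blast
  have "F (sw X b y) = F (G (\<gamma> y))" by (rule arg_cong[OF sw_eqI[OF X G y, symmetric]])
  also have "\<dots> = sw Y (\<lambda>a q z. F (b a q z)) y"
    by (rule sw_eqI[OF Y ahom_comp[OF G(1) F] _ y]) (simp add: G(2))
  finally show ?thesis .
qed

text \<open>Five-fold multilinearity, the shape of expressions in the twice applied shepherd. Unlike
  \<open>Tri\<close> it consists of equations, so that it can be verified for a concrete
  \<open>h\<close> by computing with pure tensors; \<open>Quint_lift\<close> supplies the induced
  map.\<close>

definition Quint :: "('x, 'z) ring_scheme \<Rightarrow> ('t \<Rightarrow> 'h \<Rightarrow> 't \<Rightarrow> 'h \<Rightarrow> 't \<Rightarrow> 'x) \<Rightarrow> bool" where
  "Quint X h \<longleftrightarrow> abelian_group X \<and>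
     (\<forall>a \<in> carrier T. \<forall>q \<in> carrier P. \<forall>b \<in> carrier T. \<forall>p \<in> carrier P. \<forall>c \<in> carrier T. h a q b p c \<in> carrier X) \<and>
     (\<forall>a \<in> carrier T. \<forall>a' \<in> carrier T. \<forall>q \<in> carrier P. \<forall>b \<in> carrier T. \<forall>p \<in> carrier P. \<forall>c \<in> carrier T.
        h (a \<oplus>\<^bsub>T\<^esub> a') q b p c = h a q b p c \<oplus>\<^bsub>X\<^esub> h a' q b p c) \<and>
     (\<forall>a \<in> carrier T. \<forall>q \<in> carrier P. \<forall>q' \<in> carrier P. \<forall>b \<in> carrier T. \<forall>p \<in> carrier P. \<forall>c \<in> carrier T.
        h a (q \<oplus>\<^bsub>P\<^esub> q') b p c = h a q b p c \<oplus>\<^bsub>X\<^esub> h a q' b p c) \<and>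
     (\<forall>a \<in> carrier T. \<forall>q \<in> carrier P. \<forall>b \<in> carrier T. \<forall>b' \<in> carrier T. \<forall>p \<in> carrier P. \<forall>c \<in> carrier T.
        h a q (b \<oplus>\<^bsub>T\<^esub> b') p c = h a q b p c \<oplus>\<^bsub>X\<^esub> h a q b' p c) \<and>
     (\<forall>a \<in> carrier T. \<forall>q \<in> carrier P. \<forall>b \<in> carrier T. \<forall>p \<in> carrier P. \<forall>p' \<in> carrier P. \<forall>c \<in> carrier T.
        h a q b (p \<oplus>\<^bsub>P\<^esub> p') c = h a q b p c \<oplus>\<^bsub>X\<^esub> h a q b p' c) \<and>
     (\<forall>a \<in> carrier T. \<forall>q \<in> carrier P. \<forall>b \<in> carrier T. \<forall>p \<in> carrier P. \<forall>c \<in> carrier T. \<forall>c' \<in> carrier T.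
        h a q b p (c \<oplus>\<^bsub>T\<^esub> c') = h a q b p c \<oplus>\<^bsub>X\<^esub> h a q b p c') \<and>
     (\<forall>r \<in> carrier R. \<forall>a \<in> carrier T. \<forall>q \<in> carrier P. \<forall>b \<in> carrier T. \<forall>p \<in> carrier P. \<forall>c \<in> carrier T.
        h (a \<odot>r\<^bsub>T\<^esub> r) q b p c = h a (r \<odot>\<^bsub>P\<^esub> q) b p c) \<and>
     (\<forall>s \<in> carrier S. \<forall>a \<in> carrier T. \<forall>q \<in> carrier P. \<forall>b \<in> carrier T. \<forall>p \<in> carrier P. \<forall>c \<in> carrier T.
        h a (q \<odot>r\<^bsub>P\<^esub> s) b p c = h a q (s \<odot>\<^bsub>T\<^esub> b) p c) \<and>
     (\<forall>r \<in> carrier R. \<forall>a \<in> carrier T. \<forall>q \<in> carrier P. \<forall>b \<in> carrier T. \<forall>p \<in> carrier P. \<forall>c \<in> carrier T.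
        h a q (b \<odot>r\<^bsub>T\<^esub> r) p c = h a q b (r \<odot>\<^bsub>P\<^esub> p) c) \<and>
     (\<forall>s \<in> carrier S. \<forall>a \<in> carrier T. \<forall>q \<in> carrier P. \<forall>b \<in> carrier T. \<forall>p \<in> carrier P. \<forall>c \<in> carrier T.
        h a q b (p \<odot>r\<^bsub>P\<^esub> s) c = h a q b p (s \<odot>\<^bsub>T\<^esub> c))"

text \<open>For fixed \<open>a\<close> and \<open>q\<close> the last three arguments lift to a map
  \<open>L a q\<close> on \<open>tpt\<close>. As a function of \<open>a\<close>, \<open>q\<close>
  and an element of \<open>tpt\<close> this \<open>L\<close> is again trilinear and balanced, and a
  second triple lift yields \<open>H\<close>.\<close>

lemma Quint_lift:
  assumes h: "Quint X h"
  obtains H where "H \<in> ahom (tensor S tp tpt) X"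
    "\<And>a q b p c. \<lbrakk>a \<in> carrier T; q \<in> carrier P; b \<in> carrier T; p \<in> carrier P; c \<in> carrier T\<rbrakk> \<Longrightarrow>
      H (pure_tensor S tp tpt (a \<star> q) (pure_tensor S tp T (b \<star> p) c)) = h a q b p c"
proof -
  have X: "abelian_group X" using h by (simp add: Quint_def)
  interpret X: abelian_group X by fact
  note G = group_of_add_monoid[OF X]
  define L where "L = (\<lambda>a q. tensor_lift (add_monoid X) (\<lambda>(u, c). tensor_lift (add_monoid X) (\<lambda>(b, p). h a q b p c) u))"
  have tri: "tribalanced R S T P T X (h a q)" if "a \<in> carrier T" "q \<in> carrier P" for a q
    using h that unfolding Quint_def tribalanced_def by simp
  have L: "L a q \<in> ahom tpt X"
    and Lp: "\<And>b p c. \<lbrakk>b \<in> carrier T; p \<in> carrier P; c \<in> carrier T\<rbrakk> \<Longrightarrow> L a q (pure_tensor S tp T (b \<star> p) c) = h a q b p c"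
    if "a \<in> carrier T" "q \<in> carrier P" for a q
    unfolding L_def by (rule lift3l[OF _ _ _ X G tri], use that in simp_all)+
  have aT: "a \<oplus>\<^bsub>T\<^esub> a' \<in> carrier T" if "a \<in> carrier T" "a' \<in> carrier T" for a a'
    using that abelian_group.axioms(1) abelian_monoid.a_closed base_modules(15) by metis
  have aP: "a \<oplus>\<^bsub>P\<^esub> a' \<in> carrier P" if "a \<in> carrier P" "a' \<in> carrier P" for a a'
    using that abelian_group.axioms(1) abelian_monoid.a_closed base_modules(16) by metis
  note e = tensor_eqI3l[OF base_modules(10) bimodP base_modules(9) X]
  have "tribalanced R S T P tpt X L"
    unfolding tribalanced_def
  proof (intro conjI ballI)
    fix a a' q u assume *: "a \<in> carrier T" "a' \<in> carrier T" "q \<in> carrier P" "u \<in> carrier tpt"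
    show "L (a \<oplus>\<^bsub>T\<^esub> a') q u = L a q u \<oplus>\<^bsub>X\<^esub> L a' q u"
      by (rule e[OF L ahom_pointwise_add[OF X L L] _ *(4)]) (use * h aT in \<open>auto simp: Lp Quint_def\<close>)
  next
    fix a q q' u assume *: "a \<in> carrier T" "q \<in> carrier P" "q' \<in> carrier P" "u \<in> carrier tpt"
    show "L a (q \<oplus>\<^bsub>P\<^esub> q') u = L a q u \<oplus>\<^bsub>X\<^esub> L a q' u"
      by (rule e[OF L ahom_pointwise_add[OF X L L] _ *(4)]) (use * h aP in \<open>auto simp: Lp Quint_def\<close>)
  next
    fix a r q u assume *: "a \<in> carrier T" "r \<in> carrier R" "q \<in> carrier P" "u \<in> carrier tpt"
    show "L (a \<odot>r\<^bsub>T\<^esub> r) q u = L a (r \<odot>\<^bsub>P\<^esub> q) u"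
      by (rule e[OF L L _ *(4)]) (use * h in \<open>auto simp: Lp Quint_def\<close>)
  next
    fix a s q u assume *: "a \<in> carrier T" "q \<in> carrier P" "s \<in> carrier S" "u \<in> carrier tpt"
    show "L a (q \<odot>r\<^bsub>P\<^esub> s) u = L a q (s \<odot>\<^bsub>tpt\<^esub> u)"
      by (rule e[OF L ahom_comp[OF smult_ahom L] _ *(4)]) (use * h in \<open>auto simp: Lp Quint_def\<close>)
  qed (use L in \<open>auto simp: ahom_def\<close>)
  note M = lift3l[OF base_modules(10) bimodP _ X G this]
  show ?thesis
    by (rule that[OF M(1)]) (simp_all add: M(2) Lp)
qed

lemma pure_l_ahom: "\<lbrakk>right_module K M; left_module K N; z \<in> carrier N; e \<in> ahom X M\<rbrakk> \<Longrightarrow> (\<lambda>u. pure_tensor K M N (e u) z) \<in> ahom X (tensor K M N)"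
  by (simp add: ahom_def pure_add_l)

lemma pure_r_ahom: "\<lbrakk>right_module K M; left_module K N; z \<in> carrier M; e \<in> ahom X N\<rbrakk> \<Longrightarrow> (\<lambda>u. pure_tensor K M N z (e u)) \<in> ahom X (tensor K M N)"
  by (simp add: ahom_def pure_add_r)

text \<open>Both sides of the coassociativity axiom take values in \<open>tensor S tp tpt\<close>,
  where \<open>h\<close> induces a single additive map \<open>H\<close>. Applying \<open>H\<close>
  to them gives the two nested sums; the same computation shows that the inner sums depend
  multilinearly on the outer components.\<close>

lemma
  assumes h: "Quint X h"
  shows Tri_nested1: "Tri X (\<lambda>a q z. sw X (\<lambda>a' q' z'. h a' q' z' q z) a)" (is ?t1)
    and Tri_nested2: "Tri X (\<lambda>a q z. sw X (\<lambda>a' q' z'. h a q a' q' z') z)" (is ?t2)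
    and sw_coassoc: "y \<in> carrier T \<Longrightarrow>
      sw X (\<lambda>a q z. sw X (\<lambda>a' q' z'. h a' q' z' q z) a) y = sw X (\<lambda>a q z. sw X (\<lambda>a' q' z'. h a q a' q' z') z) y"
proof -
  have X: "abelian_group X" using h by (simp add: Quint_def)
  obtain H where H: "H \<in> ahom (tensor S tp tpt) X"
    "\<And>a q b p c. \<lbrakk>a \<in> carrier T; q \<in> carrier P; b \<in> carrier T; p \<in> carrier P; c \<in> carrier T\<rbrakk> \<Longrightarrow>
      H (pure_tensor S tp tpt (a \<star> q) (pure_tensor S tp T (b \<star> p) c)) = h a q b p c"
    by (rule Quint_lift[OF h]) blast
  let ?L = "\<lambda>u. assoc S S tp tp T (tensor_map S (tensor S tp tp) T (assoc S R tp T P) id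
          (tensor_map S (tensor R tpt P) T (tensor_map R tpt P \<gamma> id) id u))"
  let ?R = "tensor_map S tp tpt id \<gamma>"
  have hL: "?L \<in> ahom tpt (tensor S tp tpt)"
    by (rule ahom_comp[OF ahom_comp[OF tensor_map_ahom tensor_map_ahom] assoc_ahom]) simp_all
  have hR: "?R \<in> ahom tpt (tensor S tp tpt)"
    by (rule tensor_map_ahom) simp_all
  have eL: "H (?L (pure_tensor S tp T (a \<star> q) z)) = sw X (\<lambda>a' q' z'. h a' q' z' q z) a"
    if "a \<in> carrier T" "q \<in> carrier P" "z \<in> carrier T" for a q z
  proof -
    have "H (?L (pure_tensor S tp T (a \<star> q) z)) =
      (\<lambda>u. H (assoc S S tp tp T (pure_tensor S (tensor S tp tp) T (assoc S R tp T P (pure_tensor R tpt P u q)) z))) (\<gamma> a)"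
      using that by simp
    also have "\<dots> = sw X (\<lambda>a' q' z'. h a' q' z' q z) a"
      by (rule sw_eqI[OF X])
         (use that H in \<open>auto intro!: ahom_comp[OF _ H(1)] ahom_comp[OF _ assoc_ahom] pure_l_ahom ahom_id\<close>)
    finally show ?thesis .
  qed
  have eR: "H (?R (pure_tensor S tp T (a \<star> q) z)) = sw X (\<lambda>a' q' z'. h a q a' q' z') z"
    if "a \<in> carrier T" "q \<in> carrier P" "z \<in> carrier T" for a q z
  proof -
    have "H (?R (pure_tensor S tp T (a \<star> q) z)) = (\<lambda>u. H (pure_tensor S tp tpt (a \<star> q) u)) (\<gamma> z)"
      using that by simp
    also have "\<dots> = sw X (\<lambda>a' q' z'. h a q a' q' z') z"
      by (rule sw_eqI[OF X])
         (use that H in \<open>auto intro!: ahom_comp[OF _ H(1)] pure_r_ahom ahom_id\<close>)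
    finally show ?thesis .
  qed
  show ?t1 by (rule Tri_I[OF X ahom_comp[OF hL H(1)]]) (use eL in simp)
  show ?t2 by (rule Tri_I[OF X ahom_comp[OF hR H(1)]]) (use eR in simp)
  assume y: "y \<in> carrier T"
  have "sw X (\<lambda>a q z. sw X (\<lambda>a' q' z'. h a' q' z' q z) a) y = H (?L (\<gamma> y))"
    by (rule sw_eqI[OF X ahom_comp[OF hL H(1)] eL y, symmetric])
  also have "\<dots> = H (?R (\<gamma> y))" by (rule arg_cong[OF shepherd_coassoc[OF y]])
  also have "\<dots> = sw X (\<lambda>a q z. sw X (\<lambda>a' q' z'. h a q a' q' z') z) y"
    by (rule sw_eqI[OF X ahom_comp[OF hR H(1)] eR y])
  finally show "sw X (\<lambda>a q z. sw X (\<lambda>a' q' z'. h a' q' z' q z) a) y = sw X (\<lambda>a q z. sw X (\<lambda>a' q' z'. h a q a' q' z') z) y" .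
qed

section \<open>Identities in the ambient tensor products\<close>

text \<open>
  The structure maps before corestriction: \<open>dC\<close> and \<open>dD\<close> are the two coproducts, \<open>lB\<close> and \<open>rB\<close> the
  coactions on \<open>T\<close>-bar, and \<open>kC\<close> and \<open>kD\<close> the two maps cov.
\<close>

definition "\<gamma>r = assoc R S T P T \<circ> \<gamma>"
definition "dC = unassoc S R P T pt \<circ> tensor_map S P (tensor R T pt) id \<gamma>r"
definition "dD = assoc S R tp T P \<circ> tensor_map R tpt P \<gamma> id"
definition "lB = assoc R R pt pt P \<circ> tensor_map R (tensor R pt pt) P dC id"
definition "rB = tensor_map S ptp tp (unassoc S R P T P) id \<circ> unassoc S S P tp tp \<circ>
  tensor_map S P (tensor S tp tp) id dD \<circ> assoc S R P T P"
definition "kC = unassoc R S pt P T \<circ> dC"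
definition "kD = assoc R R T pt P \<circ> tensor_map R (tensor R T pt) P \<gamma>r id"

lemma shepherd_r_hom: "\<gamma>r \<in> bimod_hom S R T (tensor R T pt)"
  unfolding \<gamma>r_def by (rule bimod_hom_comp[OF _ assoc_bimod_hom]) simp_all

lemmas shepherd_r_homs [simp] = shepherd_r_hom bimod_hom_left[OF shepherd_r_hom] bimod_hom_right[OF shepherd_r_hom]
  bimod_hom_ahom[OF shepherd_r_hom] bimod_hom_closed[OF shepherd_r_hom]

lemma dC_hom: "dC \<in> bimod_hom R R pt (tensor R pt pt)"
  unfolding dC_def by (rule bimod_hom_comp[OF _ unassoc_bimod_hom]) simp_all

lemmas dC_homs [simp] = dC_hom bimod_hom_left[OF dC_hom] bimod_hom_right[OF dC_hom]
  bimod_hom_ahom[OF dC_hom] bimod_hom_closed[OF dC_hom]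

lemma dD_hom: "dD \<in> bimod_hom S S tp (tensor S tp tp)"
  unfolding dD_def by (rule bimod_hom_comp[OF _ assoc_bimod_hom]) simp_all

lemmas dD_homs [simp] = dD_hom bimod_hom_left[OF dD_hom] bimod_hom_right[OF dD_hom]
  bimod_hom_ahom[OF dD_hom] bimod_hom_closed[OF dD_hom]

lemma lB_hom: "lB \<in> bimod_hom R S ptp (tensor R pt ptp)"
  unfolding lB_def by (rule bimod_hom_comp[OF _ assoc_bimod_hom]) simp_all

lemmas lB_homs [simp] = lB_hom bimod_hom_left[OF lB_hom] bimod_hom_right[OF lB_hom]
  bimod_hom_ahom[OF lB_hom] bimod_hom_closed[OF lB_hom]

lemma rB_hom: "rB \<in> bimod_hom R S ptp (tensor S ptp tp)"
  unfolding rB_def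
  by (rule bimod_hom_comp[OF assoc_bimod_hom bimod_hom_comp[OF tensor_map_bimod_hom
        bimod_hom_comp[OF unassoc_bimod_hom tensor_map_bimod_hom]]]) simp_all

lemmas rB_homs [simp] = rB_hom bimod_hom_left[OF rB_hom] bimod_hom_right[OF rB_hom]
  bimod_hom_ahom[OF rB_hom] bimod_hom_closed[OF rB_hom]

lemma kC_hom: "kC \<in> bimod_hom R R pt (tensor S ptp T)"
  unfolding kC_def by (rule bimod_hom_comp[OF _ unassoc_bimod_hom]) simp_all

lemmas kC_homs [simp] = kC_hom bimod_hom_left[OF kC_hom] bimod_hom_right[OF kC_hom]
  bimod_hom_ahom[OF kC_hom] bimod_hom_closed[OF kC_hom]

lemma kD_hom: "kD \<in> bimod_hom S S tp (tensor R T ptp)"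
  unfolding kD_def by (rule bimod_hom_comp[OF _ assoc_bimod_hom]) simp_all

lemmas kD_homs [simp] = kD_hom bimod_hom_left[OF kD_hom] bimod_hom_right[OF kD_hom]
  bimod_hom_ahom[OF kD_hom] bimod_hom_closed[OF kD_hom]

lemma sw_assoc:
  "\<lbrakk>right_module K M; bimodule K L N; left_module L Q; Tri (tensor L (tensor K M N) Q) b; y \<in> carrier T\<rbrakk> \<Longrightarrow>
    assoc K L M N Q (sw (tensor L (tensor K M N) Q) b y) = sw (tensor K M (tensor L N Q)) (\<lambda>a q z. assoc K L M N Q (b a q z)) y"
  by (rule sw_hom[OF _ assoc_ahom]) (simp_all add: bimodule_left)

lemma sw_unassoc:
  "\<lbrakk>right_module K M; bimodule K L N; left_module L Q; Tri (tensor K M (tensor L N Q)) b; y \<in> carrier T\<rbrakk> \<Longrightarrow>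
    unassoc K L M N Q (sw (tensor K M (tensor L N Q)) b y) = sw (tensor L (tensor K M N) Q) (\<lambda>a q z. unassoc K L M N Q (b a q z)) y"
  by (rule sw_hom[OF _ unassoc_ahom]) (simp_all add: bimodule_left)

lemma sw_tensor_map:
  "\<lbrakk>right_module K M; left_module K N; right_module K M'; left_module K N'; f \<in> right_hom K M M'; g \<in> left_hom K N N';
    Tri (tensor K M N) b; y \<in> carrier T\<rbrakk> \<Longrightarrow>
    tensor_map K M' N' f g (sw (tensor K M N) b y) = sw (tensor K M' N') (\<lambda>a q z. tensor_map K M' N' f g (b a q z)) y"
  by (rule sw_hom[OF _ tensor_map_ahom]) simp_all

lemma sw_pure_l:
  "\<lbrakk>right_module K M; left_module K N; v \<in> carrier N; Tri M b; y \<in> carrier T\<rbrakk> \<Longrightarrow>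
    pure_tensor K M N (sw M b y) v = sw (tensor K M N) (\<lambda>a q z. pure_tensor K M N (b a q z) v) y"
  by (rule sw_hom[OF _ pure_l_ahom[OF _ _ _ ahom_id]]) simp_all

lemma sw_pure_r:
  "\<lbrakk>right_module K M; left_module K N; v \<in> carrier M; Tri N b; y \<in> carrier T\<rbrakk> \<Longrightarrow>
    pure_tensor K M N v (sw N b y) = sw (tensor K M N) (\<lambda>a q z. pure_tensor K M N v (b a q z)) y"
  by (rule sw_hom[OF _ pure_r_ahom[OF _ _ _ ahom_id]]) simp_all

text \<open>With these rules every structural map moves inside the Sweedler sum, and an identity
  between composites becomes one between nested sums of pure tensors.\<close>

lemmas sw_push = sw_assoc sw_unassoc sw_tensor_map sw_pure_l sw_pure_r

lemma base_add_closed [simp]: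
  "\<lbrakk>x \<in> carrier T; y \<in> carrier T\<rbrakk> \<Longrightarrow> x \<oplus>\<^bsub>T\<^esub> y \<in> carrier T"
  "\<lbrakk>p \<in> carrier P; q \<in> carrier P\<rbrakk> \<Longrightarrow> p \<oplus>\<^bsub>P\<^esub> q \<in> carrier P"
  using abelian_monoid.a_closed[OF abelian_group.axioms(1)[OF base_modules(15)]]
    abelian_monoid.a_closed[OF abelian_group.axioms(1)[OF base_modules(16)]] by simp_all

text \<open>Moves scalars through pure tensors in one direction only.\<close>

lemmas multilinear_simps = pure_add_l pure_add_r pure_balanced
  rsmult_pure[symmetric]

lemma shepherd_sw: "y \<in> carrier T \<Longrightarrow> \<gamma> y = sw tpt (\<lambda>a q b. pure_tensor S tp T (a \<star> q) b) y"
  by (rule sw_eqI[OF _ ahom_id]) simp_all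

lemma tri1: "Tri tpt (\<lambda>a q b. pure_tensor S tp T (a \<star> q) b)"
  by (rule tribalanced_Tri) (simp_all add: tribalanced_def multilinear_simps del: rsmult_pure rsmult_pure')

lemma shepherd_r_sw: "y \<in> carrier T \<Longrightarrow> \<gamma>r y = sw (tensor R T pt) (\<lambda>a q b. pure_tensor R T pt a (q \<diamondop> b)) y"
  by (simp add: \<gamma>r_def shepherd_sw sw_push tri1)

lemma tri2: "p \<in> carrier P \<Longrightarrow> Tri (tensor R T pt) (\<lambda>a q b. pure_tensor R T pt a (q \<diamondop> b))"
  by (rule tribalanced_Tri) (simp_all add: tribalanced_def multilinear_simps del: rsmult_pure rsmult_pure')

lemma tri3: "p \<in> carrier P \<Longrightarrow> Tri (tensor S P (tensor R T pt)) (\<lambda>a q b. pure_tensor S P (tensor R T pt) p (pure_tensor R T pt a (q \<diamondop> b)))"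
  by (rule tribalanced_Tri) (simp_all add: tribalanced_def multilinear_simps del: rsmult_pure rsmult_pure')

lemma dC_sw: "\<lbrakk>p \<in> carrier P; y \<in> carrier T\<rbrakk> \<Longrightarrow>
    dC (p \<diamondop> y) = sw (tensor R pt pt) (\<lambda>a q b. pure_tensor R pt pt (p \<diamondop> a) (q \<diamondop> b)) y"
  by (simp add: dC_def shepherd_r_sw sw_push tri2 tri3)

lemmas tri_defs = tribalanced_Tri tribalanced_def multilinear_simps Quint_def

lemma dD_sw: "\<lbrakk>y \<in> carrier T; q' \<in> carrier P\<rbrakk> \<Longrightarrow>
    dD (y \<star> q') = sw (tensor S tp tp) (\<lambda>a q b. pure_tensor S tp tp (a \<star> q) (b \<star> q')) y"
proof -
  assume *: "y \<in> carrier T" "q' \<in> carrier P"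
  have "Tri (tensor R tpt P) (\<lambda>a q b. pure_tensor R tpt P (pure_tensor S tp T (a \<star> q) b) q')"
    using *(2) by (simp add: tri_defs del: rsmult_pure rsmult_pure')
  then show ?thesis using * by (simp add: dD_def shepherd_sw sw_push tri1)
qed

lemma lB_sw: "\<lbrakk>p \<in> carrier P; y \<in> carrier T; q' \<in> carrier P\<rbrakk> \<Longrightarrow>
    lB (pure_tensor R pt P (p \<diamondop> y) q') =
    sw (tensor R pt ptp) (\<lambda>a q b. pure_tensor R pt ptp (p \<diamondop> a) (pure_tensor R pt P (q \<diamondop> b) q')) y"
proof -
  assume *: "p \<in> carrier P" "y \<in> carrier T" "q' \<in> carrier P"
  have "Tri (tensor R (tensor R pt pt) P) (\<lambda>a q b. pure_tensor R (tensor R pt pt) P (pure_tensor R pt pt (p \<diamondop> a) (q \<diamondop> b)) q')"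
    "Tri (tensor R pt pt) (\<lambda>a q b. pure_tensor R pt pt (p \<diamondop> a) (q \<diamondop> b))"
    using *(1,3) by (simp_all add: tri_defs del: rsmult_pure rsmult_pure')
  then show ?thesis using * by (simp add: lB_def dC_sw sw_push)
qed

lemma rB_sw: "\<lbrakk>p \<in> carrier P; y \<in> carrier T; q' \<in> carrier P\<rbrakk> \<Longrightarrow>
    rB (pure_tensor R pt P (p \<diamondop> y) q') =
    sw (tensor S ptp tp) (\<lambda>a q b. pure_tensor S ptp tp (pure_tensor R pt P (p \<diamondop> a) q) (b \<star> q')) y"
proof -
  assume *: "p \<in> carrier P" "y \<in> carrier T" "q' \<in> carrier P"
  have "Tri (tensor S tp tp) (\<lambda>a q b. pure_tensor S tp tp (a \<star> q) (b \<star> q'))"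
    "Tri (tensor S P (tensor S tp tp)) (\<lambda>a q b. pure_tensor S P (tensor S tp tp) p (pure_tensor S tp tp (a \<star> q) (b \<star> q')))"
    "Tri (tensor S (tensor S P tp) tp) (\<lambda>a q b. pure_tensor S (tensor S P tp) tp (pure_tensor S P tp p (a \<star> q)) (b \<star> q'))"
    using *(1,3) by (simp_all add: tri_defs del: rsmult_pure rsmult_pure')
  then show ?thesis using * by (simp add: rB_def dD_sw sw_push)
qed

lemma kC_sw: "\<lbrakk>p \<in> carrier P; y \<in> carrier T\<rbrakk> \<Longrightarrow>
    kC (p \<diamondop> y) = sw (tensor S ptp T) (\<lambda>a q b. pure_tensor S ptp T (pure_tensor R pt P (p \<diamondop> a) q) b) y"
proof -
  assume *: "p \<in> carrier P" "y \<in> carrier T"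
  have "Tri (tensor R pt pt) (\<lambda>a q b. pure_tensor R pt pt (p \<diamondop> a) (q \<diamondop> b))"
    using *(1) by (simp_all add: tri_defs del: rsmult_pure rsmult_pure')
  then show ?thesis using * by (simp add: kC_def dC_sw sw_push)
qed

lemma kD_sw: "\<lbrakk>y \<in> carrier T; q' \<in> carrier P\<rbrakk> \<Longrightarrow>
    kD (y \<star> q') = sw (tensor R T ptp) (\<lambda>a q b. pure_tensor R T ptp a (pure_tensor R pt P (q \<diamondop> b) q')) y"
proof -
  assume *: "y \<in> carrier T" "q' \<in> carrier P"
  have "Tri (tensor R T pt) (\<lambda>a q b. pure_tensor R T pt a (q \<diamondop> b))"
    "Tri (tensor R (tensor R T pt) P) (\<lambda>a q b. pure_tensor R (tensor R T pt) P (pure_tensor R T pt a (q \<diamondop> b)) q')"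
    using *(2) by (simp_all add: tri_defs del: rsmult_pure rsmult_pure')
  then show ?thesis using * by (simp add: kD_def shepherd_r_sw sw_push)
qed

lemmas eval_sw = shepherd_sw shepherd_r_sw dC_sw dD_sw lB_sw rB_sw kC_sw kD_sw

section \<open>Coassociativity, colinearity and companion identities before corestriction\<close>

lemma coass_C: "c \<in> carrier pt \<Longrightarrow>
    assoc R R pt pt pt (tensor_map R (tensor R pt pt) pt dC id (dC c)) =
    tensor_map R pt (tensor R pt pt) id dC (dC c)"
  by (rule tensor_eqI[OF _ _ _ ahom_comp[OF ahom_comp[OF bimod_hom_ahom[OF dC_hom] tensor_map_ahom] assoc_ahom] ahom_comp[OF bimod_hom_ahom[OF dC_hom] tensor_map_ahom]])
     (simp_all add: eval_sw sw_push Tri_nested1 Tri_nested2 tri_defs sw_coassoc del: rsmult_pure rsmult_pure')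

lemma coass_D: "c \<in> carrier tp \<Longrightarrow>
    assoc S S tp tp tp (tensor_map S (tensor S tp tp) tp dD id (dD c)) =
    tensor_map S tp (tensor S tp tp) id dD (dD c)"
  by (rule tensor_eqI[OF _ _ _ ahom_comp[OF ahom_comp[OF bimod_hom_ahom[OF dD_hom] tensor_map_ahom] assoc_ahom] ahom_comp[OF bimod_hom_ahom[OF dD_hom] tensor_map_ahom]])
     (simp_all add: eval_sw sw_push Tri_nested1 Tri_nested2 tri_defs sw_coassoc del: rsmult_pure rsmult_pure')

lemma coass_T_left: "c \<in> carrier T \<Longrightarrow>
    assoc S S tp tp T (tensor_map S (tensor S tp tp) T dD id (\<gamma> c)) =
    tensor_map S tp (tensor S tp T) id \<gamma> (\<gamma> c)"
  by (simp add: eval_sw sw_push Tri_nested1 Tri_nested2 tri_defs sw_coassoc del: rsmult_pure rsmult_pure')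

lemma coass_T_right: "c \<in> carrier T \<Longrightarrow>
    assoc R R T pt pt (tensor_map R (tensor R T pt) pt \<gamma>r id (\<gamma>r c)) =
    tensor_map R T (tensor R pt pt) id dC (\<gamma>r c)"
  by (simp add: eval_sw sw_push Tri_nested1 Tri_nested2 tri_defs sw_coassoc del: rsmult_pure rsmult_pure')

lemma coass_T_mixed: "c \<in> carrier T \<Longrightarrow>
    assoc S R tp T pt (tensor_map R (tensor S tp T) pt \<gamma> id (\<gamma>r c)) =
    tensor_map S tp (tensor R T pt) id \<gamma>r (\<gamma> c)"
  by (simp add: eval_sw sw_push Tri_nested1 Tri_nested2 tri_defs sw_coassoc del: rsmult_pure rsmult_pure')

lemma coass_Tbar_left: "c \<in> carrier ptp \<Longrightarrow>
    assoc R R pt pt ptp (tensor_map R (tensor R pt pt) ptp dC id (lB c)) =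
    tensor_map R pt (tensor R pt ptp) id lB (lB c)"
  by (rule tensor_eqI3l[OF _ _ _ _ ahom_comp[OF ahom_comp[OF bimod_hom_ahom[OF lB_hom] tensor_map_ahom] assoc_ahom] ahom_comp[OF bimod_hom_ahom[OF lB_hom] tensor_map_ahom]])
     (simp_all add: eval_sw sw_push Tri_nested1 Tri_nested2 tri_defs sw_coassoc del: rsmult_pure rsmult_pure')

lemma coass_Tbar_right: "c \<in> carrier ptp \<Longrightarrow>
    assoc S S ptp tp tp (tensor_map S (tensor S ptp tp) tp rB id (rB c)) =
    tensor_map S ptp (tensor S tp tp) id dD (rB c)"
  by (rule tensor_eqI3l[OF _ _ _ _ ahom_comp[OF ahom_comp[OF bimod_hom_ahom[OF rB_hom] tensor_map_ahom] assoc_ahom] ahom_comp[OF bimod_hom_ahom[OF rB_hom] tensor_map_ahom]])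
     (simp_all add: eval_sw sw_push Tri_nested1 Tri_nested2 tri_defs sw_coassoc del: rsmult_pure rsmult_pure')

lemma coass_Tbar_mixed: "c \<in> carrier ptp \<Longrightarrow>
    assoc R S pt ptp tp (tensor_map S (tensor R pt ptp) tp lB id (rB c)) =
    tensor_map R pt (tensor S ptp tp) id rB (lB c)"
  by (rule tensor_eqI3l[OF _ _ _ _ ahom_comp[OF ahom_comp[OF bimod_hom_ahom[OF rB_hom] tensor_map_ahom] assoc_ahom] ahom_comp[OF bimod_hom_ahom[OF lB_hom] tensor_map_ahom]])
     (simp_all add: eval_sw sw_push Tri_nested1 Tri_nested2 tri_defs sw_coassoc del: rsmult_pure rsmult_pure')

lemma coass_cov_left: "c \<in> carrier pt \<Longrightarrow>
    assoc R S pt ptp T (tensor_map S (tensor R pt ptp) T lB id (kC c)) =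
    tensor_map R pt (tensor S ptp T) id kC (dC c)"
  by (rule tensor_eqI[OF _ _ _ ahom_comp[OF ahom_comp[OF bimod_hom_ahom[OF kC_hom] tensor_map_ahom] assoc_ahom] ahom_comp[OF bimod_hom_ahom[OF dC_hom] tensor_map_ahom]])
     (simp_all add: eval_sw sw_push Tri_nested1 Tri_nested2 tri_defs sw_coassoc del: rsmult_pure rsmult_pure')

lemma coass_cov_right: "c \<in> carrier pt \<Longrightarrow>
    assoc S R ptp T pt (tensor_map R (tensor S ptp T) pt kC id (dC c)) =
    tensor_map S ptp (tensor R T pt) id \<gamma>r (kC c)"
  by (rule tensor_eqI[OF _ _ _ ahom_comp[OF ahom_comp[OF bimod_hom_ahom[OF dC_hom] tensor_map_ahom] assoc_ahom] ahom_comp[OF bimod_hom_ahom[OF kC_hom] tensor_map_ahom]])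
     (simp_all add: eval_sw sw_push Tri_nested1 Tri_nested2 tri_defs sw_coassoc del: rsmult_pure rsmult_pure')

lemma coass_cov'_left: "c \<in> carrier tp \<Longrightarrow>
    assoc S R tp T ptp (tensor_map R (tensor S tp T) ptp \<gamma> id (kD c)) =
    tensor_map S tp (tensor R T ptp) id kD (dD c)"
  by (rule tensor_eqI[OF _ _ _ ahom_comp[OF ahom_comp[OF bimod_hom_ahom[OF kD_hom] tensor_map_ahom] assoc_ahom] ahom_comp[OF bimod_hom_ahom[OF dD_hom] tensor_map_ahom]])
     (simp_all add: eval_sw sw_push Tri_nested1 Tri_nested2 tri_defs sw_coassoc del: rsmult_pure rsmult_pure')

lemma coass_cov'_right: "c \<in> carrier tp \<Longrightarrow>
    assoc R S T ptp tp (tensor_map S (tensor R T ptp) tp kD id (dD c)) =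
    tensor_map R T (tensor S ptp tp) id rB (kD c)"
  by (rule tensor_eqI[OF _ _ _ ahom_comp[OF ahom_comp[OF bimod_hom_ahom[OF dD_hom] tensor_map_ahom] assoc_ahom] ahom_comp[OF bimod_hom_ahom[OF kD_hom] tensor_map_ahom]])
     (simp_all add: eval_sw sw_push Tri_nested1 Tri_nested2 tri_defs sw_coassoc del: rsmult_pure rsmult_pure')

lemma coass_companion_T: "c \<in> carrier T \<Longrightarrow>
    assoc R S T ptp T (tensor_map S (tensor R T ptp) T kD id (\<gamma> c)) =
    tensor_map R T (tensor S ptp T) id kC (\<gamma>r c)"
  by (simp add: eval_sw sw_push Tri_nested1 Tri_nested2 tri_defs sw_coassoc del: rsmult_pure rsmult_pure')

lemma coass_companion_Tbar: "c \<in> carrier ptp \<Longrightarrow>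
    assoc S R ptp T ptp (tensor_map R (tensor S ptp T) ptp kC id (lB c)) =
    tensor_map S ptp (tensor R T ptp) id kD (rB c)"
  by (rule tensor_eqI3l[OF _ _ _ _ ahom_comp[OF ahom_comp[OF bimod_hom_ahom[OF lB_hom] tensor_map_ahom] assoc_ahom] ahom_comp[OF bimod_hom_ahom[OF rB_hom] tensor_map_ahom]])
     (simp_all add: eval_sw sw_push Tri_nested1 Tri_nested2 tri_defs sw_coassoc del: rsmult_pure rsmult_pure')

end

section \<open>Corestriction, split injections and rebracketing\<close>

lemma the_inv_into_bimod_hom:
  assumes M: "bimodule K L M" and i: "i \<in> bimod_hom K L M N" "inj_on i (carrier M)"
    and X: "bimodule K L X" and f: "f \<in> bimod_hom K L X N" and sub: "\<And>x. x \<in> carrier X \<Longrightarrow> f x \<in> i ` carrier M"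
  shows "(\<lambda>x. the_inv_into (carrier M) i (f x)) \<in> bimod_hom K L X M" (is "?g \<in> _")
    and "x \<in> carrier X \<Longrightarrow> i (the_inv_into (carrier M) i (f x)) = f x"
proof -
  interpret M: bimodule K L M by fact
  interpret X: bimodule K L X by fact
  have c: "?g x \<in> carrier M" and e: "i (?g x) = f x" if "x \<in> carrier X" for x
    using sub[OF that] i(2) by (auto simp: the_inv_into_f_f)
  show "?g \<in> bimod_hom K L X M"
    using i(1) f c e
    by (auto simp: bimod_hom_iff left_hom_iff right_hom_iff ahom_def M.lsmult_closed M.right.rsmult_closed
        X.lsmult_closed X.right.rsmult_closed intro!: the_inv_into_f_eq[OF i(2)])
  show "x \<in> carrier X \<Longrightarrow> i (?g x) = f x" by (rule e)
qed

text \<open>A linear left inverse of \<open>i\<close> tensors to a left inverse of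
  \<open>M \<otimes> i\<close>. This takes the place of flatness of \<open>M\<close>.\<close>

lemma retract_inj_r:
  assumes M: "right_module K M" and X: "left_module K X" "left_module K Y"
    and i: "i \<in> left_hom K X Y" and r: "r \<in> left_hom K Y X" and ri: "\<And>x. x \<in> carrier X \<Longrightarrow> r (i x) = x"
  shows "inj_on (tensor_map K M Y id i) (carrier (tensor K M X))"
proof (rule inj_on_inverseI[of _ "tensor_map K M X id r"])
  fix u assume u: "u \<in> carrier (tensor K M X)"
  show "tensor_map K M X id r (tensor_map K M Y id i u) = u"
    by (rule tensor_eqI[OF M X(1) _ ahom_comp[OF tensor_map_ahom[OF M X(1) M X(2) right_hom_id i] tensor_map_ahom[OF M X(2) M X(1) right_hom_id r]] ahom_id _ u])
       (use assms in \<open>simp_all add: right_hom_id left_hom_closed\<close>)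
qed

lemma retract_inj_l:
  assumes M: "left_module K M" and X: "right_module K X" "right_module K Y"
    and i: "i \<in> right_hom K X Y" and r: "r \<in> right_hom K Y X" and ri: "\<And>x. x \<in> carrier X \<Longrightarrow> r (i x) = x"
  shows "inj_on (tensor_map K Y M i id) (carrier (tensor K X M))"
proof (rule inj_on_inverseI[of _ "tensor_map K X M r id"])
  fix u assume u: "u \<in> carrier (tensor K X M)"
  show "tensor_map K X M r id (tensor_map K Y M i id u) = u"
    by (rule tensor_eqI[OF X(1) M _ ahom_comp[OF tensor_map_ahom[OF X(1) M X(2) M i left_hom_id] tensor_map_ahom[OF X(2) M X(1) M r left_hom_id]] ahom_id _ u])
       (use assms in \<open>simp_all add: left_hom_id right_hom_closed\<close>)
qed

lemma tensor_map_inj_comp: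
  assumes mods: "right_module K M" "left_module K N" "right_module K M'" "left_module K N'" "right_module K M''" "left_module K N''"
    and f: "f \<in> right_hom K M M'" "f' \<in> right_hom K M' M''" and g: "g \<in> left_hom K N N'" "g' \<in> left_hom K N' N''"
    and inj: "inj_on (tensor_map K M' N' f g) (carrier (tensor K M N))" "inj_on (tensor_map K M'' N'' f' g') (carrier (tensor K M' N'))"
  shows "inj_on (tensor_map K M'' N'' (f' \<circ> f) (g' \<circ> g)) (carrier (tensor K M N))"
proof (rule inj_onI)
  fix u v assume *: "u \<in> carrier (tensor K M N)" "v \<in> carrier (tensor K M N)"
    "tensor_map K M'' N'' (f' \<circ> f) (g' \<circ> g) u = tensor_map K M'' N'' (f' \<circ> f) (g' \<circ> g) v"
  have c: "tensor_map K M' N' f g w \<in> carrier (tensor K M' N')" if "w \<in> carrier (tensor K M N)" for w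
    by (rule ahom_closed[OF tensor_map_ahom[OF mods(1-4) f(1) g(1)] that])
  have "tensor_map K M'' N'' f' g' (tensor_map K M' N' f g u) = tensor_map K M'' N'' f' g' (tensor_map K M' N' f g v)"
    using *(3) by (simp only: tensor_map_comp[OF mods f g] *(1,2))
  then have "tensor_map K M' N' f g u = tensor_map K M' N' f g v"
    by (rule inj_onD[OF inj(2)]) (rule c[OF *(1)], rule c[OF *(2)])
  then show "u = v" by (rule inj_onD[OF inj(1)]) (rule *(1), rule *(2))
qed

context
  fixes K :: "'r ring" and L :: "'s ring" and M :: "('k1, 'r, 'm, 'z1) bimod_scheme"
    and N :: "('r, 's, 'n, 'z2) bimod_scheme" and Q :: "('s, 'l1, 'p, 'z3) bimod_scheme"
    and M' :: "('k2, 'r, 'm1, 'z4) bimod_scheme"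
    and N' :: "('r, 's, 'n1, 'z5) bimod_scheme" and Q' :: "('s, 'l2, 'p1, 'z6) bimod_scheme" and f g h
  assumes M: "right_module K M" "right_module K M'" and N: "bimodule K L N" "bimodule K L N'"
    and Q: "left_module L Q" "left_module L Q'"
    and f: "f \<in> right_hom K M M'" and g: "g \<in> bimod_hom K L N N'" and h: "h \<in> left_hom L Q Q'"
begin

text \<open>By naturality the two maps are conjugate under the associativity isomorphisms.
  Regrouping is what brings a factor \<open>T\<close> next to the submodule whose inclusion it
  splits.\<close>

lemma tensor_map_inj_assoc:
  "inj_on (tensor_map L (tensor K M' N') Q' (tensor_map K M' N' f g) h) (carrier (tensor L (tensor K M N) Q)) \<longleftrightarrow>
   inj_on (tensor_map K M' (tensor L N' Q') f (tensor_map L N' Q' g h)) (carrier (tensor K M (tensor L N Q)))"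
  (is "inj_on ?l ?X \<longleftrightarrow> inj_on ?r ?Y")
proof -
  note s = N[THEN bimodule_left] N[THEN bimodule_right] bimod_hom_left[OF g] bimod_hom_right[OF g]
  have a: "assoc K L M N Q u \<in> ?Y" if "u \<in> ?X" for u by (rule ahom_closed[OF assoc_ahom[OF M(1) N(1) Q(1)] that])
  have ua: "unassoc K L M N Q u \<in> ?X" if "u \<in> ?Y" for u by (rule ahom_closed[OF unassoc_ahom[OF M(1) N(1) Q(1)] that])
  have l: "?l \<in> ahom (tensor L (tensor K M N) Q) (tensor L (tensor K M' N') Q')"
    by (rule tensor_map_ahom) (use M N Q f g h in simp_all)
  have r: "?r \<in> ahom (tensor K M (tensor L N Q)) (tensor K M' (tensor L N' Q'))"
    by (rule tensor_map_ahom) (use M N Q f g h in simp_all)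
  have nl: "assoc K L M' N' Q' (?l u) = ?r (assoc K L M N Q u)" if "u \<in> ?X" for u
    by (rule assoc_natural[OF M N Q f g h that])
  have nr: "unassoc K L M' N' Q' (?r u) = ?l (unassoc K L M N Q u)" if "u \<in> ?Y" for u
    by (rule unassoc_natural[OF M N Q f g h that])
  show ?thesis
  proof
    assume i: "inj_on ?l ?X"
    show "inj_on ?r ?Y"
    proof (rule inj_onI)
      fix u v assume *: "u \<in> ?Y" "v \<in> ?Y" "?r u = ?r v"
      have "?l (unassoc K L M N Q u) = ?l (unassoc K L M N Q v)" using nr * by metis
      then have "unassoc K L M N Q u = unassoc K L M N Q v" using inj_onD[OF i] ua * by blast
      then show "u = v" using * assoc_unassoc[OF M(1) N(1) Q(1)] by metis
    qed
  next
    assume i: "inj_on ?r ?Y"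
    show "inj_on ?l ?X"
    proof (rule inj_onI)
      fix u v assume *: "u \<in> ?X" "v \<in> ?X" "?l u = ?l v"
      have "?r (assoc K L M N Q u) = ?r (assoc K L M N Q v)" using nl * by metis
      then have "assoc K L M N Q u = assoc K L M N Q v" using inj_onD[OF i] a * by blast
      then show "u = v" using * unassoc_assoc[OF M(1) N(1) Q(1)] by metis
    qed
  qed
qed

end

lemma tensor_map_inj_cong:
  assumes "right_module R M" "left_module R N" "right_module R M'" "left_module R N'"
    and "f \<in> right_hom R M M'" "g \<in> left_hom R N N'" "f' \<in> right_hom R M M'" "g' \<in> left_hom R N N'"
    and "\<And>x. x \<in> carrier M \<Longrightarrow> f x = f' x" "\<And>x. x \<in> carrier N \<Longrightarrow> g x = g' x"
    and "inj_on (tensor_map R M' N' f g) (carrier (tensor R M N))"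
  shows "inj_on (tensor_map R M' N' f' g') (carrier (tensor R M N))"
  using assms(11) tensor_map_cong[OF assms(1-10)] by (simp add: inj_on_def)

text \<open>A tensor product of identities agrees with \<open>id\<close> only on the carrier, so the
  general statement has to be adjusted by \<open>tensor_map_inj_cong\<close>.\<close>

lemma tensor_map_inj_assoc_r:
  assumes M: "right_module K M" and N: "bimodule K L N" and Q: "left_module L Q" "left_module L Q'" and h: "h \<in> left_hom L Q Q'"
  shows "inj_on (tensor_map L (tensor K M N) Q' id h) (carrier (tensor L (tensor K M N) Q)) \<longleftrightarrow>
   inj_on (tensor_map K M (tensor L N Q') id (tensor_map L N Q' id h)) (carrier (tensor K M (tensor L N Q)))"
  unfolding tensor_map_inj_assoc[OF M M N N Q right_hom_id bimod_hom_id h, symmetric]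
  by (intro iffI; rule tensor_map_inj_cong, assumption?)
     (use M N Q h in \<open>simp_all add: right_hom_id bimod_hom_id tensor_map_id bimodule_left\<close>)

lemma tensor_map_inj_assoc_l:
  assumes M: "right_module K M" "right_module K M'" and N: "bimodule K L N" and Q: "left_module L Q" and h: "h \<in> right_hom K M M'"
  shows "inj_on (tensor_map K M' (tensor L N Q) h id) (carrier (tensor K M (tensor L N Q))) \<longleftrightarrow>
   inj_on (tensor_map L (tensor K M' N) Q (tensor_map K M' N h id) id) (carrier (tensor L (tensor K M N) Q))"
  unfolding tensor_map_inj_assoc[OF M N N Q Q h bimod_hom_id left_hom_id]
  by (intro iffI; rule tensor_map_inj_cong, assumption?)
     (use M N Q h in \<open>simp_all add: left_hom_id bimod_hom_id tensor_map_id bimodule_right bimodule_left\<close>)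

section \<open>The actions as maps on tensor products, and the counit axioms in Sweedler
  form\<close>

context herd_ctx
begin

definition "actTA = bilift T aT"
definition "actBT = bilift T bT"
definition "actAP = bilift P aP"
definition "actPB = bilift P bP"

lemmas act_hom = bilift_bimod_hom[OF bimodT bimodA bimodT aT, folded actTA_def]
  bilift_bimod_hom[OF bimodB bimodT bimodT bT, folded actBT_def]
  bilift_bimod_hom[OF bimodA bimodP bimodP aP, folded actAP_def]
  bilift_bimod_hom[OF bimodP bimodB bimodP bP, folded actPB_def]

lemmas act_homs [simp] = act_hom act_hom[THEN bimod_hom_left] act_hom[THEN bimod_hom_right] act_hom[THEN bimod_hom_ahom]
  act_hom[THEN bimod_hom_closed]

lemmas act_pure [simp] = bilift_pure[OF bimodT bimodA bimodT aT, folded actTA_def]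
  bilift_pure[OF bimodB bimodT bimodT bT, folded actBT_def]
  bilift_pure[OF bimodA bimodP bimodP aP, folded actAP_def]
  bilift_pure[OF bimodP bimodB bimodP bP, folded actPB_def]

lemma act_closed [simp]:
  "\<lbrakk>x \<in> carrier T; a \<in> carrier A\<rbrakk> \<Longrightarrow> aT x a \<in> carrier T"
  "\<lbrakk>b \<in> carrier B; x \<in> carrier T\<rbrakk> \<Longrightarrow> bT b x \<in> carrier T"
  "\<lbrakk>a \<in> carrier A; p \<in> carrier P\<rbrakk> \<Longrightarrow> aP a p \<in> carrier P"
  "\<lbrakk>p \<in> carrier P; b \<in> carrier B\<rbrakk> \<Longrightarrow> bP p b \<in> carrier P"
  using aT bT aP bP by (simp_all add: bilinear_def balanced_def)

lemma ev_simps: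
  "\<lbrakk>u \<in> carrier pt; v \<in> carrier pt\<rbrakk> \<Longrightarrow> ev (u \<oplus>\<^bsub>pt\<^esub> v) = ev u \<oplus>\<^bsub>A\<^esub> ev v"
  "\<lbrakk>r \<in> carrier R; u \<in> carrier pt\<rbrakk> \<Longrightarrow> ev (u \<odot>r\<^bsub>pt\<^esub> r) = ev u \<odot>r\<^bsub>A\<^esub> r"
  "\<lbrakk>r \<in> carrier R; p \<in> carrier P; x \<in> carrier T\<rbrakk> \<Longrightarrow> ev ((r \<odot>\<^bsub>P\<^esub> p) \<diamondop> x) = r \<odot>\<^bsub>A\<^esub> ev (p \<diamondop> x)"
  "\<lbrakk>u' \<in> carrier tp; v' \<in> carrier tp\<rbrakk> \<Longrightarrow> evh (u' \<oplus>\<^bsub>tp\<^esub> v') = evh u' \<oplus>\<^bsub>B\<^esub> evh v'"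
  "\<lbrakk>s \<in> carrier S; u' \<in> carrier tp\<rbrakk> \<Longrightarrow> evh (u' \<odot>r\<^bsub>tp\<^esub> s) = evh u' \<odot>r\<^bsub>B\<^esub> s"
  "\<lbrakk>s \<in> carrier S; x \<in> carrier T; p \<in> carrier P\<rbrakk> \<Longrightarrow> evh ((s \<odot>\<^bsub>T\<^esub> x) \<star> p) = s \<odot>\<^bsub>B\<^esub> evh (x \<star> p)"
proof -
  have h: "\<forall>r \<in> carrier R. \<forall>u \<in> carrier pt. ev (r \<odot>\<^bsub>pt\<^esub> u) = r \<odot>\<^bsub>A\<^esub> ev u"
    "\<forall>s \<in> carrier S. \<forall>u \<in> carrier tp. evh (s \<odot>\<^bsub>tp\<^esub> u) = s \<odot>\<^bsub>B\<^esub> evh u"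
    using base_homs(4,6) unfolding left_hom_iff by blast+
  show "ev ((r \<odot>\<^bsub>P\<^esub> p) \<diamondop> x) = r \<odot>\<^bsub>A\<^esub> ev (p \<diamondop> x)" if "r \<in> carrier R" "p \<in> carrier P" "x \<in> carrier T"
    using h(1)[rule_format, of r "p \<diamondop> x"] smult_pure[of r R S P T p x] that by (simp del: smult_pure smult_pure')
  show "evh ((s \<odot>\<^bsub>T\<^esub> x) \<star> p) = s \<odot>\<^bsub>B\<^esub> evh (x \<star> p)" if "s \<in> carrier S" "x \<in> carrier T" "p \<in> carrier P"
    using h(2)[rule_format, of s "x \<star> p"] smult_pure[of s S R T P x p] that by (simp del: smult_pure smult_pure')
qed (use base_homs(5,7) in \<open>simp_all add: right_hom_iff ahom_add\<close>)

lemmas ms = tri_defs ev_simps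

text \<open>The counit axiom for \<open>ev\<close>, an equation in \<open>T \<otimes> A\<close>, is
  composed with the map induced by \<open>g\<close>. In this form it collapses the last two Sweedler
  components inside an arbitrary balanced expression; \<open>sw_evh\<close> does the same for the
  first two.\<close>

lemma sw_ev:
  assumes X: "abelian_group X" and g: "balanced R T A X (\<lambda>(x, a). g x a)" and y: "y \<in> carrier T"
  shows "sw X (\<lambda>a q z. g a (ev (q \<diamondop> z))) y = g y oneA"
proof -
  let ?L = "tensor_lift (add_monoid X) (\<lambda>(x, a). g x a)"
  note L = lift_ahom[OF base_modules(10,5) group_of_add_monoid[OF X] g] lift_pure[OF base_modules(10,5) group_of_add_monoid[OF X] g]
  have "sw X (\<lambda>a q z. g a (ev (q \<diamondop> z))) y = ?L (tensor_map R T A id ev (assoc R S T P T (\<gamma> y)))"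
    by (rule sw_eqI[OF X ahom_comp[OF ahom_comp[OF assoc_ahom tensor_map_ahom] L(1)] _ y, symmetric]) (simp_all add: L(2))
  then show ?thesis using y by (simp add: shepherd_ev L(2))
qed

lemma sw_evh:
  assumes X: "abelian_group X" and g: "balanced S B T X (\<lambda>(b, x). g b x)" and y: "y \<in> carrier T"
  shows "sw X (\<lambda>a q z. g (evh (a \<star> q)) z) y = g oneB y"
proof -
  let ?L = "tensor_lift (add_monoid X) (\<lambda>(b, x). g b x)"
  note L = lift_ahom[OF base_modules(8,9) group_of_add_monoid[OF X] g] lift_pure[OF base_modules(8,9) group_of_add_monoid[OF X] g]
  have "sw X (\<lambda>a q z. g (evh (a \<star> q)) z) y = ?L (tensor_map S B T evh id (\<gamma> y))"
    by (rule sw_eqI[OF X ahom_comp[OF tensor_map_ahom L(1)] _ y, symmetric]) (simp_all add: L(2))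
  then show ?thesis using y by (simp add: shepherd_evh L(2))
qed

section \<open>The associated corings\<close>

text \<open>\<open>C\<close> is the equalizer of \<open>wC\<close> and \<open>eC\<close>, and \<open>D\<close> that of \<open>wD\<close> and \<open>eD\<close>.\<close>

definition "wC = tensor_map R A pt ev id \<circ> dC"
definition "wD = tensor_map S tp B id evh \<circ> dD"
definition "eC = pure_tensor R A pt oneA"
definition "eD = (\<lambda>d. pure_tensor S tp B d oneB)"

lemma eC_eq: "eC c = pure_tensor R A pt oneA c"
  by (simp add: eC_def)

lemma eD_eq: "eD d = pure_tensor S tp B d oneB"
  by (simp add: eD_def)

lemma wC_hom: "wC \<in> bimod_hom R R pt (tensor R A pt)"
  unfolding wC_def by (rule bimod_hom_comp[OF dC_hom tensor_map_bimod_hom]) simp_all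

lemma wD_hom: "wD \<in> bimod_hom S S tp (tensor S tp B)"
  unfolding wD_def by (rule bimod_hom_comp[OF dD_hom tensor_map_bimod_hom]) simp_all

text \<open>Left linearity uses that left and right multiples of \<open>oneA\<close> coincide, both
  being values of \<alpha>: a scalar passes through \<open>oneA\<close> to the other side.\<close>

lemma eC_hom: "eC \<in> bimod_hom R R pt (tensor R A pt)"
proof -
  have "pure_tensor R A pt oneA (r \<odot>\<^bsub>pt\<^esub> c) = r \<odot>\<^bsub>tensor R A pt\<^esub> pure_tensor R A pt oneA c"
    if "r \<in> carrier R" "c \<in> carrier pt" for r c
    using that pure_balanced[of R A pt oneA r c] by (simp add: alpha)
  moreover have "pure_tensor R A pt oneA (c \<odot>r\<^bsub>pt\<^esub> r) = pure_tensor R A pt oneA c \<odot>r\<^bsub>tensor R A pt\<^esub> r"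
    if "r \<in> carrier R" "c \<in> carrier pt" for r c
    using that by simp
  ultimately show ?thesis
    by (auto simp: eC_def bimod_hom_iff left_hom_iff right_hom_iff ahom_def pure_add_r)
qed

lemma eD_hom: "eD \<in> bimod_hom S S tp (tensor S tp B)"
proof -
  have "pure_tensor S tp B (d \<odot>r\<^bsub>tp\<^esub> s) oneB = pure_tensor S tp B d oneB \<odot>r\<^bsub>tensor S tp B\<^esub> s"
    if "s \<in> carrier S" "d \<in> carrier tp" for s d
    using that pure_balanced[of S tp B d s oneB] by (simp add: beta)
  moreover have "pure_tensor S tp B (s \<odot>\<^bsub>tp\<^esub> d) oneB = s \<odot>\<^bsub>tensor S tp B\<^esub> pure_tensor S tp B d oneB"
    if "s \<in> carrier S" "d \<in> carrier tp" for s d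
    using that by simp
  ultimately show ?thesis
    by (auto simp: eD_def bimod_hom_iff left_hom_iff right_hom_iff ahom_def pure_add_l)
qed

lemmas we_hom = wC_hom wD_hom eC_hom eD_hom
lemmas we_homs [simp] = we_hom we_hom[THEN bimod_hom_left] we_hom[THEN bimod_hom_right] we_hom[THEN bimod_hom_ahom]
  we_hom[THEN bimod_hom_closed]

lemma wC_sw: "\<lbrakk>p \<in> carrier P; y \<in> carrier T\<rbrakk> \<Longrightarrow>
    wC (p \<diamondop> y) = sw (tensor R A pt) (\<lambda>a q z. pure_tensor R A pt (ev (p \<diamondop> a)) (q \<diamondop> z)) y"
  by (simp add: wC_def eval_sw sw_push ms del: rsmult_pure rsmult_pure')

lemma wD_sw: "\<lbrakk>y \<in> carrier T; q' \<in> carrier P\<rbrakk> \<Longrightarrow>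
    wD (y \<star> q') = sw (tensor S tp B) (\<lambda>a q z. pure_tensor S tp B (a \<star> q) (evh (z \<star> q'))) y"
  by (simp add: wD_def eval_sw sw_push ms del: rsmult_pure rsmult_pure')

text \<open>The reason why \<gamma> has values in \<open>T \<otimes> C\<close>: applying
  \<open>wC\<close> in the second leg contracts components of the outer and the inner \<gamma>;
  coassociativity moves this contraction into the last two components of one \<gamma>, where the
  counit axiom replaces it by \<open>oneA\<close>.\<close>

lemma shepherd_r_equalizes:
  assumes y: "y \<in> carrier T"
  shows "tensor_map R T (tensor R A pt) id wC (\<gamma>r y) = tensor_map R T (tensor R A pt) id eC (\<gamma>r y)"
proof -
  let ?X = "tensor R T (tensor R A pt)"
  have "tensor_map R T (tensor R A pt) id wC (\<gamma>r y) =
    sw ?X (\<lambda>a q z. sw ?X (\<lambda>a' q' z'. pure_tensor R T (tensor R A pt) a (pure_tensor R A pt (ev (q \<diamondop> a')) (q' \<diamondop> z'))) z) y"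
    using y by (simp add: shepherd_r_sw wC_sw sw_push ms del: rsmult_pure rsmult_pure')
  also have "\<dots> = sw ?X (\<lambda>a q z. sw ?X (\<lambda>a' q' z'. pure_tensor R T (tensor R A pt) a' (pure_tensor R A pt (ev (q' \<diamondop> z')) (q \<diamondop> z))) a) y"
    by (rule sw_coassoc[symmetric]) (use y in \<open>simp_all add: ms del: rsmult_pure rsmult_pure'\<close>)
  also have "\<dots> = sw ?X (\<lambda>a q z. pure_tensor R T (tensor R A pt) a (pure_tensor R A pt oneA (q \<diamondop> z))) y"
    by (intro sw_cong refl sw_ev[where g = "\<lambda>a e. pure_tensor R T (tensor R A pt) a (pure_tensor R A pt e (q \<diamondop> z))" for q z])
       (simp_all add: balanced_def ms del: rsmult_pure rsmult_pure')
  also have "\<dots> = tensor_map R T (tensor R A pt) id eC (\<gamma>r y)"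
    using y by (simp add: shepherd_r_sw sw_push ms eC_eq del: rsmult_pure rsmult_pure')
  finally show ?thesis .
qed

lemma shepherd_equalizes:
  assumes y: "y \<in> carrier T"
  shows "tensor_map S (tensor S tp B) T wD id (\<gamma> y) = tensor_map S (tensor S tp B) T eD id (\<gamma> y)"
proof -
  let ?X = "tensor S (tensor S tp B) T"
  have "tensor_map S (tensor S tp B) T wD id (\<gamma> y) =
    sw ?X (\<lambda>a q z. sw ?X (\<lambda>a' q' z'. pure_tensor S (tensor S tp B) T (pure_tensor S tp B (a' \<star> q') (evh (z' \<star> q))) z) a) y"
    using y by (simp add: shepherd_sw wD_sw sw_push ms del: rsmult_pure rsmult_pure')
  also have "\<dots> = sw ?X (\<lambda>a q z. sw ?X (\<lambda>a' q' z'. pure_tensor S (tensor S tp B) T (pure_tensor S tp B (a \<star> q) (evh (a' \<star> q'))) z') z) y"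
    by (rule sw_coassoc) (use y in \<open>simp_all add: ms del: rsmult_pure rsmult_pure'\<close>)
  also have "\<dots> = sw ?X (\<lambda>a q z. pure_tensor S (tensor S tp B) T (pure_tensor S tp B (a \<star> q) oneB) z) y"
    by (intro sw_cong refl sw_evh[where g = "\<lambda>e z. pure_tensor S (tensor S tp B) T (pure_tensor S tp B (a \<star> q) e) z" for a q])
       (simp_all add: balanced_def ms del: rsmult_pure rsmult_pure')
  also have "\<dots> = tensor_map S (tensor S tp B) T eD id (\<gamma> y)"
    using y by (simp add: shepherd_sw sw_push ms eD_eq del: rsmult_pure rsmult_pure')
  finally show ?thesis .
qed

text \<open>
  \<open>tauC\<close> is a left inverse of \<open>T \<otimes> eC\<close>, and \<open>tauC \<circ> (T \<otimes> wC)\<close> equals \<open>sighatC\<close>, whose values come from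
  \<open>T \<otimes> C\<close>: so the fork becomes split after tensoring with \<open>T\<close>.
\<close>

definition "sighatC = tensor_map R T pt actBT id \<circ> unassoc S R B T pt \<circ> tensor_map S B (tensor R T pt) evh \<gamma>r \<circ> unassoc R S T P T"
definition "sighatD = tensor_map S tp T id actTA \<circ> assoc S R tp T A \<circ> tensor_map R tpt A \<gamma> ev \<circ> assoc R S T P T"
definition "tauC = tensor_map R T pt actTA id \<circ> unassoc R R T A pt"
definition "tauD = tensor_map S tp T id actBT \<circ> assoc S S tp B T"

lemma sighatC_hom: "sighatC \<in> bimod_hom S R (tensor R T pt) (tensor R T pt)"
  unfolding sighatC_def comp_assoc
  by (rule bimod_hom_comp[OF bimod_hom_comp[OF bimod_hom_comp[OF unassoc_bimod_hom tensor_map_bimod_hom] unassoc_bimod_hom]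
    tensor_map_bimod_hom, unfolded comp_assoc]) simp_all

lemma sighatD_hom: "sighatD \<in> bimod_hom S R tpt tpt"
  unfolding sighatD_def comp_assoc
  by (rule bimod_hom_comp[OF bimod_hom_comp[OF bimod_hom_comp[OF assoc_bimod_hom tensor_map_bimod_hom] assoc_bimod_hom]
    tensor_map_bimod_hom, unfolded comp_assoc]) simp_all

lemma tauC_hom: "tauC \<in> bimod_hom S R (tensor R T (tensor R A pt)) (tensor R T pt)"
  unfolding tauC_def by (rule bimod_hom_comp[OF unassoc_bimod_hom tensor_map_bimod_hom]) simp_all

lemma tauD_hom: "tauD \<in> bimod_hom S R (tensor S (tensor S tp B) T) tpt"
  unfolding tauD_def by (rule bimod_hom_comp[OF assoc_bimod_hom tensor_map_bimod_hom]) simp_all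

lemmas st_hom = sighatC_hom sighatD_hom tauC_hom tauD_hom
lemmas st_homs [simp] = st_hom st_hom[THEN bimod_hom_left] st_hom[THEN bimod_hom_right] st_hom[THEN bimod_hom_ahom]
  st_hom[THEN bimod_hom_closed]

lemma tauC_e: "\<lbrakk>x \<in> carrier T; c \<in> carrier pt\<rbrakk> \<Longrightarrow> tauC (pure_tensor R T (tensor R A pt) x (eC c)) = pure_tensor R T pt x c"
  by (simp add: tauC_def eC_eq aT_one)

lemma tauD_e: "\<lbrakk>d \<in> carrier tp; x \<in> carrier T\<rbrakk> \<Longrightarrow> tauD (pure_tensor S (tensor S tp B) T (eD d) x) = pure_tensor S tp T d x"
  by (simp add: tauD_def eD_eq bT_one)

lemma act_linear:
  "\<lbrakk>x \<in> carrier T; x' \<in> carrier T; a \<in> carrier A\<rbrakk> \<Longrightarrow> aT (x \<oplus>\<^bsub>T\<^esub> x') a = aT x a \<oplus>\<^bsub>T\<^esub> aT x' a"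
  "\<lbrakk>x \<in> carrier T; a \<in> carrier A; a' \<in> carrier A\<rbrakk> \<Longrightarrow> aT x (a \<oplus>\<^bsub>A\<^esub> a') = aT x a \<oplus>\<^bsub>T\<^esub> aT x a'"
  "\<lbrakk>x \<in> carrier T; r \<in> carrier R; a \<in> carrier A\<rbrakk> \<Longrightarrow> aT (x \<odot>r\<^bsub>T\<^esub> r) a = aT x (r \<odot>\<^bsub>A\<^esub> a)"
  "\<lbrakk>s \<in> carrier S; x \<in> carrier T; a \<in> carrier A\<rbrakk> \<Longrightarrow> aT (s \<odot>\<^bsub>T\<^esub> x) a = s \<odot>\<^bsub>T\<^esub> aT x a"
  "\<lbrakk>r \<in> carrier R; x \<in> carrier T; a \<in> carrier A\<rbrakk> \<Longrightarrow> aT x (a \<odot>r\<^bsub>A\<^esub> r) = aT x a \<odot>r\<^bsub>T\<^esub> r"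
  "\<lbrakk>b \<in> carrier B; b' \<in> carrier B; x \<in> carrier T\<rbrakk> \<Longrightarrow> bT (b \<oplus>\<^bsub>B\<^esub> b') x = bT b x \<oplus>\<^bsub>T\<^esub> bT b' x"
  "\<lbrakk>b \<in> carrier B; x \<in> carrier T; x' \<in> carrier T\<rbrakk> \<Longrightarrow> bT b (x \<oplus>\<^bsub>T\<^esub> x') = bT b x \<oplus>\<^bsub>T\<^esub> bT b x'"
  "\<lbrakk>b \<in> carrier B; s \<in> carrier S; x \<in> carrier T\<rbrakk> \<Longrightarrow> bT (b \<odot>r\<^bsub>B\<^esub> s) x = bT b (s \<odot>\<^bsub>T\<^esub> x)"
  "\<lbrakk>s \<in> carrier S; b \<in> carrier B; x \<in> carrier T\<rbrakk> \<Longrightarrow> bT (s \<odot>\<^bsub>B\<^esub> b) x = s \<odot>\<^bsub>T\<^esub> bT b x"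
  "\<lbrakk>r \<in> carrier R; b \<in> carrier B; x \<in> carrier T\<rbrakk> \<Longrightarrow> bT b (x \<odot>r\<^bsub>T\<^esub> r) = bT b x \<odot>r\<^bsub>T\<^esub> r"
  using aT bT unfolding bilinear_def balanced_def by simp_all

text \<open>On \<open>p \<diamondop> y\<close> the left side contains
  \<open>x ev(p \<otimes> a)\<close> and the right side \<open>evh(x \<otimes> p) a\<close>, for the
  first Sweedler component \<open>a\<close> of \<open>y\<close>; formal duality identifies
  them.\<close>

lemma tauC_w:
  assumes x: "x \<in> carrier T" and c: "c \<in> carrier pt"
  shows "tauC (pure_tensor R T (tensor R A pt) x (wC c)) = sighatC (pure_tensor R T pt x c)"
  by (rule tensor_eqI[OF _ _ _ ahom_comp[OF pure_r_ahom[OF _ _ x bimod_hom_ahom[OF wC_hom]] bimod_hom_ahom[OF tauC_hom]]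
    ahom_comp[OF pure_r_ahom[OF _ _ x ahom_id] bimod_hom_ahom[OF sighatC_hom]] _ c])
     (use x in \<open>simp_all add: tauC_def sighatC_def eval_sw wC_sw sw_push ms act_linear fd_T del: rsmult_pure rsmult_pure'\<close>)

lemma tauD_w:
  assumes d: "d \<in> carrier tp" and x: "x \<in> carrier T"
  shows "tauD (pure_tensor S (tensor S tp B) T (wD d) x) = sighatD (pure_tensor S tp T d x)"
  by (rule tensor_eqI[OF _ _ _ ahom_comp[OF pure_l_ahom[OF _ _ x bimod_hom_ahom[OF wD_hom]] bimod_hom_ahom[OF tauD_hom]]
    ahom_comp[OF pure_l_ahom[OF _ _ x ahom_id] bimod_hom_ahom[OF sighatD_hom]] _ d])
     (use x in \<open>simp_all add: tauD_def sighatD_def eval_sw wD_sw sw_push ms act_linear fd_T del: rsmult_pure rsmult_pure'\<close>)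

end

text \<open>\<open>U\<close> is any infinite type in which all base carriers have copies. As
  \<open>small\<close> passes to subsets and tensor products, flatness applies to everything built
  from them. The bounds on \<open>R\<close> and \<open>S\<close> serve the use of these rings as
  modules over themselves, needed for \<alpha> and \<beta>.\<close>

locale tame_ctx = herd_ctx R S A B T P oneA oneB alpha beta mulA aT bT aP bP ev evh \<gamma>
  for R :: "'r ring" and S :: "'s ring"
    and A :: "('r, 'r, 'a) bimod" and B :: "('s, 's, 'b) bimod"
    and T :: "('s, 'r, 't) bimod" and P :: "('r, 's, 'h) bimod"
    and oneA oneB alpha beta mulA aT bT aP bP ev evh \<gamma> +
  fixes U :: "'u itself"
  assumes infinite_U: "infinite (UNIV :: 'u set)"
    and ffR: "faithfully_flat_right U R T" and ffL: "faithfully_flat_left U S T"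
    and small_base [simp]: "small U (carrier A)" "small U (carrier B)" "small U (carrier T)" "small U (carrier P)"
      "small U (carrier R)" "small U (carrier S)"
begin

lemmas small_tensor' [simp] = small_tensor[OF infinite_U]

definition "cC = {c \<in> carrier pt. wC c = eC c}"
definition "cD = {d \<in> carrier tp. wD d = eD d}"
definition "Cm = pt\<lparr>carrier := cC\<rparr>"
definition "Dm = tp\<lparr>carrier := cD\<rparr>"

lemma carrier_CD [simp]: "carrier Cm = cC" "carrier Dm = cD"
  by (simp_all add: Cm_def Dm_def)

lemma CD_eq: "c \<in> cC \<Longrightarrow> wC c = eC c" "d \<in> cD \<Longrightarrow> wD d = eD d"
  by (simp_all add: cC_def cD_def)

lemma CD_subset [simp]: "c \<in> cC \<Longrightarrow> c \<in> carrier pt" "d \<in> cD \<Longrightarrow> d \<in> carrier tp"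
  by (simp_all add: cC_def cD_def)

lemma Cm_bimodule: "bimodule R R Cm"
  unfolding Cm_def cC_def by (rule bimodule_equalizer[where N = "tensor R A pt"]) simp_all

lemma Dm_bimodule: "bimodule S S Dm"
  unfolding Dm_def cD_def by (rule bimodule_equalizer[where N = "tensor S tp B"]) simp_all

lemma id_C_hom: "id \<in> bimod_hom R R Cm pt"
  unfolding Cm_def by (rule id_inclusion_hom) auto

lemma id_D_hom: "id \<in> bimod_hom S S Dm tp"
  unfolding Dm_def by (rule id_inclusion_hom) auto

lemmas CD_modules [simp] = Cm_bimodule bimodule_left[OF Cm_bimodule] bimodule_right[OF Cm_bimodule]
  bimodule_abelian_group[OF Cm_bimodule]
  Dm_bimodule bimodule_left[OF Dm_bimodule] bimodule_right[OF Dm_bimodule] bimodule_abelian_group[OF Dm_bimodule]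
lemmas CD_homs [simp] = id_C_hom bimod_hom_left[OF id_C_hom] bimod_hom_right[OF id_C_hom]
  id_D_hom bimod_hom_left[OF id_D_hom] bimod_hom_right[OF id_D_hom]

lemma small_CD [simp]: "small U cC" "small U cD"
  by (rule small_subset[of U "carrier pt"], simp, auto) (rule small_subset[of U "carrier tp"], simp, auto)

abbreviation "JC \<equiv> tensor_map R T pt id id"
abbreviation "JD \<equiv> tensor_map S tp T id id"

lemma JC_hom: "JC \<in> bimod_hom S R (tensor R T Cm) (tensor R T pt)"
  by (rule tensor_map_bimod_hom) simp_all

lemma JD_hom: "JD \<in> bimod_hom S R (tensor S Dm T) tpt"
  by (rule tensor_map_bimod_hom) simp_all

lemma JC_inj: "inj_on JC (carrier (tensor R T Cm))"
  by (subst faithfully_flat_right_inj_iff[OF ffR, symmetric]) simp_all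

lemma JD_inj: "inj_on JD (carrier (tensor S Dm T))"
  by (subst faithfully_flat_left_inj_iff[OF ffL, symmetric]) simp_all

lemma JC_image: "JC ` carrier (tensor R T Cm) =
    {u \<in> carrier (tensor R T pt). tensor_map R T (tensor R A pt) id wC u = tensor_map R T (tensor R A pt) id eC u}"
  by (subst faithfully_flat_right_equalizer_iff[OF ffR, symmetric], simp_all) (simp only: cC_def)

lemma JD_image: "JD ` carrier (tensor S Dm T) =
    {u \<in> carrier tpt. tensor_map S (tensor S tp B) T wD id u = tensor_map S (tensor S tp B) T eD id u}"
  by (subst faithfully_flat_left_equalizer_iff[OF ffL, symmetric], simp_all) (simp only: cD_def)

definition "\<gamma>C = (\<lambda>y. the_inv_into (carrier (tensor R T Cm)) JC (\<gamma>r y))"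
definition "\<gamma>D = (\<lambda>y. the_inv_into (carrier (tensor S Dm T)) JD (\<gamma> y))"

lemma \<gamma>C_hom: "\<gamma>C \<in> bimod_hom S R T (tensor R T Cm)" and \<gamma>C_eq [simp]: "y \<in> carrier T \<Longrightarrow> JC (\<gamma>C y) = \<gamma>r y"
  unfolding \<gamma>C_def
  by (rule the_inv_into_bimod_hom[OF _ JC_hom JC_inj _ shepherd_r_hom], simp_all add: JC_image shepherd_r_equalizes)+

lemma \<gamma>D_hom: "\<gamma>D \<in> bimod_hom S R T (tensor S Dm T)" and \<gamma>D_eq [simp]: "y \<in> carrier T \<Longrightarrow> JD (\<gamma>D y) = \<gamma> y"
  unfolding \<gamma>D_def
  by (rule the_inv_into_bimod_hom[OF _ JD_hom JD_inj _ shepherd], simp_all add: JD_image shepherd_equalizes)+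

lemmas \<gamma>CD_homs [simp] = \<gamma>C_hom \<gamma>C_hom[THEN bimod_hom_left] \<gamma>C_hom[THEN bimod_hom_right] \<gamma>C_hom[THEN bimod_hom_ahom]
  \<gamma>C_hom[THEN bimod_hom_closed]
  \<gamma>D_hom \<gamma>D_hom[THEN bimod_hom_left] \<gamma>D_hom[THEN bimod_hom_right] \<gamma>D_hom[THEN bimod_hom_ahom]
  \<gamma>D_hom[THEN bimod_hom_closed]

definition "sigC = tensor_map R T Cm actBT id \<circ> unassoc S R B T Cm \<circ> tensor_map S B (tensor R T Cm) evh \<gamma>C \<circ> unassoc R S T P T"
definition "sigD = tensor_map S Dm T id actTA \<circ> assoc S R Dm T A \<circ> tensor_map R (tensor S Dm T) A \<gamma>D ev \<circ> assoc R S T P T"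

lemma sigC_hom: "sigC \<in> bimod_hom S R (tensor R T pt) (tensor R T Cm)"
  unfolding sigC_def comp_assoc
  by (rule bimod_hom_comp[OF bimod_hom_comp[OF bimod_hom_comp[OF unassoc_bimod_hom tensor_map_bimod_hom] unassoc_bimod_hom]
    tensor_map_bimod_hom, unfolded comp_assoc]) simp_all

lemma sigD_hom: "sigD \<in> bimod_hom S R tpt (tensor S Dm T)"
  unfolding sigD_def comp_assoc
  by (rule bimod_hom_comp[OF bimod_hom_comp[OF bimod_hom_comp[OF assoc_bimod_hom tensor_map_bimod_hom] assoc_bimod_hom]
    tensor_map_bimod_hom, unfolded comp_assoc]) simp_all

lemmas sigCD_homs [simp] = sigC_hom sigC_hom[THEN bimod_hom_left] sigC_hom[THEN bimod_hom_right] sigC_hom[THEN bimod_hom_ahom]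
  sigC_hom[THEN bimod_hom_closed]
  sigD_hom sigD_hom[THEN bimod_hom_left] sigD_hom[THEN bimod_hom_right] sigD_hom[THEN bimod_hom_ahom]
  sigD_hom[THEN bimod_hom_closed]

text \<open>\<open>sigC\<close> is \<open>sighatC\<close> with \<open>\<gamma>r\<close> replaced by
  its corestriction \<open>\<gamma>C\<close>, and the inclusion \<open>JC\<close> commutes with
  rebracketing and with the action of \<open>B\<close> on the factor \<open>T\<close>.\<close>

lemma JC_sigC:
  assumes v: "v \<in> carrier (tensor R T pt)"
  shows "JC (sigC v) = sighatC v"
proof (rule tensor_eqI3r[OF _ _ _ _ ahom_comp[OF bimod_hom_ahom[OF sigC_hom] bimod_hom_ahom[OF JC_hom]] bimod_hom_ahom[OF sighatC_hom] _ v])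
  fix x p y assume *: "x \<in> carrier T" "p \<in> carrier P" "y \<in> carrier T"
  have "JC (tensor_map R T Cm actBT id (unassoc S R B T Cm (pure_tensor S B (tensor R T Cm) b u))) =
      tensor_map R T pt actBT id (unassoc S R B T pt (pure_tensor S B (tensor R T pt) b (JC u)))"
    if b: "b \<in> carrier B" and u: "u \<in> carrier (tensor R T Cm)" for b u
    by (rule tensor_eqI[OF _ _ _ ahom_comp[OF ahom_comp[OF ahom_comp[OF pure_r_ahom[OF _ _ b ahom_id] unassoc_ahom] tensor_map_ahom] bimod_hom_ahom[OF JC_hom]]
          ahom_comp[OF ahom_comp[OF pure_r_ahom[OF _ _ b bimod_hom_ahom[OF JC_hom]] unassoc_ahom] tensor_map_ahom] _ u])
       (use b in simp_all)
  from this[of "evh (x \<star> p)" "\<gamma>C y"] * show "JC (sigC (pure_tensor R T pt x (p \<diamondop> y))) = sighatC (pure_tensor R T pt x (p \<diamondop> y))"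
    by (simp add: sigC_def sighatC_def)
qed simp_all

lemma JD_sigD:
  assumes v: "v \<in> carrier tpt"
  shows "JD (sigD v) = sighatD v"
proof (rule tensor_eqI3l[OF _ _ _ _ ahom_comp[OF bimod_hom_ahom[OF sigD_hom] bimod_hom_ahom[OF JD_hom]] bimod_hom_ahom[OF sighatD_hom] _ v])
  fix x p y assume *: "x \<in> carrier T" "p \<in> carrier P" "y \<in> carrier T"
  have "JD (tensor_map S Dm T id actTA (assoc S R Dm T A (pure_tensor R (tensor S Dm T) A u b))) =
      tensor_map S tp T id actTA (assoc S R tp T A (pure_tensor R tpt A (JD u) b))"
    if b: "b \<in> carrier A" and u: "u \<in> carrier (tensor S Dm T)" for b u
    by (rule tensor_eqI[OF _ _ _ ahom_comp[OF ahom_comp[OF ahom_comp[OF pure_l_ahom[OF _ _ b ahom_id] assoc_ahom] tensor_map_ahom] bimod_hom_ahom[OF JD_hom]]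
          ahom_comp[OF ahom_comp[OF pure_l_ahom[OF _ _ b bimod_hom_ahom[OF JD_hom]] assoc_ahom] tensor_map_ahom] _ u])
       (use b in simp_all)
  from this[of "ev (p \<diamondop> y)" "\<gamma>D x"] * show "JD (sigD (pure_tensor S tp T (x \<star> p) y)) = sighatD (pure_tensor S tp T (x \<star> p) y)"
    by (simp add: sigD_def sighatD_def)
qed simp_all

text \<open>On \<open>C\<close> the maps \<open>wC\<close> and \<open>eC\<close> agree, so
  \<open>sighatC\<close> coincides with \<open>tauC\<close> after \<open>T \<otimes> eC\<close>,
  which is the identity. The comparison takes place in \<open>T \<otimes> pt\<close>, by injectivity
  of \<open>JC\<close>.\<close>

lemma sigC_pure:
  assumes x: "x \<in> carrier T" and c: "c \<in> cC"
  shows "sigC (pure_tensor R T pt x c) = pure_tensor R T Cm x c"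
proof (rule inj_onD[OF JC_inj])
  show "JC (sigC (pure_tensor R T pt x c)) = JC (pure_tensor R T Cm x c)"
    using x c tauC_w[OF x, of c] tauC_e[OF x, of c] by (simp add: JC_sigC CD_eq)
qed (use x c in simp_all)

lemma sigD_pure:
  assumes d: "d \<in> cD" and x: "x \<in> carrier T"
  shows "sigD (pure_tensor S tp T d x) = pure_tensor S Dm T d x"
proof (rule inj_onD[OF JD_inj])
  show "JD (sigD (pure_tensor S tp T d x)) = JD (pure_tensor S Dm T d x)"
    using x d tauD_w[OF _ x, of d] tauD_e[OF _ x, of d] by (simp add: JD_sigD CD_eq)
qed (use x d in simp_all)

lemma sigC_JC: "u \<in> carrier (tensor R T Cm) \<Longrightarrow> sigC (JC u) = u"
  by (rule tensor_eqI[OF _ _ _ ahom_comp[OF bimod_hom_ahom[OF JC_hom] bimod_hom_ahom[OF sigC_hom]] ahom_id])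
     (simp_all add: sigC_pure)

lemma sigD_JD: "u \<in> carrier (tensor S Dm T) \<Longrightarrow> sigD (JD u) = u"
  by (rule tensor_eqI[OF _ _ _ ahom_comp[OF bimod_hom_ahom[OF JD_hom] bimod_hom_ahom[OF sigD_hom]] ahom_id])
     (simp_all add: sigD_pure)

text \<open>\<open>sigC \<otimes> N\<close> up to brackets. The factor \<open>T\<close> is placed
  outermost because that is where faithful flatness removes it.\<close>

definition "rC N = assoc R R T Cm N \<circ> tensor_map R (tensor R T Cm) N sigC id \<circ> unassoc R R T pt N"
definition "rD N = unassoc S S N Dm T \<circ> tensor_map S N (tensor S Dm T) id sigD \<circ> assoc S S N tp T"

lemma rC_hom: "bimodule R L N \<Longrightarrow> rC N \<in> bimod_hom S L (tensor R T (tensor R pt N)) (tensor R T (tensor R Cm N))"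
  unfolding rC_def comp_assoc
  by (rule bimod_hom_comp[OF bimod_hom_comp[OF unassoc_bimod_hom tensor_map_bimod_hom] assoc_bimod_hom, unfolded comp_assoc])
     (simp_all add: bimodule_left)

lemma rD_hom: "bimodule K S N \<Longrightarrow> rD N \<in> bimod_hom K R (tensor S (tensor S N tp) T) (tensor S (tensor S N Dm) T)"
  unfolding rD_def comp_assoc
  by (rule bimod_hom_comp[OF bimod_hom_comp[OF assoc_bimod_hom tensor_map_bimod_hom] unassoc_bimod_hom, unfolded comp_assoc])
     (simp_all add: bimodule_right)

section \<open>Tensor products of \<open>C\<close> with an arbitrary module\<close>

context
  fixes N :: "('r, 'l, 'n, 'z) bimod_scheme" and L
  assumes N: "bimodule R L N"
begin

lemmas Nm [simp] = N bimodule_left[OF N] bimodule_right[OF N]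

abbreviation (input) "JCN \<equiv> tensor_map R T (tensor R pt N) id (tensor_map R pt N id id)"

lemma JCN_hom: "JCN \<in> bimod_hom S L (tensor R T (tensor R Cm N)) (tensor R T (tensor R pt N))"
  by (rule tensor_map_bimod_hom) simp_all

lemma rC_JCN: "u \<in> carrier (tensor R T (tensor R Cm N)) \<Longrightarrow> rC N (JCN u) = u"
  by (rule tensor_eqI3r[OF _ _ _ _ ahom_comp[OF bimod_hom_ahom[OF JCN_hom] bimod_hom_ahom[OF rC_hom[OF N]]] ahom_id])
     (simp_all add: sigC_pure rC_def)

text \<open>After tensoring with \<open>T\<close> the map has the left inverse \<open>rC N\<close>,
  and faithful flatness reflects injectivity. Thus \<open>C\<close> behaves like a pure submodule
  against every small bimodule \<open>N\<close>.\<close>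

lemma C_inj:
  assumes "small U (carrier N)"
  shows "inj_on (tensor_map R pt N id id) (carrier (tensor R Cm N))"
proof -
  have "inj_on JCN (carrier (tensor R T (tensor R Cm N)))"
    by (rule inj_on_inverseI[of _ "rC N"]) (rule rC_JCN)
  then show ?thesis
    by (subst faithfully_flat_right_inj_iff[OF ffR]) (use assms in simp_all)
qed

text \<open>The split fork argument: \<open>?tau\<close> turns the map induced by \<open>eC\<close>
  into the identity and the one induced by \<open>wC\<close> into \<open>JCN\<close> after
  \<open>rC N\<close>. An element on which both agree is therefore reproduced, and so lies in the
  image.\<close>

lemma JCN_rC:
  assumes u: "u \<in> carrier (tensor R T (tensor R pt N))"
    and eq: "tensor_map R T (tensor R (tensor R A pt) N) id (tensor_map R (tensor R A pt) N wC id) u =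
      tensor_map R T (tensor R (tensor R A pt) N) id (tensor_map R (tensor R A pt) N eC id) u"
  shows "JCN (rC N u) = u"
proof -
  let ?X = "tensor R T (tensor R (tensor R A pt) N)"
  let ?tau = "\<lambda>v. assoc R R T pt N (tensor_map R (tensor R T pt) N tauC id (unassoc R R T (tensor R A pt) N v))"
  have tau: "?tau \<in> ahom ?X (tensor R T (tensor R pt N))"
    by (rule ahom_comp[OF ahom_comp[OF unassoc_ahom tensor_map_ahom] assoc_ahom]) simp_all
  have h: "tensor_map R T (tensor R (tensor R A pt) N) id (tensor_map R (tensor R A pt) N f id) \<in> ahom (tensor R T (tensor R pt N)) ?X"
    if "f \<in> bimod_hom R R pt (tensor R A pt)" for f
    by (rule tensor_map_ahom) (use that in \<open>simp_all add: bimod_hom_right\<close>)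
  have 1: "?tau (tensor_map R T (tensor R (tensor R A pt) N) id (tensor_map R (tensor R A pt) N wC id) u) = JCN (rC N u)"
  proof (rule tensor_eqI3r[OF _ _ _ _ ahom_comp[OF h tau] ahom_comp[OF bimod_hom_ahom[OF rC_hom[OF N]] bimod_hom_ahom[OF JCN_hom]] _ u])
    fix x d n assume *: "x \<in> carrier T" "d \<in> carrier pt" "n \<in> carrier N"
    have "JCN (assoc R R T Cm N (pure_tensor R (tensor R T Cm) N v n)) = assoc R R T pt N (pure_tensor R (tensor R T pt) N (JC v) n)"
      if "v \<in> carrier (tensor R T Cm)" for v
      using assoc_natural[of R T T R Cm pt N N id id id "pure_tensor R (tensor R T Cm) N v n"] that * JC_hom
      by (simp add: bimod_hom_right)
    then show "?tau (tensor_map R T (tensor R (tensor R A pt) N) id (tensor_map R (tensor R A pt) N wC id) (pure_tensor R T (tensor R pt N) x (pure_tensor R pt N d n))) =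
      JCN (rC N (pure_tensor R T (tensor R pt N) x (pure_tensor R pt N d n)))"
      using * by (simp add: rC_def tauC_w JC_sigC)
  qed simp_all
  have 2: "?tau (tensor_map R T (tensor R (tensor R A pt) N) id (tensor_map R (tensor R A pt) N eC id) u) = u"
    by (rule tensor_eqI3r[OF _ _ _ _ ahom_comp[OF h tau] ahom_id _ u]) (simp_all add: tauC_e)
  show ?thesis using 1 2 eq by simp
qed

text \<open>A split equalizer is preserved by every tensor product; since the fork splits only after
  tensoring with \<open>T\<close>, the statement is proved there and descends. It makes membership
  in \<open>C \<otimes> N\<close> an equation.\<close>

lemma C_image:
  assumes "small U (carrier N)"
  shows "tensor_map R pt N id id ` carrier (tensor R Cm N) =
    {u \<in> carrier (tensor R pt N). tensor_map R (tensor R A pt) N wC id u = tensor_map R (tensor R A pt) N eC id u}"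
proof (subst faithfully_flat_right_equalizer_iff[OF ffR])
  let ?w = "tensor_map R T (tensor R (tensor R A pt) N) id (tensor_map R (tensor R A pt) N wC id)"
  let ?e = "tensor_map R T (tensor R (tensor R A pt) N) id (tensor_map R (tensor R A pt) N eC id)"
  have h: "tensor_map R T (tensor R (tensor R A pt) N) id (tensor_map R (tensor R A pt) N f id) \<in> ahom (tensor R T (tensor R pt N)) (tensor R T (tensor R (tensor R A pt) N))"
    if "f \<in> bimod_hom R R pt (tensor R A pt)" for f
    by (rule tensor_map_ahom) (use that in \<open>simp_all add: bimod_hom_right\<close>)
  have eq: "?w (JCN u) = ?e (JCN u)" if u: "u \<in> carrier (tensor R T (tensor R Cm N))" for u
    by (rule tensor_eqI3r[OF _ _ _ _ ahom_comp[OF bimod_hom_ahom[OF JCN_hom] h] ahom_comp[OF bimod_hom_ahom[OF JCN_hom] h] _ u])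
       (simp_all add: CD_eq)
  have cl: "JCN u \<in> carrier (tensor R T (tensor R pt N))" if "u \<in> carrier (tensor R T (tensor R Cm N))" for u
    using JCN_hom that by (rule bimod_hom_closed)
  have cl': "rC N u \<in> carrier (tensor R T (tensor R Cm N))" if "u \<in> carrier (tensor R T (tensor R pt N))" for u
    using rC_hom[OF N] that by (rule bimod_hom_closed)
  show "JCN ` carrier (tensor R T (tensor R Cm N)) = {u \<in> carrier (tensor R T (tensor R pt N)). ?w u = ?e u}"
    (is "_ ` ?a = ?b")
  proof (intro equalityI subsetI)
    fix v assume "v \<in> JCN ` ?a"
    then show "v \<in> ?b" using eq cl by blast
  next
    fix v assume "v \<in> ?b"
    then have "v = JCN (rC N v)" "rC N v \<in> ?a" using cl' JCN_rC by simp_all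
    then show "v \<in> JCN ` ?a" by (rule image_eqI)
  qed
qed (use assms in simp_all)

text \<open>The retraction survives tensoring with any right \<open>S\<close>-module
  \<open>M\<close>. With \<open>P\<close> for \<open>M\<close> this produces the factor
  \<open>pt\<close> in front.\<close>

lemma C_inj_T:
  assumes "right_module S M"
  shows "inj_on (tensor_map S M (tensor R T (tensor R pt N)) id JCN) (carrier (tensor S M (tensor R T (tensor R Cm N))))"
  by (rule retract_inj_r[OF assms _ _ bimod_hom_left[OF JCN_hom] bimod_hom_left[OF rC_hom[OF N]] rC_JCN]) simp_all

end

lemma C_inj_T0:
  assumes "right_module S M"
  shows "inj_on (tensor_map S M (tensor R T pt) id JC) (carrier (tensor S M (tensor R T Cm)))"
  by (rule retract_inj_r[OF assms _ _ bimod_hom_left[OF JC_hom] bimod_hom_left[OF sigC_hom] sigC_JC]) simp_all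

section \<open>Tensor products of \<open>D\<close> with an arbitrary module\<close>

context
  fixes N :: "('k, 's, 'n, 'z) bimod_scheme" and K
  assumes N: "bimodule K S N"
begin

lemmas Nm' [simp] = N bimodule_left[OF N] bimodule_right[OF N]

abbreviation (input) "JDN \<equiv> tensor_map S (tensor S N tp) T (tensor_map S N tp id id) id"

lemma JDN_hom: "JDN \<in> bimod_hom K R (tensor S (tensor S N Dm) T) (tensor S (tensor S N tp) T)"
  by (rule tensor_map_bimod_hom) simp_all

lemma rD_JDN: "u \<in> carrier (tensor S (tensor S N Dm) T) \<Longrightarrow> rD N (JDN u) = u"
  by (rule tensor_eqI3l[OF _ _ _ _ ahom_comp[OF bimod_hom_ahom[OF JDN_hom] bimod_hom_ahom[OF rD_hom[OF N]]] ahom_id])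
     (simp_all add: sigD_pure rD_def)

lemma D_inj:
  assumes "small U (carrier N)"
  shows "inj_on (tensor_map S N tp id id) (carrier (tensor S N Dm))"
proof -
  have "inj_on JDN (carrier (tensor S (tensor S N Dm) T))"
    by (rule inj_on_inverseI[of _ "rD N"]) (rule rD_JDN)
  then show ?thesis
    by (subst faithfully_flat_left_inj_iff[OF ffL]) (use assms in simp_all)
qed

lemma JDN_rD:
  assumes u: "u \<in> carrier (tensor S (tensor S N tp) T)"
    and eq: "tensor_map S (tensor S N (tensor S tp B)) T (tensor_map S N (tensor S tp B) id wD) id u =
      tensor_map S (tensor S N (tensor S tp B)) T (tensor_map S N (tensor S tp B) id eD) id u"
  shows "JDN (rD N u) = u"
proof -
  let ?X = "tensor S (tensor S N (tensor S tp B)) T"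
  let ?tau = "\<lambda>v. unassoc S S N tp T (tensor_map S N tpt id tauD (assoc S S N (tensor S tp B) T v))"
  have tau: "?tau \<in> ahom ?X (tensor S (tensor S N tp) T)"
    by (rule ahom_comp[OF ahom_comp[OF assoc_ahom tensor_map_ahom] unassoc_ahom]) simp_all
  have h: "tensor_map S (tensor S N (tensor S tp B)) T (tensor_map S N (tensor S tp B) id f) id \<in> ahom (tensor S (tensor S N tp) T) ?X"
    if "f \<in> bimod_hom S S tp (tensor S tp B)" for f
    by (rule tensor_map_ahom) (use that in \<open>simp_all add: bimod_hom_left\<close>)
  have 1: "?tau (tensor_map S (tensor S N (tensor S tp B)) T (tensor_map S N (tensor S tp B) id wD) id u) = JDN (rD N u)"
  proof (rule tensor_eqI3l[OF _ _ _ _ ahom_comp[OF h tau] ahom_comp[OF bimod_hom_ahom[OF rD_hom[OF N]] bimod_hom_ahom[OF JDN_hom]] _ u])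
    fix n d x assume *: "x \<in> carrier T" "d \<in> carrier tp" "n \<in> carrier N"
    have "JDN (unassoc S S N Dm T (pure_tensor S N (tensor S Dm T) n v)) = unassoc S S N tp T (pure_tensor S N tpt n (JD v))"
      if "v \<in> carrier (tensor S Dm T)" for v
      using unassoc_natural[of S N N S Dm tp T T id id id "pure_tensor S N (tensor S Dm T) n v"] that * JD_hom
      by (simp add: bimod_hom_left)
    then show "?tau (tensor_map S (tensor S N (tensor S tp B)) T (tensor_map S N (tensor S tp B) id wD) id (pure_tensor S (tensor S N tp) T (pure_tensor S N tp n d) x)) =
      JDN (rD N (pure_tensor S (tensor S N tp) T (pure_tensor S N tp n d) x))"
      using * by (simp add: rD_def tauD_w JD_sigD)
  qed simp_all
  have 2: "?tau (tensor_map S (tensor S N (tensor S tp B)) T (tensor_map S N (tensor S tp B) id eD) id u) = u"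
    by (rule tensor_eqI3l[OF _ _ _ _ ahom_comp[OF h tau] ahom_id _ u]) (simp_all add: tauD_e)
  show ?thesis using 1 2 eq by simp
qed

lemma D_image:
  assumes "small U (carrier N)"
  shows "tensor_map S N tp id id ` carrier (tensor S N Dm) =
    {u \<in> carrier (tensor S N tp). tensor_map S N (tensor S tp B) id wD u = tensor_map S N (tensor S tp B) id eD u}"
proof (subst faithfully_flat_left_equalizer_iff[OF ffL])
  let ?w = "tensor_map S (tensor S N (tensor S tp B)) T (tensor_map S N (tensor S tp B) id wD) id"
  let ?e = "tensor_map S (tensor S N (tensor S tp B)) T (tensor_map S N (tensor S tp B) id eD) id"
  have h: "tensor_map S (tensor S N (tensor S tp B)) T (tensor_map S N (tensor S tp B) id f) id \<in> ahom (tensor S (tensor S N tp) T) (tensor S (tensor S N (tensor S tp B)) T)"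
    if "f \<in> bimod_hom S S tp (tensor S tp B)" for f
    by (rule tensor_map_ahom) (use that in \<open>simp_all add: bimod_hom_left\<close>)
  have eq: "?w (JDN u) = ?e (JDN u)" if u: "u \<in> carrier (tensor S (tensor S N Dm) T)" for u
    by (rule tensor_eqI3l[OF _ _ _ _ ahom_comp[OF bimod_hom_ahom[OF JDN_hom] h] ahom_comp[OF bimod_hom_ahom[OF JDN_hom] h] _ u])
       (simp_all add: CD_eq)
  have cl: "JDN u \<in> carrier (tensor S (tensor S N tp) T)" if "u \<in> carrier (tensor S (tensor S N Dm) T)" for u
    using JDN_hom that by (rule bimod_hom_closed)
  have cl': "rD N u \<in> carrier (tensor S (tensor S N Dm) T)" if "u \<in> carrier (tensor S (tensor S N tp) T)" for u
    using rD_hom[OF N] that by (rule bimod_hom_closed)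
  show "JDN ` carrier (tensor S (tensor S N Dm) T) = {u \<in> carrier (tensor S (tensor S N tp) T). ?w u = ?e u}"
    (is "_ ` ?a = ?b")
  proof (intro equalityI subsetI)
    fix v assume "v \<in> JDN ` ?a"
    then show "v \<in> ?b" using eq cl by blast
  next
    fix v assume "v \<in> ?b"
    then have "v = JDN (rD N v)" "rD N v \<in> ?a" using cl' JDN_rD by simp_all
    then show "v \<in> JDN ` ?a" by (rule image_eqI)
  qed
qed (use assms in simp_all)

lemma D_inj_T:
  assumes "left_module R M"
  shows "inj_on (tensor_map R (tensor S (tensor S N tp) T) M JDN id) (carrier (tensor R (tensor S (tensor S N Dm) T) M))"
  by (rule retract_inj_l[OF assms _ _ bimod_hom_right[OF JDN_hom] bimod_hom_right[OF rD_hom[OF N]] rD_JDN]) simp_all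

end

lemma D_inj_T0:
  assumes "left_module R M"
  shows "inj_on (tensor_map R tpt M JD id) (carrier (tensor R (tensor S Dm T) M))"
  by (rule retract_inj_l[OF assms _ _ bimod_hom_right[OF JD_hom] bimod_hom_right[OF sigD_hom] sigD_JD]) simp_all

end

lemmas assoc_closed [simp] = ahom_closed[OF assoc_ahom]
lemmas unassoc_closed [simp] = ahom_closed[OF unassoc_ahom]

section \<open>Coassociative and counital maps satisfy the equalizer conditions\<close>

context herd_ctx
begin

text \<open>Applying \<open>wD\<close> after \<open>rho\<close> is, by coassociativity, the same as
  applying \<open>rho\<close> twice and then \<open>evh\<close>; the counit law reduces this to
  \<open>rho x \<otimes> oneB\<close>, which is the value of \<open>eD\<close>. The laws are assumed
  at the single element \<open>x\<close>, because in the applications the counit law holds only on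
  the equalizer and not on the whole ambient module.\<close>

lemma right_comodule_equalizes:
  assumes X: "bimodule K S X" and rho: "rho \<in> bimod_hom K S X (tensor S X tp)" and x: "x \<in> carrier X"
    and coass: "assoc S S X tp tp (tensor_map S (tensor S X tp) tp rho id (rho x)) = tensor_map S X (tensor S tp tp) id dD (rho x)"
    and counit: "tensor_map S X B id evh (rho x) = pure_tensor S X B x oneB"
  shows "tensor_map S X (tensor S tp B) id wD (rho x) = tensor_map S X (tensor S tp B) id eD (rho x)"
proof -
  note Xm [simp] = X bimodule_left[OF X] bimodule_right[OF X] bimodule_abelian_group[OF X]
  note rh [simp] = rho bimod_hom_left[OF rho] bimod_hom_right[OF rho] bimod_hom_ahom[OF rho] bimod_hom_closed[OF rho]
  have c: "tensor_map S (tensor S X tp) tp rho id u \<in> carrier (tensor S (tensor S X tp) tp)" if "u \<in> carrier (tensor S X tp)" for u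
    by (rule ahom_closed[OF tensor_map_ahom that]) simp_all
  have "tensor_map S X (tensor S tp B) id wD (rho x) =
      tensor_map S X (tensor S tp B) id (tensor_map S tp B id evh) (tensor_map S X (tensor S tp tp) id dD (rho x))"
    unfolding wD_def using x by (simp add: tensor_map_comp[where M = X and N = tp])
  also have "\<dots> = tensor_map S X (tensor S tp B) id (tensor_map S tp B id evh) (assoc S S X tp tp (tensor_map S (tensor S X tp) tp rho id (rho x)))"
    by (simp only: coass)
  also have "\<dots> = assoc S S X tp B (tensor_map S (tensor S X tp) B id evh (tensor_map S (tensor S X tp) tp rho id (rho x)))"
    by (rule tensor_eqI3l[OF _ _ _ _ ahom_comp[OF assoc_ahom tensor_map_ahom] ahom_comp[OF tensor_map_ahom assoc_ahom] _ c])
       (use x in simp_all)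
  also have "\<dots> = assoc S S X tp B (tensor_map S (tensor S X tp) B rho id (tensor_map S X B id evh (rho x)))"
    using x by (simp add: tensor_map_comp[where M = X and N = tp])
  also have "\<dots> = assoc S S X tp B (pure_tensor S (tensor S X tp) B (rho x) oneB)"
    using x by (simp add: counit)
  also have "\<dots> = tensor_map S X (tensor S tp B) id eD (rho x)"
    by (rule tensor_eqI[OF _ _ _ ahom_comp[OF pure_l_ahom[OF _ _ _ ahom_id] assoc_ahom] tensor_map_ahom _ bimod_hom_closed[OF rho x]])
       (simp_all add: eD_eq)
  finally show ?thesis .
qed

lemma left_comodule_equalizes:
  assumes X: "bimodule R L X" and lam: "lam \<in> bimod_hom R L X (tensor R pt X)" and x: "x \<in> carrier X"
    and coass: "assoc R R pt pt X (tensor_map R (tensor R pt pt) X dC id (lam x)) = tensor_map R pt (tensor R pt X) id lam (lam x)"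
    and counit: "tensor_map R A X ev id (lam x) = pure_tensor R A X oneA x"
  shows "tensor_map R (tensor R A pt) X wC id (lam x) = tensor_map R (tensor R A pt) X eC id (lam x)"
proof -
  note Xm [simp] = X bimodule_left[OF X] bimodule_right[OF X] bimodule_abelian_group[OF X]
  note rh [simp] = lam bimod_hom_left[OF lam] bimod_hom_right[OF lam] bimod_hom_ahom[OF lam] bimod_hom_closed[OF lam]
  have c: "tensor_map R pt (tensor R pt X) id lam u \<in> carrier (tensor R pt (tensor R pt X))" if "u \<in> carrier (tensor R pt X)" for u
    by (rule ahom_closed[OF tensor_map_ahom that]) simp_all
  have u: "unassoc R R pt pt X (tensor_map R pt (tensor R pt X) id lam (lam x)) = tensor_map R (tensor R pt pt) X dC id (lam x)"
    unfolding coass[symmetric]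
    by (rule unassoc_assoc) (use x in \<open>simp_all add: ahom_closed[OF tensor_map_ahom[OF _ _ _ _ dC_homs(3) left_hom_id]]\<close>)
  have "tensor_map R (tensor R A pt) X wC id (lam x) =
      tensor_map R (tensor R A pt) X (tensor_map R A pt ev id) id (tensor_map R (tensor R pt pt) X dC id (lam x))"
    unfolding wC_def using x by (simp add: tensor_map_comp[where M = pt and N = X])
  also have "\<dots> = tensor_map R (tensor R A pt) X (tensor_map R A pt ev id) id (unassoc R R pt pt X (tensor_map R pt (tensor R pt X) id lam (lam x)))"
    by (simp only: u)
  also have "\<dots> = unassoc R R A pt X (tensor_map R A (tensor R pt X) ev id (tensor_map R pt (tensor R pt X) id lam (lam x)))"
    by (rule tensor_eqI3r[OF _ _ _ _ ahom_comp[OF unassoc_ahom tensor_map_ahom] ahom_comp[OF tensor_map_ahom unassoc_ahom] _ c])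
       (use x in simp_all)
  also have "\<dots> = unassoc R R A pt X (tensor_map R A (tensor R pt X) id lam (tensor_map R A X ev id (lam x)))"
    using x by (simp add: tensor_map_comp[where M = pt and N = X])
  also have "\<dots> = unassoc R R A pt X (pure_tensor R A (tensor R pt X) oneA (lam x))"
    using x by (simp add: counit)
  also have "\<dots> = tensor_map R (tensor R A pt) X eC id (lam x)"
    by (rule tensor_eqI[OF _ _ _ ahom_comp[OF pure_r_ahom[OF _ _ _ ahom_id] unassoc_ahom] tensor_map_ahom _ bimod_hom_closed[OF lam x]])
       (simp_all add: eC_eq)
  finally show ?thesis .
qed

text \<open>\<open>T\<close>-bar is the joint equalizer of \<open>tensP wC\<close>, \<open>tensP eC\<close> and of \<open>Ptens wD\<close>, \<open>Ptens eD\<close>.\<close>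

definition "tensP w = tensor_map R (tensor R A pt) P w id"
definition "Ptens w = tensor_map S P (tensor S tp B) id w \<circ> assoc S R P T P"

lemma tensP_hom: "w \<in> bimod_hom R R pt (tensor R A pt) \<Longrightarrow> tensP w \<in> bimod_hom R S ptp (tensor R (tensor R A pt) P)"
  unfolding tensP_def by (rule tensor_map_bimod_hom) simp_all

lemma Ptens_hom: "w \<in> bimod_hom S S tp (tensor S tp B) \<Longrightarrow> Ptens w \<in> bimod_hom R S ptp (tensor S P (tensor S tp B))"
  unfolding Ptens_def by (rule bimod_hom_comp[OF assoc_bimod_hom tensor_map_bimod_hom]) simp_all

lemmas f_hom = tensP_hom[OF wC_hom] tensP_hom[OF eC_hom] Ptens_hom[OF wD_hom] Ptens_hom[OF eD_hom]
lemmas f_homs [simp] = f_hom f_hom[THEN bimod_hom_left] f_hom[THEN bimod_hom_right] f_hom[THEN bimod_hom_ahom]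

text \<open>The two parts together say that \<open>lB\<close> is counital at \<open>v\<close> if
  \<open>tensP wC v = tensP eC v\<close>: the first equalizer condition on T-bar yields the counit
  law of its left coaction.\<close>

lemma lB_counit:
  assumes v: "v \<in> carrier ptp"
  shows "tensor_map R A ptp ev id (lB v) = assoc R R A pt P (tensP wC v)" (is ?a)
    and "assoc R R A pt P (tensP eC v) = pure_tensor R A ptp oneA v" (is ?b)
proof -
  show ?a
    by (rule tensor_eqI3l[OF _ _ _ _ ahom_comp[OF bimod_hom_ahom[OF lB_hom] tensor_map_ahom]
          ahom_comp[OF bimod_hom_ahom[OF f_hom(1)] assoc_ahom] _ v])
       (simp_all add: tensP_def lB_sw wC_sw sw_push ms del: rsmult_pure rsmult_pure')
  show ?b
    by (rule tensor_eqI[OF _ _ _ ahom_comp[OF bimod_hom_ahom[OF f_hom(2)] assoc_ahom] pure_r_ahom[OF _ _ _ ahom_id] _ v])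
       (simp_all add: tensP_def eC_eq)
qed

lemma rB_counit:
  assumes v: "v \<in> carrier ptp"
  shows "tensor_map S ptp B id evh (rB v) = tensor_map S ptp B (unassoc S R P T P) id (unassoc S S P tp B (Ptens wD v))" (is ?a)
    and "tensor_map S ptp B (unassoc S R P T P) id (unassoc S S P tp B (Ptens eD v)) = pure_tensor S ptp B v oneB" (is ?b)
proof -
  show ?a
    by (rule tensor_eqI3l[OF _ _ _ _ ahom_comp[OF bimod_hom_ahom[OF rB_hom] tensor_map_ahom]
          ahom_comp[OF ahom_comp[OF bimod_hom_ahom[OF f_hom(3)] unassoc_ahom] tensor_map_ahom] _ v])
       (simp_all add: Ptens_def rB_sw wD_sw sw_push ms del: rsmult_pure rsmult_pure')
  show ?b
    by (rule tensor_eqI3l[OF _ _ _ _ ahom_comp[OF ahom_comp[OF bimod_hom_ahom[OF f_hom(4)] unassoc_ahom] tensor_map_ahom]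
        pure_l_ahom[OF _ _ _ ahom_id] _ v])
       (simp_all add: Ptens_def eD_eq)
qed

text \<open>Presents the left coaction as \<open>P \<otimes> kD\<close>. On
  \<open>P \<otimes> D\<close> the map \<open>kD\<close> can be corestricted, which shows that the
  coaction has its second leg in T-bar.\<close>

lemma lB_alt: "v \<in> carrier ptp \<Longrightarrow> unassoc S R P T ptp (tensor_map S P (tensor R T ptp) id kD (assoc S R P T P v)) = lB v"
  by (rule tensor_eqI3l[OF _ _ _ _ ahom_comp[OF ahom_comp[OF assoc_ahom tensor_map_ahom] unassoc_ahom] bimod_hom_ahom[OF lB_hom]])
     (simp_all add: eval_sw sw_push ms del: rsmult_pure rsmult_pure')

lemma rB_alt: "v \<in> carrier ptp \<Longrightarrow> assoc S R ptp T P (tensor_map R (tensor S ptp T) P kC id v) = rB v"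
  by (rule tensor_eqI3l[OF _ _ _ _ ahom_comp[OF tensor_map_ahom assoc_ahom] bimod_hom_ahom[OF rB_hom]])
     (simp_all add: eval_sw sw_push ms del: rsmult_pure rsmult_pure')

lemma kD_alt: "d \<in> carrier tp \<Longrightarrow> tensor_map R T ptp id (unassoc S R P T P) (assoc R S T P tp (dD d)) = kD d"
  by (rule tensor_eqI[OF _ _ _ ahom_comp[OF ahom_comp[OF bimod_hom_ahom[OF dD_hom] assoc_ahom] tensor_map_ahom] bimod_hom_ahom[OF kD_hom]])
     (simp_all add: eval_sw sw_push ms del: rsmult_pure rsmult_pure')

text \<open>\<open>kD\<close> applies \<open>\<gamma>r\<close> in its first factor, and the values
  of \<open>\<gamma>r\<close> already equalize \<open>wC\<close> and \<open>eC\<close>; hence every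
  \<open>d\<close> qualifies.\<close>

lemma kD_f1:
  assumes d: "d \<in> carrier tp"
  shows "tensor_map R T (tensor R (tensor R A pt) P) id (tensP wC) (kD d) = tensor_map R T (tensor R (tensor R A pt) P) id (tensP eC) (kD d)"
proof (rule tensor_eqI[OF _ _ _ ahom_comp[OF bimod_hom_ahom[OF kD_hom] tensor_map_ahom] ahom_comp[OF bimod_hom_ahom[OF kD_hom] tensor_map_ahom] _ d])
  fix y q assume *: "y \<in> carrier T" "q \<in> carrier P"
  have "tensor_map R T (tensor R (tensor R A pt) P) id (tensP w) (assoc R R T pt P (pure_tensor R (tensor R T pt) P u q)) =
      assoc R R T (tensor R A pt) P (pure_tensor R (tensor R T (tensor R A pt)) P (tensor_map R T (tensor R A pt) id w u) q)"
    if w: "w \<in> bimod_hom R R pt (tensor R A pt)" and u: "u \<in> carrier (tensor R T pt)" for w u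
    by (rule tensor_eqI[OF _ _ _ ahom_comp[OF ahom_comp[OF pure_l_ahom[OF _ _ *(2) ahom_id] assoc_ahom] tensor_map_ahom]
          ahom_comp[OF pure_l_ahom[OF _ _ *(2) tensor_map_ahom] assoc_ahom] _ u])
       (use w * tensP_hom[OF w] in \<open>simp_all add: bimod_hom_left bimod_hom_right bimod_hom_closed[OF w], simp add: tensP_def bimod_hom_right bimod_hom_closed[OF w]\<close>)
  then show "tensor_map R T (tensor R (tensor R A pt) P) id (tensP wC) (kD (y \<star> q)) = tensor_map R T (tensor R (tensor R A pt) P) id (tensP eC) (kD (y \<star> q))"
    using * by (simp add: kD_def shepherd_r_equalizes)
qed simp_all

text \<open>\<open>kD\<close> is a rebracketing of \<open>dD\<close>, which is coassociative; for
  \<open>d\<close> in \<open>D\<close> it is also counital at \<open>d\<close>, the counit law being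
  \<open>wD d = eD d\<close>. So \<open>right_comodule_equalizes\<close> applies with
  \<open>dD\<close> as coaction.\<close>

lemma kD_f2:
  assumes d: "d \<in> carrier tp" and eq: "wD d = eD d"
  shows "tensor_map R T (tensor S P (tensor S tp B)) id (Ptens wD) (kD d) = tensor_map R T (tensor S P (tensor S tp B)) id (Ptens eD) (kD d)"
proof -
  have "tensor_map R T (tensor S P (tensor S tp B)) id (Ptens w) (tensor_map R T ptp id (unassoc S R P T P) (assoc R S T P tp u)) =
      assoc R S T P (tensor S tp B) (tensor_map S tp (tensor S tp B) id w u)"
    if w: "w \<in> bimod_hom S S tp (tensor S tp B)" and u: "u \<in> carrier (tensor S tp tp)" for w u
    by (rule tensor_eqI3l[OF _ _ _ _ ahom_comp[OF ahom_comp[OF assoc_ahom tensor_map_ahom] tensor_map_ahom]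
          ahom_comp[OF tensor_map_ahom assoc_ahom] _ u])
       (use w Ptens_hom[OF w] in \<open>simp_all add: bimod_hom_left bimod_hom_right bimod_hom_closed[OF w], simp add: Ptens_def bimod_hom_left bimod_hom_closed[OF w]\<close>)
  moreover have "tensor_map S tp (tensor S tp B) id wD (dD d) = tensor_map S tp (tensor S tp B) id eD (dD d)"
    by (rule right_comodule_equalizes[OF _ dD_hom d coass_D[OF d]]) (use eq in \<open>simp_all add: wD_def eD_def\<close>)
  ultimately show ?thesis using d by (simp flip: kD_alt)
qed

lemma kC_f2:
  assumes c: "c \<in> carrier pt"
  shows "tensor_map S (tensor S P (tensor S tp B)) T (Ptens wD) id (kC c) = tensor_map S (tensor S P (tensor S tp B)) T (Ptens eD) id (kC c)"
proof (rule tensor_eqI[OF _ _ _ ahom_comp[OF bimod_hom_ahom[OF kC_hom] tensor_map_ahom] ahom_comp[OF bimod_hom_ahom[OF kC_hom] tensor_map_ahom] _ c])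
  fix p y assume *: "p \<in> carrier P" "y \<in> carrier T"
  let ?G = "\<lambda>u. tensor_map S ptp T (unassoc S R P T P) id (unassoc S S P tp T (pure_tensor S P tpt p u))"
  have G: "?G \<in> ahom tpt (tensor S ptp T)"
    by (rule ahom_comp[OF ahom_comp[OF pure_r_ahom[OF _ _ *(1) ahom_id] unassoc_ahom] tensor_map_ahom]) simp_all
  have "tensor_map S (tensor S P (tensor S tp B)) T (Ptens w) id (?G u) =
      unassoc S S P (tensor S tp B) T (pure_tensor S P (tensor S (tensor S tp B) T) p (tensor_map S (tensor S tp B) T w id u))"
    if w: "w \<in> bimod_hom S S tp (tensor S tp B)" and u: "u \<in> carrier tpt" for w u
    by (rule tensor_eqI[OF _ _ _ ahom_comp[OF G tensor_map_ahom] ahom_comp[OF pure_r_ahom[OF _ _ *(1) tensor_map_ahom] unassoc_ahom] _ u])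
       (use w * Ptens_hom[OF w] in \<open>simp_all add: bimod_hom_left bimod_hom_right bimod_hom_closed[OF w],
         simp add: Ptens_def bimod_hom_left bimod_hom_closed[OF w]\<close>)
  moreover have "kC (p \<diamondop> y) = ?G (\<gamma> y)"
    using * by (simp add: eval_sw sw_push ms del: rsmult_pure rsmult_pure')
  ultimately show "tensor_map S (tensor S P (tensor S tp B)) T (Ptens wD) id (kC (p \<diamondop> y)) = tensor_map S (tensor S P (tensor S tp B)) T (Ptens eD) id (kC (p \<diamondop> y))"
    using * by (simp add: shepherd_equalizes)
qed simp_all

lemma kC_f1:
  assumes c: "c \<in> carrier pt" and eq: "wC c = eC c"
  shows "tensor_map S (tensor R (tensor R A pt) P) T (tensP wC) id (kC c) = tensor_map S (tensor R (tensor R A pt) P) T (tensP eC) id (kC c)"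
proof -
  have "tensor_map S (tensor R (tensor R A pt) P) T (tensP w) id (unassoc R S pt P T u) =
      unassoc R S (tensor R A pt) P T (tensor_map R (tensor R A pt) pt w id u)"
    if w: "w \<in> bimod_hom R R pt (tensor R A pt)" and u: "u \<in> carrier (tensor R pt pt)" for w u
    by (rule tensor_eqI3r[OF _ _ _ _ ahom_comp[OF unassoc_ahom tensor_map_ahom]
          ahom_comp[OF tensor_map_ahom unassoc_ahom] _ u])
       (use w tensP_hom[OF w] in \<open>simp_all add: bimod_hom_left bimod_hom_right bimod_hom_closed[OF w], simp add: tensP_def bimod_hom_right bimod_hom_closed[OF w]\<close>)
  moreover have "tensor_map R (tensor R A pt) pt wC id (dC c) = tensor_map R (tensor R A pt) pt eC id (dC c)"
    by (rule left_comodule_equalizes[OF _ dC_hom c coass_C[OF c]]) (use eq in \<open>simp_all add: wC_def eC_def\<close>)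
  ultimately show ?thesis using c by (simp add: kC_def)
qed

end

context tame_ctx
begin

section \<open>The companion\<close>

text \<open>Flatness is available for one pair of maps at a time, so the joint equalizer is formed
  in two stages: \<open>K\<close> for the first pair, and \<open>Z\<close> as the equalizer of the
  second pair restricted to \<open>K\<close>.\<close>

lemma double_equalizer_T:
  assumes N: "bimodule R L N" and Q: "bimodule R L Q" "bimodule R L Q'"
    and small: "small U (carrier N)" "small U (carrier Q)" "small U (carrier Q')"
    and f: "f \<in> bimod_hom R L N Q" "g \<in> bimod_hom R L N Q" "f' \<in> bimod_hom R L N Q'" "g' \<in> bimod_hom R L N Q'"
  defines "Z \<equiv> N\<lparr>carrier := {n \<in> carrier N. f n = g n \<and> f' n = g' n}\<rparr>"
  shows "bimodule R L Z" (is ?bim)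
    and "tensor_map R T N id id ` carrier (tensor R T Z) =
      {u \<in> carrier (tensor R T N). tensor_map R T Q id f u = tensor_map R T Q id g u \<and>
        tensor_map R T Q' id f' u = tensor_map R T Q' id g' u}" (is "?J ` _ = ?b")
proof -
  define K where "K = N\<lparr>carrier := {n \<in> carrier N. f n = g n}\<rparr>"
  have K: "bimodule R L K" unfolding K_def by (rule bimodule_equalizer[OF N bimodule_abelian_group[OF Q(1)] f(1,2)])
  have iK: "id \<in> bimod_hom R L K N" unfolding K_def by (rule id_inclusion_hom) auto
  have fK: "f' \<in> bimod_hom R L K Q'" "g' \<in> bimod_hom R L K Q'"
    using bimod_hom_comp[OF iK f(3)] bimod_hom_comp[OF iK f(4)] by simp_all
  have ZK: "Z = K\<lparr>carrier := {n \<in> carrier K. f' n = g' n}\<rparr>" by (auto simp: Z_def K_def)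
  show Z: ?bim unfolding ZK by (rule bimodule_equalizer[OF K bimodule_abelian_group[OF Q(2)] fK])
  have iZ: "id \<in> bimod_hom R L Z K" unfolding ZK by (rule id_inclusion_hom) auto
  have iZN: "id \<in> bimod_hom R L Z N" using bimod_hom_comp[OF iZ iK] by simp
  have sK: "small U (carrier K)" by (rule small_subset[OF small(1)]) (auto simp: K_def)
  have sZ: "small U (carrier Z)" by (rule small_subset[OF small(1)]) (auto simp: Z_def)
  note m = bimodule_left[OF N] bimodule_left[OF Q(1)] bimodule_left[OF Q(2)] bimodule_left[OF K] bimodule_left[OF Z]
  note h = f[THEN bimod_hom_left] fK[THEN bimod_hom_left] iK[THEN bimod_hom_left] iZ[THEN bimod_hom_left] iZN[THEN bimod_hom_left]
  have 1: "?J ` carrier (tensor R T K) = {u \<in> carrier (tensor R T N). tensor_map R T Q id f u = tensor_map R T Q id g u}"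
    by (rule faithfully_flat_right_equalizer_iff[OF ffR m(4) m(1) m(2) sK small(1) small(2) h(7) h(1) h(2), THEN iffD1])
       (simp add: K_def)
  have 2: "tensor_map R T K id id ` carrier (tensor R T Z) =
      {u \<in> carrier (tensor R T K). tensor_map R T Q' id f' u = tensor_map R T Q' id g' u}"
    by (rule faithfully_flat_right_equalizer_iff[OF ffR m(5) m(4) m(3) sZ sK small(3) h(8) h(5) h(6), THEN iffD1])
       (simp add: ZK)
  have c: "?J (tensor_map R T K id id u) = ?J u" if "u \<in> carrier (tensor R T Z)" for u
    using tensor_map_comp[of R T Z T K T N id id id id u] m h that by simp
  have d: "tensor_map R T Q' id e (?J v) = tensor_map R T Q' id e v"
    if "v \<in> carrier (tensor R T K)" "e \<in> bimod_hom R L N Q'" for v e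
    using tensor_map_comp[of R T K T N T Q' id id id e v] m h that by (simp add: bimod_hom_left)
  show "?J ` carrier (tensor R T Z) = ?b"
  proof (intro equalityI subsetI)
    fix u assume "u \<in> ?J ` carrier (tensor R T Z)"
    then obtain v where v: "v \<in> carrier (tensor R T Z)" "u = ?J (tensor_map R T K id id v)" using c by auto
    let ?v = "tensor_map R T K id id v"
    have "?v \<in> {u \<in> carrier (tensor R T K). tensor_map R T Q' id f' u = tensor_map R T Q' id g' u}" using v(1) 2 by blast
    then have v': "?v \<in> carrier (tensor R T K)" "tensor_map R T Q' id f' ?v = tensor_map R T Q' id g' ?v" by simp_all
    have "u \<in> {u \<in> carrier (tensor R T N). tensor_map R T Q id f u = tensor_map R T Q id g u}"
      using v'(1) v(2) 1 by blast
    then show "u \<in> ?b" using v(2) v' d f by simp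
  next
    fix u assume u: "u \<in> ?b"
    then obtain v where v: "v \<in> carrier (tensor R T K)" "u = ?J v" using 1 by blast
    have "tensor_map R T Q' id f' v = tensor_map R T Q' id g' v"
      using u d[OF v(1) f(3)] d[OF v(1) f(4)] v(2) by simp
    then obtain w where w: "w \<in> carrier (tensor R T Z)" "v = tensor_map R T K id id w" using v(1) 2 by blast
    then have "u = ?J w" using v(2) c by simp
    then show "u \<in> ?J ` carrier (tensor R T Z)" using w(1) by (rule image_eqI)
  qed
qed

lemma double_equalizer_T':
  assumes N: "bimodule K0 S N" and Q: "bimodule K0 S Q" "bimodule K0 S Q'"
    and small: "small U (carrier N)" "small U (carrier Q)" "small U (carrier Q')"
    and f: "f \<in> bimod_hom K0 S N Q" "g \<in> bimod_hom K0 S N Q" "f' \<in> bimod_hom K0 S N Q'" "g' \<in> bimod_hom K0 S N Q'"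
  defines "Z \<equiv> N\<lparr>carrier := {n \<in> carrier N. f n = g n \<and> f' n = g' n}\<rparr>"
  shows "tensor_map S N T id id ` carrier (tensor S Z T) =
      {u \<in> carrier (tensor S N T). tensor_map S Q T f id u = tensor_map S Q T g id u \<and>
        tensor_map S Q' T f' id u = tensor_map S Q' T g' id u}" (is "?J ` _ = ?b")
proof -
  define K where "K = N\<lparr>carrier := {n \<in> carrier N. f n = g n}\<rparr>"
  have K: "bimodule K0 S K" unfolding K_def by (rule bimodule_equalizer[OF N bimodule_abelian_group[OF Q(1)] f(1,2)])
  have iK: "id \<in> bimod_hom K0 S K N" unfolding K_def by (rule id_inclusion_hom) auto
  have fK: "f' \<in> bimod_hom K0 S K Q'" "g' \<in> bimod_hom K0 S K Q'"
    using bimod_hom_comp[OF iK f(3)] bimod_hom_comp[OF iK f(4)] by simp_all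
  have ZK: "Z = K\<lparr>carrier := {n \<in> carrier K. f' n = g' n}\<rparr>" by (auto simp: Z_def K_def)
  have Z: "bimodule K0 S Z" unfolding ZK by (rule bimodule_equalizer[OF K bimodule_abelian_group[OF Q(2)] fK])
  have iZ: "id \<in> bimod_hom K0 S Z K" unfolding ZK by (rule id_inclusion_hom) auto
  have iZN: "id \<in> bimod_hom K0 S Z N" using bimod_hom_comp[OF iZ iK] by simp
  have sK: "small U (carrier K)" by (rule small_subset[OF small(1)]) (auto simp: K_def)
  have sZ: "small U (carrier Z)" by (rule small_subset[OF small(1)]) (auto simp: Z_def)
  note m = bimodule_right[OF N] bimodule_right[OF Q(1)] bimodule_right[OF Q(2)] bimodule_right[OF K] bimodule_right[OF Z]
  note h = f[THEN bimod_hom_right] fK[THEN bimod_hom_right] iK[THEN bimod_hom_right] iZ[THEN bimod_hom_right] iZN[THEN bimod_hom_right]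
  have 1: "?J ` carrier (tensor S K T) = {u \<in> carrier (tensor S N T). tensor_map S Q T f id u = tensor_map S Q T g id u}"
    by (rule faithfully_flat_left_equalizer_iff[OF ffL m(4) m(1) m(2) sK small(1) small(2) h(7) h(1) h(2), THEN iffD1])
       (simp add: K_def)
  have 2: "tensor_map S K T id id ` carrier (tensor S Z T) =
      {u \<in> carrier (tensor S K T). tensor_map S Q' T f' id u = tensor_map S Q' T g' id u}"
    by (rule faithfully_flat_left_equalizer_iff[OF ffL m(5) m(4) m(3) sZ sK small(3) h(8) h(5) h(6), THEN iffD1])
       (simp add: ZK)
  have c: "?J (tensor_map S K T id id u) = ?J u" if "u \<in> carrier (tensor S Z T)" for u
    using tensor_map_comp[of S Z T K T N T id id id id u] m h that by simp
  have d: "tensor_map S Q' T e id (?J v) = tensor_map S Q' T e id v"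
    if "v \<in> carrier (tensor S K T)" "e \<in> bimod_hom K0 S N Q'" for v e
    using tensor_map_comp[of S K T N T Q' T id e id id v] m h that by (simp add: bimod_hom_right)
  show "?J ` carrier (tensor S Z T) = ?b"
  proof (intro equalityI subsetI)
    fix u assume "u \<in> ?J ` carrier (tensor S Z T)"
    then obtain v where v: "v \<in> carrier (tensor S Z T)" "u = ?J (tensor_map S K T id id v)" using c by auto
    let ?v = "tensor_map S K T id id v"
    have "?v \<in> {u \<in> carrier (tensor S K T). tensor_map S Q' T f' id u = tensor_map S Q' T g' id u}" using v(1) 2 by blast
    then have v': "?v \<in> carrier (tensor S K T)" "tensor_map S Q' T f' id ?v = tensor_map S Q' T g' id ?v" by simp_all
    have "u \<in> {u \<in> carrier (tensor S N T). tensor_map S Q T f id u = tensor_map S Q T g id u}"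
      using v'(1) v(2) 1 by blast
    then show "u \<in> ?b" using v(2) v' d f by simp
  next
    fix u assume u: "u \<in> ?b"
    then obtain v where v: "v \<in> carrier (tensor S K T)" "u = ?J v" using 1 by blast
    have "tensor_map S Q' T f' id v = tensor_map S Q' T g' id v"
      using u d[OF v(1) f(3)] d[OF v(1) f(4)] v(2) by simp
    then obtain w where w: "w \<in> carrier (tensor S Z T)" "v = tensor_map S K T id id w" using v(1) 2 by blast
    then have "u = ?J w" using v(2) c by simp
    then show "u \<in> ?J ` carrier (tensor S Z T)" using w(1) by (rule image_eqI)
  qed
qed

definition "cB = {v \<in> carrier ptp. tensP wC v = tensP eC v \<and> Ptens wD v = Ptens eD v}"
definition "Tb = ptp\<lparr>carrier := cB\<rparr>"

lemma carrier_Tb [simp]: "carrier Tb = cB"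
  by (simp add: Tb_def)

lemma cB_eq: "v \<in> cB \<Longrightarrow> tensP wC v = tensP eC v" "v \<in> cB \<Longrightarrow> Ptens wD v = Ptens eD v"
  by (simp_all add: cB_def)

lemma cB_subset [simp]: "v \<in> cB \<Longrightarrow> v \<in> carrier ptp"
  by (simp add: cB_def)

lemmas Tb_image = double_equalizer_T[OF _ _ _ _ _ _ f_hom, folded cB_def, folded Tb_def]
lemmas Tb_image' = double_equalizer_T'[OF _ _ _ _ _ _ f_hom, folded cB_def, folded Tb_def]

lemma Tb_bimodule: "bimodule R S Tb"
  by (rule Tb_image(1)) simp_all

lemma id_Tb_hom: "id \<in> bimod_hom R S Tb ptp"
  unfolding Tb_def by (rule id_inclusion_hom) auto

lemmas Tb_modules [simp] = Tb_bimodule bimodule_left[OF Tb_bimodule] bimodule_right[OF Tb_bimodule]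
  bimodule_abelian_group[OF Tb_bimodule] id_Tb_hom bimod_hom_left[OF id_Tb_hom] bimod_hom_right[OF id_Tb_hom]

lemma small_Tb [simp]: "small U cB"
  by (rule small_subset[of U "carrier ptp"]) (simp, auto)

abbreviation "KT \<equiv> tensor_map R T ptp id id"
abbreviation "KT' \<equiv> tensor_map S ptp T id id"

lemma KT_hom: "KT \<in> bimod_hom S S (tensor R T Tb) (tensor R T ptp)"
  by (rule tensor_map_bimod_hom) simp_all

lemma KT'_hom: "KT' \<in> bimod_hom R R (tensor S Tb T) (tensor S ptp T)"
  by (rule tensor_map_bimod_hom) simp_all

lemma KT_inj: "inj_on KT (carrier (tensor R T Tb))"
  by (subst faithfully_flat_right_inj_iff[OF ffR, symmetric]) simp_all

lemma KT'_inj: "inj_on KT' (carrier (tensor S Tb T))"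
  by (subst faithfully_flat_left_inj_iff[OF ffL, symmetric]) simp_all

lemmas K_homs [simp] = KT_hom KT_hom[THEN bimod_hom_left] KT_hom[THEN bimod_hom_right] KT_hom[THEN bimod_hom_ahom]
  KT'_hom KT'_hom[THEN bimod_hom_left] KT'_hom[THEN bimod_hom_right] KT'_hom[THEN bimod_hom_ahom]

definition "covC = (\<lambda>c. the_inv_into (carrier (tensor S Tb T)) KT' (kC c))"
definition "covD = (\<lambda>d. the_inv_into (carrier (tensor R T Tb)) KT (kD d))"

lemma kC_hom': "kC \<in> bimod_hom R R Cm (tensor S ptp T)"
  using bimod_hom_comp[OF id_C_hom kC_hom] by simp

lemma kD_hom': "kD \<in> bimod_hom S S Dm (tensor R T ptp)"
  using bimod_hom_comp[OF id_D_hom kD_hom] by simp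

text \<open>\<open>Tb_image'\<close> describes \<open>Tb \<otimes> T\<close> by two equations in
  \<open>ptp \<otimes> T\<close>. The one for \<open>wD\<close> holds for \<open>kC c\<close>
  because \<gamma> has values in \<open>D \<otimes> T\<close>, the one for \<open>wC\<close> because
  \<open>c\<close> lies in \<open>C\<close>.\<close>

lemma covC_hom: "covC \<in> bimod_hom R R Cm (tensor S Tb T)" and covC_eq [simp]: "c \<in> cC \<Longrightarrow> KT' (covC c) = kC c"
proof -
  have *: "kC c \<in> KT' ` carrier (tensor S Tb T)" if "c \<in> carrier Cm" for c
    using that by (subst Tb_image') (simp_all add: kC_f2 kC_f1 CD_eq)
  show "covC \<in> bimod_hom R R Cm (tensor S Tb T)" "c \<in> cC \<Longrightarrow> KT' (covC c) = kC c"
    unfolding covC_def by (rule the_inv_into_bimod_hom[OF _ KT'_hom KT'_inj _ kC_hom' *], simp_all)+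
qed

lemma covD_hom: "covD \<in> bimod_hom S S Dm (tensor R T Tb)" and covD_eq [simp]: "d \<in> cD \<Longrightarrow> KT (covD d) = kD d"
proof -
  have *: "kD d \<in> KT ` carrier (tensor R T Tb)" if "d \<in> carrier Dm" for d
    using that by (subst Tb_image(2)) (simp_all add: kD_f2 kD_f1 CD_eq)
  show "covD \<in> bimod_hom S S Dm (tensor R T Tb)" "d \<in> cD \<Longrightarrow> KT (covD d) = kD d"
    unfolding covD_def by (rule the_inv_into_bimod_hom[OF _ KT_hom KT_inj _ kD_hom' *], simp_all)+
qed

lemmas cov_homs [simp] = covC_hom covC_hom[THEN bimod_hom_left] covC_hom[THEN bimod_hom_right] covC_hom[THEN bimod_hom_ahom]
  bimod_hom_closed[OF covC_hom, simplified]
  covD_hom covD_hom[THEN bimod_hom_left] covD_hom[THEN bimod_hom_right] covD_hom[THEN bimod_hom_ahom]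
  bimod_hom_closed[OF covD_hom, simplified]

abbreviation "JPD \<equiv> tensor_map S P tp id id"
abbreviation "JCP \<equiv> tensor_map R pt P id id"

lemma JPD_hom: "JPD \<in> bimod_hom R S (tensor S P Dm) (tensor S P tp)"
  by (rule tensor_map_bimod_hom) simp_all

lemma JCP_hom: "JCP \<in> bimod_hom R S (tensor R Cm P) ptp"
  by (rule tensor_map_bimod_hom) simp_all

definition "jD = (\<lambda>v. the_inv_into (carrier (tensor S P Dm)) JPD (assoc S R P T P v))"
definition "jC = (\<lambda>v. the_inv_into (carrier (tensor R Cm P)) JCP v)"

text \<open>By \<open>D_image\<close> for \<open>P\<close>, the second equalizer condition says that
  \<open>v\<close>, rebracketed, lies in \<open>P \<otimes> D\<close>. This factorization serves the
  left coaction on T-bar, and the one through \<open>C \<otimes> P\<close> given by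
  \<open>jC\<close> the right coaction.\<close>

lemma jD_hom: "jD \<in> bimod_hom R S Tb (tensor S P Dm)" and jD_eq [simp]: "v \<in> cB \<Longrightarrow> JPD (jD v) = assoc S R P T P v"
proof -
  have *: "assoc S R P T P v \<in> JPD ` carrier (tensor S P Dm)" if "v \<in> carrier Tb" for v
    using that cB_eq(2)[of v] by (subst D_image[of R]) (simp_all add: Ptens_def)
  have a: "assoc S R P T P \<in> bimod_hom R S Tb (tensor S P tp)"
    using bimod_hom_comp[OF id_Tb_hom assoc_bimod_hom[of R S P R T S P]] by simp
  have i: "inj_on JPD (carrier (tensor S P Dm))" by (rule D_inj[of R]) simp_all
  show "jD \<in> bimod_hom R S Tb (tensor S P Dm)" "v \<in> cB \<Longrightarrow> JPD (jD v) = assoc S R P T P v"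
    unfolding jD_def by (rule the_inv_into_bimod_hom[OF _ JPD_hom i _ a *], simp_all)+
qed

lemma jC_hom: "jC \<in> bimod_hom R S Tb (tensor R Cm P)" and jC_eq [simp]: "v \<in> cB \<Longrightarrow> JCP (jC v) = v"
proof -
  have *: "id v \<in> JCP ` carrier (tensor R Cm P)" if "v \<in> carrier Tb" for v
    using that cB_eq(1)[of v] by (subst C_image[of S]) (simp_all add: tensP_def)
  have i: "inj_on JCP (carrier (tensor R Cm P))" by (rule C_inj[of S]) simp_all
  note t = the_inv_into_bimod_hom[OF _ JCP_hom i _ id_Tb_hom *]
  show "jC \<in> bimod_hom R S Tb (tensor R Cm P)" "v \<in> cB \<Longrightarrow> JCP (jC v) = v"
    unfolding jC_def using t by simp_all
qed

lemmas j_homs [simp] = jD_hom jD_hom[THEN bimod_hom_left] jD_hom[THEN bimod_hom_right] jD_hom[THEN bimod_hom_ahom]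
  bimod_hom_closed[OF jD_hom, simplified]
  jC_hom jC_hom[THEN bimod_hom_left] jC_hom[THEN bimod_hom_right] jC_hom[THEN bimod_hom_ahom]
  bimod_hom_closed[OF jC_hom, simplified]

text \<open>Connects the equalizer description, on which all arguments about T-bar rest, with the
  intersection by which T-bar is defined; \<open>C_image\<close> and \<open>D_image\<close>
  characterise the two members.\<close>

lemma cB_conv: "cB = JCP ` carrier (tensor R Cm P) \<inter> unassoc S R P T P ` JPD ` carrier (tensor S P Dm)"
proof (intro equalityI subsetI)
  fix v assume v: "v \<in> cB"
  have "v \<in> JCP ` carrier (tensor R Cm P)" using v by (metis j_homs(10) jC_eq image_eqI)
  moreover have "v = unassoc S R P T P (JPD (jD v))" using v by simp
  ultimately show "v \<in> JCP ` carrier (tensor R Cm P) \<inter> unassoc S R P T P ` JPD ` carrier (tensor S P Dm)"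
    using v by (metis IntI image_eqI j_homs(5))
next
  fix v assume v: "v \<in> JCP ` carrier (tensor R Cm P) \<inter> unassoc S R P T P ` JPD ` carrier (tensor S P Dm)"
  then have 1: "v \<in> {u \<in> carrier ptp. tensor_map R (tensor R A pt) P wC id u = tensor_map R (tensor R A pt) P eC id u}"
    using C_image[of S P] by simp
  obtain w where w: "w \<in> JPD ` carrier (tensor S P Dm)" "v = unassoc S R P T P w" using v by blast
  then have 2: "w \<in> {u \<in> carrier (tensor S P tp). tensor_map S P (tensor S tp B) id wD u = tensor_map S P (tensor S tp B) id eD u}"
    using D_image[of R P] by simp
  then have "assoc S R P T P v = w" using w(2) by simp
  then show "v \<in> cB" using 1 2 unfolding cB_def tensP_def Ptens_def by simp
qed

end

lemma inj_on_conj: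
  "\<lbrakk>inj_on g B; \<And>u. u \<in> X \<Longrightarrow> a u \<in> B; inj_on a X; \<And>u. u \<in> X \<Longrightarrow> g (a u) = a' (f u)\<rbrakk> \<Longrightarrow> inj_on f X"
  by (rule inj_onI) (metis inj_onD)

context herd_ctx
begin

text \<open>Rebracketing \<open>pt \<otimes> X\<close> as \<open>P \<otimes> (T \<otimes> X)\<close>
  reduces the claim to \<open>T \<otimes> i\<close>. If that map splits, it stays injective after
  tensoring with the pen, whatever the pen is like.\<close>

lemma inj_pt:
  assumes "left_module R X" "left_module R Y" "i \<in> left_hom R X Y"
    and "inj_on (tensor_map S P (tensor R T Y) id (tensor_map R T Y id i)) (carrier (tensor S P (tensor R T X)))"
  shows "inj_on (tensor_map R pt Y id i) (carrier (tensor R pt X))"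
  using assms by (subst tensor_map_inj_assoc_r) simp_all

lemma inj_tp:
  assumes "right_module S X" "right_module S Y" "i \<in> right_hom S X Y"
    and "inj_on (tensor_map R (tensor S Y T) P (tensor_map S Y T i id) id) (carrier (tensor R (tensor S X T) P))"
  shows "inj_on (tensor_map S Y tp i id) (carrier (tensor S X tp))"
  using assms by (subst tensor_map_inj_assoc_l) simp_all

text \<open>The same regrouping with a further factor: \<open>M \<otimes> (pt \<otimes> X)\<close>
  becomes \<open>(M \<otimes> P) \<otimes> (T \<otimes> X)\<close>.\<close>

lemma inj_pt_M:
  assumes M: "right_module R M" and X: "left_module R X" "left_module R Y" and i: "i \<in> left_hom R X Y"
    and inj: "inj_on (tensor_map S (tensor R M P) (tensor R T Y) id (tensor_map R T Y id i)) (carrier (tensor S (tensor R M P) (tensor R T X)))"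
  shows "inj_on (tensor_map R M (tensor R pt Y) id (tensor_map R pt Y id i)) (carrier (tensor R M (tensor R pt X)))"
proof (rule inj_on_conj)
  have Ti: "tensor_map R T Y id i \<in> left_hom S (tensor R T X) (tensor R T Y)"
    "tensor_map R pt Y id i \<in> left_hom R (tensor R pt X) (tensor R pt Y)"
    using X i by simp_all
  show "inj_on (tensor_map R M (tensor S P (tensor R T Y)) id (tensor_map S P (tensor R T Y) id (tensor_map R T Y id i)))
      (carrier (tensor R M (tensor S P (tensor R T X))))"
    using inj M X Ti by (subst tensor_map_inj_assoc_r[symmetric]) simp_all
  let ?a = "tensor_map R M (tensor S P (tensor R T X)) id (assoc S R P T X)"
  have a: "?a \<in> ahom (tensor R M (tensor R pt X)) (tensor R M (tensor S P (tensor R T X)))"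
    by (rule tensor_map_ahom) (use M X in simp_all)
  show "?a u \<in> carrier (tensor R M (tensor S P (tensor R T X)))" if "u \<in> carrier (tensor R M (tensor R pt X))" for u
    using a that by (rule ahom_closed)
  show "inj_on ?a (carrier (tensor R M (tensor R pt X)))"
    by (rule retract_inj_r[where r = "unassoc S R P T X"]) (use M X in simp_all)
  show "tensor_map R M (tensor S P (tensor R T Y)) id (tensor_map S P (tensor R T Y) id (tensor_map R T Y id i)) (?a u) =
      tensor_map R M (tensor S P (tensor R T Y)) id (assoc S R P T Y) (tensor_map R M (tensor R pt Y) id (tensor_map R pt Y id i) u)"
    if "u \<in> carrier (tensor R M (tensor R pt X))" for u
  proof (rule tensor_eqI[OF _ _ _ ahom_comp[OF a tensor_map_ahom] ahom_comp[OF tensor_map_ahom tensor_map_ahom] _ that])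
    fix m v assume *: "m \<in> carrier M" "v \<in> carrier (tensor R pt X)"
    have "tensor_map S P (tensor R T Y) id (tensor_map R T Y id i) (assoc S R P T X v) = assoc S R P T Y (tensor_map R pt Y id i v)"
      by (rule tensor_eqI3l[OF _ _ _ _ ahom_comp[OF assoc_ahom tensor_map_ahom] ahom_comp[OF tensor_map_ahom assoc_ahom] _ *(2)])
         (use X i Ti in \<open>simp_all add: left_hom_closed[OF i]\<close>)
    then show "tensor_map R M (tensor S P (tensor R T Y)) id (tensor_map S P (tensor R T Y) id (tensor_map R T Y id i)) (?a (pure_tensor R M (tensor R pt X) m v)) =
      tensor_map R M (tensor S P (tensor R T Y)) id (assoc S R P T Y) (tensor_map R M (tensor R pt Y) id (tensor_map R pt Y id i) (pure_tensor R M (tensor R pt X) m v))"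
      using * M X Ti by (simp add: left_hom_closed[OF Ti(2)])
  qed (use M X Ti in simp_all)
qed

lemma inj_tp_M:
  assumes M: "left_module S M" and X: "right_module S X" "right_module S Y" and i: "i \<in> right_hom S X Y"
    and inj: "inj_on (tensor_map R (tensor S Y T) (tensor S P M) (tensor_map S Y T i id) id) (carrier (tensor R (tensor S X T) (tensor S P M)))"
  shows "inj_on (tensor_map S (tensor S Y tp) M (tensor_map S Y tp i id) id) (carrier (tensor S (tensor S X tp) M))"
proof (rule inj_on_conj)
  have Ti: "tensor_map S Y T i id \<in> right_hom R (tensor S X T) (tensor S Y T)"
    "tensor_map S Y tp i id \<in> right_hom S (tensor S X tp) (tensor S Y tp)"
    using X i by simp_all
  show "inj_on (tensor_map S (tensor R (tensor S Y T) P) M (tensor_map R (tensor S Y T) P (tensor_map S Y T i id) id) id)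
      (carrier (tensor S (tensor R (tensor S X T) P) M))"
    using inj M X Ti by (subst tensor_map_inj_assoc_l[symmetric]) simp_all
  let ?a = "tensor_map S (tensor R (tensor S X T) P) M (unassoc S R X T P) id"
  have a: "?a \<in> ahom (tensor S (tensor S X tp) M) (tensor S (tensor R (tensor S X T) P) M)"
    by (rule tensor_map_ahom) (use M X in simp_all)
  show "?a u \<in> carrier (tensor S (tensor R (tensor S X T) P) M)" if "u \<in> carrier (tensor S (tensor S X tp) M)" for u
    using a that by (rule ahom_closed)
  show "inj_on ?a (carrier (tensor S (tensor S X tp) M))"
    by (rule retract_inj_l[where r = "assoc S R X T P"]) (use M X in simp_all)
  show "tensor_map S (tensor R (tensor S Y T) P) M (tensor_map R (tensor S Y T) P (tensor_map S Y T i id) id) id (?a u) =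
      tensor_map S (tensor R (tensor S Y T) P) M (unassoc S R Y T P) id (tensor_map S (tensor S Y tp) M (tensor_map S Y tp i id) id u)"
    if "u \<in> carrier (tensor S (tensor S X tp) M)" for u
  proof (rule tensor_eqI[OF _ _ _ ahom_comp[OF a tensor_map_ahom] ahom_comp[OF tensor_map_ahom tensor_map_ahom] _ that])
    fix m v assume *: "v \<in> carrier (tensor S X tp)" "m \<in> carrier M"
    have "tensor_map R (tensor S Y T) P (tensor_map S Y T i id) id (unassoc S R X T P v) = unassoc S R Y T P (tensor_map S Y tp i id v)"
      by (rule tensor_eqI3r[OF _ _ _ _ ahom_comp[OF unassoc_ahom tensor_map_ahom] ahom_comp[OF tensor_map_ahom unassoc_ahom] _ *(1)])
         (use X i Ti in \<open>simp_all add: right_hom_closed[OF i]\<close>)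
    then show "tensor_map S (tensor R (tensor S Y T) P) M (tensor_map R (tensor S Y T) P (tensor_map S Y T i id) id) id (?a (pure_tensor S (tensor S X tp) M v m)) =
      tensor_map S (tensor R (tensor S Y T) P) M (unassoc S R Y T P) id (tensor_map S (tensor S Y tp) M (tensor_map S Y tp i id) id (pure_tensor S (tensor S X tp) M v m))"
      using * M X Ti by (simp add: right_hom_closed[OF Ti(2)])
  qed (use M X Ti in simp_all)
qed

end

context tame_ctx
begin

text \<open>
  \<open>omega\<close> is a retraction of \<open>(T \<otimes> Tb) \<otimes> T \<rightarrow> (T \<otimes> ptp) \<otimes> T\<close>: \<open>psihat\<close> evaluates the first two factors, \<open>sigD\<close> projects
  onto \<open>D \<otimes> T\<close>, and \<open>phi\<close> undoes \<open>psihat\<close> on \<open>T \<otimes> Tb\<close>.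
\<close>

definition "psihat = tensor_map S B tp evh id \<circ> unassoc R S T P tp \<circ> tensor_map R T (tensor S P tp) id (assoc S R P T P)"
definition "psiB = tensor_map S B Dm evh id \<circ> unassoc R S T P Dm \<circ> tensor_map R T (tensor S P Dm) id jD"
definition "phi = tensor_map R T Tb actBT id \<circ> unassoc S R B T Tb \<circ> tensor_map S B (tensor R T Tb) id covD"
definition "phihat = tensor_map R T ptp actBT id \<circ> unassoc S R B T ptp \<circ> tensor_map S B (tensor R T ptp) id kD"
definition "omega = tensor_map S (tensor R T Tb) T phi id \<circ> unassoc S S B Dm T \<circ> tensor_map S B (tensor S Dm T) id sigD \<circ>
  assoc S S B tp T \<circ> tensor_map S (tensor S B tp) T psihat id"

lemma psihat_hom: "psihat \<in> bimod_hom S S (tensor R T ptp) (tensor S B tp)"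
  unfolding psihat_def comp_assoc
  by (rule bimod_hom_comp[OF bimod_hom_comp[OF tensor_map_bimod_hom unassoc_bimod_hom] tensor_map_bimod_hom, unfolded comp_assoc])
     simp_all

lemma psiB_hom: "psiB \<in> bimod_hom S S (tensor R T Tb) (tensor S B Dm)"
  unfolding psiB_def comp_assoc
  by (rule bimod_hom_comp[OF bimod_hom_comp[OF tensor_map_bimod_hom[OF _ Tb_bimodule] unassoc_bimod_hom] tensor_map_bimod_hom, unfolded comp_assoc])
     simp_all

lemma phi_hom: "phi \<in> bimod_hom S S (tensor S B Dm) (tensor R T Tb)"
  unfolding phi_def comp_assoc
  by (rule bimod_hom_comp[OF bimod_hom_comp[OF tensor_map_bimod_hom[OF _ Dm_bimodule] unassoc_bimod_hom] tensor_map_bimod_hom, unfolded comp_assoc])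
     simp_all

lemma phihat_hom: "phihat \<in> bimod_hom S S (tensor S B tp) (tensor R T ptp)"
  unfolding phihat_def comp_assoc
  by (rule bimod_hom_comp[OF bimod_hom_comp[OF tensor_map_bimod_hom unassoc_bimod_hom] tensor_map_bimod_hom, unfolded comp_assoc])
     simp_all

lemmas pp_hom = psihat_hom psiB_hom phi_hom phihat_hom
lemmas pp_homs [simp] = pp_hom pp_hom[THEN bimod_hom_left] pp_hom[THEN bimod_hom_right] pp_hom[THEN bimod_hom_ahom]
  pp_hom[THEN bimod_hom_closed]

lemma omega_hom: "omega \<in> bimod_hom S R (tensor S (tensor R T ptp) T) (tensor S (tensor R T Tb) T)"
  unfolding omega_def comp_assoc
  by (rule bimod_hom_comp[OF bimod_hom_comp[OF bimod_hom_comp[OF bimod_hom_comp[OF tensor_map_bimod_hom assoc_bimod_hom]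
        tensor_map_bimod_hom] unassoc_bimod_hom] tensor_map_bimod_hom, unfolded comp_assoc]) simp_all

lemma JBD_hom: "tensor_map S B tp id id \<in> ahom (tensor S B Dm) (tensor S B tp)"
  by (rule tensor_map_ahom) simp_all

lemma psihat_psiB:
  assumes x: "x \<in> carrier T" and w: "w \<in> cB"
  shows "psihat (pure_tensor R T ptp x w) = tensor_map S B tp id id (psiB (pure_tensor R T Tb x w))"
proof -
  have "tensor_map S B tp id id (tensor_map S B Dm evh id (unassoc R S T P Dm (pure_tensor R T (tensor S P Dm) x z))) =
      tensor_map S B tp evh id (unassoc R S T P tp (pure_tensor R T (tensor S P tp) x (JPD z)))"
    if z: "z \<in> carrier (tensor S P Dm)" for z
    by (rule tensor_eqI[OF _ _ _ ahom_comp[OF ahom_comp[OF ahom_comp[OF pure_r_ahom[OF _ _ x ahom_id] unassoc_ahom] tensor_map_ahom] JBD_hom]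
        ahom_comp[OF ahom_comp[OF pure_r_ahom[OF _ _ x bimod_hom_ahom[OF JPD_hom]] unassoc_ahom] tensor_map_ahom] _ z])
       (use x in simp_all)
  from this[of "jD w"] show ?thesis using x w by (simp add: psihat_def psiB_def)
qed

lemma KT_phi:
  assumes v: "v \<in> carrier (tensor S B Dm)"
  shows "KT (phi v) = phihat (tensor_map S B tp id id v)"
proof (rule tensor_eqI[OF _ _ _ ahom_comp[OF bimod_hom_ahom[OF phi_hom] bimod_hom_ahom[OF KT_hom]]
    ahom_comp[OF JBD_hom bimod_hom_ahom[OF phihat_hom]] _ v])
  fix b d assume *: "b \<in> carrier B" "d \<in> carrier Dm"
  have "KT (tensor_map R T Tb actBT id (unassoc S R B T Tb (pure_tensor S B (tensor R T Tb) b u))) =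
      tensor_map R T ptp actBT id (unassoc S R B T ptp (pure_tensor S B (tensor R T ptp) b (KT u)))"
    if u: "u \<in> carrier (tensor R T Tb)" for u
    by (rule tensor_eqI[OF _ _ _ ahom_comp[OF ahom_comp[OF ahom_comp[OF pure_r_ahom[OF _ _ *(1) ahom_id] unassoc_ahom] tensor_map_ahom] bimod_hom_ahom[OF KT_hom]]
        ahom_comp[OF ahom_comp[OF pure_r_ahom[OF _ _ *(1) bimod_hom_ahom[OF KT_hom]] unassoc_ahom] tensor_map_ahom] _ u])
       (use * in simp_all)
  from this[of "covD d"] * show "KT (phi (pure_tensor S B Dm b d)) = phihat (tensor_map S B tp id id (pure_tensor S B Dm b d))"
    by (simp add: phi_def phihat_def)
qed simp_all

text \<open>Writing \<open>v\<close> as \<open>p \<diamondop> y \<otimes> q\<close>, the left side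
  starts with \<open>evh(x \<otimes> p)\<close> acting on the first Sweedler component of
  \<open>y\<close>. Formal duality turns this into \<open>x\<close> acted on by \<open>ev\<close>,
  and what remains is the left coaction of \<open>v\<close>.\<close>

lemma phihat_psihat:
  assumes x: "x \<in> carrier T" and v: "v \<in> carrier ptp"
  shows "phihat (psihat (pure_tensor R T ptp x v)) =
    tensor_map R T ptp actTA id (unassoc R R T A ptp (pure_tensor R T (tensor R A ptp) x (tensor_map R A ptp ev id (lB v))))"
  by (rule tensor_eqI3l[OF _ _ _ _ ahom_comp[OF ahom_comp[OF pure_r_ahom[OF _ _ x ahom_id] bimod_hom_ahom[OF psihat_hom]] bimod_hom_ahom[OF phihat_hom]]
     ahom_comp[OF ahom_comp[OF pure_r_ahom[OF _ _ x ahom_comp[OF bimod_hom_ahom[OF lB_hom] tensor_map_ahom]] unassoc_ahom] tensor_map_ahom] _ v])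
     (use x in \<open>simp_all add: psihat_def phihat_def eval_sw sw_push ms act_linear fd_T del: rsmult_pure rsmult_pure'\<close>)

text \<open>Under the injective \<open>KT\<close> the composite becomes \<open>x\<close> acted on by
  the \<open>ev\<close>-part of \<open>lB w\<close>. On T-bar \<open>lB\<close> is counital, so that
  part is \<open>oneA\<close>. Hence \<open>T \<otimes> Tb\<close> is a retract of
  \<open>B \<otimes> D\<close>.\<close>

lemma phi_psiB:
  assumes x: "x \<in> carrier T" and w: "w \<in> cB"
  shows "phi (psiB (pure_tensor R T Tb x w)) = pure_tensor R T Tb x w"
proof (rule inj_onD[OF KT_inj])
  have "KT (phi (psiB (pure_tensor R T Tb x w))) = phihat (psihat (pure_tensor R T ptp x w))"
    using x w by (simp add: KT_phi psihat_psiB)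
  also have "\<dots> = KT (pure_tensor R T Tb x w)"
    using x w by (simp add: phihat_psihat lB_counit cB_eq aT_one)
  finally show "KT (phi (psiB (pure_tensor R T Tb x w))) = KT (pure_tensor R T Tb x w)" .
qed (use x w in simp_all)

lemma omega_pure:
  assumes x: "x \<in> carrier T" and w: "w \<in> cB" and z: "z \<in> carrier T"
  shows "omega (pure_tensor S (tensor R T ptp) T (pure_tensor R T ptp x w) z) = pure_tensor S (tensor R T Tb) T (pure_tensor R T Tb x w) z"
proof -
  have "tensor_map S B (tensor S Dm T) id sigD (assoc S S B tp T (pure_tensor S (tensor S B tp) T (tensor_map S B tp id id v) z)) =
      assoc S S B Dm T (pure_tensor S (tensor S B Dm) T v z)" if v: "v \<in> carrier (tensor S B Dm)" for v
    by (rule tensor_eqI[OF _ _ _ ahom_comp[OF ahom_comp[OF pure_l_ahom[OF _ _ z JBD_hom] assoc_ahom] tensor_map_ahom]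
          ahom_comp[OF pure_l_ahom[OF _ _ z ahom_id] assoc_ahom] _ v])
       (use z in \<open>simp_all add: sigD_pure\<close>)
  from this[of "psiB (pure_tensor R T Tb x w)"] show ?thesis
    using x w z by (simp add: omega_def psihat_psiB phi_psiB)
qed

definition "omega' = assoc R S T Tb T \<circ> omega \<circ> unassoc R S T ptp T"

lemma omega'_hom: "omega' \<in> bimod_hom S R (tensor R T (tensor S ptp T)) (tensor R T (tensor S Tb T))"
  unfolding omega'_def comp_assoc
  by (rule bimod_hom_comp[OF bimod_hom_comp[OF unassoc_bimod_hom omega_hom] assoc_bimod_hom, unfolded comp_assoc]) simp_all

lemma omega'_pure:
  "\<lbrakk>x \<in> carrier T; w \<in> cB; z \<in> carrier T\<rbrakk> \<Longrightarrow>
    omega' (pure_tensor R T (tensor S ptp T) x (pure_tensor S ptp T w z)) = pure_tensor R T (tensor S Tb T) x (pure_tensor S Tb T w z)"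
  by (simp add: omega'_def omega_pure)

lemma omega_retract:
  "u \<in> carrier (tensor S (tensor R T Tb) T) \<Longrightarrow> omega (tensor_map S (tensor R T ptp) T KT id u) = u"
  by (rule tensor_eqI3l[OF _ _ _ _ ahom_comp[OF tensor_map_ahom bimod_hom_ahom[OF omega_hom]] ahom_id])
     (simp_all add: omega_pure)

lemma omega'_retract:
  "u \<in> carrier (tensor R T (tensor S Tb T)) \<Longrightarrow> omega' (tensor_map R T (tensor S ptp T) id KT' u) = u"
  by (rule tensor_eqI3r[OF _ _ _ _ ahom_comp[OF tensor_map_ahom bimod_hom_ahom[OF omega'_hom]] ahom_id])
     (simp_all add: omega'_pure)

text \<open>The retraction \<open>omega\<close> needs a second \<open>T\<close> on the right. That
  factor is added, injectivity follows from the retraction even after tensoring with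
  \<open>M\<close>, and faithful flatness of \<open>T\<close> over \<open>S\<close> removes it
  again; the last step is where the bound on \<open>M\<close> enters.\<close>

lemma Tb_inj_T:
  assumes M: "right_module S M" and small: "small U (carrier M)"
  shows "inj_on (tensor_map S M (tensor R T ptp) id KT) (carrier (tensor S M (tensor R T Tb)))"
proof -
  have "inj_on (tensor_map S M (tensor S (tensor R T ptp) T) id (tensor_map S (tensor R T ptp) T KT id))
      (carrier (tensor S M (tensor S (tensor R T Tb) T)))"
    by (rule retract_inj_r[OF M _ _ _ bimod_hom_left[OF omega_hom] omega_retract]) simp_all
  then have "inj_on (tensor_map S (tensor S M (tensor R T ptp)) T (tensor_map S M (tensor R T ptp) id KT) id)
      (carrier (tensor S (tensor S M (tensor R T Tb)) T))"
    by (subst tensor_map_inj_assoc) (use M in simp_all)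
  then show ?thesis
    by (subst faithfully_flat_left_inj_iff[OF ffL]) (use M small in simp_all)
qed

lemma Tb_inj_T':
  assumes N: "left_module R N" and small: "small U (carrier N)"
  shows "inj_on (tensor_map R (tensor S ptp T) N KT' id) (carrier (tensor R (tensor S Tb T) N))"
proof -
  have "inj_on (tensor_map R (tensor R T (tensor S ptp T)) N (tensor_map R T (tensor S ptp T) id KT') id)
      (carrier (tensor R (tensor R T (tensor S Tb T)) N))"
    by (rule retract_inj_l[OF N _ _ _ bimod_hom_right[OF omega'_hom] omega'_retract]) simp_all
  then have "inj_on (tensor_map R T (tensor R (tensor S ptp T) N) id (tensor_map R (tensor S ptp T) N KT' id))
      (carrier (tensor R T (tensor R (tensor S Tb T) N)))"
    by (subst tensor_map_inj_assoc[symmetric]) (use N in simp_all)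
  then show ?thesis
    by (subst faithfully_flat_right_inj_iff[OF ffR]) (use N small in simp_all)
qed

end

lemma tensor_map_inj_comp_id:
  assumes "right_module K M" "left_module K N" "right_module K M'" "left_module K N'" "right_module K M''" "left_module K N''"
    and "f \<in> right_hom K M M'" "f' \<in> right_hom K M' M''" and "g \<in> left_hom K N N'" "g' \<in> left_hom K N' N''"
    and "inj_on (tensor_map K M' N' f g) (carrier (tensor K M N))" "inj_on (tensor_map K M'' N'' f' g') (carrier (tensor K M' N'))"
    and "F \<in> right_hom K M M''" "G \<in> left_hom K N N''"
    and "\<And>x. x \<in> carrier M \<Longrightarrow> f' (f x) = F x" "\<And>x. x \<in> carrier N \<Longrightarrow> g' (g x) = G x"
  shows "inj_on (tensor_map K M'' N'' F G) (carrier (tensor K M N))"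
  by (rule tensor_map_inj_cong[OF _ _ _ _ _ _ _ _ _ _ tensor_map_inj_comp[OF assms(1-12)]])
     (use assms in \<open>simp_all add: right_hom_comp left_hom_comp\<close>)

section \<open>Injectivity of the inclusions into the iterated ambient tensor products\<close>

context tame_ctx
begin

lemma inj_pt_C: "inj_on (tensor_map R pt pt id id) (carrier (tensor R pt Cm))"
  by (rule inj_pt) (simp_all add: C_inj_T0)

lemma inj_tp_D: "inj_on (tensor_map S tp tp id id) (carrier (tensor S Dm tp))"
  by (rule inj_tp) (simp_all add: D_inj_T0)

lemma inj_pt_Tb: "inj_on (tensor_map R pt ptp id id) (carrier (tensor R pt Tb))"
  by (rule inj_pt) (simp_all add: Tb_inj_T)

lemma inj_tp_Tb: "inj_on (tensor_map S ptp tp id id) (carrier (tensor S Tb tp))"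
  by (rule inj_tp) (simp_all add: Tb_inj_T')

text \<open>One factor is enlarged at a time. Once the left factor is \<open>pt\<close>, its
  \<open>T\<close> splits the inclusion of the right one.\<close>

lemma inj_CC: "inj_on (tensor_map R pt pt id id) (carrier (tensor R Cm Cm))"
  by (rule tensor_map_inj_comp_id[OF _ _ _ _ _ _ _ _ _ _ C_inj[of R] inj_pt_C]) simp_all

lemma inj_DD: "inj_on (tensor_map S tp tp id id) (carrier (tensor S Dm Dm))"
  by (rule tensor_map_inj_comp_id[OF _ _ _ _ _ _ _ _ _ _ D_inj[of S] inj_tp_D]) simp_all

lemma inj_CTb: "inj_on (tensor_map R pt ptp id id) (carrier (tensor R Cm Tb))"
  by (rule tensor_map_inj_comp_id[OF _ _ _ _ _ _ _ _ _ _ C_inj[of S] inj_pt_Tb]) simp_all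

lemma inj_TbD: "inj_on (tensor_map S ptp tp id id) (carrier (tensor S Tb Dm))"
  by (rule tensor_map_inj_comp_id[OF _ _ _ _ _ _ _ _ _ _ D_inj[of R] inj_tp_Tb]) simp_all

text \<open>Enlarging from the left keeps each remaining \<open>C\<close> directly behind a factor
  \<open>pt\<close>, whose \<open>T\<close> splits the next inclusion. For \<open>D\<close> the
  order is reversed, because \<open>tp\<close> carries its \<open>T\<close> on the left.\<close>

lemma inj_CCC: "inj_on (tensor_map R pt (tensor R pt pt) id (tensor_map R pt pt id id)) (carrier (tensor R Cm (tensor R Cm Cm)))"
proof -
  have 1: "inj_on (tensor_map R pt (tensor R Cm Cm) id id) (carrier (tensor R Cm (tensor R Cm Cm)))"
    by (rule C_inj[of R]) simp_all
  have 2: "inj_on (tensor_map R pt (tensor R pt Cm) id (tensor_map R pt Cm id id)) (carrier (tensor R pt (tensor R Cm Cm)))"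
    by (rule inj_pt) (simp_all add: C_inj_T[OF Cm_bimodule])
  have 3: "inj_on (tensor_map R pt (tensor R pt pt) id (tensor_map R pt pt id id)) (carrier (tensor R pt (tensor R pt Cm)))"
    by (rule inj_pt_M) (simp_all add: C_inj_T0)
  have 12: "inj_on (tensor_map R pt (tensor R pt Cm) id (tensor_map R pt Cm id id)) (carrier (tensor R Cm (tensor R Cm Cm)))"
    by (rule tensor_map_inj_comp_id[OF _ _ _ _ _ _ _ _ _ _ 1 2]) simp_all
  show ?thesis
    by (rule tensor_map_inj_comp_id[OF _ _ _ _ _ _ _ _ _ _ 12 3])
       (simp_all add: tensor_map_comp[where M = Cm and N = Cm])
qed

lemma inj_CCTb: "inj_on (tensor_map R pt (tensor R pt ptp) id (tensor_map R pt ptp id id)) (carrier (tensor R Cm (tensor R Cm Tb)))"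
proof -
  have 1: "inj_on (tensor_map R pt (tensor R Cm Tb) id id) (carrier (tensor R Cm (tensor R Cm Tb)))"
    by (rule C_inj[of S]) simp_all
  have 2: "inj_on (tensor_map R pt (tensor R pt Tb) id (tensor_map R pt Tb id id)) (carrier (tensor R pt (tensor R Cm Tb)))"
    by (rule inj_pt) (simp_all add: C_inj_T[OF Tb_bimodule])
  have 3: "inj_on (tensor_map R pt (tensor R pt ptp) id (tensor_map R pt ptp id id)) (carrier (tensor R pt (tensor R pt Tb)))"
    by (rule inj_pt_M) (simp_all add: Tb_inj_T)
  have 12: "inj_on (tensor_map R pt (tensor R pt Tb) id (tensor_map R pt Tb id id)) (carrier (tensor R Cm (tensor R Cm Tb)))"
    by (rule tensor_map_inj_comp_id[OF _ _ _ _ _ _ _ _ _ _ 1 2]) simp_all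
  show ?thesis
    by (rule tensor_map_inj_comp_id[OF _ _ _ _ _ _ _ _ _ _ 12 3])
       (simp_all add: tensor_map_comp[where M = Cm and N = Tb])
qed

lemma inj_DDD: "inj_on (tensor_map S tp (tensor S tp tp) id (tensor_map S tp tp id id)) (carrier (tensor S Dm (tensor S Dm Dm)))"
proof -
  have 1: "inj_on (tensor_map S (tensor S Dm Dm) tp id id) (carrier (tensor S (tensor S Dm Dm) Dm))"
    by (rule D_inj[of S]) simp_all
  have 2: "inj_on (tensor_map S (tensor S Dm tp) tp (tensor_map S Dm tp id id) id) (carrier (tensor S (tensor S Dm Dm) tp))"
    by (rule inj_tp) (simp_all add: D_inj_T[OF Dm_bimodule])
  have 3: "inj_on (tensor_map S (tensor S tp tp) tp (tensor_map S tp tp id id) id) (carrier (tensor S (tensor S Dm tp) tp))"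
    by (rule inj_tp_M) (simp_all add: D_inj_T0)
  have 12: "inj_on (tensor_map S (tensor S Dm tp) tp (tensor_map S Dm tp id id) id) (carrier (tensor S (tensor S Dm Dm) Dm))"
    by (rule tensor_map_inj_comp_id[OF _ _ _ _ _ _ _ _ _ _ 1 2]) simp_all
  have "inj_on (tensor_map S (tensor S tp tp) tp (tensor_map S tp tp id id) id) (carrier (tensor S (tensor S Dm Dm) Dm))"
    by (rule tensor_map_inj_comp_id[OF _ _ _ _ _ _ _ _ _ _ 12 3])
       (simp_all add: tensor_map_comp[where M = Dm and N = Dm])
  then show ?thesis by (subst tensor_map_inj_assoc[symmetric]) simp_all
qed

lemma inj_TbDD: "inj_on (tensor_map S ptp (tensor S tp tp) id (tensor_map S tp tp id id)) (carrier (tensor S Tb (tensor S Dm Dm)))"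
proof -
  have 1: "inj_on (tensor_map S (tensor S Tb Dm) tp id id) (carrier (tensor S (tensor S Tb Dm) Dm))"
    by (rule D_inj[of R]) simp_all
  have 2: "inj_on (tensor_map S (tensor S Tb tp) tp (tensor_map S Tb tp id id) id) (carrier (tensor S (tensor S Tb Dm) tp))"
    by (rule inj_tp) (simp_all add: D_inj_T[OF Tb_bimodule])
  have 3: "inj_on (tensor_map S (tensor S ptp tp) tp (tensor_map S ptp tp id id) id) (carrier (tensor S (tensor S Tb tp) tp))"
    by (rule inj_tp_M) (simp_all add: Tb_inj_T')
  have 12: "inj_on (tensor_map S (tensor S Tb tp) tp (tensor_map S Tb tp id id) id) (carrier (tensor S (tensor S Tb Dm) Dm))"
    by (rule tensor_map_inj_comp_id[OF _ _ _ _ _ _ _ _ _ _ 1 2]) simp_all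
  have "inj_on (tensor_map S (tensor S ptp tp) tp (tensor_map S ptp tp id id) id) (carrier (tensor S (tensor S Tb Dm) Dm))"
    by (rule tensor_map_inj_comp_id[OF _ _ _ _ _ _ _ _ _ _ 12 3])
       (simp_all add: tensor_map_comp[where M = Tb and N = Dm])
  then show ?thesis by (subst tensor_map_inj_assoc[symmetric]) simp_all
qed

lemma inj_DDT: "inj_on (tensor_map S tp tpt id JD) (carrier (tensor S Dm (tensor S Dm T)))"
proof -
  have "inj_on (tensor_map S (tensor S tp tp) T (tensor_map S tp tp id id) id) (carrier (tensor S (tensor S Dm Dm) T))"
    by (subst faithfully_flat_left_inj_iff[OF ffL, symmetric]) (simp_all add: inj_DD)
  then show ?thesis by (subst tensor_map_inj_assoc[symmetric]) simp_all
qed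

lemma inj_TCC: "inj_on (tensor_map R T (tensor R pt pt) id (tensor_map R pt pt id id)) (carrier (tensor R T (tensor R Cm Cm)))"
  by (subst faithfully_flat_right_inj_iff[OF ffR, symmetric]) (simp_all add: inj_CC)

text \<open>The middle \<open>T\<close> serves twice: grouped with \<open>D\<close> it splits the
  inclusion of \<open>D\<close>, and grouped with \<open>C\<close> that of \<open>C\<close>.\<close>

lemma inj_DTC: "inj_on (tensor_map S tp (tensor R T pt) id JC) (carrier (tensor S Dm (tensor R T Cm)))"
proof -
  have 1: "inj_on (tensor_map S tp (tensor R T Cm) id id) (carrier (tensor S Dm (tensor R T Cm)))"
    by (subst tensor_map_inj_assoc_l) (simp_all add: D_inj_T0)
  show ?thesis
    by (rule tensor_map_inj_comp_id[OF _ _ _ _ _ _ _ _ _ _ 1 C_inj_T0]) simp_all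
qed

lemma inj_DTTb: "inj_on (tensor_map S tp (tensor R T ptp) id KT) (carrier (tensor S Dm (tensor R T Tb)))"
proof -
  have 1: "inj_on (tensor_map S tp (tensor R T Tb) id id) (carrier (tensor S Dm (tensor R T Tb)))"
    by (subst tensor_map_inj_assoc_l) (simp_all add: D_inj_T0)
  show ?thesis
    by (rule tensor_map_inj_comp_id[OF _ _ _ _ _ _ _ _ _ _ 1 Tb_inj_T]) simp_all
qed

lemma inj_TbTC: "inj_on (tensor_map S ptp (tensor R T pt) id JC) (carrier (tensor S Tb (tensor R T Cm)))"
proof -
  have 1: "inj_on (tensor_map S ptp (tensor R T Cm) id id) (carrier (tensor S Tb (tensor R T Cm)))"
    by (subst tensor_map_inj_assoc_l) (simp_all add: Tb_inj_T')
  show ?thesis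
    by (rule tensor_map_inj_comp_id[OF _ _ _ _ _ _ _ _ _ _ 1 C_inj_T0]) simp_all
qed

lemma inj_TbTTb: "inj_on (tensor_map S ptp (tensor R T ptp) id KT) (carrier (tensor S Tb (tensor R T Tb)))"
proof -
  have 1: "inj_on (tensor_map S ptp (tensor R T Tb) id id) (carrier (tensor S Tb (tensor R T Tb)))"
    by (subst tensor_map_inj_assoc_l) (simp_all add: Tb_inj_T')
  show ?thesis
    by (rule tensor_map_inj_comp_id[OF _ _ _ _ _ _ _ _ _ _ 1 Tb_inj_T]) simp_all
qed

lemma inj_CTbT: "inj_on (tensor_map R pt (tensor S ptp T) id KT') (carrier (tensor R Cm (tensor S Tb T)))"
proof -
  have "inj_on (tensor_map S (tensor R pt ptp) T (tensor_map R pt ptp id id) id) (carrier (tensor S (tensor R Cm Tb) T))"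
    by (subst faithfully_flat_left_inj_iff[OF ffL, symmetric]) (simp_all add: inj_CTb)
  then show ?thesis by (subst tensor_map_inj_assoc[symmetric]) simp_all
qed

lemma inj_TTbD: "inj_on (tensor_map R T (tensor S ptp tp) id (tensor_map S ptp tp id id)) (carrier (tensor R T (tensor S Tb Dm)))"
  by (subst faithfully_flat_right_inj_iff[OF ffR, symmetric]) (simp_all add: inj_TbD)

lemma inj_TTbT: "inj_on (tensor_map R T (tensor S ptp T) id KT') (carrier (tensor R T (tensor S Tb T)))"
  by (subst faithfully_flat_right_inj_iff[OF ffR, symmetric]) (simp_all add: KT'_inj)

text \<open>The outer factors are enlarged before T-bar. At that stage T-bar stands between the
  \<open>T\<close> of \<open>pt\<close> and the \<open>T\<close> of \<open>tp\<close>, exactly the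
  two copies that its splitting requires, so the last step needs no descent.\<close>

lemma inj_CTbD: "inj_on (tensor_map R pt (tensor S ptp tp) id (tensor_map S ptp tp id id)) (carrier (tensor R Cm (tensor S Tb Dm)))"
proof -
  have 1: "inj_on (tensor_map R pt (tensor S Tb Dm) id id) (carrier (tensor R Cm (tensor S Tb Dm)))"
    by (rule C_inj[of S]) simp_all
  have 2: "inj_on (tensor_map R pt (tensor S Tb tp) id (tensor_map S Tb tp id id)) (carrier (tensor R pt (tensor S Tb Dm)))"
    by (subst tensor_map_inj_assoc_r[symmetric]) (simp_all add: D_inj[of R])
  let ?i = "tensor_map R pt ptp id id"
  \<comment> \<open>After rebracketing, \<open>(pt \<otimes> ptp) \<otimes> T\<close> is
    \<open>P \<otimes> (T \<otimes> (ptp \<otimes> T))\<close>, and \<open>r\<close> applies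
    \<open>omega'\<close> to the inner part.\<close>
  define r where "r = unassoc R S pt Tb T \<circ> unassoc S R P T (tensor S Tb T) \<circ> tensor_map S P (tensor R T (tensor S Tb T)) id omega' \<circ>
    assoc S R P T (tensor S ptp T) \<circ> assoc R S pt ptp T"
  note o = bimod_hom_left[OF omega'_hom]
  have ao: "tensor_map S P (tensor R T (tensor S Tb T)) id omega' \<in>
      bimod_hom R R (tensor S P (tensor R T (tensor S ptp T))) (tensor S P (tensor R T (tensor S Tb T)))"
    by (rule tensor_map_bimod_hom) (simp_all add: omega'_hom)
  have r: "r \<in> bimod_hom R R (tensor S (tensor R pt ptp) T) (tensor S (tensor R pt Tb) T)"
    unfolding r_def comp_assoc
    by (rule bimod_hom_comp[OF bimod_hom_comp[OF bimod_hom_comp[OF bimod_hom_comp[OF assoc_bimod_hom assoc_bimod_hom] ao]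
      unassoc_bimod_hom] unassoc_bimod_hom, unfolded comp_assoc]) simp_all
  have r_pure: "r (pure_tensor S (tensor R pt ptp) T (pure_tensor R pt ptp c w) z) = pure_tensor S (tensor R pt Tb) T (pure_tensor R pt Tb c w) z"
    if "c \<in> carrier pt" "w \<in> cB" "z \<in> carrier T" for c w z
  proof (rule tensor_eqI[OF _ _ _ ahom_comp[OF pure_l_ahom[OF _ _ that(3) pure_l_ahom[OF _ _ _ ahom_id]] bimod_hom_ahom[OF r]]
      pure_l_ahom[OF _ _ that(3) pure_l_ahom[OF _ _ _ ahom_id]] _ that(1)])
    fix p y assume *: "p \<in> carrier P" "y \<in> carrier T"
    show "r (pure_tensor S (tensor R pt ptp) T (pure_tensor R pt ptp (p \<diamondop> y) w) z) = pure_tensor S (tensor R pt Tb) T (pure_tensor R pt Tb (p \<diamondop> y) w) z"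
      using * that by (simp add: r_def omega'_pure o)
  qed (use that in simp_all)
  have ri: "r (tensor_map S (tensor R pt ptp) T ?i id u) = u" if "u \<in> carrier (tensor S (tensor R pt Tb) T)" for u
    by (rule tensor_eqI3l[OF _ _ _ _ ahom_comp[OF tensor_map_ahom bimod_hom_ahom[OF r]] ahom_id _ that]) (simp_all add: r_pure)
  have "inj_on (tensor_map S (tensor R pt ptp) tp ?i id) (carrier (tensor S (tensor R pt Tb) tp))"
    by (rule inj_tp[OF _ _ _ retract_inj_l[OF _ _ _ _ bimod_hom_right[OF r] ri]]) simp_all
  then have 3: "inj_on (tensor_map R pt (tensor S ptp tp) id (tensor_map S ptp tp id id)) (carrier (tensor R pt (tensor S Tb tp)))"
    by (subst tensor_map_inj_assoc[symmetric]) simp_all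
  have 12: "inj_on (tensor_map R pt (tensor S Tb tp) id (tensor_map S Tb tp id id)) (carrier (tensor R Cm (tensor S Tb Dm)))"
    by (rule tensor_map_inj_comp_id[OF _ _ _ _ _ _ _ _ _ _ 1 2]) simp_all
  show ?thesis
    by (rule tensor_map_inj_comp_id[OF _ _ _ _ _ _ _ _ _ _ 12 3])
       (simp_all add: tensor_map_comp[where M = Tb and N = Dm])
qed

text \<open>For a submodule \<open>N\<close> of \<open>N'\<close>: an element of
  \<open>pt \<otimes> N\<close> satisfying the equation of \<open>C \<otimes> N'\<close> already
  comes from \<open>C \<otimes> N\<close>. The equation lives in
  \<open>(A \<otimes> pt) \<otimes> N'\<close>, and injectivity of
  \<open>(A \<otimes> pt) \<otimes> N\<close> into it brings it back to \<open>N\<close>, where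
  \<open>C_image\<close> applies.\<close>

lemma left_corestrict:
  assumes N: "bimodule R L N" "bimodule R L N'" and i: "id \<in> bimod_hom R L N N'" and small: "small U (carrier N)"
    and inj: "inj_on (tensor_map R (tensor R A pt) N' id id) (carrier (tensor R (tensor R A pt) N))"
    and u: "u \<in> carrier (tensor R pt N)"
    and eq: "tensor_map R (tensor R A pt) N' wC id (tensor_map R pt N' id id u) = tensor_map R (tensor R A pt) N' eC id (tensor_map R pt N' id id u)"
  shows "tensor_map R pt N' id id u \<in> tensor_map R pt N' id id ` carrier (tensor R Cm N)"
proof -
  note [simp] = N N[THEN bimodule_left] i i[THEN bimod_hom_left]
  have c: "tensor_map R (tensor R A pt) N w id u \<in> carrier (tensor R (tensor R A pt) N)" if "w \<in> bimod_hom R R pt (tensor R A pt)" for w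
    by (rule ahom_closed[OF tensor_map_ahom u]) (use that in \<open>simp_all add: bimod_hom_right\<close>)
  have w: "tensor_map R (tensor R A pt) N' id id (tensor_map R (tensor R A pt) N w id u) = tensor_map R (tensor R A pt) N' w id (tensor_map R pt N' id id u)"
    if "w \<in> bimod_hom R R pt (tensor R A pt)" for w
    using that u by (simp add: tensor_map_comp[where M = pt and N = N] bimod_hom_right)
  have "tensor_map R (tensor R A pt) N wC id u = tensor_map R (tensor R A pt) N eC id u"
    by (rule inj_onD[OF inj]) (use w[OF wC_hom] w[OF eC_hom] eq c in simp_all)
  then have "u \<in> tensor_map R pt N id id ` carrier (tensor R Cm N)"
    using u by (subst C_image[OF N(1) small]) simp
  then obtain v where v: "v \<in> carrier (tensor R Cm N)" "u = tensor_map R pt N id id v" by blast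
  then have "tensor_map R pt N' id id u = tensor_map R pt N' id id v"
    by (simp add: tensor_map_comp[where M = Cm and N = N])
  then show ?thesis using v(1) by (rule image_eqI)
qed

lemma right_corestrict:
  assumes N: "bimodule K S N" "bimodule K S N'" and i: "id \<in> bimod_hom K S N N'" and small: "small U (carrier N)"
    and inj: "inj_on (tensor_map S N' (tensor S tp B) id id) (carrier (tensor S N (tensor S tp B)))"
    and u: "u \<in> carrier (tensor S N tp)"
    and eq: "tensor_map S N' (tensor S tp B) id wD (tensor_map S N' tp id id u) = tensor_map S N' (tensor S tp B) id eD (tensor_map S N' tp id id u)"
  shows "tensor_map S N' tp id id u \<in> tensor_map S N' tp id id ` carrier (tensor S N Dm)"
proof -
  note [simp] = N N[THEN bimodule_right] i i[THEN bimod_hom_right]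
  have c: "tensor_map S N (tensor S tp B) id w u \<in> carrier (tensor S N (tensor S tp B))" if "w \<in> bimod_hom S S tp (tensor S tp B)" for w
    by (rule ahom_closed[OF tensor_map_ahom u]) (use that in \<open>simp_all add: bimod_hom_left\<close>)
  have w: "tensor_map S N' (tensor S tp B) id id (tensor_map S N (tensor S tp B) id w u) = tensor_map S N' (tensor S tp B) id w (tensor_map S N' tp id id u)"
    if "w \<in> bimod_hom S S tp (tensor S tp B)" for w
    using that u by (simp add: tensor_map_comp[where M = N and N = tp] bimod_hom_left)
  have "tensor_map S N (tensor S tp B) id wD u = tensor_map S N (tensor S tp B) id eD u"
    by (rule inj_onD[OF inj]) (use w[OF wD_hom] w[OF eD_hom] eq c in simp_all)
  then have "u \<in> tensor_map S N tp id id ` carrier (tensor S N Dm)"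
    using u by (subst D_image[OF N(1) small]) simp
  then obtain v where v: "v \<in> carrier (tensor S N Dm)" "u = tensor_map S N tp id id v" by blast
  then have "tensor_map S N' tp id id u = tensor_map S N' tp id id v"
    by (simp add: tensor_map_comp[where M = N and N = Dm])
  then show ?thesis using v(1) by (rule image_eqI)
qed

section \<open>Coproducts and coactions take values in the submodules\<close>

lemma inj_Apt: "inj_on (tensor_map R (tensor R A pt) pt id id) (carrier (tensor R (tensor R A pt) Cm))"
  by (subst tensor_map_inj_assoc_r) (simp_all add: inj_pt_M C_inj_T0)

lemma inj_ApTb: "inj_on (tensor_map R (tensor R A pt) ptp id id) (carrier (tensor R (tensor R A pt) Tb))"
  by (subst tensor_map_inj_assoc_r) (simp_all add: inj_pt_M Tb_inj_T)

lemma inj_tpB: "inj_on (tensor_map S tp (tensor S tp B) id id) (carrier (tensor S Dm (tensor S tp B)))"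
  by (subst tensor_map_inj_assoc_l) (simp_all add: inj_tp_M D_inj_T0)

lemma inj_TbtpB: "inj_on (tensor_map S ptp (tensor S tp B) id id) (carrier (tensor S Tb (tensor S tp B)))"
  by (subst tensor_map_inj_assoc_l) (simp_all add: inj_tp_M Tb_inj_T')

text \<open>The right leg lies in \<open>C\<close> because \<open>dC\<close> is
  \<open>P \<otimes> \<gamma>\<close> and \<gamma> has values in \<open>T \<otimes> C\<close>; the
  left leg because \<open>dC\<close> is coassociative and, on \<open>C\<close>, counital.
  \<open>left_corestrict\<close> combines the two.\<close>

lemma dC_mem:
  assumes c: "c \<in> cC"
  shows "dC c \<in> tensor_map R pt pt id id ` carrier (tensor R Cm Cm)"
proof -
  let ?d = "\<lambda>c. unassoc S R P T Cm (tensor_map S P (tensor R T Cm) id \<gamma>C c)"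
  have dh: "?d \<in> ahom pt (tensor R pt Cm)"
    by (rule ahom_comp[OF tensor_map_ahom unassoc_ahom]) simp_all
  have J: "tensor_map R pt pt id id \<in> ahom (tensor R pt Cm) (tensor R pt pt)" by (rule tensor_map_ahom) simp_all
  have "tensor_map R pt pt id id (?d c') = dC c'" if c': "c' \<in> carrier pt" for c'
  proof (rule tensor_eqI[OF _ _ _ ahom_comp[OF dh J] bimod_hom_ahom[OF dC_hom] _ c'])
    fix p y assume *: "p \<in> carrier P" "y \<in> carrier T"
    have "tensor_map R pt pt id id (unassoc S R P T Cm (pure_tensor S P (tensor R T Cm) p u)) =
        unassoc S R P T pt (pure_tensor S P (tensor R T pt) p (JC u))" if u: "u \<in> carrier (tensor R T Cm)" for u
      by (rule tensor_eqI[OF _ _ _ ahom_comp[OF ahom_comp[OF pure_r_ahom[OF _ _ *(1) ahom_id] unassoc_ahom] J]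
          ahom_comp[OF pure_r_ahom[OF _ _ *(1) bimod_hom_ahom[OF JC_hom]] unassoc_ahom] _ u])
         (use * in simp_all)
    then show "tensor_map R pt pt id id (?d (p \<diamondop> y)) = dC (p \<diamondop> y)" using * by (simp add: dC_def)
  qed simp_all
  then have e: "tensor_map R pt pt id id (?d c) = dC c" using c by simp
  have "tensor_map R pt pt id id (?d c) \<in> tensor_map R pt pt id id ` carrier (tensor R Cm Cm)"
  proof (rule left_corestrict[OF _ _ id_C_hom _ inj_Apt])
    show "?d c \<in> carrier (tensor R pt Cm)" by (rule ahom_closed[OF dh]) (use c in simp)
    show "tensor_map R (tensor R A pt) pt wC id (tensor_map R pt pt id id (?d c)) = tensor_map R (tensor R A pt) pt eC id (tensor_map R pt pt id id (?d c))"
      unfolding e by (rule left_comodule_equalizes[OF _ dC_hom _ coass_C]) (use c CD_eq(1)[OF c] in \<open>simp_all add: wC_def eC_def\<close>)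
  qed simp_all
  then show ?thesis by (simp only: e)
qed

lemma dD_mem:
  assumes d: "d \<in> cD"
  shows "dD d \<in> tensor_map S tp tp id id ` carrier (tensor S Dm Dm)"
proof -
  let ?d = "\<lambda>d. assoc S R Dm T P (tensor_map R (tensor S Dm T) P \<gamma>D id d)"
  have dh: "?d \<in> ahom tp (tensor S Dm tp)"
    by (rule ahom_comp[OF tensor_map_ahom assoc_ahom]) simp_all
  have J: "tensor_map S tp tp id id \<in> ahom (tensor S Dm tp) (tensor S tp tp)" by (rule tensor_map_ahom) simp_all
  have "tensor_map S tp tp id id (?d d') = dD d'" if d': "d' \<in> carrier tp" for d'
  proof (rule tensor_eqI[OF _ _ _ ahom_comp[OF dh J] bimod_hom_ahom[OF dD_hom] _ d'])
    fix y q assume *: "y \<in> carrier T" "q \<in> carrier P"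
    have "tensor_map S tp tp id id (assoc S R Dm T P (pure_tensor R (tensor S Dm T) P u q)) =
        assoc S R tp T P (pure_tensor R tpt P (JD u) q)" if u: "u \<in> carrier (tensor S Dm T)" for u
      by (rule tensor_eqI[OF _ _ _ ahom_comp[OF ahom_comp[OF pure_l_ahom[OF _ _ *(2) ahom_id] assoc_ahom] J]
          ahom_comp[OF pure_l_ahom[OF _ _ *(2) bimod_hom_ahom[OF JD_hom]] assoc_ahom] _ u])
         (use * in simp_all)
    then show "tensor_map S tp tp id id (?d (y \<star> q)) = dD (y \<star> q)" using * by (simp add: dD_def)
  qed simp_all
  then have e: "tensor_map S tp tp id id (?d d) = dD d" using d by simp
  have "tensor_map S tp tp id id (?d d) \<in> tensor_map S tp tp id id ` carrier (tensor S Dm Dm)"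
  proof (rule right_corestrict[OF _ _ id_D_hom _ inj_tpB])
    show "?d d \<in> carrier (tensor S Dm tp)" by (rule ahom_closed[OF dh]) (use d in simp)
    show "tensor_map S tp (tensor S tp B) id wD (tensor_map S tp tp id id (?d d)) = tensor_map S tp (tensor S tp B) id eD (tensor_map S tp tp id id (?d d))"
      unfolding e by (rule right_comodule_equalizes[OF _ dD_hom _ coass_D]) (use d CD_eq(2)[OF d] in \<open>simp_all add: wD_def eD_def\<close>)
  qed simp_all
  then show ?thesis by (simp only: e)
qed

text \<open>Through \<open>jD\<close> the element comes from \<open>P \<otimes> D\<close>, where
  applying \<open>covD\<close> puts the right leg into T-bar. The left leg follows from
  coassociativity and the counit law of \<open>lB\<close>.\<close>

lemma lB_mem:
  assumes v: "v \<in> cB"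
  shows "lB v \<in> tensor_map R pt ptp id id ` carrier (tensor R Cm Tb)"
proof -
  let ?l = "\<lambda>z. unassoc S R P T Tb (tensor_map S P (tensor R T Tb) id covD z)"
  have lh: "?l \<in> ahom (tensor S P Dm) (tensor R pt Tb)"
    by (rule ahom_comp[OF tensor_map_ahom unassoc_ahom]) simp_all
  have J: "tensor_map R pt ptp id id \<in> ahom (tensor R pt Tb) (tensor R pt ptp)" by (rule tensor_map_ahom) simp_all
  have "tensor_map R pt ptp id id (?l z) = unassoc S R P T ptp (tensor_map S P (tensor R T ptp) id kD (JPD z))"
    if z: "z \<in> carrier (tensor S P Dm)" for z
  proof (rule tensor_eqI[OF _ _ _ ahom_comp[OF lh J] ahom_comp[OF ahom_comp[OF bimod_hom_ahom[OF JPD_hom] tensor_map_ahom] unassoc_ahom] _ z])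
    fix p d assume *: "p \<in> carrier P" "d \<in> carrier Dm"
    have "tensor_map R pt ptp id id (unassoc S R P T Tb (pure_tensor S P (tensor R T Tb) p u)) =
        unassoc S R P T ptp (pure_tensor S P (tensor R T ptp) p (KT u))" if u: "u \<in> carrier (tensor R T Tb)" for u
      by (rule tensor_eqI[OF _ _ _ ahom_comp[OF ahom_comp[OF pure_r_ahom[OF _ _ *(1) ahom_id] unassoc_ahom] J]
          ahom_comp[OF pure_r_ahom[OF _ _ *(1) bimod_hom_ahom[OF KT_hom]] unassoc_ahom] _ u])
         (use * in simp_all)
    then show "tensor_map R pt ptp id id (?l (pure_tensor S P Dm p d)) =
        unassoc S R P T ptp (tensor_map S P (tensor R T ptp) id kD (JPD (pure_tensor S P Dm p d)))" using * by simp
  qed simp_all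
  then have e: "tensor_map R pt ptp id id (?l (jD v)) = lB v" using v by (simp add: lB_alt)
  have "tensor_map R pt ptp id id (?l (jD v)) \<in> tensor_map R pt ptp id id ` carrier (tensor R Cm Tb)"
  proof (rule left_corestrict[OF _ _ id_Tb_hom _ inj_ApTb])
    show "?l (jD v) \<in> carrier (tensor R pt Tb)" by (rule ahom_closed[OF lh]) (use v in simp)
    show "tensor_map R (tensor R A pt) ptp wC id (tensor_map R pt ptp id id (?l (jD v))) = tensor_map R (tensor R A pt) ptp eC id (tensor_map R pt ptp id id (?l (jD v)))"
      unfolding e by (rule left_comodule_equalizes[OF _ lB_hom _ coass_Tbar_left]) (use v in \<open>simp_all add: lB_counit cB_eq\<close>)
  qed simp_all
  then show ?thesis by (simp only: e)
qed

lemma rB_mem: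
  assumes v: "v \<in> cB"
  shows "rB v \<in> tensor_map S ptp tp id id ` carrier (tensor S Tb Dm)"
proof -
  let ?l = "\<lambda>z. assoc S R Tb T P (tensor_map R (tensor S Tb T) P covC id z)"
  have lh: "?l \<in> ahom (tensor R Cm P) (tensor S Tb tp)"
    by (rule ahom_comp[OF tensor_map_ahom assoc_ahom]) simp_all
  have J: "tensor_map S ptp tp id id \<in> ahom (tensor S Tb tp) (tensor S ptp tp)" by (rule tensor_map_ahom) simp_all
  have "tensor_map S ptp tp id id (?l z) = assoc S R ptp T P (tensor_map R (tensor S ptp T) P kC id (JCP z))"
    if z: "z \<in> carrier (tensor R Cm P)" for z
  proof (rule tensor_eqI[OF _ _ _ ahom_comp[OF lh J] ahom_comp[OF ahom_comp[OF bimod_hom_ahom[OF JCP_hom] tensor_map_ahom] assoc_ahom] _ z])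
    fix c p assume *: "c \<in> carrier Cm" "p \<in> carrier P"
    have "tensor_map S ptp tp id id (assoc S R Tb T P (pure_tensor R (tensor S Tb T) P u p)) =
        assoc S R ptp T P (pure_tensor R (tensor S ptp T) P (KT' u) p)" if u: "u \<in> carrier (tensor S Tb T)" for u
      by (rule tensor_eqI[OF _ _ _ ahom_comp[OF ahom_comp[OF pure_l_ahom[OF _ _ *(2) ahom_id] assoc_ahom] J]
          ahom_comp[OF pure_l_ahom[OF _ _ *(2) bimod_hom_ahom[OF KT'_hom]] assoc_ahom] _ u])
         (use * in simp_all)
    then show "tensor_map S ptp tp id id (?l (pure_tensor R Cm P c p)) =
        assoc S R ptp T P (tensor_map R (tensor S ptp T) P kC id (JCP (pure_tensor R Cm P c p)))" using * by simp
  qed simp_all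
  then have e: "tensor_map S ptp tp id id (?l (jC v)) = rB v" using v by (simp add: rB_alt)
  have "tensor_map S ptp tp id id (?l (jC v)) \<in> tensor_map S ptp tp id id ` carrier (tensor S Tb Dm)"
  proof (rule right_corestrict[OF _ _ id_Tb_hom _ inj_TbtpB])
    show "?l (jC v) \<in> carrier (tensor S Tb tp)" by (rule ahom_closed[OF lh]) (use v in simp)
    show "tensor_map S ptp (tensor S tp B) id wD (tensor_map S ptp tp id id (?l (jC v))) = tensor_map S ptp (tensor S tp B) id eD (tensor_map S ptp tp id id (?l (jC v)))"
      unfolding e by (rule right_comodule_equalizes[OF _ rB_hom _ coass_Tbar_right]) (use v in \<open>simp_all add: rB_counit cB_eq\<close>)
  qed simp_all
  then show ?thesis by (simp only: e)
qed

end

section \<open>The bicomodule structures\<close>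

text \<open>Primed objects and maps are the ambient ones. The identity is tested after the injection
  into \<open>X' \<otimes> (Y' \<otimes> Z')\<close>, where naturality turns it into
  \<open>eq\<close>. The shape is general enough for coassociativity, compatibility of coactions,
  colinearity of both maps cov and the companion identities.\<close>

lemma coassoc_corestrict:
  assumes mods: "right_module K X" "right_module K X'" "bimodule K L Y" "bimodule K L Y'" "left_module L Z" "left_module L Z'"
      "right_module L V" "right_module L V'" "left_module K W" "left_module K W'"
    and ids: "id \<in> right_hom K X X'" "id \<in> bimod_hom K L Y Y'" "id \<in> left_hom L Z Z'" "id \<in> right_hom L V V'" "id \<in> left_hom K W W'"
    and inj: "inj_on (tensor_map K X' (tensor L Y' Z') id (tensor_map L Y' Z' id id)) (carrier (tensor K X (tensor L Y Z)))"
    and f: "f \<in> right_hom L V (tensor K X Y)" "f' \<in> right_hom L V' (tensor K X' Y')"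
      "\<And>v. v \<in> carrier V \<Longrightarrow> tensor_map K X' Y' id id (f v) = f' v"
    and g: "g \<in> carrier (tensor L V Z)" "tensor_map L V' Z' id id g = g'"
    and h: "h \<in> left_hom K W (tensor L Y Z)" "h' \<in> left_hom K W' (tensor L Y' Z')"
      "\<And>w. w \<in> carrier W \<Longrightarrow> tensor_map L Y' Z' id id (h w) = h' w"
    and k: "k \<in> carrier (tensor K X W)" "tensor_map K X' W' id id k = k'"
    and eq: "assoc K L X' Y' Z' (tensor_map L (tensor K X' Y') Z' f' id g') = tensor_map K X' (tensor L Y' Z') id h' k'"
  shows "assoc K L X Y Z (tensor_map L (tensor K X Y) Z f id g) = tensor_map K X (tensor L Y Z) id h k"
proof (rule inj_onD[OF inj])
  note [simp] = mods ids mods(3,4)[THEN bimodule_left] mods(3,4)[THEN bimodule_right] ids(2)[THEN bimod_hom_left] ids(2)[THEN bimod_hom_right]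
    f(1,2) h(1,2) left_hom_id right_hom_id
  have fc: "f v \<in> carrier (tensor K X Y)" if "v \<in> carrier V" for v by (rule right_hom_closed[OF f(1) that])
  have hc: "h w \<in> carrier (tensor L Y Z)" if "w \<in> carrier W" for w by (rule left_hom_closed[OF h(1) that])
  have g1: "tensor_map L (tensor K X Y) Z f id g \<in> carrier (tensor L (tensor K X Y) Z)"
    by (rule ahom_closed[OF tensor_map_ahom g(1)]) simp_all
  then show "assoc K L X Y Z (tensor_map L (tensor K X Y) Z f id g) \<in> carrier (tensor K X (tensor L Y Z))" by simp
  show "tensor_map K X (tensor L Y Z) id h k \<in> carrier (tensor K X (tensor L Y Z))"
    by (rule ahom_closed[OF tensor_map_ahom k(1)]) simp_all
  have jXY: "tensor_map K X' Y' id id \<in> right_hom L (tensor K X Y) (tensor K X' Y')" by simp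
  have jYZ: "tensor_map L Y' Z' id id \<in> left_hom K (tensor L Y Z) (tensor L Y' Z')" by simp
  have "tensor_map K X' (tensor L Y' Z') id (tensor_map L Y' Z' id id) (assoc K L X Y Z (tensor_map L (tensor K X Y) Z f id g)) =
      assoc K L X' Y' Z' (tensor_map L (tensor K X' Y') Z' (tensor_map K X' Y' id id) id (tensor_map L (tensor K X Y) Z f id g))"
    by (rule assoc_natural[symmetric, OF _ _ _ _ _ _ _ _ _ g1]) simp_all
  also have "tensor_map L (tensor K X' Y') Z' (tensor_map K X' Y' id id) id (tensor_map L (tensor K X Y) Z f id g) =
      tensor_map L (tensor K X' Y') Z' (tensor_map K X' Y' id id \<circ> f) (id \<circ> id) g"
    by (rule tensor_map_comp[OF _ _ _ _ _ _ _ _ _ _ g(1)]) simp_all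
  also have "\<dots> = tensor_map L (tensor K X' Y') Z' (f' \<circ> id) (id \<circ> id) g"
    by (rule tensor_map_cong[OF _ _ _ _ _ _ _ _ _ _ g(1)]) (simp_all add: f(3) right_hom_comp[OF f(1) jXY] right_hom_comp[OF ids(4) f(2), simplified])
  also have "\<dots> = tensor_map L (tensor K X' Y') Z' f' id (tensor_map L V' Z' id id g)"
    by (rule tensor_map_comp[symmetric, OF _ _ _ _ _ _ _ _ _ _ g(1)]) simp_all
  also have "assoc K L X' Y' Z' (\<dots>) = tensor_map K X' (tensor L Y' Z') id h' (tensor_map K X' W' id id k)"
    by (simp only: g(2) k(2) eq)
  also have "\<dots> = tensor_map K X' (tensor L Y' Z') (id \<circ> id) (h' \<circ> id) k"
    by (rule tensor_map_comp[OF _ _ _ _ _ _ _ _ _ _ k(1)]) simp_all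
  also have "\<dots> = tensor_map K X' (tensor L Y' Z') (id \<circ> id) (tensor_map L Y' Z' id id \<circ> h) k"
    by (rule tensor_map_cong[OF _ _ _ _ _ _ _ _ _ _ k(1)]) (simp_all add: h(3) left_hom_comp[OF h(1) jYZ] left_hom_comp[OF ids(5) h(2), simplified])
  also have "\<dots> = tensor_map K X' (tensor L Y' Z') id (tensor_map L Y' Z' id id) (tensor_map K X (tensor L Y Z) id h k)"
    by (rule tensor_map_comp[symmetric, OF _ _ _ _ _ _ _ _ _ _ k(1)]) simp_all
  finally show "tensor_map K X' (tensor L Y' Z') id (tensor_map L Y' Z' id id) (assoc K L X Y Z (tensor_map L (tensor K X Y) Z f id g)) =
      tensor_map K X' (tensor L Y' Z') id (tensor_map L Y' Z' id id) (tensor_map K X (tensor L Y Z) id h k)" .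
qed

lemma ring_bimod_simps [simp]:
  "carrier (ring_bimod R) = carrier R" "a \<odot>\<^bsub>ring_bimod R\<^esub> b = a \<otimes>\<^bsub>R\<^esub> b" "a \<odot>r\<^bsub>ring_bimod R\<^esub> b = a \<otimes>\<^bsub>R\<^esub> b"
  "a \<oplus>\<^bsub>ring_bimod R\<^esub> b = a \<oplus>\<^bsub>R\<^esub> b" "\<zero>\<^bsub>ring_bimod R\<^esub> = \<zero>\<^bsub>R\<^esub>"
  by (simp_all add: ring_bimod_def)

lemma ring_bimod_bimodule:
  assumes "ring R"
  shows "bimodule R R (ring_bimod R)"
proof -
  interpret R: ring R by fact
  have ab: "abelian_group (ring_bimod R)"
    by (rule abelian_groupI) (auto simp: R.a_ac intro: R.l_neg)
  show ?thesis
    using ab R.ring_axioms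
    by (auto simp: bimodule_def left_module_def right_module_def left_module_axioms_def right_module_axioms_def
        bimodule_axioms_def R.l_distr R.r_distr R.m_assoc)
qed

lemma ahom_pure_l: "\<lbrakk>right_module K M; left_module K N; z \<in> carrier N; e \<in> ahom X M\<rbrakk> \<Longrightarrow> (\<lambda>u. pure_tensor K M N (e u) z) \<in> ahom X (tensor K M N)"
  by (simp add: ahom_def pure_add_l)

lemma ahom_pure_r: "\<lbrakk>right_module K M; left_module K N; z \<in> carrier M; e \<in> ahom X N\<rbrakk> \<Longrightarrow> (\<lambda>u. pure_tensor K M N z (e u)) \<in> ahom X (tensor K M N)"
  by (simp add: ahom_def pure_add_r)

context
  fixes R :: "'r ring"
  assumes ringR: "ring R"
begin

private lemmas rb = ring_bimod_bimodule[OF ringR] bimodule_left[OF ring_bimod_bimodule[OF ringR]]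
  bimodule_right[OF ring_bimod_bimodule[OF ringR]]

lemma one_closed': "\<one>\<^bsub>R\<^esub> \<in> carrier R"
  using ringR by (simp add: ring.ring_simprules)

lemma lunit_balanced: "left_module R M \<Longrightarrow> balanced R (ring_bimod R) M M (\<lambda>(a, x). a \<odot>\<^bsub>M\<^esub> x)"
  by (auto simp: balanced_def left_module.lsmult_closed left_module.lsmult_l_distr left_module.lsmult_r_distr left_module.lsmult_assoc)

lemma runit_balanced: "right_module R M \<Longrightarrow> balanced R M (ring_bimod R) M (\<lambda>(x, a). x \<odot>r\<^bsub>M\<^esub> a)"
  by (auto simp: balanced_def right_module.rsmult_closed right_module.rsmult_l_distr right_module.rsmult_r_distr right_module.rsmult_assoc)

lemma lunit_ahom: "left_module R M \<Longrightarrow> lunit M \<in> ahom (tensor R (ring_bimod R) M) M"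
  unfolding lunit_def by (rule lift_ahom[OF rb(3) _ group_of_add_monoid lunit_balanced]) (simp_all add: left_module_abelian_group)

lemma lunit_pure: "\<lbrakk>left_module R M; a \<in> carrier R; x \<in> carrier M\<rbrakk> \<Longrightarrow> lunit M (pure_tensor R (ring_bimod R) M a x) = a \<odot>\<^bsub>M\<^esub> x"
  unfolding lunit_def by (subst lift_pure[OF rb(3) _ group_of_add_monoid lunit_balanced]) (simp_all add: left_module_abelian_group)

lemma runit_ahom: "right_module R M \<Longrightarrow> runit M \<in> ahom (tensor R M (ring_bimod R)) M"
  unfolding runit_def by (rule lift_ahom[OF _ rb(2) group_of_add_monoid runit_balanced]) (simp_all add: right_module_abelian_group)

lemma runit_pure: "\<lbrakk>right_module R M; a \<in> carrier R; x \<in> carrier M\<rbrakk> \<Longrightarrow> runit M (pure_tensor R M (ring_bimod R) x a) = x \<odot>r\<^bsub>M\<^esub> a"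
  unfolding runit_def by (subst lift_pure[OF _ rb(2) group_of_add_monoid runit_balanced]) (simp_all add: right_module_abelian_group)

lemma lunit_inverse:
  assumes M: "left_module R M" and u: "u \<in> carrier (tensor R (ring_bimod R) M)"
  shows "pure_tensor R (ring_bimod R) M \<one>\<^bsub>R\<^esub> (lunit M u) = u"
proof (rule tensor_eqI[OF rb(3) M _ ahom_pure_r[OF rb(3) M _ lunit_ahom[OF M]] ahom_id _ u])
  fix a x assume *: "a \<in> carrier (ring_bimod R)" "x \<in> carrier M"
  have "pure_tensor R (ring_bimod R) M \<one>\<^bsub>R\<^esub> (a \<odot>\<^bsub>M\<^esub> x) = pure_tensor R (ring_bimod R) M (\<one>\<^bsub>R\<^esub> \<otimes>\<^bsub>R\<^esub> a) x"
    using pure_balanced[OF rb(3) M, of "\<one>\<^bsub>R\<^esub>" a x] * one_closed' by simp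
  then show "pure_tensor R (ring_bimod R) M \<one>\<^bsub>R\<^esub> (lunit M (pure_tensor R (ring_bimod R) M a x)) = pure_tensor R (ring_bimod R) M a x"
    using * by (simp only: ring_bimod_simps lunit_pure[OF M] monoid.l_one[OF ring.is_monoid[OF ringR]])
qed (use M rb one_closed' in simp_all)

lemma runit_inverse:
  assumes M: "right_module R M" and u: "u \<in> carrier (tensor R M (ring_bimod R))"
  shows "pure_tensor R M (ring_bimod R) (runit M u) \<one>\<^bsub>R\<^esub> = u"
proof (rule tensor_eqI[OF M rb(2) _ ahom_pure_l[OF M rb(2) _ runit_ahom[OF M]] ahom_id _ u])
  fix x a assume *: "x \<in> carrier M" "a \<in> carrier (ring_bimod R)"
  have "pure_tensor R M (ring_bimod R) (x \<odot>r\<^bsub>M\<^esub> a) \<one>\<^bsub>R\<^esub> = pure_tensor R M (ring_bimod R) x (a \<otimes>\<^bsub>R\<^esub> \<one>\<^bsub>R\<^esub>)"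
    using pure_balanced[OF M rb(2), of x a "\<one>\<^bsub>R\<^esub>"] * one_closed' by simp
  then show "pure_tensor R M (ring_bimod R) (runit M (pure_tensor R M (ring_bimod R) x a)) \<one>\<^bsub>R\<^esub> = pure_tensor R M (ring_bimod R) x a"
    using * by (simp only: ring_bimod_simps runit_pure[OF M] monoid.r_one[OF ring.is_monoid[OF ringR]])
qed (use M rb one_closed' in simp_all)

end

section \<open>The counits: descent along \<alpha> and \<beta>, and the counit laws\<close>

context tame_ctx
begin

lemmas ring_mods [simp] = ring_bimod_bimodule[OF ringR] bimodule_left[OF ring_bimod_bimodule[OF ringR]]
  bimodule_right[OF ring_bimod_bimodule[OF ringR]] bimodule_abelian_group[OF ring_bimod_bimodule[OF ringR]]
  ring_bimod_bimodule[OF ringS] bimodule_left[OF ring_bimod_bimodule[OF ringS]]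
  bimodule_right[OF ring_bimod_bimodule[OF ringS]] bimodule_abelian_group[OF ring_bimod_bimodule[OF ringS]]
  one_closed'[OF ringR] one_closed'[OF ringS]

lemma alpha_closed [simp]: "r \<in> carrier R \<Longrightarrow> alpha r \<in> carrier A"
  by (simp flip: alpha(1))

lemma beta_closed [simp]: "s \<in> carrier S \<Longrightarrow> beta s \<in> carrier B"
  by (simp flip: beta(1))

lemma alpha_hom: "alpha \<in> bimod_hom R R (ring_bimod R) A"
proof -
  interpret A: bimodule R R A by simp
  interpret R: ring R by (rule ringR)
  have "alpha (r \<oplus>\<^bsub>R\<^esub> r') = alpha r \<oplus>\<^bsub>A\<^esub> alpha r'" "alpha (r \<otimes>\<^bsub>R\<^esub> r') = r \<odot>\<^bsub>A\<^esub> alpha r'" "alpha (r \<otimes>\<^bsub>R\<^esub> r') = alpha r \<odot>r\<^bsub>A\<^esub> r'"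
    if "r \<in> carrier R" "r' \<in> carrier R" for r r'
    using that A.lsmult_l_distr[of r r' oneA] A.lsmult_assoc[of r r' oneA] A.right.rsmult_assoc[of r r' oneA]
    by (simp_all add: alpha)
  then show ?thesis by (simp add: bimod_hom_iff left_hom_iff right_hom_iff ahom_def)
qed

lemma beta_hom: "beta \<in> bimod_hom S S (ring_bimod S) B"
proof -
  interpret A: bimodule S S B by simp
  interpret R: ring S by (rule ringS)
  have "beta (r \<oplus>\<^bsub>S\<^esub> r') = beta r \<oplus>\<^bsub>B\<^esub> beta r'" "beta (r \<otimes>\<^bsub>S\<^esub> r') = r \<odot>\<^bsub>B\<^esub> beta r'" "beta (r \<otimes>\<^bsub>S\<^esub> r') = beta r \<odot>r\<^bsub>B\<^esub> r'"
    if "r \<in> carrier S" "r' \<in> carrier S" for r r'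
    using that A.lsmult_l_distr[of r r' oneB] A.lsmult_assoc[of r r' oneB] A.right.rsmult_assoc[of r r' oneB]
    by (simp_all add: beta)
  then show ?thesis by (simp add: bimod_hom_iff left_hom_iff right_hom_iff ahom_def)
qed

lemmas ab_homs [simp] = alpha_hom alpha_hom[THEN bimod_hom_left] alpha_hom[THEN bimod_hom_right]
  beta_hom beta_hom[THEN bimod_hom_left] beta_hom[THEN bimod_hom_right]

lemma aT_alpha: "\<lbrakk>x \<in> carrier T; r \<in> carrier R\<rbrakk> \<Longrightarrow> aT x (alpha r) = x \<odot>r\<^bsub>T\<^esub> r"
proof -
  assume *: "x \<in> carrier T" "r \<in> carrier R"
  have "aT (x \<odot>r\<^bsub>T\<^esub> r) oneA = aT x (r \<odot>\<^bsub>A\<^esub> oneA)" using aT * oneA by (simp add: bilinear_def balanced_def)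
  then show ?thesis using * by (simp add: aT_one alpha)
qed

lemma bT_beta: "\<lbrakk>x \<in> carrier T; s \<in> carrier S\<rbrakk> \<Longrightarrow> bT (beta s) x = s \<odot>\<^bsub>T\<^esub> x"
proof -
  assume *: "x \<in> carrier T" "s \<in> carrier S"
  have "bT (oneB \<odot>r\<^bsub>B\<^esub> s) x = bT oneB (s \<odot>\<^bsub>T\<^esub> x)" using bT * oneB by (simp add: bilinear_def balanced_def)
  then show ?thesis using * by (simp add: bT_one beta)
qed

text \<open>After tensoring with \<open>T\<close> the map sends \<open>x \<otimes> r\<close> to
  \<open>x \<otimes> alpha r\<close>, and the action of \<open>A\<close> on \<open>T\<close>
  recovers \<open>x r\<close> from this, which determines the tensor over \<open>R\<close>. Faithful
  flatness reflects injectivity.\<close>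

lemma alpha_inj: "inj_on alpha (carrier R)"
proof -
  have "inj_on (tensor_map R T A id alpha) (carrier (tensor R T (ring_bimod R)))"
  proof (rule inj_on_inverseI[of _ "\<lambda>u. pure_tensor R T (ring_bimod R) (actTA u) \<one>\<^bsub>R\<^esub>"])
    fix u assume u: "u \<in> carrier (tensor R T (ring_bimod R))"
    show "pure_tensor R T (ring_bimod R) (actTA (tensor_map R T A id alpha u)) \<one>\<^bsub>R\<^esub> = u"
    proof (rule tensor_eqI[OF _ _ _ pure_l_ahom[OF _ _ _ ahom_comp[OF tensor_map_ahom act_homs(13)]] ahom_id _ u])
      fix x r assume *: "x \<in> carrier T" "r \<in> carrier (ring_bimod R)"
      then show "pure_tensor R T (ring_bimod R) (actTA (tensor_map R T A id alpha (pure_tensor R T (ring_bimod R) x r))) \<one>\<^bsub>R\<^esub> =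
        pure_tensor R T (ring_bimod R) x r"
        using pure_balanced[of R T "ring_bimod R" x r "\<one>\<^bsub>R\<^esub>"] ringR by (simp add: aT_alpha monoid.r_one ring.is_monoid)
    qed simp_all
  qed
  then have "inj_on alpha (carrier (ring_bimod R))"
    by (subst faithfully_flat_right_inj_iff[OF ffR]) simp_all
  then show ?thesis by simp
qed

lemma beta_inj: "inj_on beta (carrier S)"
proof -
  have "inj_on (tensor_map S B T beta id) (carrier (tensor S (ring_bimod S) T))"
  proof (rule inj_on_inverseI[of _ "\<lambda>u. pure_tensor S (ring_bimod S) T \<one>\<^bsub>S\<^esub> (actBT u)"])
    fix u assume u: "u \<in> carrier (tensor S (ring_bimod S) T)"
    show "pure_tensor S (ring_bimod S) T \<one>\<^bsub>S\<^esub> (actBT (tensor_map S B T beta id u)) = u"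
    proof (rule tensor_eqI[OF _ _ _ pure_r_ahom[OF _ _ _ ahom_comp[OF tensor_map_ahom act_homs(14)]] ahom_id _ u])
      fix s x assume *: "s \<in> carrier (ring_bimod S)" "x \<in> carrier T"
      then show "pure_tensor S (ring_bimod S) T \<one>\<^bsub>S\<^esub> (actBT (tensor_map S B T beta id (pure_tensor S (ring_bimod S) T s x))) =
        pure_tensor S (ring_bimod S) T s x"
        using pure_balanced[of S "ring_bimod S" T "\<one>\<^bsub>S\<^esub>" s x] ringS by (simp add: bT_beta monoid.l_one ring.is_monoid left_module.lsmult_one[OF bimodule_left[OF bimodT]])
    qed simp_all
  qed
  then have "inj_on beta (carrier (ring_bimod S))"
    by (subst faithfully_flat_left_inj_iff[OF ffL]) simp_all
  then show ?thesis by simp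
qed

text \<open>The fork \<open>R \<rightarrow> A \<rightrightarrows> A \<otimes> A\<close> is split by the action of \<open>A\<close> after tensoring with \<open>T\<close>, hence exact.\<close>

lemma alpha_image: "alpha ` carrier R = {a \<in> carrier A. pure_tensor R A A a oneA = pure_tensor R A A oneA a}"
proof -
  let ?l = "\<lambda>a. pure_tensor R A A a oneA" and ?r = "\<lambda>a. pure_tensor R A A oneA a"
  have l: "?l \<in> left_hom R A (tensor R A A)" by (simp add: left_hom_iff ahom_def pure_add_l)
  have r: "?r \<in> left_hom R A (tensor R A A)"
    using pure_balanced[of R A A oneA] by (simp add: left_hom_iff ahom_def pure_add_r alpha)
  let ?J = "tensor_map R T A id alpha"
  let ?tau = "\<lambda>v. tensor_map R T A actTA id (unassoc R R T A A v)"
  have tau: "?tau \<in> ahom (tensor R T (tensor R A A)) (tensor R T A)"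
    by (rule ahom_comp[OF unassoc_ahom tensor_map_ahom]) simp_all
  have J: "?J u \<in> carrier (tensor R T A)" if "u \<in> carrier (tensor R T (ring_bimod R))" for u
    by (rule ahom_closed[OF tensor_map_ahom that]) simp_all
  have hl: "tensor_map R T (tensor R A A) id ?l \<in> ahom (tensor R T A) (tensor R T (tensor R A A))"
    "tensor_map R T (tensor R A A) id ?r \<in> ahom (tensor R T A) (tensor R T (tensor R A A))"
    using l r by (simp_all add: tensor_map_ahom)
  have "?J ` carrier (tensor R T (ring_bimod R)) =
    {u \<in> carrier (tensor R T A). tensor_map R T (tensor R A A) id ?l u = tensor_map R T (tensor R A A) id ?r u}" (is "_ = ?b")
  proof (intro equalityI subsetI)
    fix v assume "v \<in> ?J ` carrier (tensor R T (ring_bimod R))"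
    then obtain u where u: "u \<in> carrier (tensor R T (ring_bimod R))" "v = ?J u" by blast
    have lr: "?l (alpha r) = ?r (alpha r)" if "r \<in> carrier R" for r
      using that pure_balanced[of R A A oneA r oneA] by (simp add: alpha)
    have "tensor_map R T (tensor R A A) id ?l (?J u) = tensor_map R T (tensor R A A) id ?r (?J u)"
      by (rule tensor_eqI[OF _ _ _ ahom_comp[OF tensor_map_ahom hl(1)] ahom_comp[OF tensor_map_ahom hl(2)] _ u(1)])
         (use l r lr in simp_all)
    then show "v \<in> ?b" using u J by simp
  next
    fix v assume v: "v \<in> ?b"
    \<comment> \<open>\<open>?tau\<close> multiplies the first copy of \<open>A\<close> into
      \<open>T\<close>. It undoes \<open>?r\<close>, while after \<open>?l\<close> it leaves
      \<open>oneA\<close> in the second place and so lands in the image of \<open>?J\<close>. On the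
      equalizer the two results coincide.\<close>
    have 1: "?tau (tensor_map R T (tensor R A A) id ?r v) = v"
      by (rule tensor_eqI[OF _ _ _ ahom_comp[OF hl(2) tau] ahom_id]) (use v r in \<open>simp_all add: aT_one\<close>)
    have 2: "?tau (tensor_map R T (tensor R A A) id ?l v) = ?J (pure_tensor R T (ring_bimod R) (actTA v) \<one>\<^bsub>R\<^esub>)"
      by (rule tensor_eqI[OF _ _ _ ahom_comp[OF hl(1) tau] ahom_comp[OF pure_l_ahom[OF _ _ _ act_homs(13)] tensor_map_ahom]])
         (use v l ringR in \<open>simp_all flip: alpha add: bimodA left_module.lsmult_one[OF bimodule_left[OF bimodA]]\<close>)
    have "v = ?J (pure_tensor R T (ring_bimod R) (actTA v) \<one>\<^bsub>R\<^esub>)" using 1 2 v by simp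
    moreover have "pure_tensor R T (ring_bimod R) (actTA v) \<one>\<^bsub>R\<^esub> \<in> carrier (tensor R T (ring_bimod R))" using v by simp
    ultimately show "v \<in> ?J ` carrier (tensor R T (ring_bimod R))" by (rule image_eqI)
  qed
  then have "alpha ` carrier (ring_bimod R) = {a \<in> carrier A. ?l a = ?r a}"
    by (subst faithfully_flat_right_equalizer_iff[OF ffR, where P = "tensor R A A"]) (use l r in simp_all)
  then show ?thesis by simp
qed

lemma beta_image: "beta ` carrier S = {b \<in> carrier B. pure_tensor S B B b oneB = pure_tensor S B B oneB b}"
proof -
  let ?l = "\<lambda>a. pure_tensor S B B a oneB" and ?r = "\<lambda>a. pure_tensor S B B oneB a"
  have r: "?r \<in> right_hom S B (tensor S B B)" by (simp add: right_hom_iff ahom_def pure_add_r)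
  have l: "?l \<in> right_hom S B (tensor S B B)"
    using pure_balanced[of S B B _ _ oneB] by (simp add: right_hom_iff ahom_def pure_add_l beta)
  let ?J = "tensor_map S B T beta id"
  let ?tau = "\<lambda>v. tensor_map S B T id actBT (assoc S S B B T v)"
  have tau: "?tau \<in> ahom (tensor S (tensor S B B) T) (tensor S B T)"
    by (rule ahom_comp[OF assoc_ahom tensor_map_ahom]) simp_all
  have J: "?J u \<in> carrier (tensor S B T)" if "u \<in> carrier (tensor S (ring_bimod S) T)" for u
    by (rule ahom_closed[OF tensor_map_ahom that]) simp_all
  have hl: "tensor_map S (tensor S B B) T ?l id \<in> ahom (tensor S B T) (tensor S (tensor S B B) T)"
    "tensor_map S (tensor S B B) T ?r id \<in> ahom (tensor S B T) (tensor S (tensor S B B) T)"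
    using l r by (simp_all add: tensor_map_ahom)
  have "?J ` carrier (tensor S (ring_bimod S) T) =
    {u \<in> carrier (tensor S B T). tensor_map S (tensor S B B) T ?l id u = tensor_map S (tensor S B B) T ?r id u}" (is "_ = ?b")
  proof (intro equalityI subsetI)
    fix v assume "v \<in> ?J ` carrier (tensor S (ring_bimod S) T)"
    then obtain u where u: "u \<in> carrier (tensor S (ring_bimod S) T)" "v = ?J u" by blast
    have lr: "?l (beta r) = ?r (beta r)" if "r \<in> carrier S" for r
      using that pure_balanced[of S B B oneB r oneB] by (simp add: beta)
    have "tensor_map S (tensor S B B) T ?l id (?J u) = tensor_map S (tensor S B B) T ?r id (?J u)"
      by (rule tensor_eqI[OF _ _ _ ahom_comp[OF tensor_map_ahom hl(1)] ahom_comp[OF tensor_map_ahom hl(2)] _ u(1)])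
         (use l r lr in simp_all)
    then show "v \<in> ?b" using u J by simp
  next
    fix v assume v: "v \<in> ?b"
    have 1: "?tau (tensor_map S (tensor S B B) T ?l id v) = v"
      by (rule tensor_eqI[OF _ _ _ ahom_comp[OF hl(1) tau] ahom_id]) (use v l in \<open>simp_all add: bT_one\<close>)
    have 2: "?tau (tensor_map S (tensor S B B) T ?r id v) = ?J (pure_tensor S (ring_bimod S) T \<one>\<^bsub>S\<^esub> (actBT v))"
      by (rule tensor_eqI[OF _ _ _ ahom_comp[OF hl(2) tau] ahom_comp[OF pure_r_ahom[OF _ _ _ act_homs(14)] tensor_map_ahom]])
         (use v r ringS in \<open>simp_all flip: beta add: bimodB left_module.lsmult_one[OF bimodule_left[OF bimodB]]\<close>)
    have "v = ?J (pure_tensor S (ring_bimod S) T \<one>\<^bsub>S\<^esub> (actBT v))" using 1 2 v by simp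
    moreover have "pure_tensor S (ring_bimod S) T \<one>\<^bsub>S\<^esub> (actBT v) \<in> carrier (tensor S (ring_bimod S) T)" using v by simp
    ultimately show "v \<in> ?J ` carrier (tensor S (ring_bimod S) T)" by (rule image_eqI)
  qed
  then have "beta ` carrier (ring_bimod S) = {a \<in> carrier B. ?l a = ?r a}"
    by (subst faithfully_flat_left_equalizer_iff[OF ffL, where P = "tensor S B B"]) (use l r in simp_all)
  then show ?thesis by simp
qed

text \<open>Apply \<open>A \<otimes> ev\<close> to \<open>wC c = eC c\<close>. The counit axiom
  turns the left side into \<open>ev c \<otimes> oneA\<close>, the right side is
  \<open>oneA \<otimes> ev c\<close>, and this equality characterises the image of \<alpha>.\<close>

lemma ev_C:
  assumes c: "c \<in> cC" shows "ev c \<in> alpha ` carrier R"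
proof -
  have h: "tensor_map R A A id ev \<in> ahom (tensor R A pt) (tensor R A A)" by (rule tensor_map_ahom) simp_all
  have "tensor_map R A A id ev (wC d) = pure_tensor R A A (ev d) oneA" if "d \<in> carrier pt" for d
  proof (rule tensor_eqI[OF _ _ _ ahom_comp[OF bimod_hom_ahom[OF wC_hom] h] pure_l_ahom[OF _ _ _ bimod_hom_ahom[OF ev]] _ that])
    fix p y assume *: "p \<in> carrier P" "y \<in> carrier T"
    then have "tensor_map R A A id ev (wC (p \<diamondop> y)) = sw (tensor R A A) (\<lambda>a q z. pure_tensor R A A (ev (p \<diamondop> a)) (ev (q \<diamondop> z))) y"
      by (simp add: wC_sw sw_push ms del: rsmult_pure rsmult_pure')
    also have "\<dots> = pure_tensor R A A (ev (p \<diamondop> y)) oneA"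
      using * by (intro sw_ev[where g = "\<lambda>a e. pure_tensor R A A (ev (p \<diamondop> a)) e"]) (simp_all add: balanced_def ms del: rsmult_pure rsmult_pure')
    finally show "tensor_map R A A id ev (wC (p \<diamondop> y)) = pure_tensor R A A (ev (p \<diamondop> y)) oneA" .
  qed simp_all
  from this[of c] c have "pure_tensor R A A (ev c) oneA = pure_tensor R A A oneA (ev c)"
    by (simp add: CD_eq eC_eq)
  then show ?thesis using c by (simp add: alpha_image)
qed

lemma evh_D:
  assumes d: "d \<in> cD" shows "evh d \<in> beta ` carrier S"
proof -
  have h: "tensor_map S B B evh id \<in> ahom (tensor S tp B) (tensor S B B)" by (rule tensor_map_ahom) simp_all
  have "tensor_map S B B evh id (wD e) = pure_tensor S B B oneB (evh e)" if "e \<in> carrier tp" for e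
  proof (rule tensor_eqI[OF _ _ _ ahom_comp[OF bimod_hom_ahom[OF wD_hom] h] pure_r_ahom[OF _ _ _ bimod_hom_ahom[OF evh]] _ that])
    fix y q' assume *: "y \<in> carrier T" "q' \<in> carrier P"
    then have "tensor_map S B B evh id (wD (y \<star> q')) = sw (tensor S B B) (\<lambda>a q z. pure_tensor S B B (evh (a \<star> q)) (evh (z \<star> q'))) y"
      by (simp add: wD_sw sw_push ms del: rsmult_pure rsmult_pure')
    also have "\<dots> = pure_tensor S B B oneB (evh (y \<star> q'))"
      using * by (intro sw_evh[where g = "\<lambda>e z. pure_tensor S B B e (evh (z \<star> q'))"]) (simp_all add: balanced_def ms del: rsmult_pure rsmult_pure')
    finally show "tensor_map S B B evh id (wD (y \<star> q')) = pure_tensor S B B oneB (evh (y \<star> q'))" .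
  qed simp_all
  from this[of d] d have "pure_tensor S B B (evh d) oneB = pure_tensor S B B oneB (evh d)"
    by (simp add: CD_eq eD_eq)
  then show ?thesis using d by (simp add: beta_image)
qed

definition "epsC = (\<lambda>c. the_inv_into (carrier R) alpha (ev c))"
definition "epsD = (\<lambda>d. the_inv_into (carrier S) beta (evh d))"

lemma epsC_hom: "epsC \<in> bimod_hom R R Cm (ring_bimod R)" and alpha_epsC: "c \<in> cC \<Longrightarrow> alpha (epsC c) = ev c"
proof -
  have e: "ev \<in> bimod_hom R R Cm A" using bimod_hom_comp[OF id_C_hom ev] by simp
  note t = the_inv_into_bimod_hom[OF ring_mods(1) alpha_hom _ Cm_bimodule e, simplified, OF alpha_inj ev_C]
  show "epsC \<in> bimod_hom R R Cm (ring_bimod R)" "c \<in> cC \<Longrightarrow> alpha (epsC c) = ev c"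
    unfolding epsC_def using t by simp_all
qed

lemma epsD_hom: "epsD \<in> bimod_hom S S Dm (ring_bimod S)" and beta_epsD: "d \<in> cD \<Longrightarrow> beta (epsD d) = evh d"
proof -
  have e: "evh \<in> bimod_hom S S Dm B" using bimod_hom_comp[OF id_D_hom evh] by simp
  note t = the_inv_into_bimod_hom[OF ring_mods(5) beta_hom _ Dm_bimodule e, simplified, OF beta_inj evh_D]
  show "epsD \<in> bimod_hom S S Dm (ring_bimod S)" "d \<in> cD \<Longrightarrow> beta (epsD d) = evh d"
    unfolding epsD_def using t by simp_all
qed

lemmas eps_homs [simp] = epsC_hom epsC_hom[THEN bimod_hom_left] epsC_hom[THEN bimod_hom_right] epsC_hom[THEN bimod_hom_ahom]
  bimod_hom_closed[OF epsC_hom, simplified]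
  epsD_hom epsD_hom[THEN bimod_hom_left] epsD_hom[THEN bimod_hom_right] epsD_hom[THEN bimod_hom_ahom]
  bimod_hom_closed[OF epsD_hom, simplified]

definition "comult_C = (\<lambda>c. the_inv_into (carrier (tensor R Cm Cm)) (tensor_map R pt pt id id) (dC c))"
definition "comult_D = (\<lambda>d. the_inv_into (carrier (tensor S Dm Dm)) (tensor_map S tp tp id id) (dD d))"
definition "lcoact_Tb = (\<lambda>v. the_inv_into (carrier (tensor R Cm Tb)) (tensor_map R pt ptp id id) (lB v))"
definition "rcoact_Tb = (\<lambda>v. the_inv_into (carrier (tensor S Tb Dm)) (tensor_map S ptp tp id id) (rB v))"

lemma comult_C_hom: "comult_C \<in> bimod_hom R R Cm (tensor R Cm Cm)" and comult_C_eq [simp]: "c \<in> cC \<Longrightarrow> tensor_map R pt pt id id (comult_C c) = dC c"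
proof -
  have h: "dC \<in> bimod_hom R R Cm (tensor R pt pt)" using bimod_hom_comp[OF id_C_hom dC_hom] by simp
  show "comult_C \<in> bimod_hom R R Cm (tensor R Cm Cm)" "c \<in> cC \<Longrightarrow> tensor_map R pt pt id id (comult_C c) = dC c"
    unfolding comult_C_def by (rule the_inv_into_bimod_hom[OF _ tensor_map_bimod_hom inj_CC _ h dC_mem], simp_all)+
qed

lemma comult_D_hom: "comult_D \<in> bimod_hom S S Dm (tensor S Dm Dm)" and comult_D_eq [simp]: "d \<in> cD \<Longrightarrow> tensor_map S tp tp id id (comult_D d) = dD d"
proof -
  have h: "dD \<in> bimod_hom S S Dm (tensor S tp tp)" using bimod_hom_comp[OF id_D_hom dD_hom] by simp
  show "comult_D \<in> bimod_hom S S Dm (tensor S Dm Dm)" "d \<in> cD \<Longrightarrow> tensor_map S tp tp id id (comult_D d) = dD d"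
    unfolding comult_D_def by (rule the_inv_into_bimod_hom[OF _ tensor_map_bimod_hom inj_DD _ h dD_mem], simp_all)+
qed

lemma lcoact_Tb_hom: "lcoact_Tb \<in> bimod_hom R S Tb (tensor R Cm Tb)" and lcoact_Tb_eq [simp]: "v \<in> cB \<Longrightarrow> tensor_map R pt ptp id id (lcoact_Tb v) = lB v"
proof -
  have h: "lB \<in> bimod_hom R S Tb (tensor R pt ptp)" using bimod_hom_comp[OF id_Tb_hom lB_hom] by simp
  show "lcoact_Tb \<in> bimod_hom R S Tb (tensor R Cm Tb)" "v \<in> cB \<Longrightarrow> tensor_map R pt ptp id id (lcoact_Tb v) = lB v"
    unfolding lcoact_Tb_def by (rule the_inv_into_bimod_hom[OF _ tensor_map_bimod_hom inj_CTb _ h lB_mem], simp_all)+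
qed

lemma rcoact_Tb_hom: "rcoact_Tb \<in> bimod_hom R S Tb (tensor S Tb Dm)" and rcoact_Tb_eq [simp]: "v \<in> cB \<Longrightarrow> tensor_map S ptp tp id id (rcoact_Tb v) = rB v"
proof -
  have h: "rB \<in> bimod_hom R S Tb (tensor S ptp tp)" using bimod_hom_comp[OF id_Tb_hom rB_hom] by simp
  show "rcoact_Tb \<in> bimod_hom R S Tb (tensor S Tb Dm)" "v \<in> cB \<Longrightarrow> tensor_map S ptp tp id id (rcoact_Tb v) = rB v"
    unfolding rcoact_Tb_def by (rule the_inv_into_bimod_hom[OF _ tensor_map_bimod_hom inj_TbD _ h rB_mem], simp_all)+
qed

lemmas dd_homs [simp] = comult_C_hom comult_C_hom[THEN bimod_hom_left] comult_C_hom[THEN bimod_hom_right] comult_C_hom[THEN bimod_hom_ahom]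
  bimod_hom_closed[OF comult_C_hom, simplified]
  comult_D_hom comult_D_hom[THEN bimod_hom_left] comult_D_hom[THEN bimod_hom_right] comult_D_hom[THEN bimod_hom_ahom]
  bimod_hom_closed[OF comult_D_hom, simplified]
  lcoact_Tb_hom lcoact_Tb_hom[THEN bimod_hom_left] lcoact_Tb_hom[THEN bimod_hom_right] lcoact_Tb_hom[THEN bimod_hom_ahom]
  bimod_hom_closed[OF lcoact_Tb_hom, simplified]
  rcoact_Tb_hom rcoact_Tb_hom[THEN bimod_hom_left] rcoact_Tb_hom[THEN bimod_hom_right] rcoact_Tb_hom[THEN bimod_hom_ahom]
  bimod_hom_closed[OF rcoact_Tb_hom, simplified]

text \<open>\<open>epsC\<close> is known only through \<open>alpha (epsC c) = ev c\<close>, so the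
  law has to be deduced from its version over \<open>A\<close> in the ambient module
  \<open>M'\<close>. The map \<open>act\<close> contracts \<open>A \<otimes> M'\<close>; being
  linear and unital it sends \<open>alpha r \<otimes> x\<close> to \<open>r x\<close>, which
  compares with \<open>lunit\<close>, and \<open>lunit\<close> is invertible.\<close>

lemma left_counit_C:
  assumes M [simp]: "left_module R M" "left_module R M'" and i [simp]: "id \<in> left_hom R M M'"
    and act: "act \<in> left_hom R (tensor R A M') M'" "\<And>x. x \<in> carrier M' \<Longrightarrow> act (pure_tensor R A M' oneA x) = x"
    and u: "u \<in> carrier (tensor R Cm M)" and m: "m \<in> carrier M"
    and eq: "tensor_map R A M' ev id (tensor_map R pt M' id id u) = pure_tensor R A M' oneA m"
  shows "tensor_map R (ring_bimod R) M epsC id u = pure_tensor R (ring_bimod R) M \<one>\<^bsub>R\<^esub> m"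
proof -
  have c [simp]: "x \<in> carrier M \<Longrightarrow> x \<in> carrier M'" for x using left_hom_closed[OF i] by simp
  have "act (tensor_map R A M' ev id (tensor_map R pt M' id id u)) = id (lunit M (tensor_map R (ring_bimod R) M epsC id u))"
  proof (rule tensor_eqI[OF _ _ _ ahom_comp[OF ahom_comp[OF tensor_map_ahom tensor_map_ahom] left_hom_ahom[OF act(1)]]
      ahom_comp[OF ahom_comp[OF tensor_map_ahom lunit_ahom] left_hom_ahom[OF i]] _ u])
    fix c x assume *: "c \<in> carrier Cm" "x \<in> carrier M"
    have "pure_tensor R A M' (alpha (epsC c)) x = epsC c \<odot>\<^bsub>tensor R A M'\<^esub> pure_tensor R A M' oneA x"
      using * by (subst smult_pure[where K = R]) (simp_all add: alpha)
    moreover have "act (epsC c \<odot>\<^bsub>tensor R A M'\<^esub> pure_tensor R A M' oneA x) = epsC c \<odot>\<^bsub>M'\<^esub> x"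
      using act * by (simp add: left_hom_iff del: smult_pure smult_pure')
    moreover have "epsC c \<odot>\<^bsub>M'\<^esub> x = epsC c \<odot>\<^bsub>M\<^esub> x" using i * by (simp add: left_hom_iff)
    ultimately show "act (tensor_map R A M' ev id (tensor_map R pt M' id id (pure_tensor R Cm M c x))) =
        id (lunit M (tensor_map R (ring_bimod R) M epsC id (pure_tensor R Cm M c x)))"
      using * by (simp add: lunit_pure[OF ringR] flip: alpha_epsC)
  qed (simp_all add: ringR left_module_abelian_group[OF M(2)])
  then have "lunit M (tensor_map R (ring_bimod R) M epsC id u) = m" using eq act(2) m by simp
  moreover have "tensor_map R (ring_bimod R) M epsC id u \<in> carrier (tensor R (ring_bimod R) M)"
    by (rule ahom_closed[OF tensor_map_ahom u]) simp_all
  ultimately show ?thesis using lunit_inverse[OF ringR M(1)] by metis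
qed

lemma left_counit_D:
  assumes M [simp]: "left_module S M" "left_module S M'" and i [simp]: "id \<in> left_hom S M M'"
    and act: "act \<in> left_hom S (tensor S B M') M'" "\<And>x. x \<in> carrier M' \<Longrightarrow> act (pure_tensor S B M' oneB x) = x"
    and u: "u \<in> carrier (tensor S Dm M)" and m: "m \<in> carrier M"
    and eq: "tensor_map S B M' evh id (tensor_map S tp M' id id u) = pure_tensor S B M' oneB m"
  shows "tensor_map S (ring_bimod S) M epsD id u = pure_tensor S (ring_bimod S) M \<one>\<^bsub>S\<^esub> m"
proof -
  have c [simp]: "x \<in> carrier M \<Longrightarrow> x \<in> carrier M'" for x using left_hom_closed[OF i] by simp
  have "act (tensor_map S B M' evh id (tensor_map S tp M' id id u)) = id (lunit M (tensor_map S (ring_bimod S) M epsD id u))"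
  proof (rule tensor_eqI[OF _ _ _ ahom_comp[OF ahom_comp[OF tensor_map_ahom tensor_map_ahom] left_hom_ahom[OF act(1)]]
      ahom_comp[OF ahom_comp[OF tensor_map_ahom lunit_ahom] left_hom_ahom[OF i]] _ u])
    fix c x assume *: "c \<in> carrier Dm" "x \<in> carrier M"
    have "pure_tensor S B M' (beta (epsD c)) x = epsD c \<odot>\<^bsub>tensor S B M'\<^esub> pure_tensor S B M' oneB x"
      using * by (subst smult_pure[where K = S]) (simp_all add: beta)
    moreover have "act (epsD c \<odot>\<^bsub>tensor S B M'\<^esub> pure_tensor S B M' oneB x) = epsD c \<odot>\<^bsub>M'\<^esub> x"
      using act * by (simp add: left_hom_iff del: smult_pure smult_pure')
    moreover have "epsD c \<odot>\<^bsub>M'\<^esub> x = epsD c \<odot>\<^bsub>M\<^esub> x" using i * by (simp add: left_hom_iff)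
    ultimately show "act (tensor_map S B M' evh id (tensor_map S tp M' id id (pure_tensor S Dm M c x))) =
        id (lunit M (tensor_map S (ring_bimod S) M epsD id (pure_tensor S Dm M c x)))"
      using * by (simp add: lunit_pure[OF ringS] flip: beta_epsD)
  qed (simp_all add: ringS left_module_abelian_group[OF M(2)])
  then have "lunit M (tensor_map S (ring_bimod S) M epsD id u) = m" using eq act(2) m by simp
  moreover have "tensor_map S (ring_bimod S) M epsD id u \<in> carrier (tensor S (ring_bimod S) M)"
    by (rule ahom_closed[OF tensor_map_ahom u]) simp_all
  ultimately show ?thesis using lunit_inverse[OF ringS M(1)] by metis
qed

lemma right_counit_C:
  assumes M [simp]: "right_module R M" "right_module R M'" and i [simp]: "id \<in> right_hom R M M'"
    and act: "act \<in> right_hom R (tensor R M' A) M'" "\<And>x. x \<in> carrier M' \<Longrightarrow> act (pure_tensor R M' A x oneA) = x"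
    and u: "u \<in> carrier (tensor R M Cm)" and m: "m \<in> carrier M"
    and eq: "tensor_map R M' A id ev (tensor_map R M' pt id id u) = pure_tensor R M' A m oneA"
  shows "tensor_map R M (ring_bimod R) id epsC u = pure_tensor R M (ring_bimod R) m \<one>\<^bsub>R\<^esub>"
proof -
  have c [simp]: "x \<in> carrier M \<Longrightarrow> x \<in> carrier M'" for x using right_hom_closed[OF i] by simp
  have "act (tensor_map R M' A id ev (tensor_map R M' pt id id u)) = id (runit M (tensor_map R M (ring_bimod R) id epsC u))"
  proof (rule tensor_eqI[OF _ _ _ ahom_comp[OF ahom_comp[OF tensor_map_ahom tensor_map_ahom] right_hom_ahom[OF act(1)]]
      ahom_comp[OF ahom_comp[OF tensor_map_ahom runit_ahom] right_hom_ahom[OF i]] _ u])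
    fix x c assume *: "x \<in> carrier M" "c \<in> carrier Cm"
    have "pure_tensor R M' A x (alpha (epsC c)) = pure_tensor R M' A x oneA \<odot>r\<^bsub>tensor R M' A\<^esub> epsC c"
      using * by (subst rsmult_pure[where L = R]) (simp_all add: alpha)
    moreover have "act (pure_tensor R M' A x oneA \<odot>r\<^bsub>tensor R M' A\<^esub> epsC c) = x \<odot>r\<^bsub>M'\<^esub> epsC c"
      using act * by (simp add: right_hom_iff del: rsmult_pure rsmult_pure')
    moreover have "x \<odot>r\<^bsub>M'\<^esub> epsC c = x \<odot>r\<^bsub>M\<^esub> epsC c" using i * by (simp add: right_hom_iff)
    ultimately show "act (tensor_map R M' A id ev (tensor_map R M' pt id id (pure_tensor R M Cm x c))) =
        id (runit M (tensor_map R M (ring_bimod R) id epsC (pure_tensor R M Cm x c)))"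
      using * by (simp add: runit_pure[OF ringR] flip: alpha_epsC)
  qed (simp_all add: ringR right_module_abelian_group[OF M(2)])
  then have "runit M (tensor_map R M (ring_bimod R) id epsC u) = m" using eq act(2) m by simp
  moreover have "tensor_map R M (ring_bimod R) id epsC u \<in> carrier (tensor R M (ring_bimod R))"
    by (rule ahom_closed[OF tensor_map_ahom u]) simp_all
  ultimately show ?thesis using runit_inverse[OF ringR M(1)] by metis
qed

lemma right_counit_D:
  assumes M [simp]: "right_module S M" "right_module S M'" and i [simp]: "id \<in> right_hom S M M'"
    and act: "act \<in> right_hom S (tensor S M' B) M'" "\<And>x. x \<in> carrier M' \<Longrightarrow> act (pure_tensor S M' B x oneB) = x"
    and u: "u \<in> carrier (tensor S M Dm)" and m: "m \<in> carrier M"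
    and eq: "tensor_map S M' B id evh (tensor_map S M' tp id id u) = pure_tensor S M' B m oneB"
  shows "tensor_map S M (ring_bimod S) id epsD u = pure_tensor S M (ring_bimod S) m \<one>\<^bsub>S\<^esub>"
proof -
  have c [simp]: "x \<in> carrier M \<Longrightarrow> x \<in> carrier M'" for x using right_hom_closed[OF i] by simp
  have "act (tensor_map S M' B id evh (tensor_map S M' tp id id u)) = id (runit M (tensor_map S M (ring_bimod S) id epsD u))"
  proof (rule tensor_eqI[OF _ _ _ ahom_comp[OF ahom_comp[OF tensor_map_ahom tensor_map_ahom] right_hom_ahom[OF act(1)]]
      ahom_comp[OF ahom_comp[OF tensor_map_ahom runit_ahom] right_hom_ahom[OF i]] _ u])
    fix x c assume *: "x \<in> carrier M" "c \<in> carrier Dm"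
    have "pure_tensor S M' B x (beta (epsD c)) = pure_tensor S M' B x oneB \<odot>r\<^bsub>tensor S M' B\<^esub> epsD c"
      using * by (subst rsmult_pure[where L = S]) (simp_all add: beta)
    moreover have "act (pure_tensor S M' B x oneB \<odot>r\<^bsub>tensor S M' B\<^esub> epsD c) = x \<odot>r\<^bsub>M'\<^esub> epsD c"
      using act * by (simp add: right_hom_iff del: rsmult_pure rsmult_pure')
    moreover have "x \<odot>r\<^bsub>M'\<^esub> epsD c = x \<odot>r\<^bsub>M\<^esub> epsD c" using i * by (simp add: right_hom_iff)
    ultimately show "act (tensor_map S M' B id evh (tensor_map S M' tp id id (pure_tensor S M Dm x c))) =
        id (runit M (tensor_map S M (ring_bimod S) id epsD (pure_tensor S M Dm x c)))"
      using * by (simp add: runit_pure[OF ringS] flip: beta_epsD)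
  qed (simp_all add: ringS right_module_abelian_group[OF M(2)])
  then have "runit M (tensor_map S M (ring_bimod S) id epsD u) = m" using eq act(2) m by simp
  moreover have "tensor_map S M (ring_bimod S) id epsD u \<in> carrier (tensor S M (ring_bimod S))"
    by (rule ahom_closed[OF tensor_map_ahom u]) simp_all
  ultimately show ?thesis using runit_inverse[OF ringS M(1)] by metis
qed

definition "act_A_pt = tensor_map S P T actAP id \<circ> unassoc R S A P T"
definition "act_A_ptp = tensor_map R pt P act_A_pt id \<circ> unassoc R R A pt P"
definition "act_pt_A = tensor_map S P T id actTA \<circ> assoc S R P T A"
definition "act_B_tp = tensor_map R T P actBT id \<circ> unassoc S R B T P"
definition "act_tp_B = tensor_map R T P id actPB \<circ> assoc R S T P B"
definition "act_ptp_B = tensor_map R pt P id actPB \<circ> assoc R S pt P B"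

lemma act_A_pt_hom: "act_A_pt \<in> bimod_hom R R (tensor R A pt) pt"
  unfolding act_A_pt_def by (rule bimod_hom_comp[OF unassoc_bimod_hom tensor_map_bimod_hom]) simp_all

lemma act_A_ptp_hom: "act_A_ptp \<in> bimod_hom R S (tensor R A ptp) ptp"
  unfolding act_A_ptp_def by (rule bimod_hom_comp[OF unassoc_bimod_hom tensor_map_bimod_hom]) (simp_all add: act_A_pt_hom)

lemma act_pt_A_hom: "act_pt_A \<in> bimod_hom R R (tensor R pt A) pt"
  unfolding act_pt_A_def by (rule bimod_hom_comp[OF assoc_bimod_hom tensor_map_bimod_hom]) simp_all

lemma act_B_tp_hom: "act_B_tp \<in> bimod_hom S S (tensor S B tp) tp"
  unfolding act_B_tp_def by (rule bimod_hom_comp[OF unassoc_bimod_hom tensor_map_bimod_hom]) simp_all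

lemma act_tp_B_hom: "act_tp_B \<in> bimod_hom S S (tensor S tp B) tp"
  unfolding act_tp_B_def by (rule bimod_hom_comp[OF assoc_bimod_hom tensor_map_bimod_hom]) simp_all

lemma act_ptp_B_hom: "act_ptp_B \<in> bimod_hom R S (tensor S ptp B) ptp"
  unfolding act_ptp_B_def by (rule bimod_hom_comp[OF assoc_bimod_hom tensor_map_bimod_hom]) simp_all

lemmas act_bimod_hom = act_A_pt_hom act_A_ptp_hom act_pt_A_hom act_B_tp_hom act_tp_B_hom act_ptp_B_hom
lemmas act_bimod_homs [simp] = act_bimod_hom act_bimod_hom[THEN bimod_hom_left] act_bimod_hom[THEN bimod_hom_right]
  act_bimod_hom[THEN bimod_hom_ahom]

lemma act_A_pt_one: "u \<in> carrier pt \<Longrightarrow> act_A_pt (pure_tensor R A pt oneA u) = u"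
  by (rule tensor_eqI[OF _ _ _ ahom_comp[OF pure_r_ahom[OF _ _ _ ahom_id] bimod_hom_ahom[OF act_A_pt_hom]] ahom_id])
     (simp_all add: act_A_pt_def aP_one)

lemma act_A_ptp_one: "u \<in> carrier ptp \<Longrightarrow> act_A_ptp (pure_tensor R A ptp oneA u) = u"
  by (rule tensor_eqI[OF _ _ _ ahom_comp[OF pure_r_ahom[OF _ _ _ ahom_id] bimod_hom_ahom[OF act_A_ptp_hom]] ahom_id])
     (simp_all add: act_A_ptp_def act_A_pt_one)

lemma act_pt_A_one: "u \<in> carrier pt \<Longrightarrow> act_pt_A (pure_tensor R pt A u oneA) = u"
  by (rule tensor_eqI[OF _ _ _ ahom_comp[OF pure_l_ahom[OF _ _ _ ahom_id] bimod_hom_ahom[OF act_pt_A_hom]] ahom_id])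
     (simp_all add: act_pt_A_def aT_one)

lemma act_B_tp_one: "u \<in> carrier tp \<Longrightarrow> act_B_tp (pure_tensor S B tp oneB u) = u"
  by (rule tensor_eqI[OF _ _ _ ahom_comp[OF pure_r_ahom[OF _ _ _ ahom_id] bimod_hom_ahom[OF act_B_tp_hom]] ahom_id])
     (simp_all add: act_B_tp_def bT_one)

lemma act_tp_B_one: "u \<in> carrier tp \<Longrightarrow> act_tp_B (pure_tensor S tp B u oneB) = u"
  by (rule tensor_eqI[OF _ _ _ ahom_comp[OF pure_l_ahom[OF _ _ _ ahom_id] bimod_hom_ahom[OF act_tp_B_hom]] ahom_id])
     (simp_all add: act_tp_B_def bP_one)

lemma act_ptp_B_one: "u \<in> carrier ptp \<Longrightarrow> act_ptp_B (pure_tensor S ptp B u oneB) = u"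
  by (rule tensor_eqI[OF _ _ _ ahom_comp[OF pure_l_ahom[OF _ _ _ ahom_id] bimod_hom_ahom[OF act_ptp_B_hom]] ahom_id])
     (simp_all add: act_ptp_B_def bP_one)

lemma dC_ev:
  assumes c: "c \<in> carrier pt"
  shows "tensor_map R pt A id ev (dC c) = pure_tensor R pt A c oneA"
proof (rule tensor_eqI[OF _ _ _ ahom_comp[OF bimod_hom_ahom[OF dC_hom] tensor_map_ahom] pure_l_ahom[OF _ _ _ ahom_id] _ c])
  fix p y assume *: "p \<in> carrier P" "y \<in> carrier T"
  then have "tensor_map R pt A id ev (dC (p \<diamondop> y)) = sw (tensor R pt A) (\<lambda>a q z. pure_tensor R pt A (p \<diamondop> a) (ev (q \<diamondop> z))) y"
    by (simp add: dC_sw sw_push ms del: rsmult_pure rsmult_pure')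
  also have "\<dots> = pure_tensor R pt A (p \<diamondop> y) oneA"
    using * by (intro sw_ev) (simp_all add: balanced_def ms del: rsmult_pure rsmult_pure')
  finally show "tensor_map R pt A id ev (dC (p \<diamondop> y)) = pure_tensor R pt A (p \<diamondop> y) oneA" .
qed simp_all

lemma dD_evh:
  assumes d: "d \<in> carrier tp"
  shows "tensor_map S B tp evh id (dD d) = pure_tensor S B tp oneB d"
proof (rule tensor_eqI[OF _ _ _ ahom_comp[OF bimod_hom_ahom[OF dD_hom] tensor_map_ahom] pure_r_ahom[OF _ _ _ ahom_id] _ d])
  fix y q' assume *: "y \<in> carrier T" "q' \<in> carrier P"
  then have "tensor_map S B tp evh id (dD (y \<star> q')) = sw (tensor S B tp) (\<lambda>a q z. pure_tensor S B tp (evh (a \<star> q)) (z \<star> q')) y"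
    by (simp add: dD_sw sw_push ms del: rsmult_pure rsmult_pure')
  also have "\<dots> = pure_tensor S B tp oneB (y \<star> q')"
    using * by (intro sw_evh) (simp_all add: balanced_def ms del: rsmult_pure rsmult_pure')
  finally show "tensor_map S B tp evh id (dD (y \<star> q')) = pure_tensor S B tp oneB (y \<star> q')" .
qed simp_all

text \<open>The laws have different origins. For \<open>C\<close> the left law is the equation
  \<open>wC c = eC c\<close> and the right law the counit axiom for \<open>ev\<close>; for
  \<open>D\<close> the sides are exchanged. Both laws for \<open>T\<close> are shepherd axioms, and
  both for T-bar come from its equalizer conditions.\<close>

lemma counits:
  "c \<in> cC \<Longrightarrow> tensor_map R (ring_bimod R) Cm epsC id (comult_C c) = pure_tensor R (ring_bimod R) Cm \<one>\<^bsub>R\<^esub> c"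
  "c \<in> cC \<Longrightarrow> tensor_map R Cm (ring_bimod R) id epsC (comult_C c) = pure_tensor R Cm (ring_bimod R) c \<one>\<^bsub>R\<^esub>"
  "d \<in> cD \<Longrightarrow> tensor_map S (ring_bimod S) Dm epsD id (comult_D d) = pure_tensor S (ring_bimod S) Dm \<one>\<^bsub>S\<^esub> d"
  "d \<in> cD \<Longrightarrow> tensor_map S Dm (ring_bimod S) id epsD (comult_D d) = pure_tensor S Dm (ring_bimod S) d \<one>\<^bsub>S\<^esub>"
  "x \<in> carrier T \<Longrightarrow> tensor_map S (ring_bimod S) T epsD id (\<gamma>D x) = pure_tensor S (ring_bimod S) T \<one>\<^bsub>S\<^esub> x"
  "x \<in> carrier T \<Longrightarrow> tensor_map R T (ring_bimod R) id epsC (\<gamma>C x) = pure_tensor R T (ring_bimod R) x \<one>\<^bsub>R\<^esub>"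
  "v \<in> cB \<Longrightarrow> tensor_map R (ring_bimod R) Tb epsC id (lcoact_Tb v) = pure_tensor R (ring_bimod R) Tb \<one>\<^bsub>R\<^esub> v"
  "v \<in> cB \<Longrightarrow> tensor_map S Tb (ring_bimod S) id epsD (rcoact_Tb v) = pure_tensor S Tb (ring_bimod S) v \<one>\<^bsub>S\<^esub>"
proof -
  show "tensor_map R (ring_bimod R) Cm epsC id (comult_C c) = pure_tensor R (ring_bimod R) Cm \<one>\<^bsub>R\<^esub> c" if c: "c \<in> cC"
    by (rule left_counit_C[where M' = pt and act = act_A_pt])
       (use c CD_eq(1)[OF c] in \<open>simp_all add: act_A_pt_one wC_def eC_eq\<close>)
  show "tensor_map R Cm (ring_bimod R) id epsC (comult_C c) = pure_tensor R Cm (ring_bimod R) c \<one>\<^bsub>R\<^esub>" if "c \<in> cC"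
    by (rule right_counit_C[where M' = pt and act = act_pt_A]) (use that in \<open>simp_all add: act_pt_A_one dC_ev\<close>)
  show "tensor_map S (ring_bimod S) Dm epsD id (comult_D d) = pure_tensor S (ring_bimod S) Dm \<one>\<^bsub>S\<^esub> d" if "d \<in> cD"
    by (rule left_counit_D[where M' = tp and act = act_B_tp]) (use that in \<open>simp_all add: act_B_tp_one dD_evh\<close>)
  show "tensor_map S Dm (ring_bimod S) id epsD (comult_D d) = pure_tensor S Dm (ring_bimod S) d \<one>\<^bsub>S\<^esub>" if d: "d \<in> cD"
    by (rule right_counit_D[where M' = tp and act = act_tp_B])
       (use d CD_eq(2)[OF d] in \<open>simp_all add: act_tp_B_one wD_def eD_eq\<close>)
  show "tensor_map S (ring_bimod S) T epsD id (\<gamma>D x) = pure_tensor S (ring_bimod S) T \<one>\<^bsub>S\<^esub> x" if "x \<in> carrier T"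
    by (rule left_counit_D[where M' = T and act = actBT]) (use that in \<open>simp_all add: bT_one shepherd_evh left_hom_id\<close>)
  show "tensor_map R T (ring_bimod R) id epsC (\<gamma>C x) = pure_tensor R T (ring_bimod R) x \<one>\<^bsub>R\<^esub>" if "x \<in> carrier T"
    by (rule right_counit_C[where M' = T and act = actTA]) (use that in \<open>simp_all add: aT_one \<gamma>r_def shepherd_ev right_hom_id\<close>)
  show "tensor_map R (ring_bimod R) Tb epsC id (lcoact_Tb v) = pure_tensor R (ring_bimod R) Tb \<one>\<^bsub>R\<^esub> v" if v: "v \<in> cB"
    by (rule left_counit_C[where M' = ptp and act = act_A_ptp])
       (use v cB_eq[OF v] in \<open>simp_all add: act_A_ptp_one lB_counit\<close>)
  show "tensor_map S Tb (ring_bimod S) id epsD (rcoact_Tb v) = pure_tensor S Tb (ring_bimod S) v \<one>\<^bsub>S\<^esub>" if v: "v \<in> cB"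
    by (rule right_counit_D[where M' = ptp and act = act_ptp_B])
       (use v cB_eq[OF v] in \<open>simp_all add: act_ptp_B_one rB_counit\<close>)
qed

lemma coassoc_C: "c \<in> cC \<Longrightarrow>
    assoc R R Cm Cm Cm (tensor_map R (tensor R Cm Cm) Cm comult_C id (comult_C c)) = tensor_map R Cm (tensor R Cm Cm) id comult_C (comult_C c)"
  by (rule coassoc_corestrict[where V = Cm and V' = pt and W = Cm and W' = pt, rotated -1, OF coass_C[of c] _ _ _ _ _ _ _ _ _ _ _ _ _ _ _ inj_CCC])
     simp_all

lemma coassoc_D: "d \<in> cD \<Longrightarrow>
    assoc S S Dm Dm Dm (tensor_map S (tensor S Dm Dm) Dm comult_D id (comult_D d)) = tensor_map S Dm (tensor S Dm Dm) id comult_D (comult_D d)"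
  by (rule coassoc_corestrict[where V = Dm and V' = tp and W = Dm and W' = tp, rotated -1, OF coass_D[of d] _ _ _ _ _ _ _ _ _ _ _ _ _ _ _ inj_DDD])
     simp_all

lemma coassoc_T_left: "x \<in> carrier T \<Longrightarrow>
    assoc S S Dm Dm T (tensor_map S (tensor S Dm Dm) T comult_D id (\<gamma>D x)) = tensor_map S Dm (tensor S Dm T) id \<gamma>D (\<gamma>D x)"
  by (rule coassoc_corestrict[where V = Dm and V' = tp and W = T and W' = T, rotated -1, OF coass_T_left[of x] _ _ _ _ _ _ _ _ _ _ _ _ _ _ _ inj_DDT])
     (simp_all add: left_hom_id right_hom_id)

lemma coassoc_T_right: "x \<in> carrier T \<Longrightarrow>
    assoc R R T Cm Cm (tensor_map R (tensor R T Cm) Cm \<gamma>C id (\<gamma>C x)) = tensor_map R T (tensor R Cm Cm) id comult_C (\<gamma>C x)"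
  by (rule coassoc_corestrict[where V = T and V' = T and W = Cm and W' = pt, rotated -1, OF coass_T_right[of x] _ _ _ _ _ _ _ _ _ _ _ _ _ _ _ inj_TCC])
     (simp_all add: left_hom_id right_hom_id)

lemma coassoc_T_mixed: "x \<in> carrier T \<Longrightarrow>
    assoc S R Dm T Cm (tensor_map R (tensor S Dm T) Cm \<gamma>D id (\<gamma>C x)) = tensor_map S Dm (tensor R T Cm) id \<gamma>C (\<gamma>D x)"
  by (rule coassoc_corestrict[where V = T and V' = T and W = T and W' = T, rotated -1, OF coass_T_mixed[of x] _ _ _ _ _ _ _ _ _ _ _ _ _ _ _ inj_DTC])
     (simp_all add: left_hom_id right_hom_id bimod_hom_id)

lemma coassoc_Tb_left: "v \<in> cB \<Longrightarrow>
    assoc R R Cm Cm Tb (tensor_map R (tensor R Cm Cm) Tb comult_C id (lcoact_Tb v)) = tensor_map R Cm (tensor R Cm Tb) id lcoact_Tb (lcoact_Tb v)"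
  by (rule coassoc_corestrict[where V = Cm and V' = pt and W = Tb and W' = ptp, rotated -1, OF coass_Tbar_left[of v] _ _ _ _ _ _ _ _ _ _ _ _ _ _ _ inj_CCTb])
     simp_all

lemma coassoc_Tb_right: "v \<in> cB \<Longrightarrow>
    assoc S S Tb Dm Dm (tensor_map S (tensor S Tb Dm) Dm rcoact_Tb id (rcoact_Tb v)) = tensor_map S Tb (tensor S Dm Dm) id comult_D (rcoact_Tb v)"
  by (rule coassoc_corestrict[where V = Tb and V' = ptp and W = Dm and W' = tp, rotated -1, OF coass_Tbar_right[of v] _ _ _ _ _ _ _ _ _ _ _ _ _ _ _ inj_TbDD])
     simp_all

lemma coassoc_Tb_mixed: "v \<in> cB \<Longrightarrow>
    assoc R S Cm Tb Dm (tensor_map S (tensor R Cm Tb) Dm lcoact_Tb id (rcoact_Tb v)) = tensor_map R Cm (tensor S Tb Dm) id rcoact_Tb (lcoact_Tb v)"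
  by (rule coassoc_corestrict[where V = Tb and V' = ptp and W = Tb and W' = ptp, rotated -1, OF coass_Tbar_mixed[of v] _ _ _ _ _ _ _ _ _ _ _ _ _ _ _ inj_CTbD])
     simp_all

lemma covC_left: "c \<in> cC \<Longrightarrow>
    assoc R S Cm Tb T (tensor_map S (tensor R Cm Tb) T lcoact_Tb id (covC c)) = tensor_map R Cm (tensor S Tb T) id covC (comult_C c)"
  by (rule coassoc_corestrict[where V = Tb and V' = ptp and W = Cm and W' = pt, rotated -1, OF coass_cov_left[of c] _ _ _ _ _ _ _ _ _ _ _ _ _ _ _ inj_CTbT])
     (simp_all add: left_hom_id right_hom_id bimod_hom_id)

lemma covC_right: "c \<in> cC \<Longrightarrow>
    assoc S R Tb T Cm (tensor_map R (tensor S Tb T) Cm covC id (comult_C c)) = tensor_map S Tb (tensor R T Cm) id \<gamma>C (covC c)"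
  by (rule coassoc_corestrict[where V = Cm and V' = pt and W = T and W' = T, rotated -1, OF coass_cov_right[of c] _ _ _ _ _ _ _ _ _ _ _ _ _ _ _ inj_TbTC])
     (simp_all add: left_hom_id right_hom_id bimod_hom_id)

lemma covD_left: "d \<in> cD \<Longrightarrow>
    assoc S R Dm T Tb (tensor_map R (tensor S Dm T) Tb \<gamma>D id (covD d)) = tensor_map S Dm (tensor R T Tb) id covD (comult_D d)"
  by (rule coassoc_corestrict[where V = T and V' = T and W = Dm and W' = tp, rotated -1, OF coass_cov'_left[of d] _ _ _ _ _ _ _ _ _ _ _ _ _ _ _ inj_DTTb])
     (simp_all add: left_hom_id right_hom_id bimod_hom_id)

lemma covD_right: "d \<in> cD \<Longrightarrow>
    assoc R S T Tb Dm (tensor_map S (tensor R T Tb) Dm covD id (comult_D d)) = tensor_map R T (tensor S Tb Dm) id rcoact_Tb (covD d)"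
  by (rule coassoc_corestrict[where V = Dm and V' = tp and W = Tb and W' = ptp, rotated -1, OF coass_cov'_right[of d] _ _ _ _ _ _ _ _ _ _ _ _ _ _ _ inj_TTbD])
     (simp_all add: left_hom_id right_hom_id bimod_hom_id)

lemma cov_companion_T: "x \<in> carrier T \<Longrightarrow>
    assoc R S T Tb T (tensor_map S (tensor R T Tb) T covD id (\<gamma>D x)) = tensor_map R T (tensor S Tb T) id covC (\<gamma>C x)"
  by (rule coassoc_corestrict[where V = Dm and V' = tp and W = Cm and W' = pt, rotated -1, OF coass_companion_T[of x] _ _ _ _ _ _ _ _ _ _ _ _ _ _ _ inj_TTbT])
     (simp_all add: left_hom_id right_hom_id bimod_hom_id)

lemma cov_companion_Tb: "v \<in> cB \<Longrightarrow>
    assoc S R Tb T Tb (tensor_map R (tensor S Tb T) Tb covC id (lcoact_Tb v)) = tensor_map S Tb (tensor R T Tb) id covD (rcoact_Tb v)"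
  by (rule coassoc_corestrict[where V = Cm and V' = pt and W = Dm and W' = tp, rotated -1, OF coass_companion_Tbar[of v] _ _ _ _ _ _ _ _ _ _ _ _ _ _ _ inj_TbTTb])
     (simp_all add: left_hom_id right_hom_id bimod_hom_id)

end

section \<open>Invariance of the constructions under added coring and coaction data\<close>

lemma extend_fields [simp]:
  "carrier (bimod.extend M f) = carrier M" "add (bimod.extend M f) = add M" "ring.zero (bimod.extend M f) = ring.zero M"
  "smult (bimod.extend M f) = smult M" "rsmult (bimod.extend M f) = rsmult M"
  by (simp_all add: bimod.extend_def)

lemma with_coactions_fields [simp]:
  "carrier (with_coactions M l r) = carrier M" "add (with_coactions M l r) = add M" "ring.zero (with_coactions M l r) = ring.zero M"
  "smult (with_coactions M l r) = smult M" "rsmult (with_coactions M l r) = rsmult M"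
  "lcoact (with_coactions M l r) = l" "rcoact (with_coactions M l r) = r"
  by (simp_all add: with_coactions_def)

lemma coring_fields [simp]:
  "comult (bimod.extend M (coring.fields d e)) = d" "counit (bimod.extend M (coring.fields d e)) = e"
  by (simp_all add: bimod.extend_def coring.fields_def)

text \<open>The relations of a tensor product see only carriers, additions and actions, so attached
  coproducts or coactions do not change it. This carries results about the bare modules over to the
  corings and bicomodules.\<close>

lemma extend_subgroup [simp]:
  "tensor_subgroup R (bimod.extend M f) N = tensor_subgroup R M N"
  "tensor_subgroup R M' (bimod.extend N' f) = tensor_subgroup R M' N'"
  "tensor_subgroup R (with_coactions X l r) Y = tensor_subgroup R X Y"
  "tensor_subgroup R X' (with_coactions Y' l' r') = tensor_subgroup R X' Y'"
  by (simp_all add: tensor_subgroup_def tensor_relations_def)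

lemma extend_group [simp]:
  "tensor_group R (bimod.extend M f) N = tensor_group R M N"
  "tensor_group R M' (bimod.extend N' f) = tensor_group R M' N'"
  "tensor_group R (with_coactions X l r) Y = tensor_group R X Y"
  "tensor_group R X' (with_coactions Y' l' r') = tensor_group R X' Y'"
  by (simp_all add: tensor_group_def)

lemma extend_pure [simp]:
  "pure_tensor R (bimod.extend M f) N = pure_tensor R M N"
  "pure_tensor R M' (bimod.extend N' f) = pure_tensor R M' N'"
  "pure_tensor R (with_coactions X l r) Y = pure_tensor R X Y"
  "pure_tensor R X' (with_coactions Y' l' r') = pure_tensor R X' Y'"
  by (simp_all add: pure_tensor_def fun_eq_iff)

lemma extend_tensor [simp]:
  "tensor R (bimod.extend M f) N = tensor R M N"
  "tensor R M' (bimod.extend N' f) = tensor R M' N'"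
  "tensor R (with_coactions X l r) Y = tensor R X Y"
  "tensor R X' (with_coactions Y' l' r') = tensor R X' Y'"
  by (simp_all add: tensor_def)

lemma extend_map [simp]:
  "tensor_map R (bimod.extend M f) N = tensor_map R M N"
  "tensor_map R M' (bimod.extend N' f) = tensor_map R M' N'"
  "tensor_map R (with_coactions X l r) Y = tensor_map R X Y"
  "tensor_map R X' (with_coactions Y' l' r') = tensor_map R X' Y'"
  by (simp_all add: tensor_map_def fun_eq_iff)

lemma extend_assoc [simp]:
  "assoc R S (bimod.extend M f) N Q = assoc R S M N Q"
  "assoc R S M1 (bimod.extend N1 f) Q1 = assoc R S M1 N1 Q1"
  "assoc R S M2 N2 (bimod.extend Q2 f) = assoc R S M2 N2 Q2"
  "assoc R S (with_coactions X l r) Y Z = assoc R S X Y Z"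
  "assoc R S X1 (with_coactions Y1 l1 r1) Z1 = assoc R S X1 Y1 Z1"
  "assoc R S X2 Y2 (with_coactions Z2 l2 r2) = assoc R S X2 Y2 Z2"
  by (simp_all add: assoc_def)

lemma extend_unassoc [simp]:
  "unassoc R S (bimod.extend M f) N Q = unassoc R S M N Q"
  "unassoc R S M1 (bimod.extend N1 f) Q1 = unassoc R S M1 N1 Q1"
  "unassoc R S M2 N2 (bimod.extend Q2 f) = unassoc R S M2 N2 Q2"
  "unassoc R S (with_coactions X l r) Y Z = unassoc R S X Y Z"
  "unassoc R S X1 (with_coactions Y1 l1 r1) Z1 = unassoc R S X1 Y1 Z1"
  "unassoc R S X2 Y2 (with_coactions Z2 l2 r2) = unassoc R S X2 Y2 Z2"
  by (simp_all add: unassoc_def)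

lemma extend_unit [simp]:
  "lunit (bimod.extend M f) = lunit M" "runit (bimod.extend M' f) = runit M'"
  "lunit (with_coactions X l r) = lunit X" "runit (with_coactions X' l' r') = runit X'"
  by (simp_all add: lunit_def runit_def fun_eq_iff tensor_lift_def finprod_def int_pow_def nat_pow_def m_inv_def cong: if_cong)

lemma extend_hom [simp]:
  "bimod_hom K L (bimod.extend M f) N = bimod_hom K L M N"
  "bimod_hom K L M' (bimod.extend N' f) = bimod_hom K L M' N'"
  "bimod_hom K L (with_coactions X l r) Y = bimod_hom K L X Y"
  "bimod_hom K L X' (with_coactions Y' l' r') = bimod_hom K L X' Y'"
  by (simp_all add: set_eq_iff bimod_hom_iff left_hom_iff right_hom_iff ahom_def)

lemma extend_abelian_group:
  "abelian_group (bimod.extend M f) = abelian_group M" "abelian_group (with_coactions M l r) = abelian_group M"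
  by (simp_all add: abelian_group_def abelian_monoid_def abelian_group_axioms_def comm_group_def comm_monoid_def
      comm_monoid_axioms_def group_def group_axioms_def monoid_def Units_def)

lemma extend_bimodule [simp]:
  "bimodule K L (bimod.extend M f) = bimodule K L M" "bimodule K L (with_coactions M l r) = bimodule K L M"
  by (simp_all add: bimodule_def left_module_def right_module_def bimodule_axioms_def left_module_axioms_def right_module_axioms_def
      extend_abelian_group)

context tame_ctx
begin

definition "coring_C = bimod.extend Cm (coring.fields comult_C epsC)"
definition "coring_D = bimod.extend Dm (coring.fields comult_D epsD)"
definition "bicomod_T = with_coactions T \<gamma>D \<gamma>C"
definition "bicomod_Tb = with_coactions Tb lcoact_Tb rcoact_Tb"

lemma unassoc_eqI:
  assumes "right_module K X" "bimodule K L Y" "left_module L Z" "u \<in> carrier (tensor L (tensor K X Y) Z)" "assoc K L X Y Z u = v"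
  shows "u = unassoc K L X Y Z v"
  using unassoc_assoc assms by metis

lemma companion_via_bicomod_T: "companion_via R S coring_C coring_D bicomod_T bicomod_Tb covC covD"
proof -
  \<comment> \<open>The right coaction of a tensor product of bicomodules is defined with
    \<open>unassoc\<close>, whereas \<open>covC_right\<close> is an identity between values of
    \<open>assoc\<close>.\<close>
  have r: "tensor_map R (tensor S Tb T) Cm covC id (comult_C c) = unassoc S R Tb T Cm (tensor_map S Tb (tensor R T Cm) id \<gamma>C (covC c))" if "c \<in> cC" for c
    by (rule unassoc_eqI[OF _ _ _ ahom_closed[OF tensor_map_ahom bimod_hom_closed[OF comult_C_hom]] covC_right]) (use that in simp_all)
  have r': "tensor_map S (tensor R T Tb) Dm covD id (comult_D d) = unassoc R S T Tb Dm (tensor_map R T (tensor S Tb Dm) id rcoact_Tb (covD d))" if "d \<in> cD" for d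
    by (rule unassoc_eqI[OF _ _ _ ahom_closed[OF tensor_map_ahom bimod_hom_closed[OF comult_D_hom]] covD_right]) (use that in simp_all)
  show ?thesis
    unfolding companion_via_def bicomodule_def is_coring_def bicomod_hom_def coring_bicomod_def tensor_bicomod_def coring_C_def coring_D_def bicomod_T_def bicomod_Tb_def
    by (simp add: counits coassoc_C coassoc_D coassoc_T_left coassoc_T_right coassoc_T_mixed coassoc_Tb_left coassoc_Tb_right
        coassoc_Tb_mixed covC_left covD_left cov_companion_T cov_companion_Tb r r')
qed

section \<open>The coherd structure\<close>

text \<open>The contraction of the middle argument for fixed outer \<open>x\<close> and
  \<open>z\<close>. It is defined on all of \<open>ptp\<close>, so that it can be evaluated on pure
  tensors, which need not lie in T-bar. \<open>G\<close> stays a parameter because \<chi> is defined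
  with the additive group of the unrestricted module, while \<open>T\<close> is its
  restriction.\<close>

definition "chiK G x z = tensor_lift G (\<lambda>(v, q). tensor_lift G (\<lambda>(p, y). aT (bT (evh (x \<star> p)) y) (ev (q \<diamondop> z))) v)"
definition "chiT G = tensor_lift G (\<lambda>(u, z). tensor_lift G (\<lambda>(x, w). chiK G x z w) u)"

context
  fixes G :: "('t, 'z) monoid_scheme"
  assumes G: "group_of G T"
begin

lemma chiK_tribalanced:
  "\<lbrakk>x \<in> carrier T; z \<in> carrier T\<rbrakk> \<Longrightarrow> tribalanced S R P T P T (\<lambda>p y q. aT (bT (evh (x \<star> p)) y) (ev (q \<diamondop> z)))"
  by (simp add: act_linear ms del: rsmult_pure rsmult_pure')

lemma chiK_ahom: "\<lbrakk>x \<in> carrier T; z \<in> carrier T\<rbrakk> \<Longrightarrow> chiK G x z \<in> ahom ptp T"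
  unfolding chiK_def by (rule lift3l(1)[OF _ _ _ _ G chiK_tribalanced]) simp_all

lemma chiK_pure: "\<lbrakk>x \<in> carrier T; z \<in> carrier T; p \<in> carrier P; y \<in> carrier T; q \<in> carrier P\<rbrakk> \<Longrightarrow>
    chiK G x z (pure_tensor R pt P (p \<diamondop> y) q) = aT (bT (evh (x \<star> p)) y) (ev (q \<diamondop> z))"
  unfolding chiK_def by (rule lift3l(2)[OF _ _ _ _ G chiK_tribalanced]) simp_all

lemma chiK_closed [simp]: "\<lbrakk>x \<in> carrier T; z \<in> carrier T; w \<in> carrier ptp\<rbrakk> \<Longrightarrow> chiK G x z w \<in> carrier T"
  using ahom_closed[OF chiK_ahom] .

lemma T_smult_ahom: "s \<in> carrier S \<Longrightarrow> smult T s \<in> ahom T T" "r \<in> carrier R \<Longrightarrow> (\<lambda>x. x \<odot>r\<^bsub>T\<^esub> r) \<in> ahom T T"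
  by (simp_all add: ahom_def left_module.lsmult_closed[OF bimodule_left[OF bimodT]] left_module.lsmult_r_distr[OF bimodule_left[OF bimodT]]
      right_module.rsmult_closed[OF bimodule_right[OF bimodT]] right_module.rsmult_l_distr[OF bimodule_right[OF bimodT]])

lemma ahom_plus: "\<lbrakk>abelian_group Y; f \<in> ahom X Y; g \<in> ahom X Y\<rbrakk> \<Longrightarrow> (\<lambda>x. f x \<oplus>\<^bsub>Y\<^esub> g x) \<in> ahom X Y"
proof -
  assume *: "abelian_group Y" "f \<in> ahom X Y" "g \<in> ahom X Y"
  interpret Y: abelian_group Y by fact
  show ?thesis using * by (auto simp: ahom_def Y.a_ac)
qed

lemma chiK_linear:
  assumes x: "x \<in> carrier T" "x' \<in> carrier T" and z: "z \<in> carrier T" "z' \<in> carrier T" and w: "w \<in> carrier ptp"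
  shows "chiK G (x \<oplus>\<^bsub>T\<^esub> x') z w = chiK G x z w \<oplus>\<^bsub>T\<^esub> chiK G x' z w"
    and "chiK G x (z \<oplus>\<^bsub>T\<^esub> z') w = chiK G x z w \<oplus>\<^bsub>T\<^esub> chiK G x z' w"
    and "s \<in> carrier S \<Longrightarrow> chiK G (s \<odot>\<^bsub>T\<^esub> x) z w = s \<odot>\<^bsub>T\<^esub> chiK G x z w"
    and "r \<in> carrier R \<Longrightarrow> chiK G x (z \<odot>r\<^bsub>T\<^esub> r) w = chiK G x z w \<odot>r\<^bsub>T\<^esub> r"
    and "r \<in> carrier R \<Longrightarrow> chiK G (x \<odot>r\<^bsub>T\<^esub> r) z w = chiK G x z (r \<odot>\<^bsub>ptp\<^esub> w)"
    and "s \<in> carrier S \<Longrightarrow> chiK G x z (w \<odot>r\<^bsub>ptp\<^esub> s) = chiK G x (s \<odot>\<^bsub>T\<^esub> z) w"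
proof -
  note q = tensor_eqI3l[OF _ _ _ _ _ _ _ w]
  show "chiK G (x \<oplus>\<^bsub>T\<^esub> x') z w = chiK G x z w \<oplus>\<^bsub>T\<^esub> chiK G x' z w"
    by (rule q[OF _ _ _ _ chiK_ahom ahom_plus[OF _ chiK_ahom chiK_ahom]])
       (use x z in \<open>simp_all add: chiK_pure act_linear ms del: rsmult_pure rsmult_pure'\<close>)
  show "chiK G x (z \<oplus>\<^bsub>T\<^esub> z') w = chiK G x z w \<oplus>\<^bsub>T\<^esub> chiK G x z' w"
    by (rule q[OF _ _ _ _ chiK_ahom ahom_plus[OF _ chiK_ahom chiK_ahom]])
       (use x z in \<open>simp_all add: chiK_pure act_linear ms del: rsmult_pure rsmult_pure'\<close>)
  show "chiK G (s \<odot>\<^bsub>T\<^esub> x) z w = s \<odot>\<^bsub>T\<^esub> chiK G x z w" if "s \<in> carrier S"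
    by (rule q[OF _ _ _ _ chiK_ahom ahom_comp[OF chiK_ahom T_smult_ahom(1)]])
       (use x z that in \<open>simp_all add: chiK_pure act_linear ms del: rsmult_pure rsmult_pure'\<close>)
  show "chiK G x (z \<odot>r\<^bsub>T\<^esub> r) w = chiK G x z w \<odot>r\<^bsub>T\<^esub> r" if "r \<in> carrier R"
    by (rule q[OF _ _ _ _ chiK_ahom ahom_comp[OF chiK_ahom T_smult_ahom(2)]])
       (use x z that in \<open>simp_all add: chiK_pure act_linear ms del: rsmult_pure rsmult_pure'\<close>)
  show "chiK G (x \<odot>r\<^bsub>T\<^esub> r) z w = chiK G x z (r \<odot>\<^bsub>ptp\<^esub> w)" if "r \<in> carrier R"
    by (rule q[OF _ _ _ _ chiK_ahom ahom_comp[OF smult_ahom chiK_ahom]])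
       (use x z that in \<open>simp_all add: chiK_pure act_linear ms left_module.lsmult_closed[OF bimodule_left[OF bimodP]] del: rsmult_pure rsmult_pure'\<close>)
  show "chiK G x z (w \<odot>r\<^bsub>ptp\<^esub> s) = chiK G x (s \<odot>\<^bsub>T\<^esub> z) w" if "s \<in> carrier S"
    by (rule q[OF _ _ _ _ ahom_comp[OF rsmult_ahom chiK_ahom] chiK_ahom])
       (use x z that in \<open>simp_all add: chiK_pure act_linear pure_balanced right_module.rsmult_closed[OF bimodule_right[OF bimodP]]\<close>)
qed

lemma Tb_ops: "smult Tb = smult ptp" "rsmult Tb = rsmult ptp" "add Tb = add ptp"
  by (simp_all add: Tb_def)

lemma chiT_tribalanced: "tribalanced R S T Tb T T (\<lambda>x w z. chiK G x z w)"
  by (simp add: tribalanced_def chiK_linear Tb_ops ahom_add[OF chiK_ahom])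

lemma chiT_ahom: "(chiT G) \<in> ahom (tensor S (tensor R T Tb) T) T"
  unfolding chiT_def by (rule lift3l(1)[OF _ _ _ _ G chiT_tribalanced]) simp_all

lemma chiT_pure: "\<lbrakk>x \<in> carrier T; w \<in> cB; z \<in> carrier T\<rbrakk> \<Longrightarrow>
    (chiT G) (pure_tensor S (tensor R T Tb) T (pure_tensor R T Tb x w) z) = chiK G x z w"
  unfolding chiT_def by (rule lift3l(2)[OF _ _ _ _ G chiT_tribalanced]) simp_all

lemma chiT_hom: "(chiT G) \<in> bimod_hom S R (tensor S (tensor R T Tb) T) T"
proof -
  have "(chiT G) (s \<odot>\<^bsub>tensor S (tensor R T Tb) T\<^esub> u) = s \<odot>\<^bsub>T\<^esub> (chiT G) u"
    if "s \<in> carrier S" "u \<in> carrier (tensor S (tensor R T Tb) T)" for s u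
    by (rule tensor_eqI3l[OF _ _ _ _ ahom_comp[OF smult_ahom chiT_ahom] ahom_comp[OF chiT_ahom T_smult_ahom(1)] _ that(2)])
       (use that in \<open>simp_all add: chiT_pure chiK_linear\<close>)
  moreover have "(chiT G) (u \<odot>r\<^bsub>tensor S (tensor R T Tb) T\<^esub> r) = (chiT G) u \<odot>r\<^bsub>T\<^esub> r"
    if "r \<in> carrier R" "u \<in> carrier (tensor S (tensor R T Tb) T)" for r u
    by (rule tensor_eqI3l[OF _ _ _ _ ahom_comp[OF rsmult_ahom chiT_ahom] ahom_comp[OF chiT_ahom T_smult_ahom(2)] _ that(2)])
       (use that in \<open>simp_all add: chiT_pure chiK_linear\<close>)
  ultimately show ?thesis using chiT_ahom by (simp add: bimod_hom_iff left_hom_iff right_hom_iff)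
qed

lemmas chiT_homs [simp] = chiT_hom chiT_hom[THEN bimod_hom_left] chiT_hom[THEN bimod_hom_right] chiT_hom[THEN bimod_hom_ahom]

text \<open>For \<open>c = p \<diamondop> y\<close> the contraction is
  \<open>evh(x \<otimes> p)\<close> applied to the sum of \<open>a ev(q \<otimes> z)\<close> over
  the components of \<open>\<gamma> y\<close>. The counit axiom makes it
  \<open>evh(x \<otimes> p) y\<close>, and formal duality \<open>x ev(p \<otimes> y)\<close>, that
  is, \<open>x\<close> times the counit of \<open>c\<close>. Additivity extends this to all of
  \<open>C\<close>.\<close>

lemma chiT_cov:
  assumes u: "u \<in> carrier (tensor R T Cm)"
  shows "(chiT G) (unassoc R S T Tb T (tensor_map R T (tensor S Tb T) id covC u)) = runit T (tensor_map R T (ring_bimod R) id epsC u)"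
proof (rule tensor_eqI[OF _ _ _ ahom_comp[OF ahom_comp[OF tensor_map_ahom unassoc_ahom] chiT_ahom] ahom_comp[OF tensor_map_ahom runit_ahom] _ u])
  fix x c assume *: "x \<in> carrier T" "c \<in> carrier Cm"
  \<comment> \<open>The contraction with \<open>x\<close> on the ambient
    \<open>ptp \<otimes> T\<close>. It allows computing with \<open>kC\<close>, for which Sweedler
    sums are available, in place of its corestriction \<open>covC\<close>.\<close>
  define L where "L = tensor_lift G (\<lambda>(w, z). chiK G x z w)"
  have bal: "balanced S ptp T T (\<lambda>(w, z). chiK G x z w)"
    using * by (simp add: balanced_def chiK_linear ahom_add[OF chiK_ahom])
  have L: "L \<in> ahom (tensor S ptp T) T" "\<And>w z. \<lbrakk>w \<in> carrier ptp; z \<in> carrier T\<rbrakk> \<Longrightarrow> L (pure_tensor S ptp T w z) = chiK G x z w"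
    unfolding L_def using lift_ahom[OF _ _ G bal] lift_pure[OF _ _ G bal] by simp_all
  have 1: "(chiT G) (unassoc R S T Tb T (pure_tensor R T (tensor S Tb T) x v)) = L (KT' v)" if "v \<in> carrier (tensor S Tb T)" for v
    by (rule tensor_eqI[OF _ _ _ ahom_comp[OF pure_r_ahom[OF _ _ _ ahom_id] ahom_comp[OF unassoc_ahom chiT_ahom]] ahom_comp[OF bimod_hom_ahom[OF KT'_hom] L(1)] _ that])
       (use * in \<open>simp_all add: chiT_pure L(2)\<close>)
  have aev: "(\<lambda>c. aT x (ev c)) \<in> ahom pt T"
    using * by (simp add: ahom_def act_linear ev_simps bimod_hom_closed[OF ev])
  have 2: "L (kC d) = aT x (ev d)" if "d \<in> carrier pt" for d
  proof (rule tensor_eqI[OF _ _ _ ahom_comp[OF bimod_hom_ahom[OF kC_hom] L(1)] aev _ that])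
    fix p y assume p: "p \<in> carrier P" "y \<in> carrier T"
    have "L (kC (p \<diamondop> y)) = sw T (\<lambda>a q z. L (pure_tensor S ptp T (pure_tensor R pt P (p \<diamondop> a) q) z)) y"
      using p by (simp add: kC_sw sw_hom[OF _ L(1)] tri_defs del: rsmult_pure rsmult_pure')
    also have "\<dots> = sw T (\<lambda>a q z. aT (bT (evh (x \<star> p)) a) (ev (q \<diamondop> z))) y"
      by (rule sw_cong) (use * p in \<open>simp_all add: L(2) chiK_pure\<close>)
    also have "\<dots> = aT (bT (evh (x \<star> p)) y) oneA"
      by (rule sw_ev) (use * p in \<open>simp_all add: balanced_def act_linear\<close>)
    also have "\<dots> = aT x (ev (p \<diamondop> y))" using * p by (simp add: aT_one fd_T)
    finally show "L (kC (p \<diamondop> y)) = aT x (ev (p \<diamondop> y))" .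
  qed simp_all
  show "(chiT G) (unassoc R S T Tb T (tensor_map R T (tensor S Tb T) id covC (pure_tensor R T Cm x c))) =
      runit T (tensor_map R T (ring_bimod R) id epsC (pure_tensor R T Cm x c))"
    using * by (simp add: 1 2 runit_pure[OF ringR] aT_alpha flip: alpha_epsC)
qed (simp_all add: ringR)

lemma chiT_cov':
  assumes u: "u \<in> carrier (tensor S Dm T)"
  shows "(chiT G) (tensor_map S (tensor R T Tb) T covD id u) = lunit T (tensor_map S (ring_bimod S) T epsD id u)"
proof (rule tensor_eqI[OF _ _ _ ahom_comp[OF tensor_map_ahom chiT_ahom] ahom_comp[OF tensor_map_ahom lunit_ahom] _ u])
  fix d z assume *: "d \<in> carrier Dm" "z \<in> carrier T"
  define L where "L = tensor_lift G (\<lambda>(x, w). chiK G x z w)"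
  have bal: "balanced R T ptp T (\<lambda>(x, w). chiK G x z w)"
    using * by (simp add: balanced_def chiK_linear ahom_add[OF chiK_ahom])
  have L: "L \<in> ahom (tensor R T ptp) T" "\<And>w x. \<lbrakk>w \<in> carrier ptp; x \<in> carrier T\<rbrakk> \<Longrightarrow> L (pure_tensor R T ptp x w) = chiK G x z w"
    unfolding L_def using lift_ahom[OF _ _ G bal] lift_pure[OF _ _ G bal] by simp_all
  have 1: "(chiT G) (pure_tensor S (tensor R T Tb) T v z) = L (KT v)" if "v \<in> carrier (tensor R T Tb)" for v
    by (rule tensor_eqI[OF _ _ _ ahom_comp[OF pure_l_ahom[OF _ _ _ ahom_id] chiT_ahom] ahom_comp[OF bimod_hom_ahom[OF KT_hom] L(1)] _ that])
       (use * in \<open>simp_all add: chiT_pure L(2)\<close>)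
  have aev: "(\<lambda>c. bT (evh c) z) \<in> ahom tp T"
    using * by (simp add: ahom_def act_linear ev_simps bimod_hom_closed[OF evh])
  have 2: "L (kD c) = bT (evh c) z" if "c \<in> carrier tp" for c
  proof (rule tensor_eqI[OF _ _ _ ahom_comp[OF bimod_hom_ahom[OF kD_hom] L(1)] aev _ that])
    fix y q' assume p: "y \<in> carrier T" "q' \<in> carrier P"
    have "L (kD (y \<star> q')) = sw T (\<lambda>a q b. L (pure_tensor R T ptp a (pure_tensor R pt P (q \<diamondop> b) q'))) y"
      using p by (simp add: kD_sw sw_hom[OF _ L(1)] tri_defs del: rsmult_pure rsmult_pure')
    also have "\<dots> = sw T (\<lambda>a q b. aT (bT (evh (a \<star> q)) b) (ev (q' \<diamondop> z))) y"
      by (rule sw_cong) (use * p in \<open>simp_all add: L(2) chiK_pure\<close>)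
    also have "\<dots> = aT (bT oneB y) (ev (q' \<diamondop> z))"
      by (rule sw_evh) (use * p in \<open>simp_all add: balanced_def act_linear\<close>)
    also have "\<dots> = bT (evh (y \<star> q')) z" using * p by (simp add: bT_one fd_T)
    finally show "L (kD (y \<star> q')) = bT (evh (y \<star> q')) z" .
  qed simp_all
  show "(chiT G) (tensor_map S (tensor R T Tb) T covD id (pure_tensor S Dm T d z)) =
      lunit T (tensor_map S (ring_bimod S) T epsD id (pure_tensor S Dm T d z))"
    using * by (simp add: 1 2 lunit_pure[OF ringS] bT_beta flip: beta_epsD)
qed (simp_all add: ringS)

text \<open>By formal duality the contraction is
  \<open>x ev(p \<otimes> y) ev(q \<otimes> z)\<close>, with all scalars acting from the right.
  Right linearity of \<open>ev\<close> over the ring then moves the inner contraction, which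
  multiplies \<open>z\<close>, out of \<open>ev(q \<otimes> z)\<close>; both sides become
  \<open>x\<close> followed by the same four scalars.\<close>

lemma chiK_assoc:
  assumes *: "x \<in> carrier T" "z \<in> carrier T" "z' \<in> carrier T" and w: "w \<in> carrier ptp" and w': "w' \<in> carrier ptp"
  shows "chiK G (chiK G x z w) z' w' = chiK G x (chiK G z z' w') w"
proof -
  have add_z: "(\<lambda>z. chiK G x z w) \<in> ahom T T" if "x \<in> carrier T" "w \<in> carrier ptp" for x w
    using that by (simp add: ahom_def chiK_linear)
  have add_x: "(\<lambda>x. chiK G x z w) \<in> ahom T T" if "z \<in> carrier T" "w \<in> carrier ptp" for z w
    using that by (simp add: ahom_def chiK_linear)
  have p: "chiK G x z (pure_tensor R pt P (p \<diamondop> y) q) = aT (aT x (ev (p \<diamondop> y))) (ev (q \<diamondop> z))"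
    if "x \<in> carrier T" "z \<in> carrier T" "p \<in> carrier P" "y \<in> carrier T" "q \<in> carrier P" for x z p y q
    using that by (simp add: chiK_pure fd_T)
  show ?thesis
  proof (rule tensor_eqI3l[OF _ _ _ _ ahom_comp[OF chiK_ahom add_x] chiK_ahom _ w])
    fix p y q assume pyq: "p \<in> carrier P" "y \<in> carrier T" "q \<in> carrier P"
    then have v: "pure_tensor R pt P (p \<diamondop> y) q \<in> carrier ptp" by simp
    show "chiK G (chiK G x z (pure_tensor R pt P (p \<diamondop> y) q)) z' w' = chiK G x (chiK G z z' w') (pure_tensor R pt P (p \<diamondop> y) q)"
      by (rule tensor_eqI3l[OF _ _ _ _ chiK_ahom ahom_comp[OF chiK_ahom add_z] _ w'])
         (use * pyq v in \<open>simp_all add: p ev_mul mulA_closed flip: aT_mul\<close>)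
  qed (use * w' in simp_all)
qed

lemma chiT_assoc:
  assumes u: "u \<in> carrier (tensor S (tensor R (tensor S (tensor R T Tb) T) Tb) T)"
  shows "(chiT G) (tensor_map S (tensor R T Tb) T (tensor_map R T Tb (chiT G) id) id u) =
         (chiT G) (tensor_map S (tensor R T Tb) T id (chiT G)
           (assoc S S (tensor R T Tb) (tensor R T Tb) T (tensor_map S (tensor S (tensor R T Tb) (tensor R T Tb)) T
             (assoc S R (tensor R T Tb) T Tb) id u)))"
proof -
  let ?XY = "tensor R T Tb" let ?XYX = "tensor S ?XY T" let ?W = "tensor S (tensor R ?XYX Tb) T"
  let ?F = "\<lambda>u. (chiT G) (tensor_map S ?XY T (tensor_map R T Tb (chiT G) id) id u)"
  let ?H = "\<lambda>u. (chiT G) (tensor_map S ?XY T id (chiT G) (assoc S S ?XY ?XY T (tensor_map S (tensor S ?XY ?XY) T (assoc S R ?XY T Tb) id u)))"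
  have F: "?F \<in> ahom ?W T"
    by (rule ahom_comp[OF tensor_map_ahom[where f = "tensor_map R T Tb (chiT G) id" and g = id] chiT_ahom])
       (simp_all add: left_hom_id bimod_hom_id)
  have H: "?H \<in> ahom ?W T"
    by (rule ahom_comp[OF tensor_map_ahom[where f = "assoc S R ?XY T Tb" and g = id]
          ahom_comp[OF assoc_ahom ahom_comp[OF tensor_map_ahom[where f = id and g = "chiT G"] chiT_ahom]]])
       (simp_all add: left_hom_id right_hom_id)
  show ?thesis
  proof (rule tensor_eqI[OF _ _ _ F H _ u])
    fix v z' assume z': "z' \<in> carrier T" and v: "v \<in> carrier (tensor R ?XYX Tb)"
    have hv: "(\<lambda>v. pure_tensor S (tensor R ?XYX Tb) T v z') \<in> ahom (tensor R ?XYX Tb) ?W"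
      using z' by (intro pure_l_ahom[OF _ _ _ ahom_id]) simp_all
    show "?F (pure_tensor S (tensor R ?XYX Tb) T v z') = ?H (pure_tensor S (tensor R ?XYX Tb) T v z')"
    proof (rule tensor_eqI[OF _ _ _ ahom_comp[OF hv F] ahom_comp[OF hv H] _ v])
      fix t w' assume w': "w' \<in> carrier Tb" and t: "t \<in> carrier ?XYX"
      have ht: "(\<lambda>t. pure_tensor R ?XYX Tb t w') \<in> ahom ?XYX (tensor R ?XYX Tb)"
        using w' by (intro pure_l_ahom[OF _ _ _ ahom_id]) simp_all
      show "?F (pure_tensor S (tensor R ?XYX Tb) T (pure_tensor R ?XYX Tb t w') z') =
          ?H (pure_tensor S (tensor R ?XYX Tb) T (pure_tensor R ?XYX Tb t w') z')"
      proof (rule tensor_eqI3l[OF _ _ _ _ ahom_comp[OF ht ahom_comp[OF hv F]] ahom_comp[OF ht ahom_comp[OF hv H]] _ t])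
        fix x w z assume "x \<in> carrier T" "w \<in> carrier Tb" "z \<in> carrier T"
        then show "?F (pure_tensor S (tensor R ?XYX Tb) T (pure_tensor R ?XYX Tb (pure_tensor S ?XY T (pure_tensor R T Tb x w) z) w') z') =
            ?H (pure_tensor S (tensor R ?XYX Tb) T (pure_tensor R ?XYX Tb (pure_tensor S ?XY T (pure_tensor R T Tb x w) z) w') z')"
          using z' w' by (simp add: chiT_pure chiK_assoc left_hom_id right_hom_id bimod_hom_id)
      qed simp_all
    qed simp_all
  qed simp_all
qed

lemma coherd_bicomod_T: "bicomodule_coherd R S coring_C coring_D bicomod_T bicomod_Tb (chiT G)"
proof -
  have 1: "companion_via R S coring_C coring_D bicomod_T bicomod_Tb covC covD" by (rule companion_via_bicomod_T)
  have 2: "\<forall>u \<in> carrier (tensor R bicomod_T coring_C). (chiT G) (unassoc R S bicomod_T bicomod_Tb bicomod_T (tensor_map R bicomod_T (tensor S bicomod_Tb bicomod_T) id covC u)) =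
      runit bicomod_T (tensor_map R bicomod_T (ring_bimod R) id (counit coring_C) u)"
    unfolding bicomod_T_def bicomod_Tb_def coring_C_def by (simp add: chiT_cov)
  have 3: "\<forall>u \<in> carrier (tensor S coring_D bicomod_T). (chiT G) (tensor_map S (tensor R bicomod_T bicomod_Tb) bicomod_T covD id u) =
           lunit bicomod_T (tensor_map S (ring_bimod S) bicomod_T (counit coring_D) id u)"
    unfolding bicomod_T_def bicomod_Tb_def coring_D_def by (simp add: chiT_cov')
  show ?thesis
    unfolding bicomodule_coherd_def Let_def
    by (intro conjI exI[of _ covC] exI[of _ covD] 1 2 3) (simp_all add: bicomod_T_def bicomod_Tb_def chiT_assoc)
qed

end

lemma companion_bicomod_T: "companion R S coring_C coring_D bicomod_T bicomod_Tb"
  unfolding companion_def using companion_via_bicomod_T by blast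

end

section \<open>Tame herds\<close>

text \<open>Elements of T-bar are written as finite sums in the ambient \<open>PTP\<close>; this
  evaluates an additive map on such a sum.\<close>

lemma ahom_finsum:
  assumes "abelian_group M" "abelian_group N" "f \<in> ahom M N" "finite I" "g \<in> I \<rightarrow> carrier M"
  shows "f (\<Oplus>\<^bsub>M\<^esub>i\<in>I. g i) = (\<Oplus>\<^bsub>N\<^esub>i\<in>I. f (g i))"
proof -
  interpret M: abelian_group M by fact
  interpret N: abelian_group N by fact
  from assms(4,5) show ?thesis
  proof (induction I)
    case empty then show ?case using ahom_zero[OF assms(1-3)] by simp
  next
    case (insert i I)
    then have "g \<in> I \<rightarrow> carrier M" "g i \<in> carrier M" "(\<lambda>i. f (g i)) \<in> I \<rightarrow> carrier N" "f (g i) \<in> carrier N"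
      using ahom_closed[OF assms(3)] by auto
    then show ?case using insert by (simp add: ahom_add[OF assms(3)])
  qed
qed

section \<open>Restriction of scalars\<close>

lemma restrict_scalars_fields [simp]:
  "carrier (restrict_scalars f g M) = carrier M" "add (restrict_scalars f g M) = add M"
  "ring.zero (restrict_scalars f g M) = ring.zero M"
  "a \<odot>\<^bsub>restrict_scalars f g M\<^esub> x = f a \<odot>\<^bsub>M\<^esub> x" "x \<odot>r\<^bsub>restrict_scalars f g M\<^esub> b = x \<odot>r\<^bsub>M\<^esub> g b"
  by (simp_all add: restrict_scalars_def)

lemma restrict_scalars_abelian_group: "abelian_group (restrict_scalars f g M) = abelian_group M"
  by (simp add: abelian_group_def abelian_monoid_def abelian_group_axioms_def comm_group_def comm_monoid_def
      comm_monoid_axioms_def group_def group_axioms_def monoid_def Units_def)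

lemma finsum_restrict_scalars: "finsum (restrict_scalars f g M) h I = finsum M h I"
  by (simp add: finsum_def finprod_def)

lemma restrict_scalars_left_module:
  assumes "left_module B M" "ring S" "f \<in> ring_hom S B"
  shows "left_module S (restrict_scalars f g M)"
proof -
  interpret M: left_module B M by fact
  interpret S: ring S by fact
  show ?thesis
    using M.abelian_group_axioms S.ring_axioms assms(3)
    by (simp add: left_module_def left_module_axioms_def restrict_scalars_abelian_group ring_hom_closed ring_hom_add ring_hom_mult
        ring_hom_one M.lsmult_closed M.lsmult_l_distr M.lsmult_r_distr M.lsmult_assoc M.lsmult_one)
qed

lemma restrict_scalars_right_module:
  assumes "right_module A M" "ring R" "g \<in> ring_hom R A"
  shows "right_module R (restrict_scalars f g M)"
proof -
  interpret M: right_module A M by fact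
  interpret R: ring R by fact
  show ?thesis
    using M.abelian_group_axioms R.ring_axioms assms(3)
    by (simp add: right_module_def right_module_axioms_def restrict_scalars_abelian_group ring_hom_closed ring_hom_add ring_hom_mult
        ring_hom_one M.rsmult_closed M.rsmult_l_distr M.rsmult_r_distr M.rsmult_assoc M.rsmult_one)
qed

lemma restrict_scalars_bimodule:
  assumes M: "bimodule B A M" and "ring S" "ring R" "f \<in> ring_hom S B" "g \<in> ring_hom R A"
  shows "bimodule S R (restrict_scalars f g M)"
  unfolding bimodule_def bimodule_axioms_def
  using restrict_scalars_left_module[OF bimodule_left[OF M] assms(2,4), of g]
    restrict_scalars_right_module[OF bimodule_right[OF M] assms(3,5), of f]
    bimodule.smult_rsmult[OF M] ring_hom_closed[OF assms(4)] ring_hom_closed[OF assms(5)]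
  by simp

lemma restrict_scalars_hom:
  assumes "h \<in> bimod_hom B A M N" "f \<in> ring_hom S B" "g \<in> ring_hom R A"
  shows "h \<in> bimod_hom S R (restrict_scalars f g M) (restrict_scalars f g N)"
  using assms(1) ring_hom_closed[OF assms(2)] ring_hom_closed[OF assms(3)]
  by (simp add: bimod_hom_iff left_hom_iff right_hom_iff ahom_def)

lemma tensor_restrict_scalars:
  "tensor_subgroup S (restrict_scalars f g M) (restrict_scalars h k N) = tensor_subgroup S (restrict_scalars f' g M) (restrict_scalars h k' N)"
  "tensor_group S (restrict_scalars f g M) (restrict_scalars h k N) = tensor_group S (restrict_scalars f' g M) (restrict_scalars h k' N)"
  "pure_tensor S (restrict_scalars f g M) (restrict_scalars h k N) = pure_tensor S (restrict_scalars f' g M) (restrict_scalars h k' N)"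
proof -
  show 1: "tensor_subgroup S (restrict_scalars f g M) (restrict_scalars h k N) = tensor_subgroup S (restrict_scalars f' g M) (restrict_scalars h k' N)"
    by (simp add: tensor_subgroup_def tensor_relations_def)
  then show "tensor_group S (restrict_scalars f g M) (restrict_scalars h k N) = tensor_group S (restrict_scalars f' g M) (restrict_scalars h k' N)"
    "pure_tensor S (restrict_scalars f g M) (restrict_scalars h k N) = pure_tensor S (restrict_scalars f' g M) (restrict_scalars h k' N)"
    by (simp_all add: tensor_group_def pure_tensor_def fun_eq_iff)
qed

text \<open>Only the inner scalars enter the relations of a tensor product. Hence \<open>ev\<close>,
  given as an \<open>A\<close>-bimodule map with the outer actions kept, becomes an
  \<open>R\<close>-bimodule map on the same group by restriction; likewise
  \<open>evh\<close>.\<close>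

lemma tensor_restrict_scalars_outer:
  "tensor S (restrict_scalars f g M) (restrict_scalars h k N) =
    restrict_scalars f k (tensor S (restrict_scalars id g M) (restrict_scalars h id N))"
  unfolding restrict_scalars_def[of f k "tensor S (restrict_scalars id g M) (restrict_scalars h id N)"]
  by (simp add: tensor_def tensor_restrict_scalars(2)[of S f g M h k N id id] tensor_restrict_scalars(3)[of S f g M h k N id id] fun_eq_iff)

lemma lepoll_sum_type:
  "(UNIV :: 'x set) \<lesssim> (UNIV :: ('x + 'y) set)" "(UNIV :: 'y set) \<lesssim> (UNIV :: ('x + 'y) set)"
  unfolding lepoll_def by (metis inj_Inl subset_UNIV, metis inj_Inr subset_UNIV)

lemma small_lepoll: "(UNIV :: 'x set) \<lesssim> (UNIV :: 'u set) \<Longrightarrow> small TYPE('u) (X :: 'x set)"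
  unfolding small_def by (rule lepoll_trans[OF subset_imp_lepoll]) auto

lemma infinite_sum_type: "infinite (UNIV :: ('r + 's + 'a + 'b + 't + 'h + nat) set)"
  using infinite_UNIV_nat by simp

lemma tame_ctx_herd:
  fixes E :: "('r, 's, 'a, 'b, 't, 'h) herd_data"
  assumes "tame_herd E"
  shows "tame_ctx (ringR E) (ringS E) (ringA_R E) (ringB_S E) (modT_SR E) (pen_RS E) \<one>\<^bsub>ringA E\<^esub> \<one>\<^bsub>ringB E\<^esub>
    (alpha E) (beta E) (monoid.mult (ringA E)) (rsmult (modT E)) (smult (modT E)) (smult (pen E)) (rsmult (pen E))
    (ev E) (evh E) (shepherd E) TYPE('r + 's + 'a + 'b + 't + 'h + nat)"
proof -
  have E: "ring (ringR E)" "ring (ringS E)" "ring (ringA E)" "ring (ringB E)"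
    "alpha E \<in> ring_hom (ringR E) (ringA E)" "beta E \<in> ring_hom (ringS E) (ringB E)"
    "bimodule (ringB E) (ringA E) (modT E)" "bimodule (ringA E) (ringB E) (pen E)" "formal_dual E"
    and sh: "shepherd E \<in> bimod_hom (ringS E) (ringR E) (modT_SR E) (TPT E)"
    and ax: "\<forall>x \<in> carrier (modT E).
        tensor_map (ringS E) (ringB_S E) (modT_SR E) (evh E) id (shepherd E x) =
          pure_tensor (ringS E) (ringB_S E) (modT_SR E) \<one>\<^bsub>ringB E\<^esub> x \<and>
        tensor_map (ringR E) (modT_SR E) (ringA_R E) id (ev E) (shepherd_r E x) =
          pure_tensor (ringR E) (modT_SR E) (ringA_R E) x \<one>\<^bsub>ringA E\<^esub> \<and>
        assoc (ringS E) (ringS E) (TP E) (TP E) (modT_SR E)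
          (tensor_map (ringS E) (tensor (ringS E) (TP E) (TP E)) (modT_SR E)
            (assoc (ringS E) (ringR E) (TP E) (modT_SR E) (pen_RS E)) id
            (tensor_map (ringS E) (tensor (ringR E) (TPT E) (pen_RS E)) (modT_SR E)
              (tensor_map (ringR E) (TPT E) (pen_RS E) (shepherd E) id) id (shepherd E x))) =
        tensor_map (ringS E) (TP E) (TPT E) id (shepherd E) (shepherd E x)"
    and ff: "faithfully_flat_right TYPE('r + 's + 'a + 'b + 't + 'h + nat) (ringR E) (modT_SR E)"
     "faithfully_flat_left TYPE('r + 's + 'a + 'b + 't + 'h + nat) (ringS E) (modT_SR E)"
    using assms unfolding tame_herd_def herd_def by blast+
  interpret R: ring "ringR E" by fact
  interpret S: ring "ringS E" by fact
  interpret A: ring "ringA E" by fact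
  interpret B: ring "ringB E" by fact
  interpret T: bimodule "ringB E" "ringA E" "modT E" by fact
  interpret P: bimodule "ringA E" "ringB E" "pen E" by fact
  have fd: "ev E \<in> bimod_hom (ringA E) (ringA E)
       (tensor (ringS E) (restrict_scalars id (beta E) (pen E)) (restrict_scalars (beta E) id (modT E)))
       (ring_bimod (ringA E))"
     "evh E \<in> bimod_hom (ringB E) (ringB E)
       (tensor (ringR E) (restrict_scalars id (alpha E) (modT E)) (restrict_scalars (alpha E) id (pen E)))
       (ring_bimod (ringB E))"
     "\<And>x y p. x \<in> carrier (modT E) \<Longrightarrow> y \<in> carrier (modT E) \<Longrightarrow> p \<in> carrier (pen E) \<Longrightarrow>
        evh E (pure_tensor (ringR E) (modT_SR E) (pen_RS E) x p) \<odot>\<^bsub>modT E\<^esub> y =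
        x \<odot>r\<^bsub>modT E\<^esub> ev E (pure_tensor (ringS E) (pen_RS E) (modT_SR E) p y)"
     "\<And>x p q. x \<in> carrier (modT E) \<Longrightarrow> p \<in> carrier (pen E) \<Longrightarrow> q \<in> carrier (pen E) \<Longrightarrow>
        p \<odot>r\<^bsub>pen E\<^esub> evh E (pure_tensor (ringR E) (modT_SR E) (pen_RS E) x q) =
        ev E (pure_tensor (ringS E) (pen_RS E) (modT_SR E) p x) \<odot>\<^bsub>pen E\<^esub> q"
    using E(9) unfolding formal_dual_def by blast+
  have id_hom: "id \<in> ring_hom X X" for X :: "('x, 'y) ring_scheme" by (simp add: ring_hom_def)
  have ev: "ev E \<in> bimod_hom (ringR E) (ringR E) (tensor (ringS E) (pen_RS E) (modT_SR E)) (ringA_R E)"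
    unfolding pen_RS_def modT_SR_def ringA_R_def tensor_restrict_scalars_outer[of _ "alpha E"]
    by (rule restrict_scalars_hom[OF fd(1) E(5) E(5)])
  have evh: "evh E \<in> bimod_hom (ringS E) (ringS E) (tensor (ringR E) (modT_SR E) (pen_RS E)) (ringB_S E)"
    unfolding pen_RS_def modT_SR_def ringB_S_def tensor_restrict_scalars_outer[of _ "beta E"]
    by (rule restrict_scalars_hom[OF fd(2) E(6) E(6)])
  \<comment> \<open>Right linearity over \<open>A\<close> is invisible in the restricted modules. It
    is read off by viewing the same pure tensors in the tensor product that keeps the outer action
    of \<open>A\<close>.\<close>
  have ev_mul: "ev E (pure_tensor (ringS E) (pen_RS E) (modT_SR E) p (x \<odot>r\<^bsub>modT E\<^esub> a)) =
      ev E (pure_tensor (ringS E) (pen_RS E) (modT_SR E) p x) \<otimes>\<^bsub>ringA E\<^esub> a"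
    if *: "p \<in> carrier (pen_RS E)" "x \<in> carrier (modT_SR E)" "a \<in> carrier (ringA_R E)" for p x a
  proof -
    let ?P = "restrict_scalars id (beta E) (pen E)" and ?T = "restrict_scalars (beta E) id (modT E)"
    have m: "right_module (ringS E) ?P" "bimodule (ringS E) (ringA E) ?T"
      by (intro restrict_scalars_right_module[where A = "ringB E"] restrict_scalars_bimodule[where B = "ringB E" and A = "ringA E"] id_hom E
          bimodule_right[OF E(8)])+
    have pt: "pure_tensor (ringS E) (pen_RS E) (modT_SR E) = pure_tensor (ringS E) ?P ?T"
      unfolding pen_RS_def modT_SR_def by (rule tensor_restrict_scalars(3))
    have "pure_tensor (ringS E) ?P ?T p x \<odot>r\<^bsub>tensor (ringS E) ?P ?T\<^esub> a = pure_tensor (ringS E) ?P ?T p (x \<odot>r\<^bsub>modT E\<^esub> a)"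
      using * m by (subst rsmult_pure) (simp_all add: pen_RS_def modT_SR_def ringA_R_def)
    moreover have "pure_tensor (ringS E) ?P ?T p x \<in> carrier (tensor (ringS E) ?P ?T)"
      using * m by (simp add: pen_RS_def modT_SR_def bimodule_left)
    ultimately show ?thesis
      using fd(1) * unfolding pt by (simp add: bimod_hom_iff right_hom_iff ringA_R_def del: rsmult_pure rsmult_pure') metis
  qed
  have modA: "bimodule (ringR E) (ringR E) (ringA_R E)" and modB: "bimodule (ringS E) (ringS E) (ringB_S E)"
    unfolding ringA_R_def ringB_S_def
    by (intro restrict_scalars_bimodule[OF ring_bimod_bimodule] E)+
  have modT: "bimodule (ringS E) (ringR E) (modT_SR E)" and modP: "bimodule (ringR E) (ringS E) (pen_RS E)"
    unfolding modT_SR_def pen_RS_def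
    by (intro restrict_scalars_bimodule[OF E(7)] restrict_scalars_bimodule[OF E(8)] E)+
  note defs = ringA_R_def ringB_S_def modT_SR_def pen_RS_def ring_hom_closed[OF E(5)] ring_hom_closed[OF E(6)]
  have cs: "carrier (modT_SR E) = carrier (modT E)" "carrier (pen_RS E) = carrier (pen E)"
    "carrier (ringA_R E) = carrier (ringA E)" "carrier (ringB_S E) = carrier (ringB E)"
    "\<And>r a. r \<odot>\<^bsub>ringA_R E\<^esub> a = alpha E r \<otimes>\<^bsub>ringA E\<^esub> a" "\<And>r a. a \<odot>r\<^bsub>ringA_R E\<^esub> r = a \<otimes>\<^bsub>ringA E\<^esub> alpha E r"
    "\<And>s b. s \<odot>\<^bsub>ringB_S E\<^esub> b = beta E s \<otimes>\<^bsub>ringB E\<^esub> b" "\<And>s b. b \<odot>r\<^bsub>ringB_S E\<^esub> s = b \<otimes>\<^bsub>ringB E\<^esub> beta E s"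
    "\<And>r. r \<in> carrier (ringR E) \<Longrightarrow> alpha E r \<in> carrier (ringA E)" "\<And>s. s \<in> carrier (ringS E) \<Longrightarrow> beta E s \<in> carrier (ringB E)"
    by (simp_all add: defs)
  show ?thesis
  proof (intro tame_ctx.intro herd_ctx.intro tame_ctx_axioms.intro)
    show "bilinear (ringS E) (ringR E) (ringR E) (modT_SR E) (ringA_R E) (modT_SR E) (rsmult (modT E))"
      by (auto simp: bilinear_def balanced_def defs T.right.rsmult_closed T.right.rsmult_l_distr T.right.rsmult_r_distr T.right.rsmult_assoc T.smult_rsmult)
    show "bilinear (ringS E) (ringS E) (ringR E) (ringB_S E) (modT_SR E) (modT_SR E) (smult (modT E))"
      by (auto simp: bilinear_def balanced_def defs T.lsmult_closed T.lsmult_l_distr T.lsmult_r_distr T.lsmult_assoc T.smult_rsmult)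
    show "bilinear (ringR E) (ringR E) (ringS E) (ringA_R E) (pen_RS E) (pen_RS E) (smult (pen E))"
      by (auto simp: bilinear_def balanced_def defs P.lsmult_closed P.lsmult_l_distr P.lsmult_r_distr P.lsmult_assoc P.smult_rsmult)
    show "bilinear (ringR E) (ringS E) (ringS E) (pen_RS E) (ringB_S E) (pen_RS E) (rsmult (pen E))"
      by (auto simp: bilinear_def balanced_def defs P.right.rsmult_closed P.right.rsmult_l_distr P.right.rsmult_r_distr P.right.rsmult_assoc P.smult_rsmult)
    show "shepherd E \<in> bimod_hom (ringS E) (ringR E) (modT_SR E)
      (tensor (ringS E) (tensor (ringR E) (modT_SR E) (pen_RS E)) (modT_SR E))"
      using sh by (simp add: TPT_def TP_def)
    show "infinite (UNIV :: ('r + 's + 'a + 'b + 't + 'h + nat) set)" by (rule infinite_sum_type)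
    \<comment> \<open>Each type enters the nested sum by a left injection followed by one right
      injection for every preceding summand. The final summand \<open>nat\<close> makes the sum
      infinite and leaves even the type of the pen a left summand.\<close>
    note l = lepoll_sum_type(1) lepoll_trans[OF lepoll_sum_type(1) lepoll_sum_type(2)]
    note l3 = lepoll_trans[OF l(2) lepoll_sum_type(2)]
    note l4 = lepoll_trans[OF l3 lepoll_sum_type(2)]
    note l5 = lepoll_trans[OF l4 lepoll_sum_type(2)]
    note l6 = lepoll_trans[OF l5 lepoll_sum_type(2)]
    show "small TYPE('r + 's + 'a + 'b + 't + 'h + nat) (carrier (ringR E))" by (rule small_lepoll, rule l)
    show "small TYPE('r + 's + 'a + 'b + 't + 'h + nat) (carrier (ringS E))" by (rule small_lepoll, rule l)
    show "small TYPE('r + 's + 'a + 'b + 't + 'h + nat) (carrier (ringA_R E))" by (rule small_lepoll, rule l3)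
    show "small TYPE('r + 's + 'a + 'b + 't + 'h + nat) (carrier (ringB_S E))" by (rule small_lepoll, rule l4)
    show "small TYPE('r + 's + 'a + 'b + 't + 'h + nat) (carrier (modT_SR E))" by (rule small_lepoll, rule l5)
    show "small TYPE('r + 's + 'a + 'b + 't + 'h + nat) (carrier (pen_RS E))" by (rule small_lepoll, rule l6)
  qed (use ff ev evh ev_mul fd(3,4) ax modA modB modT modP E(1,2) in
      \<open>simp_all add: cs TPT_def TP_def shepherd_r_def T.right.rsmult_one T.lsmult_one P.lsmult_one P.right.rsmult_one T.right.rsmult_assoc\<close>)
qed

theorem theorem3p4:
  fixes E :: "('r, 's, 'a, 'b, 't, 'h) herd_data"
  assumes "tame_herd E"
  shows "companion (ringR E) (ringS E) (coringC E) (coringD E) (bicomodT E) (bicomodTbar E) \<and>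
    bicomodule_coherd (ringR E) (ringS E) (coringC E) (coringD E) (bicomodT E) (bicomodTbar E) (chi E) \<and>
    (\<forall>x \<in> carrier (modT E). \<forall>z \<in> carrier (modT E). \<forall>(n :: nat) p y q w.
      (\<forall>i < n. p i \<in> carrier (pen E) \<and> y i \<in> carrier (modT E) \<and> q i \<in> carrier (pen E)) \<longrightarrow>
      w = (\<Oplus>\<^bsub>PTP E\<^esub>i \<in> {..<n}.
             pure_tensor (ringR E) (PT E) (pen_RS E) (pure_tensor (ringS E) (pen_RS E) (modT_SR E) (p i) (y i)) (q i)) \<longrightarrow>
      w \<in> carrier (bicomodTbar E) \<longrightarrow>
      chi E (pure_tensor (ringS E) (tensor (ringR E) (bicomodT E) (bicomodTbar E)) (bicomodT E)
               (pure_tensor (ringR E) (bicomodT E) (bicomodTbar E) x w) z) =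
      (\<Oplus>\<^bsub>modT E\<^esub>i \<in> {..<n}.
         (evh E (pure_tensor (ringR E) (modT_SR E) (pen_RS E) x (p i)) \<odot>\<^bsub>modT E\<^esub> y i)
           \<odot>r\<^bsub>modT E\<^esub> ev E (pure_tensor (ringS E) (pen_RS E) (modT_SR E) (q i) z)))"
proof -
  interpret H: tame_ctx "ringR E" "ringS E" "ringA_R E" "ringB_S E" "modT_SR E" "pen_RS E" "\<one>\<^bsub>ringA E\<^esub>" "\<one>\<^bsub>ringB E\<^esub>"
    "alpha E" "beta E" "monoid.mult (ringA E)" "rsmult (modT E)" "smult (modT E)" "smult (pen E)" "rsmult (pen E)"
    "ev E" "evh E" "shepherd E" "TYPE('r + 's + 'a + 'b + 't + 'h + nat)"
    by (rule tame_ctx_herd[OF assms])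
  have amb: "shepherd_r E = H.\<gamma>r" "pen_shepherd E = H.dC" "shepherd_pen E = H.dD" "pen_shepherd_pen_l E = H.lB" "pen_shepherd_pen_r E = H.rB"
    by (simp_all only: shepherd_r_def H.\<gamma>r_def pen_shepherd_def H.dC_def shepherd_pen_def H.dD_def pen_shepherd_pen_l_def H.lB_def
        pen_shepherd_pen_r_def H.rB_def PT_def TP_def TPT_def PTP_def)
  have C: "coringC_carrier E = H.cC" "coringD_carrier E = H.cD"
    by (simp_all only: coringC_carrier_def coringD_carrier_def H.cC_def H.cD_def H.wC_def H.wD_def H.eC_eq H.eD_eq PT_def TP_def amb o_apply)
  have bC: "bimodC E = H.Cm" "bimodD E = H.Dm"
    by (simp_all only: bimodC_def bimodD_def H.Cm_def H.Dm_def C PT_def TP_def)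
  have cC: "coringC E = H.coring_C" "coringD E = H.coring_D"
    by (simp_all only: coringC_def coringD_def H.coring_C_def H.coring_D_def bC amb H.comult_C_def H.comult_D_def H.epsC_def H.epsD_def PT_def TP_def)
  have T: "bicomodT E = H.bicomod_T"
    by (simp only: bicomodT_def H.bicomod_T_def cC H.coring_C_def H.coring_D_def amb H.\<gamma>C_def H.\<gamma>D_def PT_def TP_def extend_tensor)
  \<comment> \<open>Here the defining intersection is matched with the equalizer, by
    \<open>cB_conv\<close>. The surrounding identifications unfold definitions, up to dropping the
    coring fields inside tensor products.\<close>
  have cB: "Tbar_carrier E = H.cB"
    by (simp only: Tbar_carrier_def H.cB_conv cC H.coring_C_def H.coring_D_def PT_def TP_def extend_tensor)
  have bB: "bimodTbar E = H.Tb"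
    by (simp only: bimodTbar_def H.Tb_def cB PTP_def PT_def)
  have B: "bicomodTbar E = H.bicomod_Tb"
    by (simp only: bicomodTbar_def H.bicomod_Tb_def bB cC H.coring_C_def H.coring_D_def amb H.lcoact_Tb_def H.rcoact_Tb_def PTP_def PT_def TP_def extend_tensor)
  let ?G = "add_monoid (modT E)"
  have abT: "abelian_group (modT E)"
    using H.base_modules(15) by (simp add: modT_SR_def restrict_scalars_abelian_group)
  then have G: "group_of ?G (modT_SR E)"
    by (simp add: group_of_def modT_SR_def abelian_group.a_comm_group)
  have chi: "chi E = H.chiT ?G"
    by (simp only: chi_def H.chiT_def H.chiK_def Let_def)
  have "chi E (pure_tensor (ringS E) (tensor (ringR E) (bicomodT E) (bicomodTbar E)) (bicomodT E)
               (pure_tensor (ringR E) (bicomodT E) (bicomodTbar E) x w) z) =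
      (\<Oplus>\<^bsub>modT E\<^esub>i \<in> {..<n}.
         (evh E (pure_tensor (ringR E) (modT_SR E) (pen_RS E) x (p i)) \<odot>\<^bsub>modT E\<^esub> y i)
           \<odot>r\<^bsub>modT E\<^esub> ev E (pure_tensor (ringS E) (pen_RS E) (modT_SR E) (q i) z))"
    if x: "x \<in> carrier (modT E)" and z: "z \<in> carrier (modT E)"
      and pyq: "\<forall>i < n. p i \<in> carrier (pen E) \<and> y i \<in> carrier (modT E) \<and> q i \<in> carrier (pen E)"
      and w: "w = (\<Oplus>\<^bsub>PTP E\<^esub>i \<in> {..<n}.
             pure_tensor (ringR E) (PT E) (pen_RS E) (pure_tensor (ringS E) (pen_RS E) (modT_SR E) (p i) (y i)) (q i))"
        "w \<in> carrier (bicomodTbar E)" for x z and n :: nat and p y q w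
  proof -
    have c: "carrier (modT_SR E) = carrier (modT E)" "carrier (pen_RS E) = carrier (pen E)"
      by (simp_all add: modT_SR_def pen_RS_def)
    have wB: "w \<in> H.cB" using w(2) by (simp add: B H.bicomod_Tb_def)
    let ?t = "\<lambda>i. pure_tensor (ringR E) (PT E) (pen_RS E) (pure_tensor (ringS E) (pen_RS E) (modT_SR E) (p i) (y i)) (q i)"
    have "chi E (pure_tensor (ringS E) (tensor (ringR E) (bicomodT E) (bicomodTbar E)) (bicomodT E)
               (pure_tensor (ringR E) (bicomodT E) (bicomodTbar E) x w) z) = H.chiK ?G x z w"
      using x z wB by (simp add: chi T B H.bicomod_T_def H.bicomod_Tb_def H.chiT_pure[OF G] c)
    \<comment> \<open>The sum is split under \<open>chiK\<close>, which is additive on the whole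
      ambient module: single summands of \<open>w\<close> need not belong to T-bar, so \<chi> itself
      could not be applied to them.\<close>
    also have "\<dots> = (\<Oplus>\<^bsub>modT_SR E\<^esub>i \<in> {..<n}. H.chiK ?G x z (?t i))"
      unfolding w(1) PTP_def PT_def
      by (rule ahom_finsum[OF _ _ H.chiK_ahom[OF G]]) (use x z pyq in \<open>auto simp: c\<close>)
    also have "\<dots> = (\<Oplus>\<^bsub>modT E\<^esub>i \<in> {..<n}. H.chiK ?G x z (?t i))"
      by (simp add: modT_SR_def finsum_restrict_scalars)
    also have "\<dots> = (\<Oplus>\<^bsub>modT E\<^esub>i \<in> {..<n}.
         (evh E (pure_tensor (ringR E) (modT_SR E) (pen_RS E) x (p i)) \<odot>\<^bsub>modT E\<^esub> y i)
           \<odot>r\<^bsub>modT E\<^esub> ev E (pure_tensor (ringS E) (pen_RS E) (modT_SR E) (q i) z))"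
      by (rule abelian_monoid.finsum_cong'[OF abelian_group.axioms(1)[OF abT] refl])
         (use x z pyq in \<open>auto simp: c H.chiK_pure[OF G] PT_def intro!: H.act_closed[unfolded c]\<close>)
    finally show ?thesis .
  qed
  then show ?thesis
    using H.companion_bicomod_T H.coherd_bicomod_T[OF G] unfolding chi cC T B by blast
qed

end
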